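(* Let $(X,d,\mu)$ be a metric-measure space with Borel regular doubling measure that supports a $p$-Poincaré inequality for some $p\in[1,\infty)$. Then $$\Vert u\Vert_{1,p}^* :=\Big(\Vert u\Vert_{L^p(X)}^p+\limsup_{k\to\infty} \big\Vert|T_{k} u|_p\big\Vert_{L^p(X)}^p\Big)^{1/p},\qquad u\in N^{1,p}(X),$$ is an equivalent norm on $N^{1,p}(X)$ (that is, it is a norm equivalent to $\Vert\cdot\Vert_{N^{1,p}(X)}$). Moreover, if $p\in(1,\infty)$, then the space $N^{1,p}(X)$ with the equivalent norm $\Vert\cdot\Vert_{1,p}^*$ is uniformly convex and hence the space $N^{1,p}(X)$ is reflexive.
   Context: All function spaces are real. Setting: $(X,d)$ is a metric space, $\mu$ is a Borel measure with $0<\mu(B)<\infty$ for every ball $B$; a ball is $B(x,r)=\{y:d(x,y)<r\}$ with prescribed center and radius $r>0$, and $\lambda B$ is the concentric ball with radius multiplied by $\lambda$. $\mu$ is Borel regular (every $\mu$-measurable set is contained in a Borel set of equal measure) and doubling: there is $C_d\ge1$ with $\mu(2B)\le C_d\,\mu(B)$ for every ball $B$. $L^1_{\rm loc}(X)$ denotes functions integrable on every ball; $u_B=\frac{1}{\mu(B)}\int_B u\,d\mu$. Curves and Sobolev space: $\Gamma(X)$ is the family of nonconstant rectifiable curves $\gamma:[a,b]\to X$; for Borel $\varrho\ge0$, $\int_\gamma\varrho\,ds$ is the integral with respect to arc length. A Borel function $g:X\to[0,\infty]$ is an upper gradient of a Borel function $u:X\to[-\infty,\infty]$ if $|u(\gamma(a))-u(\gamma(b))|\le\int_\gamma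 g\,ds$ for every $\gamma\in\Gamma(X)$, with the convention $|(\pm\infty)-(\pm\infty)|=\infty$. $\widetilde N^{1,p}(X)$ is the set of Borel $u:X\to[-\infty,\infty]$ with $\|u\|_{N^{1,p}(X)}:=(\|u\|_{L^p(X)}^p+\inf_g\|g\|_{L^p(X)}^p)^{1/p}<\infty$, the infimum over all upper gradients $g$ of $u$; $N^{1,p}(X)=\widetilde N^{1,p}(X)/\!\sim$, where $u\sim v$ iff $\|u-v\|_{N^{1,p}(X)}=0$. It is a Banach space with this norm. Poincaré inequality: $X$ supports a $p$-Poincaré inequality if there are $c_{\mathrm{PI}}>0$, $\lambda\ge1$ such that $\frac1{\mu(B)}\int_B|u-u_B|\,d\mu\le c_{\mathrm{PI}}\operatorname{diam}(B)\big(\frac1{\mu(\lambda B)}\int_{\lambda B}g^p\,d\mu\big)^{1/p}$ for all balls $B$, all Borel $u\in L^1_{\rm loc}(X)$ and all upper gradients $g$ of $u$. Operators $T_k$: for each $k\in\mathbb Z$ fix a covering $\{B_i^k\}_{i=1}^{M(k)}$, $M(k)\in\mathbb N\cup\{\infty\}$, of $X$ by balls of radius $2^{-k}$ such that the balls $\frac15B_i^k$ are pairwise disjoint. $B_i^k$ and $B_j^k$ are neighbors, $B_i^k\sim B_j^k$, if $\operatorname{dist}(B_i^k,B_j^k)<2^{-k}$ (each ball is its own neighbor). The number of neighbors of a ball is bounded by a constant $N\in\mathbb N$ depending only on $C_d$. For $x\in X$ let $B^k[x]:=B_i^k$ where $i$ is the smallest index with $x\in B_i^k$. For $u\in L^1_{\rm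 loc}(X)$, $|T_ku(x)|_p:=2^k\big(\sum_{j:B_j^k\sim B^k[x]}|u_{B^k[x]}-u_{B_j^k}|^p\big)^{1/p}$. Uniform convexity: a normed space $(Z,\|\cdot\|)$ is uniformly convex if for every $\varepsilon>0$ there is $\delta>0$ such that $\|x+y\|\le2(1-\delta)$ whenever $\|x\|=\|y\|=1$ and $\|x-y\|>\varepsilon$. *)

theory Defs
  imports "HOL-Analysis.Analysis"
begin

section \<open>Normed spaces on a carrier set\<close>

text \<open>
  The space \<open>N\<^sup>1\<^sup>,\<^sup>p\<close> depends on a measure and an exponent and hence is not a type, so normed
  spaces and their duals are formulated with an explicit carrier.
\<close>

record 'v nspace =
  vcarrier :: "'v set"
  vadd :: "'v \<Rightarrow> 'v \<Rightarrow> 'v"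
  vscale :: "real \<Rightarrow> 'v \<Rightarrow> 'v"
  vzero :: 'v
  vnorm :: "'v \<Rightarrow> real"

locale real_normed_space =
  fixes Z :: "'v nspace"
  assumes zero_closed: "vzero Z \<in> vcarrier Z"
    and add_closed: "\<lbrakk>x \<in> vcarrier Z; y \<in> vcarrier Z\<rbrakk> \<Longrightarrow> vadd Z x y \<in> vcarrier Z"
    and scale_closed: "x \<in> vcarrier Z \<Longrightarrow> vscale Z a x \<in> vcarrier Z"
    and add_assoc: "\<lbrakk>x \<in> vcarrier Z; y \<in> vcarrier Z; z \<in> vcarrier Z\<rbrakk>
      \<Longrightarrow> vadd Z (vadd Z x y) z = vadd Z x (vadd Z y z)"
    and add_commute: "\<lbrakk>x \<in> vcarrier Z; y \<in> vcarrier Z\<rbrakk> \<Longrightarrow> vadd Z x y = vadd Z y x"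
    and add_zero: "x \<in> vcarrier Z \<Longrightarrow> vadd Z x (vzero Z) = x"
    and add_inverse: "x \<in> vcarrier Z \<Longrightarrow> vadd Z x (vscale Z (- 1) x) = vzero Z"
    and scale_one: "x \<in> vcarrier Z \<Longrightarrow> vscale Z 1 x = x"
    and scale_scale: "x \<in> vcarrier Z \<Longrightarrow> vscale Z a (vscale Z b x) = vscale Z (a * b) x"
    and scale_add_right: "\<lbrakk>x \<in> vcarrier Z; y \<in> vcarrier Z\<rbrakk>
      \<Longrightarrow> vscale Z a (vadd Z x y) = vadd Z (vscale Z a x) (vscale Z a y)"
    and scale_add_left: "x \<in> vcarrier Z
      \<Longrightarrow> vscale Z (a + b) x = vadd Z (vscale Z a x) (vscale Z b x)"
    and norm_nonneg: "x \<in> vcarrier Z \<Longrightarrow> 0 \<le> vnorm Z x"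
    and norm_eq_zero_iff: "x \<in> vcarrier Z \<Longrightarrow> vnorm Z x = 0 \<longleftrightarrow> x = vzero Z"
    and norm_scale: "x \<in> vcarrier Z \<Longrightarrow> vnorm Z (vscale Z a x) = \<bar>a\<bar> * vnorm Z x"
    and norm_triangle: "\<lbrakk>x \<in> vcarrier Z; y \<in> vcarrier Z\<rbrakk>
      \<Longrightarrow> vnorm Z (vadd Z x y) \<le> vnorm Z x + vnorm Z y"

definition vdiff :: "'v nspace \<Rightarrow> 'v \<Rightarrow> 'v \<Rightarrow> 'v" where
  "vdiff Z x y = vadd Z x (vscale Z (- 1) y)"

definition equivalent_norms_on :: "'v set \<Rightarrow> ('v \<Rightarrow> real) \<Rightarrow> ('v \<Rightarrow> real) \<Rightarrow> bool" where
  "equivalent_norms_on V n1 n2 \<longleftrightarrow>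
    (\<exists>c>0. \<exists>C>0. \<forall>x\<in>V. c * n2 x \<le> n1 x \<and> n1 x \<le> C * n2 x)"

definition uniformly_convex :: "'v nspace \<Rightarrow> bool" where
  "uniformly_convex Z \<longleftrightarrow>
    (\<forall>\<epsilon>>0. \<exists>\<delta>>0. \<forall>x\<in>vcarrier Z. \<forall>y\<in>vcarrier Z.
      vnorm Z x = 1 \<and> vnorm Z y = 1 \<and> vnorm Z (vdiff Z x y) > \<epsilon>
        \<longrightarrow> vnorm Z (vadd Z x y) \<le> 2 * (1 - \<delta>))"

text \<open>Functionals are extensional (\<open>undefined\<close> off the carrier), so that equality in the dual is
  equality on the carrier.\<close>

definition dual_space :: "'v nspace \<Rightarrow> ('v \<Rightarrow> real) nspace" where
  "dual_space Z = \<lparr>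
     vcarrier = {f \<in> extensional (vcarrier Z).
       (\<forall>x\<in>vcarrier Z. \<forall>y\<in>vcarrier Z. f (vadd Z x y) = f x + f y) \<and>
       (\<forall>a. \<forall>x\<in>vcarrier Z. f (vscale Z a x) = a * f x) \<and>
       (\<exists>C. \<forall>x\<in>vcarrier Z. \<bar>f x\<bar> \<le> C * vnorm Z x)},
     vadd = (\<lambda>f g. \<lambda>x\<in>vcarrier Z. f x + g x),
     vscale = (\<lambda>a f. \<lambda>x\<in>vcarrier Z. a * f x),
     vzero = (\<lambda>x\<in>vcarrier Z. 0),
     vnorm = (\<lambda>f. SUP x\<in>{x \<in> vcarrier Z. vnorm Z x \<le> 1}. \<bar>f x\<bar>)\<rparr>"

definition canonical_embedding :: "'v nspace \<Rightarrow> 'v \<Rightarrow> ('v \<Rightarrow> real) \<Rightarrow> real" where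
  "canonical_embedding Z x = (\<lambda>f\<in>vcarrier (dual_space Z). f x)"

definition reflexive_space :: "'v nspace \<Rightarrow> bool" where
  "reflexive_space Z \<longleftrightarrow>
    canonical_embedding Z ` vcarrier Z = vcarrier (dual_space (dual_space Z))"


section \<open>Metric measure spaces\<close>

text \<open>The domain of \<open>M\<close> may be larger than the Borel sets, e.g. after completion.\<close>

definition metric_measure_space :: "'a::metric_space measure \<Rightarrow> bool" where
  "metric_measure_space M \<longleftrightarrow> space M = UNIV \<and> sets borel \<subseteq> sets M \<and>
    (\<forall>x r. 0 < r \<longrightarrow> 0 < emeasure M (ball x r) \<and> emeasure M (ball x r) < \<infinity>)"

definition borel_regular :: "'a::metric_space measure \<Rightarrow> bool" where
  "borel_regular M \<longleftrightarrow>
    (\<forall>A\<in>sets M. \<exists>B\<in>sets borel. A \<subseteq> B \<and> emeasure M B = emeasure M A)"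

definition doubling :: "'a::metric_space measure \<Rightarrow> bool" where
  "doubling M \<longleftrightarrow> (\<exists>C\<ge>1. \<forall>x r. 0 < r \<longrightarrow>
    emeasure M (ball x (2 * r)) \<le> ennreal C * emeasure M (ball x r))"

text \<open>Only used for positive exponents.\<close>

definition ennpowr :: "ennreal \<Rightarrow> real \<Rightarrow> ennreal" where
  "ennpowr x p = (if x = \<infinity> then \<infinity> else ennreal (enn2real x powr p))"

definition Lp_powr :: "'a measure \<Rightarrow> real \<Rightarrow> ('a \<Rightarrow> ennreal) \<Rightarrow> ennreal" where
  "Lp_powr M p f = (\<integral>\<^sup>+ x. ennpowr (f x) p \<partial>M)"

definition loc_integrable :: "'a::metric_space measure \<Rightarrow> ('a \<Rightarrow> ereal) \<Rightarrow> bool" where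
  "loc_integrable M u \<longleftrightarrow> u \<in> borel_measurable M \<and>
    (\<forall>x r. 0 < r \<longrightarrow> (\<integral>\<^sup>+ y \<in> ball x r. e2ennreal \<bar>u y\<bar> \<partial>M) < \<infinity>)"

text \<open>A locally integrable function is finite almost everywhere, so replacing its infinite values
  by \<open>0\<close>, as \<open>real_of_ereal\<close> does, does not change the average.\<close>

definition avg :: "'a::metric_space measure \<Rightarrow> ('a \<Rightarrow> ereal) \<Rightarrow> 'a set \<Rightarrow> real" where
  "avg M u B = (LINT y:B|M. real_of_ereal (u y)) / measure M B"


section \<open>Curves and upper gradients\<close>

definition curve_length :: "real \<Rightarrow> real \<Rightarrow> (real \<Rightarrow> 'a::metric_space) \<Rightarrow> ennreal" where
  "curve_length a b \<gamma> =
    (SUP ts\<in>{ts. sorted ts \<and> set ts \<subseteq> {a..b}}.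
      \<Sum>i<length ts - 1. ennreal (dist (\<gamma> (ts ! i)) (\<gamma> (ts ! Suc i))))"

definition rectifiable_curve :: "real \<Rightarrow> real \<Rightarrow> (real \<Rightarrow> 'a::metric_space) \<Rightarrow> bool" where
  "rectifiable_curve a b \<gamma> \<longleftrightarrow>
    a \<le> b \<and> continuous_on {a..b} \<gamma> \<and> curve_length a b \<gamma> < \<infinity>"

definition nonconstant_curve :: "real \<Rightarrow> real \<Rightarrow> (real \<Rightarrow> 'a) \<Rightarrow> bool" where
  "nonconstant_curve a b \<gamma> \<longleftrightarrow> \<not> \<gamma> constant_on {a..b}"

text \<open>The choice of \<open>s\<close> is immaterial: \<open>\<gamma>\<close> is constant on the fibres of its length function.\<close>

definition arclength_param :: "real \<Rightarrow> real \<Rightarrow> (real \<Rightarrow> 'a::metric_space) \<Rightarrow> real \<Rightarrow> 'a" where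
  "arclength_param a b \<gamma> t = \<gamma> (SOME s. s \<in> {a..b} \<and> curve_length a s \<gamma> = ennreal t)"

definition curve_integral ::
    "real \<Rightarrow> real \<Rightarrow> (real \<Rightarrow> 'a::metric_space) \<Rightarrow> ('a \<Rightarrow> ennreal) \<Rightarrow> ennreal" where
  "curve_integral a b \<gamma> \<rho> =
    (\<integral>\<^sup>+ t \<in> {0..enn2real (curve_length a b \<gamma>)}. \<rho> (arclength_param a b \<gamma> t) \<partial>lborel)"

text \<open>Encodes the convention \<open>\<bar>(\<plusminus>\<infinity>) - (\<plusminus>\<infinity>)\<bar> = \<infinity>\<close>.\<close>

definition ext_absdiff :: "ereal \<Rightarrow> ereal \<Rightarrow> ennreal" where
  "ext_absdiff x y = (if \<bar>x\<bar> = \<infinity> \<and> \<bar>y\<bar> = \<infinity> then \<infinity> else e2ennreal \<bar>x - y\<bar>)"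

definition upper_gradient ::
    "('a::metric_space \<Rightarrow> ereal) \<Rightarrow> ('a \<Rightarrow> ennreal) \<Rightarrow> bool" where
  "upper_gradient u g \<longleftrightarrow> u \<in> borel_measurable borel \<and> g \<in> borel_measurable borel \<and>
    (\<forall>a b \<gamma>. rectifiable_curve a b \<gamma> \<and> nonconstant_curve a b \<gamma> \<longrightarrow>
      ext_absdiff (u (\<gamma> a)) (u (\<gamma> b)) \<le> curve_integral a b \<gamma> g)"

definition poincare_inequality :: "'a::metric_space measure \<Rightarrow> real \<Rightarrow> bool" where
  "poincare_inequality M p \<longleftrightarrow>
    (\<exists>c>0. \<exists>\<Lambda>\<ge>1. \<forall>x r u g.
      0 < r \<and> u \<in> borel_measurable borel \<and> loc_integrable M u \<and> upper_gradient u g \<longrightarrow>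
      (\<integral>\<^sup>+ y \<in> ball x r. e2ennreal \<bar>u y - ereal (avg M u (ball x r))\<bar> \<partial>M)
          / emeasure M (ball x r)
        \<le> ennreal (c * diameter (ball x r)) *
          ennpowr ((\<integral>\<^sup>+ y \<in> ball x (\<Lambda> * r). ennpowr (g y) p \<partial>M)
            / emeasure M (ball x (\<Lambda> * r))) (1 / p))"


section \<open>The Sobolev space\<close>

definition N1p_norm :: "'a::metric_space measure \<Rightarrow> real \<Rightarrow> ('a \<Rightarrow> ereal) \<Rightarrow> ennreal" where
  "N1p_norm M p u =
    ennpowr (Lp_powr M p (\<lambda>x. e2ennreal \<bar>u x\<bar>) + (INF g\<in>{g. upper_gradient u g}. Lp_powr M p g))
      (1 / p)"

definition N1p_functions :: "'a::metric_space measure \<Rightarrow> real \<Rightarrow> ('a \<Rightarrow> ereal) set" where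
  "N1p_functions M p = {u \<in> borel_measurable borel. N1p_norm M p u < \<infinity>}"

text \<open>
  Differences and sums are taken in \<^typ>\<open>ereal\<close>, where \<open>\<infinity> - \<infinity> = \<infinity>\<close>. The convention is immaterial:
  if \<open>g\<close> is an upper gradient of \<open>u\<close>, then \<open>\<integral>g ds = \<infinity>\<close> along every nonconstant rectifiable curve
  with an endpoint in \<open>{\<bar>u\<bar> = \<infinity>}\<close>.
\<close>

definition N1p_rel ::
    "'a::metric_space measure \<Rightarrow> real \<Rightarrow> (('a \<Rightarrow> ereal) \<times> ('a \<Rightarrow> ereal)) set" where
  "N1p_rel M p = {(u, v). u \<in> N1p_functions M p \<and> v \<in> N1p_functions M p \<and>
    N1p_norm M p (\<lambda>x. u x - v x) = 0}"

text \<open>The value on an equivalence class of a function that is constant on it.\<close>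

definition class_norm :: "('f \<Rightarrow> ennreal) \<Rightarrow> 'f set \<Rightarrow> real" where
  "class_norm n c = enn2real (the_elem (n ` c))"

definition N1p_space :: "'a::metric_space measure \<Rightarrow> real \<Rightarrow> ('a \<Rightarrow> ereal) set nspace" where
  "N1p_space M p = \<lparr>
     vcarrier = N1p_functions M p // N1p_rel M p,
     vadd = (\<lambda>c d. \<Union>u\<in>c. \<Union>v\<in>d. N1p_rel M p `` {\<lambda>x. u x + v x}),
     vscale = (\<lambda>a c. \<Union>u\<in>c. N1p_rel M p `` {\<lambda>x. ereal a * u x}),
     vzero = N1p_rel M p `` {\<lambda>x. 0},
     vnorm = class_norm (N1p_norm M p)\<rparr>"


section \<open>The operators \<open>T\<^sub>k\<close>\<close>

text \<open>The \<open>k\<close>-th covering consists of balls with centres \<open>ctr k i\<close>, \<open>1 \<le> i \<le> m k\<close>, where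
  \<open>m k = \<infinity>\<close> is allowed.\<close>

definition cov_index :: "(int \<Rightarrow> enat) \<Rightarrow> int \<Rightarrow> nat set" where
  "cov_index m k = {i. 1 \<le> i \<and> enat i \<le> m k}"

definition cov_ball :: "(int \<Rightarrow> nat \<Rightarrow> 'a::metric_space) \<Rightarrow> int \<Rightarrow> nat \<Rightarrow> 'a set" where
  "cov_ball ctr k i = ball (ctr k i) (2 powi (- k))"

definition ball_coverings :: "(int \<Rightarrow> enat) \<Rightarrow> (int \<Rightarrow> nat \<Rightarrow> 'a::metric_space) \<Rightarrow> bool" where
  "ball_coverings m ctr \<longleftrightarrow> (\<forall>k.
    (\<Union>i\<in>cov_index m k. cov_ball ctr k i) = UNIV \<and>
    disjoint_family_on (\<lambda>i. ball (ctr k i) (1 / 5 * 2 powi (- k))) (cov_index m k))"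

definition neighbors ::
    "(int \<Rightarrow> enat) \<Rightarrow> (int \<Rightarrow> nat \<Rightarrow> 'a::metric_space) \<Rightarrow> int \<Rightarrow> nat \<Rightarrow> nat set" where
  "neighbors m ctr k i =
    {j \<in> cov_index m k. setdist (cov_ball ctr k j) (cov_ball ctr k i) < 2 powi (- k)}"

definition first_index ::
    "(int \<Rightarrow> enat) \<Rightarrow> (int \<Rightarrow> nat \<Rightarrow> 'a::metric_space) \<Rightarrow> int \<Rightarrow> 'a \<Rightarrow> nat" where
  "first_index m ctr k x = (LEAST i. i \<in> cov_index m k \<and> x \<in> cov_ball ctr k i)"

text \<open>\<open>\<bar>T\<^sub>k u(x)\<bar>\<^sub>p\<close>. For a doubling measure each ball has only finitely many neighbours.\<close>

definition T_abs ::
    "'a::metric_space measure \<Rightarrow> (int \<Rightarrow> enat) \<Rightarrow> (int \<Rightarrow> nat \<Rightarrow> 'a) \<Rightarrow> real \<Rightarrow> int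
      \<Rightarrow> ('a \<Rightarrow> ereal) \<Rightarrow> 'a \<Rightarrow> real" where
  "T_abs M m ctr p k u x = 2 powi k *
    (let i = first_index m ctr k x in
      \<Sum>j\<in>neighbors m ctr k i.
        \<bar>avg M u (cov_ball ctr k i) - avg M u (cov_ball ctr k j)\<bar> powr p) powr (1 / p)"

definition star_norm ::
    "'a::metric_space measure \<Rightarrow> (int \<Rightarrow> enat) \<Rightarrow> (int \<Rightarrow> nat \<Rightarrow> 'a) \<Rightarrow> real
      \<Rightarrow> ('a \<Rightarrow> ereal) \<Rightarrow> ennreal" where
  "star_norm M m ctr p u =
    ennpowr (Lp_powr M p (\<lambda>x. e2ennreal \<bar>u x\<bar>) +
      Limsup at_top (\<lambda>k::int. Lp_powr M p (\<lambda>x. ennreal (T_abs M m ctr p k u x)))) (1 / p)"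

definition N1p_star_space ::
    "'a::metric_space measure \<Rightarrow> (int \<Rightarrow> enat) \<Rightarrow> (int \<Rightarrow> nat \<Rightarrow> 'a) \<Rightarrow> real
      \<Rightarrow> ('a \<Rightarrow> ereal) set nspace" where
  "N1p_star_space M m ctr p = (N1p_space M p)\<lparr>vnorm := class_norm (star_norm M m ctr p)\<rparr>"

end

theory Submission
  imports Defs
begin

text \<open>
  The upper bound of \<open>\<parallel>\<bar>T\<^sub>k u\<bar>\<^sub>p\<parallel>\<close> follows from the Poincare inequality and the bounded overlap of the
  coverings. For the lower bound, the step function \<open>u\<^sub>k(x) = u\<^bsub>B\<^sup>k[x]\<^esub>\<close> satisfies the upper
  gradient inequality for \<open>6\<bar>T\<^sub>k u\<bar>\<^sub>p\<close> along every arc of length at least \<open>2\<^sup>-\<^sup>k\<close>. Convex combinations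
  of the \<open>\<bar>T\<^sub>k u\<bar>\<^sub>p\<close> converge in \<open>L\<^sup>p\<close>; the Poincare inequality makes the sequence equi-integrable,
  so that this holds for \<open>p = 1\<close> too. The limit is an upper gradient of \<open>u\<close> up to an arbitrarily
  small error.

  The starred norm is a limit superior of \<open>L\<^sup>p\<close> norms of vectors. The uniform convexity inequality
  for \<open>\<bar>t\<bar>\<^sup>p\<close> holds at each scale, and it survives the limit superior because the lower bound
  applies along every subsequence: \<open>\<parallel>u - v\<parallel> > \<epsilon>\<close> makes the difference term large at all small scales.
  Reflexivity then is the Milman-Pettis theorem, since completeness passes to the equivalent norm.
\<close>

section \<open>Uniformly convex Banach spaces are reflexive\<close>

text \<open>The averages in \<open>T_abs\<close> ignore null sets, whereas an upper gradient has to
  control \<open>u\<close> at both ends of every curve. The step functions converge only almost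
  everywhere, so in the limit the inequality first holds between good points of an arc. Since
  \<open>u\<close> lies in the Sobolev space, it already has some \<open>p\<close>-integrable upper
  gradient, and this one carries the inequality from good points to the ends at arbitrarily small
  cost. The bad null set is made part of the error function with value infinity, so that an arc with
  finite error integral is at good points at almost all times.

  A step function also jumps along arcs shorter than its mesh, where nothing controls it. Hence
  combinations are formed from scales \<open>k \<ge> n\<close> only, which handles arcs of length at
  least 2^-n, and a summable error makes the bounds for all \<open>n\<close> comparable.

  Estimates concern \<open>p\<close>-th powers of norms on real-valued representatives. These powers
  add over the coordinates of a vector and are convex, so the triangle inequality is derived from
  convexity and never enters as Minkowski's inequality.\<close>

context real_normed_space
begin

abbreviation plus (infixl "\<oplus>" 65) where "x \<oplus> y \<equiv> vadd Z x y"
abbreviation minus (infixl "\<ominus>" 65) where "x \<ominus> y \<equiv> vdiff Z x y"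
abbreviation times (infixr "\<odot>" 75) where "a \<odot> x \<equiv> vscale Z a x"
abbreviation len where "len x \<equiv> vnorm Z x"

lemma diff_closed: "x \<in> vcarrier Z \<Longrightarrow> y \<in> vcarrier Z \<Longrightarrow> x \<ominus> y \<in> vcarrier Z"
  by (simp add: vdiff_def add_closed scale_closed)

lemma add_left_commute:
  assumes "x \<in> vcarrier Z" "y \<in> vcarrier Z" "z \<in> vcarrier Z"
  shows "x \<oplus> (y \<oplus> z) = y \<oplus> (x \<oplus> z)"
  using assms by (metis add_assoc add_commute)

lemma diff_add_cancel:
  assumes "x \<in> vcarrier Z" "y \<in> vcarrier Z"
  shows "(x \<ominus> y) \<oplus> y = x"
  using assms unfolding vdiff_def
  by (metis add_assoc add_commute add_inverse add_zero scale_closed)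

lemma diff_add_diff:
  assumes "x \<in> vcarrier Z" "y \<in> vcarrier Z" "z \<in> vcarrier Z"
  shows "(x \<ominus> y) \<oplus> (y \<ominus> z) = x \<ominus> z"
  using assms diff_add_cancel[of x y] diff_closed[of x y] scale_closed[of z "-1"]
    add_assoc[of "x \<ominus> y" y "-1 \<odot> z"] unfolding vdiff_def[of Z y z] vdiff_def[of Z x z] by simp

lemma len_diff_triangle:
  assumes "x \<in> vcarrier Z" "y \<in> vcarrier Z" "z \<in> vcarrier Z"
  shows "len (x \<ominus> z) \<le> len (x \<ominus> y) + len (y \<ominus> z)"
  using norm_triangle[of "x \<ominus> y" "y \<ominus> z"] assms diff_add_diff diff_closed by metis

lemma len_diff_commute:
  assumes "x \<in> vcarrier Z" "y \<in> vcarrier Z"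
  shows "len (x \<ominus> y) = len (y \<ominus> x)"
proof -
  have "-1 \<odot> (x \<ominus> y) = y \<ominus> x"
    unfolding vdiff_def using assms
    by (simp add: scale_add_right scale_closed scale_scale scale_one add_commute)
  then show ?thesis
    using norm_scale[of "x \<ominus> y" "-1"] assms diff_closed by simp
qed

lemma len_add_diff:
  assumes "x \<in> vcarrier Z" "y \<in> vcarrier Z" "x' \<in> vcarrier Z" "y' \<in> vcarrier Z"
  shows "len (x \<oplus> y) \<le> len (x' \<oplus> y') + len (x \<ominus> x') + len (y \<ominus> y')"
proof -
  have "x \<oplus> y = ((x \<ominus> x') \<oplus> x') \<oplus> ((y \<ominus> y') \<oplus> y')"
    using assms diff_add_cancel by simp
  also have "\<dots> = (x' \<oplus> y') \<oplus> ((x \<ominus> x') \<oplus> (y \<ominus> y'))"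
    using assms by (simp add: add_assoc add_commute add_left_commute add_closed diff_closed)
  finally have "len (x \<oplus> y) \<le> len (x' \<oplus> y') + len ((x \<ominus> x') \<oplus> (y \<ominus> y'))"
    using assms by (simp add: norm_triangle add_closed diff_closed)
  then show ?thesis
    using norm_triangle[of "x \<ominus> x'" "y \<ominus> y'"] assms diff_closed by fastforce
qed

lemma len_zero: "len (vzero Z) = 0"
  using norm_eq_zero_iff zero_closed by blast

lemma len_diff_scale:
  assumes "x \<in> vcarrier Z"
  shows "len (x \<ominus> a \<odot> x) = \<bar>1 - a\<bar> * len x"
proof -
  have "x \<ominus> a \<odot> x = (1 + - a) \<odot> x"
    unfolding vdiff_def using assms scale_add_left[of x 1 "-a"] by (simp add: scale_scale scale_one)
  then show ?thesis using norm_scale assms by simp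
qed

text \<open>Near-equality in the triangle inequality forces both norms close to 1, so the vectors
  may be normalised at a cost of \<open>\<theta>\<close> each. This form is needed because weak
  approximation produces vectors of the unit ball, not of the unit sphere.\<close>

lemma uniformly_convex_unit_ball:
  assumes uc: "uniformly_convex Z" and \<eta>: "0 < \<eta>"
  obtains \<theta> where "0 < \<theta>"
    "\<And>x y. \<lbrakk>x \<in> vcarrier Z; y \<in> vcarrier Z; len x \<le> 1; len y \<le> 1; 2 - \<theta> \<le> len (x \<oplus> y)\<rbrakk>
      \<Longrightarrow> len (x \<ominus> y) \<le> \<eta>"
proof -
  obtain \<delta> where \<delta>: "\<delta> > 0"
    and uc: "\<And>x y. \<lbrakk>x \<in> vcarrier Z; y \<in> vcarrier Z; len x = 1; len y = 1; len (x \<ominus> y) > \<eta>/2\<rbrakk>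
      \<Longrightarrow> len (x \<oplus> y) \<le> 2 * (1 - \<delta>)"
    using uc[unfolded uniformly_convex_def] \<eta> by (metis half_gt_zero)
  \<comment> \<open>The bound \<open>1/2\<close> keeps both norms positive,
    \<open>\<delta>/3\<close> makes the normalised sum exceed \<open>2 * (1 - \<delta>)\<close>, and
    \<open>\<eta>/4\<close> pays for the two normalisations on top of
    \<open>\<eta>/2\<close>.\<close>
  define \<theta> where "\<theta> = min (1/2) (min (\<delta>/3) (\<eta>/4))"
  have \<theta>: "0 < \<theta>" "\<theta> \<le> 1/2" "\<theta> \<le> \<delta>/3" "\<theta> \<le> \<eta>/4" using \<delta> \<eta> by (auto simp: \<theta>_def)
  show ?thesis
  proof (rule that[OF \<theta>(1)])
    fix x y assume xy: "x \<in> vcarrier Z" "y \<in> vcarrier Z" "len x \<le> 1" "len y \<le> 1"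
      and sum: "2 - \<theta> \<le> len (x \<oplus> y)"
    have "len (x \<oplus> y) \<le> len x + len y" using norm_triangle xy by blast
    then have pos: "len x \<ge> 1 - \<theta>" "len y \<ge> 1 - \<theta>" "len x > 0" "len y > 0"
      using sum xy(3,4) \<theta>(2) by auto
    define x' where "x' = (1 / len x) \<odot> x"
    define y' where "y' = (1 / len y) \<odot> y"
    have c': "x' \<in> vcarrier Z" "y' \<in> vcarrier Z" by (auto simp: x'_def y'_def xy scale_closed)
    have n': "len x' = 1" "len y' = 1" using pos by (auto simp: x'_def y'_def norm_scale xy)
    have "len (x \<ominus> x') = 1 - len x"
      unfolding x'_def len_diff_scale[OF xy(1)] using pos xy(3) by (simp add: abs_if field_simps)
    then have dx: "len (x \<ominus> x') \<le> \<theta>" using pos by simp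
    have "len (y \<ominus> y') = 1 - len y"
      unfolding y'_def len_diff_scale[OF xy(2)] using pos xy(4) by (simp add: abs_if field_simps)
    then have dy: "len (y \<ominus> y') \<le> \<theta>" using pos by simp
    have "len (x' \<ominus> y') \<le> \<eta>/2"
      using uc[OF c' n'] len_add_diff[OF xy(1,2) c'] sum dx dy \<theta> \<delta>
      by (cases "\<eta>/2 < len (x' \<ominus> y')") auto
    then show "len (x \<ominus> y) \<le> \<eta>"
      using len_diff_triangle[OF xy(1) c'(1) xy(2)] len_diff_triangle[OF c' xy(2)]
        len_diff_commute[OF xy(2) c'(2)] dx dy \<theta> by linarith
  qed
qed

lemma dual_carrier_iff: "f \<in> vcarrier (dual_space Z) \<longleftrightarrow> f \<in> extensional (vcarrier Z) \<and>
       (\<forall>x\<in>vcarrier Z. \<forall>y\<in>vcarrier Z. f (x \<oplus> y) = f x + f y) \<and>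
       (\<forall>a. \<forall>x\<in>vcarrier Z. f (a \<odot> x) = a * f x) \<and>
       (\<exists>C. \<forall>x\<in>vcarrier Z. \<bar>f x\<bar> \<le> C * len x)"
  by (simp add: dual_space_def)

lemma dual_norm_def: "vnorm (dual_space Z) f = (SUP x\<in>{x \<in> vcarrier Z. len x \<le> 1}. \<bar>f x\<bar>)"
  by (simp add: dual_space_def)

lemma dual_bounded:
  assumes "f \<in> vcarrier (dual_space Z)"
  obtains C where "C \<ge> 0" "\<And>x. x \<in> vcarrier Z \<Longrightarrow> \<bar>f x\<bar> \<le> C * len x"
proof -
  obtain C where C: "\<And>x. x \<in> vcarrier Z \<Longrightarrow> \<bar>f x\<bar> \<le> C * len x"
    using assms dual_carrier_iff by blast
  have "\<bar>f x\<bar> \<le> \<bar>C\<bar> * len x" if "x \<in> vcarrier Z" for x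
    using C[OF that] norm_nonneg[OF that] mult_right_mono[of C "\<bar>C\<bar>" "len x"] by linarith
  then show ?thesis using that[of "\<bar>C\<bar>"] by simp
qed

lemma dual_bdd_above:
  assumes "f \<in> vcarrier (dual_space Z)"
  shows "bdd_above ((\<lambda>x. \<bar>f x\<bar>) ` {x \<in> vcarrier Z. len x \<le> 1})"
proof -
  obtain C where C: "C \<ge> 0" "\<And>x. x \<in> vcarrier Z \<Longrightarrow> \<bar>f x\<bar> \<le> C * len x"
    using dual_bounded assms by blast
  have "\<bar>f x\<bar> \<le> C" if "x \<in> vcarrier Z" "len x \<le> 1" for x
    using C(2)[OF that(1)] mult_left_mono[OF that(2) C(1)] by simp
  then show ?thesis by (intro bdd_aboveI) auto
qed

lemma dual_norm_upper:
  assumes "f \<in> vcarrier (dual_space Z)" "x \<in> vcarrier Z" "len x \<le> 1"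
  shows "\<bar>f x\<bar> \<le> vnorm (dual_space Z) f"
  unfolding dual_norm_def using assms by (intro cSUP_upper dual_bdd_above) auto

lemma dual_norm_least:
  assumes "\<And>x. x \<in> vcarrier Z \<Longrightarrow> len x \<le> 1 \<Longrightarrow> \<bar>f x\<bar> \<le> C"
  shows "vnorm (dual_space Z) f \<le> C"
  unfolding dual_norm_def
  by (rule cSUP_least) (use assms zero_closed len_zero in auto)

lemma dual_norm_nonneg:
  assumes "f \<in> vcarrier (dual_space Z)"
  shows "0 \<le> vnorm (dual_space Z) f"
  using dual_norm_upper[OF assms zero_closed] len_zero by (smt (verit))

lemma dual_apply_le:
  assumes f: "f \<in> vcarrier (dual_space Z)" and x: "x \<in> vcarrier Z"
  shows "\<bar>f x\<bar> \<le> vnorm (dual_space Z) f * len x"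
proof (cases "len x = 0")
  case True
  obtain C where "C \<ge> 0" "\<And>x. x \<in> vcarrier Z \<Longrightarrow> \<bar>f x\<bar> \<le> C * len x"
    using dual_bounded f by blast
  then show ?thesis using True x by fastforce
next
  case False
  then have pos: "len x > 0" using norm_nonneg x by fastforce
  have "\<bar>f ((1 / len x) \<odot> x)\<bar> \<le> vnorm (dual_space Z) f"
    using pos by (intro dual_norm_upper f scale_closed x) (simp add: norm_scale x)
  moreover have "f ((1 / len x) \<odot> x) = f x / len x" using f x dual_carrier_iff by simp
  ultimately show ?thesis using pos by (simp add: field_simps)
qed

lemma dual_diff:
  assumes "f \<in> vcarrier (dual_space Z)" "x \<in> vcarrier Z" "y \<in> vcarrier Z"
  shows "f (x \<ominus> y) = f x - f y"
  using assms scale_closed unfolding vdiff_def dual_carrier_iff by simp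

lemma dual_lincomb:
  assumes "finite I" "I \<subseteq> vcarrier (dual_space Z)"
  shows "(\<lambda>x\<in>vcarrier Z. \<Sum>f\<in>I. a f * f x) \<in> vcarrier (dual_space Z)" (is "?h \<in> _")
  unfolding dual_carrier_iff
proof (intro conjI ballI allI)
  have I: "f (x \<oplus> y) = f x + f y" "f (b \<odot> x) = b * f x"
    if "f \<in> I" "x \<in> vcarrier Z" "y \<in> vcarrier Z" for f x y b
    using that assms(2) dual_carrier_iff by auto
  show "?h (x \<oplus> y) = ?h x + ?h y" if "x \<in> vcarrier Z" "y \<in> vcarrier Z" for x y
    using that by (simp add: add_closed I sum.distrib algebra_simps)
  show "?h (b \<odot> x) = b * ?h x" if "x \<in> vcarrier Z" for b x
    using that by (simp add: scale_closed I sum_distrib_left mult_ac)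
  have "\<bar>?h x\<bar> \<le> (\<Sum>f\<in>I. \<bar>a f\<bar> * vnorm (dual_space Z) f) * len x" if x: "x \<in> vcarrier Z" for x
  proof -
    have "\<bar>?h x\<bar> \<le> (\<Sum>f\<in>I. \<bar>a f * f x\<bar>)" using x by simp
    also have "\<dots> \<le> (\<Sum>f\<in>I. \<bar>a f\<bar> * (vnorm (dual_space Z) f * len x))"
      using assms x by (intro sum_mono) (auto simp: abs_mult intro!: mult_left_mono dual_apply_le)
    also have "\<dots> = (\<Sum>f\<in>I. \<bar>a f\<bar> * vnorm (dual_space Z) f) * len x"
      by (simp add: sum_distrib_right mult.assoc)
    finally show ?thesis .
  qed
  then show "\<exists>C. \<forall>x\<in>vcarrier Z. \<bar>?h x\<bar> \<le> C * len x" by blast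
qed simp

end

lemma bidual_lincomb:
  assumes "real_normed_space Z"
    and \<Phi>: "\<Phi> \<in> vcarrier (dual_space (dual_space Z))"
    and "finite I" "I \<subseteq> vcarrier (dual_space Z)"
  shows "\<Phi> (\<lambda>x\<in>vcarrier Z. \<Sum>f\<in>I. a f * f x) = (\<Sum>f\<in>I. a f * \<Phi> f)"
  using assms(3,4)
proof (induction I rule: finite_induct)
  interpret real_normed_space Z by fact
  have add: "\<Phi> (vadd (dual_space Z) f g) = \<Phi> f + \<Phi> g"
    and scale: "\<Phi> (vscale (dual_space Z) b f) = b * \<Phi> f"
    if "f \<in> vcarrier (dual_space Z)" "g \<in> vcarrier (dual_space Z)" for f g b
    using \<Phi> that unfolding dual_space_def[of "dual_space Z"] by auto
  have vs: "vscale (dual_space Z) b f = (\<lambda>x\<in>vcarrier Z. b * f x)"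
    and va: "vadd (dual_space Z) f g = (\<lambda>x\<in>vcarrier Z. f x + g x)" for b f g
    by (auto simp: dual_space_def)
  {
    case empty
    have 0: "(\<lambda>x\<in>vcarrier Z. 0) \<in> vcarrier (dual_space Z)"
      using dual_lincomb[of "{}"] by simp
    have "(\<lambda>x\<in>vcarrier Z. \<Sum>f\<in>{}. a f * f x) = vscale (dual_space Z) 0 (\<lambda>x\<in>vcarrier Z. 0)"
      by (auto simp: vs fun_eq_iff)
    then show ?case using scale[where b = 0, OF 0 0] by (simp only: sum.empty mult_zero_left)
  next
    case (insert f I)
    have f: "f \<in> vcarrier (dual_space Z)" using insert by auto
    have "(\<lambda>x\<in>vcarrier Z. \<Sum>f\<in>{f}. a f * f x) \<in> vcarrier (dual_space Z)"
      by (rule dual_lincomb) (use f in auto)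
    then have af: "(\<lambda>x\<in>vcarrier Z. a f * f x) \<in> vcarrier (dual_space Z)" by simp
    have h: "(\<lambda>x\<in>vcarrier Z. \<Sum>f\<in>I. a f * f x) \<in> vcarrier (dual_space Z)"
      using insert by (intro dual_lincomb) auto
    have "(\<lambda>x\<in>vcarrier Z. \<Sum>f\<in>insert f I. a f * f x)
        = vadd (dual_space Z) (vscale (dual_space Z) (a f) f) (\<lambda>x\<in>vcarrier Z. \<Sum>f\<in>I. a f * f x)"
      unfolding va vs using insert by (auto simp: fun_eq_iff)
    moreover have IH: "\<Phi> (\<lambda>x\<in>vcarrier Z. \<Sum>f\<in>I. a f * f x) = (\<Sum>f\<in>I. a f * \<Phi> f)"
      by (rule insert.IH) (use insert in auto)
    ultimately have "\<Phi> (\<lambda>x\<in>vcarrier Z. \<Sum>f\<in>insert f I. a f * f x)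
        = \<Phi> (vscale (dual_space Z) (a f) f) + \<Phi> (\<lambda>x\<in>vcarrier Z. \<Sum>f\<in>I. a f * f x)"
      using add[OF af[folded vs] h] by (simp only:)
    also have "\<dots> = a f * \<Phi> f + (\<Sum>f\<in>I. a f * \<Phi> f)"
      using scale[where b = "a f", OF f f] IH by (simp only:)
    also have "\<dots> = (\<Sum>f\<in>insert f I. a f * \<Phi> f)" using insert by simp
    finally show ?case .
  }
qed

text \<open>Goldstine's lemma, without the Hahn-Banach theorem: if \<open>\<Sum>\<^sub>f (f x - \<Phi> f)\<^sup>2\<close> had a positive
  infimum \<open>d\<close> over the unit ball, the first variation at a near-minimiser \<open>x\<^sub>0\<close> would bound the norm
  of the functional \<open>h = \<Sum>\<^sub>f (\<Phi> f - f x\<^sub>0) f\<close> by a number smaller than \<open>\<Phi> h\<close>.\<close>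

lemma goldstine:
  assumes Z: "real_normed_space Z"
    and \<Phi>: "\<Phi> \<in> vcarrier (dual_space (dual_space Z))"
    and le: "\<And>f. f \<in> vcarrier (dual_space Z) \<Longrightarrow> \<bar>\<Phi> f\<bar> \<le> vnorm (dual_space Z) f"
    and I: "finite I" "I \<subseteq> vcarrier (dual_space Z)" and e: "0 < e"
  shows "\<exists>x\<in>vcarrier Z. vnorm Z x \<le> 1 \<and> (\<forall>f\<in>I. \<bar>f x - \<Phi> f\<bar> < e)"
proof -
  interpret real_normed_space Z by fact
  let ?D = "dual_space Z"
  let ?B = "{x \<in> vcarrier Z. len x \<le> 1}"
  define G where "G x = (\<Sum>f\<in>I. (f x - \<Phi> f)\<^sup>2)" for x
  define d where "d = Inf (G ` ?B)"
  have G0: "0 \<le> G x" for x by (simp add: G_def sum_nonneg)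
  have bdd: "bdd_below (G ` ?B)" using G0 by (intro bdd_belowI) auto
  have ne: "?B \<noteq> {}" using zero_closed len_zero by fastforce
  have d_le: "d \<le> G x" if "x \<in> ?B" for x unfolding d_def using that bdd by (intro cInf_lower) auto
  show ?thesis
  proof (cases "d \<le> 0")
    case True
    then have "Inf (G ` ?B) < e\<^sup>2" using e unfolding d_def by (smt (verit) zero_less_power)
    then obtain x where x: "x \<in> ?B" "G x < e\<^sup>2"
      using cInf_lessD[of "G ` ?B"] ne by blast
    have "\<bar>f x - \<Phi> f\<bar> < e" if "f \<in> I" for f
    proof -
      have "(f x - \<Phi> f)\<^sup>2 \<le> G x" unfolding G_def using I that by (intro member_le_sum) auto
      then have "(f x - \<Phi> f)\<^sup>2 < e\<^sup>2" using x by linarith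
      then show ?thesis using e abs_le_square_iff power2_abs by (metis abs_of_pos linorder_not_le)
    qed
    then show ?thesis using x by blast
  next
    case False
    then have d: "d > 0" by simp
    define R where "R = (\<Sum>f\<in>I. (2 * vnorm ?D f)\<^sup>2) + 1"
    have "R \<ge> 1" unfolding R_def by (simp add: sum_nonneg)
    \<comment> \<open>Moving from \<open>x0\<close> towards a point \<open>y\<close> of the unit
      ball by the fraction \<open>t\<close> changes \<open>G\<close> by a linear term plus at most
      \<open>t\<^sup>2 * R\<close>, since \<open>\<bar>f y - f x0\<bar>\<close> is at most twice the
      norm of \<open>f\<close>. The choice gives \<open>t * R \<le> d / 2\<close>.\<close>
    define t where "t = min 1 (d / (2 * R))"
    have t: "0 < t" "t \<le> 1" "t * R \<le> d / 2" using d \<open>R \<ge> 1\<close>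
      by (auto simp: t_def min_def field_simps)
    \<comment> \<open>The tolerance is proportional to \<open>t\<close>, so that dividing the first
      variation by \<open>t\<close> leaves an error of \<open>d / 2\<close>.\<close>
    have "Inf (G ` ?B) < d + t * d / 2" using d t unfolding d_def by simp
    then obtain x0 where x0: "x0 \<in> ?B" "G x0 < d + t * d / 2"
      using cInf_lessD[of "G ` ?B"] ne by blast
    define a where "a f = \<Phi> f - f x0" for f
    define h where "h = (\<lambda>x\<in>vcarrier Z. \<Sum>f\<in>I. a f * f x)"
    have h: "h \<in> vcarrier ?D" unfolding h_def using dual_lincomb I by blast
    have var: "h y \<le> h x0 + d / 2" if y: "y \<in> ?B" for y
    proof -
      define z where "z = ((1 - t) \<odot> x0) \<oplus> (t \<odot> y)"
      have c: "(1 - t) \<odot> x0 \<in> vcarrier Z" "t \<odot> y \<in> vcarrier Z" using x0 y scale_closed by auto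
      have "len z \<le> (1 - t) * len x0 + t * len y"
        unfolding z_def using norm_triangle[OF c] x0 y t by (simp add: norm_scale)
      also have "\<dots> \<le> (1 - t) * 1 + t * 1" using x0 y t by (intro add_mono mult_left_mono) auto
      finally have z: "z \<in> ?B" using c add_closed by (simp add: z_def)
      have fz: "f z = f x0 + t * (f y - f x0)" if "f \<in> I" for f
      proof -
        have "f \<in> vcarrier ?D" using that I by blast
        then show ?thesis using c x0 y by (simp add: z_def dual_carrier_iff algebra_simps)
      qed
      have "G z = (\<Sum>f\<in>I. (f x0 - \<Phi> f)\<^sup>2 - 2 * t * (a f * (f y - f x0)) + t\<^sup>2 * (f y - f x0)\<^sup>2)"
        unfolding G_def by (intro sum.cong) (auto simp: fz a_def power2_eq_square algebra_simps)
      also have "\<dots> = G x0 - 2 * t * (\<Sum>f\<in>I. a f * (f y - f x0)) + t\<^sup>2 * (\<Sum>f\<in>I. (f y - f x0)\<^sup>2)"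
        by (simp add: sum.distrib sum_subtractf sum_distrib_left G_def mult_ac)
      also have "(\<Sum>f\<in>I. a f * (f y - f x0)) = h y - h x0"
        using y x0 by (simp add: h_def sum_subtractf right_diff_distrib)
      finally have eq: "G z = G x0 - 2 * t * (h y - h x0) + t\<^sup>2 * (\<Sum>f\<in>I. (f y - f x0)\<^sup>2)" .
      have "(\<Sum>f\<in>I. (f y - f x0)\<^sup>2) \<le> (\<Sum>f\<in>I. (2 * vnorm ?D f)\<^sup>2)"
      proof (intro sum_mono)
        fix f assume "f \<in> I"
        then have f: "f \<in> vcarrier ?D" using I by blast
        have "\<bar>f y - f x0\<bar> \<le> 2 * vnorm ?D f"
          using dual_norm_upper[OF f, of y] dual_norm_upper[OF f, of x0] x0 y by simp
        then show "(f y - f x0)\<^sup>2 \<le> (2 * vnorm ?D f)\<^sup>2"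
          by (metis abs_ge_zero power2_abs power_mono)
      qed
      then have "(\<Sum>f\<in>I. (f y - f x0)\<^sup>2) \<le> R" by (simp add: R_def)
      then have "t\<^sup>2 * (\<Sum>f\<in>I. (f y - f x0)\<^sup>2) \<le> t * (t * R)"
        using t by (simp add: power2_eq_square mult_left_mono)
      also have "\<dots> \<le> t * (d / 2)" using t by (intro mult_left_mono) auto
      finally have "2 * t * (h y - h x0) \<le> t * d" using eq d_le[OF z] x0(2) by linarith
      then have "t * (2 * (h y - h x0)) \<le> t * d" by (simp add: algebra_simps)
      then show ?thesis using t by simp
    qed
    have "\<bar>h y\<bar> \<le> h x0 + d / 2" if y: "y \<in> vcarrier Z" "len y \<le> 1" for y
    proof -
      have "h (-1 \<odot> y) = - h y" using h y(1) dual_carrier_iff by simp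
      moreover have "-1 \<odot> y \<in> ?B" using y by (simp add: norm_scale scale_closed)
      ultimately show ?thesis using var[of y] var[of "-1 \<odot> y"] y by simp
    qed
    then have "vnorm ?D h \<le> h x0 + d / 2" by (rule dual_norm_least)
    moreover have "\<Phi> h = h x0 + G x0"
    proof -
      have "\<Phi> h = (\<Sum>f\<in>I. a f * \<Phi> f)" unfolding h_def by (rule bidual_lincomb[OF Z \<Phi> I])
      also have "\<dots> = (\<Sum>f\<in>I. a f * f x0 + (f x0 - \<Phi> f)\<^sup>2)"
        by (intro sum.cong) (auto simp: a_def power2_eq_square algebra_simps)
      finally show ?thesis using x0 by (simp add: h_def sum.distrib G_def)
    qed
    \<comment> \<open>Contradiction: \<open>\<Phi> h = h x0 + G x0 \<ge> h x0 + d\<close> exceeds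
      the bound \<open>h x0 + d / 2\<close> on the norm of \<open>h\<close>.\<close>
    ultimately show ?thesis using le[OF h] d_le[OF x0(1)] d by linarith
  qed
qed

definition complete_nspace :: "'v nspace \<Rightarrow> bool" where
  "complete_nspace Z \<longleftrightarrow> (\<forall>X. (\<forall>n. X n \<in> vcarrier Z) \<and>
      (\<forall>e>0. \<exists>N. \<forall>i\<ge>N. \<forall>j\<ge>N. vnorm Z (vdiff Z (X i) (X j)) < e) \<longrightarrow>
    (\<exists>x\<in>vcarrier Z. (\<lambda>n. vnorm Z (vdiff Z (X n) x)) \<longlonglongrightarrow> 0))"

text \<open>By uniform convexity a functional that almost norms \<open>\<Phi>\<close> cuts a piece
  of small diameter out of the unit ball. Points in the first \<open>n\<close> such pieces form a
  Cauchy sequence. For an arbitrary \<open>g\<close> the construction is repeated with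
  \<open>g\<close> added to the finite list; the new points stay close to the old ones, so the one
  limit represents \<open>\<Phi>\<close> at every \<open>g\<close>.\<close>

lemma milman_pettis_unit:
  assumes Z: "real_normed_space Z" and compl: "complete_nspace Z" and uc: "uniformly_convex Z"
    and \<Phi>: "\<Phi> \<in> vcarrier (dual_space (dual_space Z))"
    and le: "\<And>f. f \<in> vcarrier (dual_space Z) \<Longrightarrow> \<bar>\<Phi> f\<bar> \<le> vnorm (dual_space Z) f"
    and sup: "\<And>e. 0 < e \<Longrightarrow> \<exists>f\<in>vcarrier (dual_space Z). vnorm (dual_space Z) f \<le> 1 \<and> 1 - e < \<bar>\<Phi> f\<bar>"
  shows "\<exists>x\<in>vcarrier Z. \<forall>f\<in>vcarrier (dual_space Z). \<Phi> f = f x"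
proof -
  interpret real_normed_space Z by fact
  let ?D = "dual_space Z"
  define S where "S I e = {x \<in> vcarrier Z. len x \<le> 1 \<and> (\<forall>f\<in>I. \<bar>f x - \<Phi> f\<bar> < e)}" for I e
  have small: "\<exists>f\<in>vcarrier ?D. \<exists>e>0. \<forall>x\<in>S {f} e. \<forall>y\<in>S {f} e. len (x \<ominus> y) \<le> \<eta>" if \<eta>: "0 < \<eta>" for \<eta>
  proof -
    obtain \<theta> where \<theta>: "0 < \<theta>"
      "\<And>x y. \<lbrakk>x \<in> vcarrier Z; y \<in> vcarrier Z; len x \<le> 1; len y \<le> 1; 2 - \<theta> \<le> len (x \<oplus> y)\<rbrakk>
        \<Longrightarrow> len (x \<ominus> y) \<le> \<eta>"
      using uniformly_convex_unit_ball[OF uc \<eta>] by blast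
    obtain f where f: "f \<in> vcarrier ?D" "vnorm ?D f \<le> 1" "1 - \<theta>/4 < \<bar>\<Phi> f\<bar>"
      using sup[of "\<theta>/4"] \<theta> by auto
    have "len (x \<ominus> y) \<le> \<eta>" if "x \<in> S {f} (\<theta>/4)" "y \<in> S {f} (\<theta>/4)" for x y
    proof (rule \<theta>(2))
      show c: "x \<in> vcarrier Z" "y \<in> vcarrier Z" "len x \<le> 1" "len y \<le> 1"
        using that by (auto simp: S_def)
      have "\<bar>f x - \<Phi> f\<bar> < \<theta>/4" "\<bar>f y - \<Phi> f\<bar> < \<theta>/4" using that by (auto simp: S_def)
      then have "2 - \<theta> \<le> \<bar>f x + f y\<bar>" using f(3) by linarith
      also have "f x + f y = f (x \<oplus> y)" using f(1) c dual_carrier_iff by simp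
      also have "\<bar>f (x \<oplus> y)\<bar> \<le> vnorm ?D f * len (x \<oplus> y)"
        using dual_apply_le[OF f(1)] c add_closed by blast
      also have "\<dots> \<le> 1 * len (x \<oplus> y)"
        using f(2) c add_closed norm_nonneg by (intro mult_right_mono) auto
      finally show "2 - \<theta> \<le> len (x \<oplus> y)" by simp
    qed
    then show ?thesis using f(1) \<theta>(1) by (intro bexI[of _ f] exI[of _ "\<theta>/4"]) auto
  qed
  have "\<exists>f e. f \<in> vcarrier ?D \<and> e > 0 \<and>
      (\<forall>x\<in>S {f} e. \<forall>y\<in>S {f} e. len (x \<ominus> y) \<le> 1 / real (Suc n))" for n
    using small[of "1 / real (Suc n)"] by fastforce
  then obtain F E where F: "\<And>n. F n \<in> vcarrier ?D" and E: "\<And>n. E n > 0"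
    and FE: "\<And>n x y. x \<in> S {F n} (E n) \<Longrightarrow> y \<in> S {F n} (E n) \<Longrightarrow> len (x \<ominus> y) \<le> 1 / real (Suc n)"
    by metis
  \<comment> \<open>A common tolerance below all \<open>E k\<close> with \<open>k \<le> n\<close>,
    so that the approximating point lies in all pieces found so far.\<close>
  define \<delta> where "\<delta> n = min (1 / real (Suc n)) (Min (E ` {..n}))" for n
  have \<delta>: "\<delta> n > 0" "\<delta> n \<le> 1 / real (Suc n)" and \<delta>E: "k \<le> n \<Longrightarrow> \<delta> n \<le> E k" for n k
    using E by (auto simp: \<delta>_def min_le_iff_disj)
  have ne: "\<exists>x. x \<in> S (insert g (F ` {..n})) (\<delta> n)" if "g \<in> vcarrier ?D" for g n
    using goldstine[OF Z \<Phi> le, of "insert g (F ` {..n})" "\<delta> n"] F that \<delta>(1) by (fastforce simp: S_def)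
  then obtain Y where Y: "\<And>g n. g \<in> vcarrier ?D \<Longrightarrow> Y g n \<in> S (insert g (F ` {..n})) (\<delta> n)"
    by metis
  have mem: "Y g n \<in> S {F k} (E k)" if "g \<in> vcarrier ?D" "k \<le> n" for g n k
    using Y[OF that(1), of n] \<delta>E[OF that(2)] that(2) by (auto simp: S_def intro: less_le_trans)
  have close: "len (Y g n \<ominus> Y g' n') \<le> 1 / real (Suc k)"
    if "g \<in> vcarrier ?D" "g' \<in> vcarrier ?D" "k \<le> n" "k \<le> n'" for g g' n n' k
    using FE mem that by blast
  \<comment> \<open>\<open>F 0\<close> is just some element of the dual: by \<open>close\<close>,
    all the sequences \<open>Y g\<close> have the same limit.\<close>
  define X where "X = Y (F 0)"
  have X: "X n \<in> vcarrier Z" for n using Y[OF F[of 0], of n] by (simp add: X_def S_def)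
  have "\<exists>N. \<forall>i\<ge>N. \<forall>j\<ge>N. len (X i \<ominus> X j) < e" if e: "e > 0" for e
  proof -
    obtain N where "1 / real (Suc N) < e" using nat_approx_posE[OF e] by blast
    then show ?thesis unfolding X_def using close[OF F[of 0] F[of 0]] by (meson le_less_trans)
  qed
  then obtain x where x: "x \<in> vcarrier Z" "(\<lambda>n. len (X n \<ominus> x)) \<longlonglongrightarrow> 0"
    using compl X unfolding complete_nspace_def by blast
  have "\<Phi> g = g x" if g: "g \<in> vcarrier ?D" for g
  proof -
    have Yc: "Y g n \<in> vcarrier Z" for n using Y[OF g, of n] by (simp add: S_def)
    have bound: "\<bar>\<Phi> g - g x\<bar> \<le> inverse (real (Suc n)) + vnorm ?D g * inverse (real (Suc n)) +
        vnorm ?D g * len (X n \<ominus> x)" for n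
    proof -
      have "\<bar>g (Y g n) - \<Phi> g\<bar> < \<delta> n" using Y[OF g, of n] by (simp add: S_def)
      moreover have "\<bar>g (Y g n) - g (X n)\<bar> \<le> vnorm ?D g * len (Y g n \<ominus> X n)"
        using dual_apply_le[OF g] dual_diff[OF g] Yc X diff_closed by metis
      moreover have "\<dots> \<le> vnorm ?D g * (1 / real (Suc n))"
        unfolding X_def using close[OF g F[of 0]] by (intro mult_left_mono dual_norm_nonneg g) auto
      moreover have "\<bar>g (X n) - g x\<bar> \<le> vnorm ?D g * len (X n \<ominus> x)"
        using dual_apply_le[OF g] dual_diff[OF g] x(1) X diff_closed by metis
      ultimately show ?thesis using \<delta>(2)[of n] by (simp add: inverse_eq_divide)
    qed
    have "(\<lambda>n. inverse (real (Suc n)) + vnorm ?D g * inverse (real (Suc n)) +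
        vnorm ?D g * len (X n \<ominus> x)) \<longlonglongrightarrow> 0 + vnorm ?D g * 0 + vnorm ?D g * 0"
      using x(2) LIMSEQ_inverse_real_of_nat by (intro tendsto_intros) auto
    then have "\<bar>\<Phi> g - g x\<bar> \<le> 0" using bound by (intro LIMSEQ_le_const) auto
    then show ?thesis by simp
  qed
  then show ?thesis using x(1) by blast
qed

text \<open>Division by the bidual norm \<open>K\<close> of \<open>\<Phi>\<close> reduces to norm
  one; for \<open>K = 0\<close> the zero vector represents \<open>\<Phi>\<close>.\<close>

theorem milman_pettis:
  assumes Z: "real_normed_space Z" and compl: "complete_nspace Z" and uc: "uniformly_convex Z"
  shows "reflexive_space Z"
  unfolding reflexive_space_def
proof (intro equalityI subsetI)
  interpret real_normed_space Z by fact
  let ?D = "dual_space Z"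
  have bidual: "\<Phi> \<in> vcarrier (dual_space ?D) \<longleftrightarrow> \<Phi> \<in> extensional (vcarrier ?D) \<and>
       (\<forall>x\<in>vcarrier ?D. \<forall>y\<in>vcarrier ?D. \<Phi> (vadd ?D x y) = \<Phi> x + \<Phi> y) \<and>
       (\<forall>a. \<forall>x\<in>vcarrier ?D. \<Phi> (vscale ?D a x) = a * \<Phi> x) \<and>
       (\<exists>C. \<forall>x\<in>vcarrier ?D. \<bar>\<Phi> x\<bar> \<le> C * vnorm ?D x)" for \<Phi>
    by (simp add: dual_space_def[of ?D])
  have add: "vadd ?D f g = (\<lambda>x\<in>vcarrier Z. f x + g x)"
    and scale: "vscale ?D a f = (\<lambda>x\<in>vcarrier Z. a * f x)" for f g a
    by (auto simp: dual_space_def)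
  have scale_c: "vscale ?D a f \<in> vcarrier ?D" if "f \<in> vcarrier ?D" for a f
    using dual_lincomb[of "{f}" "\<lambda>_. a"] that by (simp add: scale)
  \<comment> \<open>For \<open>f = g\<close> the set \<open>{f, g}\<close> has a single element, so
    the sum must be treated as a multiple.\<close>
  have add_c: "vadd ?D f g \<in> vcarrier ?D" if "f \<in> vcarrier ?D" "g \<in> vcarrier ?D" for f g
  proof (cases "f = g")
    case True
    then have "vadd ?D f g = vscale ?D 2 f" by (simp add: add scale)
    then show ?thesis using scale_c[OF that(1), of 2] by simp
  next
    case False
    then show ?thesis using dual_lincomb[of "{f, g}" "\<lambda>_. 1"] that by (simp add: add)
  qed
  {
    fix \<Phi> assume "\<Phi> \<in> canonical_embedding Z ` vcarrier Z"
    then obtain x where x: "x \<in> vcarrier Z" and \<Phi>: "\<Phi> = (\<lambda>f\<in>vcarrier ?D. f x)"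
      by (auto simp: canonical_embedding_def)
    show "\<Phi> \<in> vcarrier (dual_space ?D)"
      unfolding bidual \<Phi> using x dual_apply_le[of _ x] scale_c add_c
      by (auto simp: add scale mult.commute intro!: exI[of _ "len x"])
  next
    fix \<Phi> assume \<Phi>: "\<Phi> \<in> vcarrier (dual_space ?D)"
    obtain C where C: "\<And>f. f \<in> vcarrier ?D \<Longrightarrow> \<bar>\<Phi> f\<bar> \<le> C * vnorm ?D f"
      using \<Phi> bidual by blast
    let ?B = "{f \<in> vcarrier ?D. vnorm ?D f \<le> 1}"
    define K where "K = (SUP f\<in>?B. \<bar>\<Phi> f\<bar>)"
    have bdd: "bdd_above ((\<lambda>f. \<bar>\<Phi> f\<bar>) ` ?B)"
    proof (intro bdd_aboveI2)
      fix f assume f: "f \<in> ?B"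
      then have "C * vnorm ?D f \<le> \<bar>C\<bar> * 1"
        using dual_norm_nonneg by (intro mult_mono) auto
      then show "\<bar>\<Phi> f\<bar> \<le> \<bar>C\<bar>" using C[of f] f by simp
    qed
    have le: "\<bar>\<Phi> f\<bar> \<le> K * vnorm ?D f" if f: "f \<in> vcarrier ?D" for f
    proof (cases "vnorm ?D f = 0")
      case True then show ?thesis using C[OF f] by simp
    next
      case False
      define s where "s = vnorm ?D f"
      have s: "s > 0" using False dual_norm_nonneg[OF f] by (simp add: s_def)
      have "vnorm ?D (vscale ?D (1/s) f) \<le> 1"
        using dual_norm_upper[OF f] s by (intro dual_norm_least) (simp add: scale s_def abs_mult field_simps)
      then have "\<bar>\<Phi> (vscale ?D (1/s) f)\<bar> \<le> K"
        unfolding K_def using scale_c[OF f] by (intro cSUP_upper bdd) auto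
      moreover have "\<Phi> (vscale ?D (1/s) f) = \<Phi> f / s" using \<Phi> f bidual by simp
      ultimately show ?thesis using s by (simp add: s_def[symmetric] field_simps)
    qed
    have z: "(\<lambda>x\<in>vcarrier Z. 0) \<in> ?B"
      using dual_lincomb[of "{}"] dual_norm_least[of "\<lambda>x\<in>vcarrier Z. 0" 1] by simp
    have "0 \<le> K" unfolding K_def using z by (intro cSUP_upper2[OF bdd]) auto
    have "\<exists>x\<in>vcarrier Z. \<forall>f\<in>vcarrier ?D. \<Phi> f = f x"
    proof (cases "K = 0")
      case True
      have "f (vzero Z) = 0" if "f \<in> vcarrier ?D" for f
        using dual_apply_le[OF that zero_closed] len_zero by simp
      then show ?thesis using le True zero_closed by force
    next
      case False
      then have K: "K > 0" using \<open>0 \<le> K\<close> by simp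
      define \<Psi> where "\<Psi> = (\<lambda>f\<in>vcarrier ?D. \<Phi> f / K)"
      have \<Psi>le: "\<bar>\<Psi> f\<bar> \<le> vnorm ?D f" if "f \<in> vcarrier ?D" for f
        using le[OF that] K that by (simp add: \<Psi>_def field_simps)
      have \<Psi>: "\<Psi> \<in> vcarrier (dual_space ?D)"
        unfolding bidual using \<Phi>[unfolded bidual] add_c scale_c \<Psi>le
        by (auto simp: \<Psi>_def add_divide_distrib intro!: exI[of _ 1])
      have "\<exists>f\<in>vcarrier ?D. vnorm ?D f \<le> 1 \<and> 1 - e < \<bar>\<Psi> f\<bar>" if e: "e > 0" for e
      proof -
        have "K * (1 - e) < (SUP f\<in>?B. \<bar>\<Phi> f\<bar>)" using K e by (simp add: K_def[symmetric])
        then obtain f where f: "f \<in> ?B" "K * (1 - e) < \<bar>\<Phi> f\<bar>"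
          using less_cSUP_iff[OF _ bdd] z by blast
        then show ?thesis using K by (intro bexI[of _ f]) (auto simp: \<Psi>_def field_simps)
      qed
      then obtain x where x: "x \<in> vcarrier Z" "\<And>f. f \<in> vcarrier ?D \<Longrightarrow> \<Psi> f = f x"
        using milman_pettis_unit[OF Z compl uc \<Psi> \<Psi>le] by blast
      have "\<Phi> f = f (K \<odot> x)" if f: "f \<in> vcarrier ?D" for f
        using x(2)[OF f] f x(1) dual_carrier_iff K by (simp add: \<Psi>_def field_simps)
      then show ?thesis using x(1) scale_closed by blast
    qed
    then obtain x where x: "x \<in> vcarrier Z" "\<And>f. f \<in> vcarrier ?D \<Longrightarrow> \<Phi> f = f x" by blast
    have "\<Phi> = canonical_embedding Z x"
      using x \<Phi> bidual by (intro extensionalityI[of _ "vcarrier ?D"]) (auto simp: canonical_embedding_def)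
    then show "\<Phi> \<in> canonical_embedding Z ` vcarrier Z" using x by blast
  }
qed

section \<open>Duals and reflexivity under a change of norm\<close>

lemma dual_space_mono:
  assumes Z: "real_normed_space Z" and Z': "real_normed_space Z'"
    and eq: "vcarrier Z' = vcarrier Z" "vadd Z' = vadd Z" "vscale Z' = vscale Z"
    and C: "0 \<le> C" "\<And>x. x \<in> vcarrier Z \<Longrightarrow> vnorm Z x \<le> C * vnorm Z' x"
    and f: "f \<in> vcarrier (dual_space Z)"
  shows "f \<in> vcarrier (dual_space Z')"
    and "vnorm (dual_space Z') f \<le> C * vnorm (dual_space Z) f"
proof -
  interpret real_normed_space Z by fact
  have le: "\<bar>f x\<bar> \<le> C * vnorm (dual_space Z) f * vnorm Z' x" if x: "x \<in> vcarrier Z" for x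
  proof -
    have "\<bar>f x\<bar> \<le> vnorm (dual_space Z) f * vnorm Z x" by (rule dual_apply_le[OF f x])
    also have "\<dots> \<le> vnorm (dual_space Z) f * (C * vnorm Z' x)"
      by (rule mult_left_mono[OF C(2)[OF x] dual_norm_nonneg[OF f]])
    finally show ?thesis by (simp add: mult_ac)
  qed
  then show "f \<in> vcarrier (dual_space Z')"
    using f unfolding dual_carrier_iff real_normed_space.dual_carrier_iff[OF Z'] eq by blast
  show "vnorm (dual_space Z') f \<le> C * vnorm (dual_space Z) f"
  proof (rule real_normed_space.dual_norm_least[OF Z'])
    fix x assume x: "x \<in> vcarrier Z'" "vnorm Z' x \<le> 1"
    have "C * vnorm (dual_space Z) f * vnorm Z' x \<le> C * vnorm (dual_space Z) f * 1"
      using x C(1) dual_norm_nonneg[OF f] by (intro mult_left_mono) auto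
    then show "\<bar>f x\<bar> \<le> C * vnorm (dual_space Z) f" using le[of x] x eq by simp
  qed
qed

text \<open>Equivalent norms have the same bounded functionals, for the dual and hence for the
  second dual, and the canonical embedding is built from these carriers alone.\<close>

lemma reflexive_space_equivalent_norm:
  assumes Z: "real_normed_space Z" and Z': "real_normed_space Z'"
    and eq: "vcarrier Z' = vcarrier Z" "vadd Z' = vadd Z" "vscale Z' = vscale Z"
    and equiv: "equivalent_norms_on (vcarrier Z) (vnorm Z') (vnorm Z)"
    and refl: "reflexive_space Z'"
  shows "reflexive_space Z"
proof -
  obtain c C where c: "0 < c" "0 < C" "\<And>x. x \<in> vcarrier Z \<Longrightarrow> c * vnorm Z x \<le> vnorm Z' x"
    "\<And>x. x \<in> vcarrier Z \<Longrightarrow> vnorm Z' x \<le> C * vnorm Z x"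
    using equiv unfolding equivalent_norms_on_def by blast
  have c': "vnorm Z x \<le> (1/c) * vnorm Z' x" if "x \<in> vcarrier Z" for x
    using c(3)[OF that] c(1) by (simp add: field_simps)
  have c'': "vnorm Z' x \<le> C * vnorm Z x" if "x \<in> vcarrier Z'" for x
    using c(4) that eq(1) by simp
  have mono: "f \<in> vcarrier (dual_space Z')" "vnorm (dual_space Z') f \<le> 1/c * vnorm (dual_space Z) f"
    if "f \<in> vcarrier (dual_space Z)" for f
    by (rule dual_space_mono[OF Z Z' eq _ c' that]; use c(1) in simp)+
  have mono': "f \<in> vcarrier (dual_space Z)" "vnorm (dual_space Z) f \<le> C * vnorm (dual_space Z') f"
    if "f \<in> vcarrier (dual_space Z')" for f
    by (rule dual_space_mono[OF Z' Z eq[symmetric] less_imp_le[OF c(2)] c'' that]; simp)+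
  have D: "vcarrier (dual_space Z') = vcarrier (dual_space Z)"
    using mono(1) mono'(1) by blast
  have ops: "vadd (dual_space Z') = vadd (dual_space Z)" "vscale (dual_space Z') = vscale (dual_space Z)"
    unfolding dual_space_def using eq by simp_all
  \<comment> \<open>Stated for arbitrary \<open>n\<close> and \<open>n'\<close>, so that it serves
    in both directions between the two dual norms.\<close>
  have bounded: "\<exists>K. \<forall>f\<in>S. \<bar>\<Phi> f\<bar> \<le> K * n' f"
    if le: "\<And>f. f \<in> S \<Longrightarrow> n f \<le> K * n' f" and nonneg: "\<And>f. f \<in> S \<Longrightarrow> 0 \<le> n f"
      and bdd: "\<exists>L. \<forall>f\<in>S. \<bar>\<Phi> f\<bar> \<le> L * n f"
    for S K and \<Phi> n n' :: "('a \<Rightarrow> real) \<Rightarrow> real"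
  proof -
    obtain L where L: "\<And>f. f \<in> S \<Longrightarrow> \<bar>\<Phi> f\<bar> \<le> L * n f" using bdd by blast
    have "\<bar>\<Phi> f\<bar> \<le> (\<bar>L\<bar> * K) * n' f" if f: "f \<in> S" for f
    proof -
      have "L * n f \<le> \<bar>L\<bar> * n f" using nonneg[OF f] by (intro mult_right_mono) auto
      also have "\<dots> \<le> \<bar>L\<bar> * (K * n' f)" using le[OF f] by (intro mult_left_mono) auto
      finally show ?thesis using L[OF f] by (simp add: mult_ac)
    qed
    then show ?thesis by (intro exI[of _ "\<bar>L\<bar> * K"]) simp
  qed
  have norms: "\<exists>K. \<forall>f\<in>vcarrier (dual_space Z). \<bar>\<Phi> f\<bar> \<le> K * vnorm (dual_space Z) f"
    if "\<exists>K. \<forall>f\<in>vcarrier (dual_space Z). \<bar>\<Phi> f\<bar> \<le> K * vnorm (dual_space Z') f" for \<Phi>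
    by (rule bounded[where K = "1/c", OF _ _ that]) (use mono(2) real_normed_space.dual_norm_nonneg[OF Z'] D in auto)
  have norms': "\<exists>K. \<forall>f\<in>vcarrier (dual_space Z). \<bar>\<Phi> f\<bar> \<le> K * vnorm (dual_space Z') f"
    if "\<exists>K. \<forall>f\<in>vcarrier (dual_space Z). \<bar>\<Phi> f\<bar> \<le> K * vnorm (dual_space Z) f" for \<Phi>
    by (rule bounded[OF _ _ that]) (use mono'(2) real_normed_space.dual_norm_nonneg[OF Z] D in auto)
  have DD: "vcarrier (dual_space (dual_space Z')) = vcarrier (dual_space (dual_space Z))"
    unfolding dual_space_def[of "dual_space Z"] dual_space_def[of "dual_space Z'"] D ops
    by (simp add: iffI[OF norms norms'])
  have "canonical_embedding Z' = canonical_embedding Z"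
    unfolding canonical_embedding_def D by simp
  then show ?thesis using refl unfolding reflexive_space_def DD eq by simp
qed

text \<open>The algebraic axioms hold pointwise for functions and are transported by
  \<open>q\<close>. In the application \<open>V\<close> consists of the real-valued representatives,
  \<open>q\<close> takes classes, and \<open>N\<close> is either of the two norms.\<close>

lemma real_normed_space_quotient:
  fixes q :: "('a \<Rightarrow> real) \<Rightarrow> 'v" and Z :: "'v nspace"
  assumes V: "(\<lambda>x. 0) \<in> V" "\<And>f g. f \<in> V \<Longrightarrow> g \<in> V \<Longrightarrow> (\<lambda>x. f x + g x) \<in> V"
      "\<And>a f. f \<in> V \<Longrightarrow> (\<lambda>x. a * f x) \<in> V"
    and Z: "vcarrier Z = q ` V" "vzero Z = q (\<lambda>x. 0)"
      "\<And>f g. f \<in> V \<Longrightarrow> g \<in> V \<Longrightarrow> vadd Z (q f) (q g) = q (\<lambda>x. f x + g x)"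
      "\<And>a f. f \<in> V \<Longrightarrow> vscale Z a (q f) = q (\<lambda>x. a * f x)"
      "\<And>f. f \<in> V \<Longrightarrow> vnorm Z (q f) = N f"
    and N: "\<And>f. f \<in> V \<Longrightarrow> 0 \<le> N f" "\<And>f. f \<in> V \<Longrightarrow> N f = 0 \<Longrightarrow> q f = q (\<lambda>x. 0)"
      "\<And>a f. f \<in> V \<Longrightarrow> N (\<lambda>x. a * f x) = \<bar>a\<bar> * N f"
      "\<And>f g. f \<in> V \<Longrightarrow> g \<in> V \<Longrightarrow> N (\<lambda>x. f x + g x) \<le> N f + N g"
  shows "real_normed_space Z"
proof -
  have N0: "N (\<lambda>x. 0) = 0" using N(3)[OF V(1), of 0] by simp
  show ?thesis
  proof (unfold_locales, unfold Z(1); (elim imageE)?)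
    show "vnorm Z x = 0 \<longleftrightarrow> x = vzero Z" if "x = q f" "f \<in> V" for x f
      using Z(2,5) N0 N(2) V(1) that by metis
    show "vscale Z (a + b) x = vadd Z (vscale Z a x) (vscale Z b x)" if "x = q f" "f \<in> V" for a b x f
      using that by (simp add: Z V distrib_right)
    show "vscale Z a (vadd Z x y) = vadd Z (vscale Z a x) (vscale Z a y)"
      if "x = q f" "y = q g" "f \<in> V" "g \<in> V" for a x y f g
      using that by (simp add: Z V distrib_left)
    show "vadd Z x (vscale Z (- 1) x) = vzero Z" if "x = q f" "f \<in> V" for x f
      using that Z(3)[OF that(2) V(3)[OF that(2), of "-1"]] by (simp add: Z)
  qed (use V in \<open>auto simp: Z N add_ac mult_ac\<close>)
qed

section \<open>Arc length parametrisation\<close>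

text \<open>The sum in \<open>curve_length\<close> as a recursion, so that inserting and joining
  points are list inductions.\<close>

fun polygon_length :: "(real \<Rightarrow> 'a::metric_space) \<Rightarrow> real list \<Rightarrow> ennreal" where
  "polygon_length \<gamma> (x # y # xs) = ennreal (dist (\<gamma> x) (\<gamma> y)) + polygon_length \<gamma> (y # xs)"
| "polygon_length \<gamma> xs = 0"

lemma polygon_length_eq_sum:
  "(\<Sum>i<length ts - 1. ennreal (dist (\<gamma> (ts ! i)) (\<gamma> (ts ! Suc i)))) = polygon_length \<gamma> ts"
proof (induction \<gamma> ts rule: polygon_length.induct)
  case (1 \<gamma> x y xs)
  then show ?case by (simp add: sum.lessThan_Suc_shift del: sum.lessThan_Suc sum_ennreal)
qed simp_all

lemma curve_length_eq_SUP:
  "curve_length a b \<gamma> = (SUP ts\<in>{ts. sorted ts \<and> set ts \<subseteq> {a..b}}. polygon_length \<gamma> ts)"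
  unfolding curve_length_def polygon_length_eq_sum ..

lemma polygon_length_le_curve_length:
  "sorted ts \<Longrightarrow> set ts \<subseteq> {a..b} \<Longrightarrow> polygon_length \<gamma> ts \<le> curve_length a b \<gamma>"
  unfolding curve_length_eq_SUP by (rule SUP_upper) simp

lemma polygon_length_append:
  "polygon_length \<gamma> (xs @ c # ys) = polygon_length \<gamma> (xs @ [c]) + polygon_length \<gamma> (c # ys)"
proof (induction xs)
  case (Cons x xs)
  then show ?case by (cases xs) (auto simp: add.assoc)
qed simp

lemma polygon_length_Cons_le: "polygon_length \<gamma> xs \<le> polygon_length \<gamma> (x # xs)"
  by (cases xs) auto

lemma polygon_length_insert: "polygon_length \<gamma> (xs @ ys) \<le> polygon_length \<gamma> (xs @ c # ys)"
proof (induction xs)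
  case Nil
  show ?case using polygon_length_Cons_le[of \<gamma> ys c] by simp
next
  case (Cons x xs)
  show ?case
  proof (cases xs)
    case Nil
    show ?thesis
    proof (cases ys)
      case (Cons y zs)
      have "ennreal (dist (\<gamma> x) (\<gamma> y)) \<le> ennreal (dist (\<gamma> x) (\<gamma> c)) + ennreal (dist (\<gamma> c) (\<gamma> y))"
        using ennreal_leI[OF dist_triangle[of "\<gamma> x" "\<gamma> y" "\<gamma> c"]] by (simp add: ennreal_plus)
      then show ?thesis using Nil Cons by (simp add: add.assoc[symmetric] add_right_mono)
    qed (simp add: Nil)
  next
    case (Cons z zs)
    then show ?thesis using Cons.IH by (simp add: add_left_mono)
  qed
qed

lemma polygon_length_append_ge:
  "polygon_length \<gamma> xs + polygon_length \<gamma> ys \<le> polygon_length \<gamma> (xs @ ys)"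
proof (cases ys)
  case (Cons y zs)
  have "polygon_length \<gamma> (xs @ []) \<le> polygon_length \<gamma> (xs @ [y])" by (rule polygon_length_insert)
  then show ?thesis unfolding Cons polygon_length_append[of \<gamma> xs y zs] by (intro add_right_mono) simp
qed simp

lemma sorted_split_filter:
  fixes xs :: "real list"
  assumes "sorted xs"
  shows "xs = filter (\<lambda>x. x \<le> c) xs @ filter (\<lambda>x. c < x) xs"
  using assms
proof (induction xs)
  case (Cons x xs)
  show ?case
  proof (cases "x \<le> c")
    case True then show ?thesis using Cons by auto
  next
    case False
    then have "filter (\<lambda>x. x \<le> c) xs = []" "filter (\<lambda>x. c < x) xs = xs"
      using Cons by (auto simp: filter_empty_conv filter_id_conv)
    then show ?thesis using False by simp
  qed
qed simp

text \<open>Inserting \<open>c\<close> into a partition can only lengthen its polygon. Conversely,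
  partitions of the two halves concatenate, and the joining edge only adds length.\<close>

lemma curve_length_add:
  assumes "a \<le> c" "c \<le> b"
  shows "curve_length a b \<gamma> = curve_length a c \<gamma> + curve_length c b \<gamma>"
proof (rule antisym)
  show "curve_length a b \<gamma> \<le> curve_length a c \<gamma> + curve_length c b \<gamma>"
    unfolding curve_length_eq_SUP[of a b]
  proof (rule SUP_least)
    fix ts assume ts: "ts \<in> {ts. sorted ts \<and> set ts \<subseteq> {a..b}}"
    let ?l = "filter (\<lambda>x. x \<le> c) ts" and ?r = "filter (\<lambda>x. c < x) ts"
    have "polygon_length \<gamma> ts \<le> polygon_length \<gamma> (?l @ c # ?r)"
      using sorted_split_filter[of ts c] polygon_length_insert[of \<gamma> ?l ?r c] ts by simp
    also have "\<dots> = polygon_length \<gamma> (?l @ [c]) + polygon_length \<gamma> (c # ?r)"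
      by (rule polygon_length_append)
    also have "\<dots> \<le> curve_length a c \<gamma> + curve_length c b \<gamma>"
      using ts assms sorted_filter[of id ts]
      by (intro add_mono polygon_length_le_curve_length) (auto simp: sorted_append less_imp_le)
    finally show "polygon_length \<gamma> ts \<le> curve_length a c \<gamma> + curve_length c b \<gamma>" .
  qed
next
  have "polygon_length \<gamma> ts + polygon_length \<gamma> us \<le> curve_length a b \<gamma>"
    if "sorted ts" "set ts \<subseteq> {a..c}" "sorted us" "set us \<subseteq> {c..b}" for ts us
  proof -
    have "x \<le> y" if "x \<in> set ts" "y \<in> set us" for x y
      using that \<open>set ts \<subseteq> {a..c}\<close> \<open>set us \<subseteq> {c..b}\<close> by fastforce
    then have "polygon_length \<gamma> (ts @ us) \<le> curve_length a b \<gamma>"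
      using that assms by (intro polygon_length_le_curve_length) (auto simp: sorted_append)
    then show ?thesis using polygon_length_append_ge order_trans by blast
  qed
  then have "polygon_length \<gamma> ts + curve_length c b \<gamma> \<le> curve_length a b \<gamma>"
    if "sorted ts" "set ts \<subseteq> {a..c}" for ts
    unfolding curve_length_eq_SUP[of c b] using that
    by (subst ennreal_SUP_add_right) (auto intro!: SUP_least exI[of _ "[]"])
  then show "curve_length a c \<gamma> + curve_length c b \<gamma> \<le> curve_length a b \<gamma>"
    unfolding curve_length_eq_SUP[of a c]
    by (subst ennreal_SUP_add_left[symmetric]) (auto intro!: SUP_least exI[of _ "[]"])
qed

lemma curve_length_refl: "curve_length a a \<gamma> = 0"
proof -
  have "polygon_length \<gamma> ts = 0" if "set ts \<subseteq> {a}" for ts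
    using that by (induction \<gamma> ts rule: polygon_length.induct) auto
  then show ?thesis unfolding curve_length_eq_SUP by (intro SUP_eq_const) (auto intro: exI[of _ "[]"])
qed

lemma dist_le_curve_length:
  assumes "s \<le> t"
  shows "ennreal (dist (\<gamma> s) (\<gamma> t)) \<le> curve_length s t \<gamma>"
  using polygon_length_le_curve_length[of "[s, t]" s t \<gamma>] assms by simp

text \<open>A monotone change of parameter carries partitions to partitions with the same polygon.
  Equality of lengths follows where a change of parameter exists in each direction.\<close>

lemma curve_length_reparam:
  assumes "mono_on {a..b} V" "\<And>s. s \<in> {a..b} \<Longrightarrow> V s \<in> {a'..b'} \<and> c (V s) = \<gamma> s"
  shows "curve_length a b \<gamma> \<le> curve_length a' b' c"
  unfolding curve_length_eq_SUP[of a b]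
proof (rule SUP_least)
  fix ts assume ts: "ts \<in> {ts. sorted ts \<and> set ts \<subseteq> {a..b}}"
  have "polygon_length \<gamma> ts = polygon_length c (map V ts)" if "set ts \<subseteq> {a..b}" for ts
    using that assms(2) by (induction \<gamma> ts rule: polygon_length.induct) auto
  moreover have "sorted (map V ts)" if "sorted ts" "set ts \<subseteq> {a..b}" for ts
    using that by (induction ts) (auto intro!: mono_onD[OF assms(1)])
  moreover have "V x \<in> {a'..b'}" if "x \<in> set ts" for x using assms(2)[of x] ts that by blast
  ultimately show "polygon_length \<gamma> ts \<le> curve_length a' b' c"
    using ts by (auto intro!: polygon_length_le_curve_length)
qed

lemma curve_length_le_lipschitz:
  assumes "\<And>s t. a \<le> s \<Longrightarrow> s \<le> t \<Longrightarrow> t \<le> b \<Longrightarrow> dist (c s) (c t) \<le> t - s" and "a \<le> b"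
  shows "curve_length a b c \<le> ennreal (b - a)"
  unfolding curve_length_eq_SUP
proof (rule SUP_least)
  fix ts assume ts: "ts \<in> {ts. sorted ts \<and> set ts \<subseteq> {a..b}}"
  have "polygon_length c (x # ts) \<le> ennreal (b - x)" if "sorted (x # ts)" "set (x # ts) \<subseteq> {a..b}" for x ts
    using that
  proof (induction ts arbitrary: x)
    case (Cons y ts)
    have "polygon_length c (x # y # ts) \<le> ennreal (y - x) + ennreal (b - y)"
      unfolding polygon_length.simps using Cons.prems
      by (intro add_mono Cons.IH ennreal_leI assms(1)) auto
    also have "\<dots> = ennreal (b - x)" using Cons.prems by (subst ennreal_plus[symmetric]) auto
    finally show ?case .
  qed simp
  note le = this
  show "polygon_length c ts \<le> ennreal (b - a)"
  proof (cases ts)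
    case (Cons x xs)
    then have "polygon_length c ts \<le> ennreal (b - x)" using le[of x xs] ts by simp
    also have "\<dots> \<le> ennreal (b - a)" using ts Cons by (intro ennreal_leI) auto
    finally show ?thesis .
  qed simp
qed

locale rectifiable =
  fixes a b :: real and \<gamma> :: "real \<Rightarrow> 'a::metric_space"
  assumes rect: "rectifiable_curve a b \<gamma>"
begin

definition arclen :: "real \<Rightarrow> real" where
  "arclen t = enn2real (curve_length a t \<gamma>)"

lemma le: "a \<le> b" using rect by (simp add: rectifiable_curve_def)

lemma finite_length: "a \<le> s \<Longrightarrow> s \<le> t \<Longrightarrow> t \<le> b \<Longrightarrow> curve_length s t \<gamma> < \<infinity>"
  using rect curve_length_add[of a s b \<gamma>] curve_length_add[of s t b \<gamma>]
  by (auto simp: rectifiable_curve_def ennreal_add_less_top)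

lemma curve_length_arclen:
  assumes "a \<le> s" "s \<le> t" "t \<le> b"
  shows "curve_length s t \<gamma> = ennreal (arclen t - arclen s)" "arclen s \<le> arclen t"
proof -
  have "curve_length a t \<gamma> = curve_length a s \<gamma> + curve_length s t \<gamma>"
    using assms by (intro curve_length_add) auto
  moreover have "curve_length a s \<gamma> < \<infinity>" "curve_length s t \<gamma> < \<infinity>"
    using assms finite_length[of a s] finite_length[of s t] by auto
  ultimately have *: "arclen t = arclen s + enn2real (curve_length s t \<gamma>)"
    unfolding arclen_def by (simp add: enn2real_plus)
  then show "arclen s \<le> arclen t" by simp
  show "curve_length s t \<gamma> = ennreal (arclen t - arclen s)"
    using * \<open>curve_length s t \<gamma> < \<infinity>\<close> by simp
qed

lemma arclen_start: "arclen a = 0" by (simp add: arclen_def curve_length_refl)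

lemma curve_length_from_start: "t \<in> {a..b} \<Longrightarrow> curve_length a t \<gamma> = ennreal (arclen t)"
  using curve_length_arclen(1)[of a t] arclen_start by simp

lemma arclen_nonneg: "t \<in> {a..b} \<Longrightarrow> 0 \<le> arclen t"
  using curve_length_arclen(2)[of a t] arclen_start by simp

lemma dist_le_arclen: "a \<le> s \<Longrightarrow> s \<le> t \<Longrightarrow> t \<le> b \<Longrightarrow> dist (\<gamma> s) (\<gamma> t) \<le> arclen t - arclen s"
  using dist_le_curve_length[of s t \<gamma>] curve_length_arclen[of s t] by (simp add: ennreal_le_iff)

text \<open>Take a partition whose polygon comes within \<open>e\<close> of the total length. The
  ends of an interval free of interior partition points may be inserted; since every other piece is
  at most as long as its arc, the chord of this interval falls short of its arc by at most
  \<open>e\<close>. This gives continuity of the length function.\<close>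

lemma arclen_near_chord:
  assumes "0 < e"
  obtains P where "finite P"
    "\<And>s t. \<lbrakk>a \<le> s; s \<le> t; t \<le> b; P \<inter> {s<..<t} = {}\<rbrakk> \<Longrightarrow> arclen t - arclen s \<le> dist (\<gamma> s) (\<gamma> t) + e"
proof -
  \<comment> \<open>For length 0 a strict approximation from below is impossible, as negative reals
    become 0 in \<open>ennreal\<close>; the empty partition serves instead.\<close>
  have "ennreal (arclen b - e) < curve_length a b \<gamma> \<or> curve_length a b \<gamma> = 0"
  proof (cases "arclen b > 0")
    case True
    then show ?thesis
      using curve_length_from_start[of b] le assms by (simp add: ennreal_lessI)
  qed (use curve_length_from_start[of b] arclen_nonneg[of b] le in auto)
  then obtain ts where ts: "sorted ts" "set ts \<subseteq> {a..b}" "ennreal (arclen b - e) \<le> polygon_length \<gamma> ts"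
  proof
    assume "ennreal (arclen b - e) < curve_length a b \<gamma>"
    then show ?thesis unfolding curve_length_eq_SUP less_SUP_iff using that less_imp_le by blast
  next
    assume "curve_length a b \<gamma> = 0"
    then have "arclen b - e \<le> 0" using assms by (simp add: arclen_def)
    then show ?thesis using that[of "[]"] by (simp add: ennreal_neg)
  qed
  show ?thesis
  proof (rule that[of "set ts"])
    fix s t assume st: "a \<le> s" "s \<le> t" "t \<le> b" "set ts \<inter> {s<..<t} = {}"
    let ?l = "filter (\<lambda>x. x \<le> s) ts" and ?r = "filter (\<lambda>x. s < x) ts"
    have r: "t \<le> x" if "x \<in> set ts" "s < x" for x using that st(4) by force
    have "polygon_length \<gamma> ts \<le> polygon_length \<gamma> (?l @ s # ?r)"
      using sorted_split_filter[of ts s] polygon_length_insert[of \<gamma> ?l ?r s] ts by simp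
    also have "\<dots> \<le> polygon_length \<gamma> (?l @ s # t # ?r)"
      using polygon_length_insert[of \<gamma> "?l @ [s]" ?r t] by simp
    also have "\<dots> = polygon_length \<gamma> (?l @ [s]) + (ennreal (dist (\<gamma> s) (\<gamma> t)) + polygon_length \<gamma> (t # ?r))"
      by (subst polygon_length_append) simp
    also have "\<dots> \<le> curve_length a s \<gamma> + (ennreal (dist (\<gamma> s) (\<gamma> t)) + curve_length t b \<gamma>)"
      using ts st r sorted_filter[of id ts]
      by (intro add_mono polygon_length_le_curve_length order_refl) (auto simp: sorted_append)
    also have "\<dots> = ennreal (arclen s + (dist (\<gamma> s) (\<gamma> t) + (arclen b - arclen t)))"
      using st curve_length_arclen(2)[of t b] curve_length_arclen(1)[of t b]
        curve_length_from_start[of s] arclen_nonneg[of s]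
      by (simp add: ennreal_plus)
    finally have "ennreal (arclen b - e) \<le> ennreal (arclen s + (dist (\<gamma> s) (\<gamma> t) + (arclen b - arclen t)))"
      using ts(3) order_trans by blast
    moreover have "0 \<le> arclen s + (dist (\<gamma> s) (\<gamma> t) + (arclen b - arclen t))"
      using st arclen_nonneg[of s] curve_length_arclen(2)[of t b] by simp
    ultimately show "arclen t - arclen s \<le> dist (\<gamma> s) (\<gamma> t) + e" by (simp add: ennreal_le_iff)
  qed simp
qed

text \<open>Near \<open>t0\<close> the finite partition has no points except possibly
  \<open>t0\<close> itself, so the arc between \<open>t0\<close> and a nearby parameter is almost
  its chord, and the chord is small by continuity of the curve.\<close>

lemma continuous_on_arclen: "continuous_on {a..b} arclen"
proof -
  have "\<exists>d>0. \<forall>t\<in>{a..b}. dist t t0 < d \<longrightarrow> dist (arclen t) (arclen t0) < e"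
    if t0: "t0 \<in> {a..b}" and e: "e > 0" for t0 e
  proof -
    obtain P where P: "finite P" "\<And>s t. \<lbrakk>a \<le> s; s \<le> t; t \<le> b; P \<inter> {s<..<t} = {}\<rbrakk>
        \<Longrightarrow> arclen t - arclen s \<le> dist (\<gamma> s) (\<gamma> t) + e/2"
      using arclen_near_chord[of "e/2"] e by auto
    have "continuous_on {a..b} \<gamma>" using rect by (simp add: rectifiable_curve_def)
    then obtain d1 where d1: "d1 > 0" "\<And>t. t \<in> {a..b} \<Longrightarrow> dist t t0 < d1 \<Longrightarrow> dist (\<gamma> t) (\<gamma> t0) < e/2"
      using t0 e unfolding continuous_on_iff by (metis half_gt_zero)
    obtain d2 where d2: "d2 > 0" "\<And>x. x \<in> P \<Longrightarrow> x \<noteq> t0 \<Longrightarrow> d2 \<le> dist t0 x"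
      using finite_set_avoid[OF P(1), of t0] by blast
    have "dist (arclen t) (arclen t0) < e" if t: "t \<in> {a..b}" "dist t t0 < min d1 d2" for t
    proof (cases "t \<le> t0")
      case True
      have "P \<inter> {t<..<t0} = {}" using d2(2) t(2) True by (force simp: dist_real_def)
      then have "arclen t0 - arclen t \<le> dist (\<gamma> t) (\<gamma> t0) + e/2" using P(2) t t0 True by auto
      then show ?thesis
        using d1(2)[of t] t curve_length_arclen(2)[of t t0] t0 True by (simp add: dist_real_def)
    next
      case False
      have "P \<inter> {t0<..<t} = {}" using d2(2) t(2) False by (force simp: dist_real_def)
      then have "arclen t - arclen t0 \<le> dist (\<gamma> t0) (\<gamma> t) + e/2" using P(2) t t0 False by auto
      then show ?thesis
        using d1(2)[of t] t curve_length_arclen(2)[of t0 t] t0 False by (simp add: dist_real_def dist_commute)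
    qed
    then show ?thesis using d1(1) d2(1) by (intro exI[of _ "min d1 d2"]) auto
  qed
  then show ?thesis unfolding continuous_on_iff by blast
qed

lemma arclen_onto:
  assumes "\<tau> \<in> {0..arclen b}"
  obtains s where "s \<in> {a..b}" "arclen s = \<tau>"
  using IVT'[of arclen a \<tau> b] assms le continuous_on_arclen arclen_start by auto

text \<open>Parameters of equal arc length bound a piece of length 0, hence have the same image,
  whichever of them is chosen.\<close>

lemma arclength_param_arclen:
  assumes "s \<in> {a..b}"
  shows "arclength_param a b \<gamma> (arclen s) = \<gamma> s"
proof -
  define s' where "s' = (SOME s'. s' \<in> {a..b} \<and> curve_length a s' \<gamma> = ennreal (arclen s))"
  have "s' \<in> {a..b} \<and> curve_length a s' \<gamma> = ennreal (arclen s)"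
    unfolding s'_def by (rule someI[of _ s]) (use assms curve_length_from_start in auto)
  then have "s' \<in> {a..b}" "arclen s' = arclen s"
    using curve_length_from_start[of s'] arclen_nonneg assms by auto
  then have "dist (\<gamma> s) (\<gamma> s') \<le> 0"
    using dist_le_arclen[of s s'] dist_le_arclen[of s' s] assms dist_commute[of "\<gamma> s" "\<gamma> s'"]
    by (cases "s \<le> s'") simp_all
  then show ?thesis unfolding arclength_param_def s'_def[symmetric] by simp
qed

text \<open>The parametrisation is 1-Lipschitz, which bounds the length from above. The original
  curve is a reparametrisation of it by the monotone \<open>arclen\<close>, which bounds the length
  from below.\<close>

lemma curve_length_arclength_param:
  assumes "0 \<le> s" "s \<le> t" "t \<le> arclen b"
  shows "curve_length s t (arclength_param a b \<gamma>) = ennreal (t - s)"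
proof (rule antisym)
  let ?c = "arclength_param a b \<gamma>"
  \<comment> \<open>Preimages under \<open>arclen\<close> can be chosen in order: if they come out
    reversed, the two values agree and one preimage serves for both.\<close>
  have lift: "\<exists>s' t'. a \<le> s' \<and> s' \<le> t' \<and> t' \<le> b \<and> arclen s' = s \<and> arclen t' = t"
    if st: "0 \<le> s" "s \<le> t" "t \<le> arclen b" for s t
  proof -
    obtain s' where s': "s' \<in> {a..b}" "arclen s' = s" by (rule arclen_onto[of s]) (use st in auto)
    obtain t' where t': "t' \<in> {a..b}" "arclen t' = t" by (rule arclen_onto[of t]) (use st in auto)
    show ?thesis
    proof (cases "s' \<le> t'")
      case False
      then have "arclen t' \<le> arclen s'" using curve_length_arclen(2)[of t' s'] s' t' by auto
      then show ?thesis using s' t' st by (intro exI[of _ s']) auto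
    qed (use s' t' in auto)
  qed
  have "dist (?c x) (?c y) \<le> y - x" if "s \<le> x" "x \<le> y" "y \<le> t" for x y
    using lift[of x y] that assms dist_le_arclen arclength_param_arclen by fastforce
  then show "curve_length s t ?c \<le> ennreal (t - s)"
    using assms by (intro curve_length_le_lipschitz) auto
  obtain s' t' where st: "a \<le> s'" "s' \<le> t'" "t' \<le> b" "arclen s' = s" "arclen t' = t"
    using lift assms by blast
  have "ennreal (t - s) = curve_length s' t' \<gamma>" using curve_length_arclen(1)[of s' t'] st by simp
  also have "\<dots> \<le> curve_length s t ?c"
    using st curve_length_arclen(2) arclength_param_arclen
    by (intro curve_length_reparam[where V = arclen]) (auto intro!: mono_onI)
  finally show "ennreal (t - s) \<le> curve_length s t ?c" .
qed

end

text \<open>Parametrisation by arc length on \<open>{0..l}\<close>; the condition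
  \<open>0 < l\<close> takes the place of nonconstancy.\<close>

definition unit_speed :: "real \<Rightarrow> (real \<Rightarrow> 'a::metric_space) \<Rightarrow> bool" where
  "unit_speed l c \<longleftrightarrow> 0 < l \<and>
    (\<forall>s t. 0 \<le> s \<and> s \<le> t \<and> t \<le> l \<longrightarrow> curve_length s t c = ennreal (t - s))"

definition line_integral :: "(real \<Rightarrow> 'a) \<Rightarrow> real \<Rightarrow> real \<Rightarrow> ('a \<Rightarrow> ennreal) \<Rightarrow> ennreal" where
  "line_integral c s t g = (\<integral>\<^sup>+ \<tau>\<in>{s..t}. g (c \<tau>) \<partial>lborel)"

lemma unit_speed_dist:
  assumes "unit_speed l c" "s \<in> {0..l}" "t \<in> {0..l}"
  shows "dist (c s) (c t) \<le> \<bar>s - t\<bar>"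
proof -
  have *: "dist (c s) (c t) \<le> t - s" if "0 \<le> s" "s \<le> t" "t \<le> l" for s t
    using dist_le_curve_length[of s t c] that assms(1) by (simp add: unit_speed_def ennreal_le_iff)
  show ?thesis
    using *[of s t] *[of t s] assms by (cases "s \<le> t") (auto simp: dist_commute)
qed

lemma unit_speed_continuous:
  assumes "unit_speed l c"
  shows "continuous_on {0..l} c"
  unfolding continuous_on_iff
  using unit_speed_dist[OF assms] by (metis dist_real_def le_less_trans)

lemma unit_speed_subarc:
  assumes c: "unit_speed l c" and st: "0 \<le> s" "s < t" "t \<le> l"
  shows "unit_speed (t - s) (\<lambda>\<tau>. c (s + \<tau>))"
  unfolding unit_speed_def
proof (intro conjI allI impI)
  fix x y assume xy: "0 \<le> x \<and> x \<le> y \<and> y \<le> t - s"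
  have "curve_length x y (\<lambda>\<tau>. c (s + \<tau>)) = curve_length (s + x) (s + y) c"
    by (intro antisym curve_length_reparam[where V = "\<lambda>\<tau>. s + \<tau>"]
        curve_length_reparam[where V = "\<lambda>\<tau>. \<tau> - s"]) (auto intro!: mono_onI)
  then show "curve_length x y (\<lambda>\<tau>. c (s + \<tau>)) = ennreal (y - x)"
    using c st xy by (simp add: unit_speed_def)
qed (use st in simp)

text \<open>A nonconstant rectifiable curve has the same end points and the same integrals as its
  arc length parametrisation, and a unit speed arc is its own parametrisation. All later arguments
  about curves take place on such arcs, where the integral is a plain Lebesgue integral.\<close>

lemma upper_gradient_iff_unit_speed:
  "upper_gradient u g \<longleftrightarrow> u \<in> borel_measurable borel \<and> g \<in> borel_measurable borel \<and>
    (\<forall>l c. unit_speed l c \<longrightarrow> ext_absdiff (u (c 0)) (u (c l)) \<le> line_integral c 0 l g)"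
proof -
  have A: "ext_absdiff (u (c 0)) (u (c l)) \<le> line_integral c 0 l g"
    if ug: "\<And>a b \<gamma>. rectifiable_curve a b \<gamma> \<Longrightarrow> nonconstant_curve a b \<gamma> \<Longrightarrow>
        ext_absdiff (u (\<gamma> a)) (u (\<gamma> b)) \<le> curve_integral a b \<gamma> g"
      and c: "unit_speed l c" for l c
  proof -
    have l: "0 < l" and len: "curve_length 0 t c = ennreal t" if "t \<in> {0..l}" for t
      using c that by (auto simp: unit_speed_def)
    have l: "0 < l" using c by (simp add: unit_speed_def)
    have "rectifiable_curve 0 l c"
      using l len[of l] unit_speed_continuous[OF c] by (auto simp: rectifiable_curve_def)
    moreover have "nonconstant_curve 0 l c"
      unfolding nonconstant_curve_def
    proof
      assume "c constant_on {0..l}"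
      then obtain y where "c t = y" if "t \<in> {0..l}" for t unfolding constant_on_def by blast
      then have "polygon_length c ts = 0" if "set ts \<subseteq> {0..l}" for ts
        using that by (induction c ts rule: polygon_length.induct) auto
      then have "curve_length 0 l c \<le> 0" unfolding curve_length_eq_SUP by (intro SUP_least) auto
      then show False using len[of l] l by simp
    qed
    moreover have "curve_integral 0 l c g = line_integral c 0 l g"
    proof -
      have "arclength_param 0 l c t = c t" if t: "t \<in> {0..l}" for t
      proof -
        have "(SOME s. s \<in> {0..l} \<and> curve_length 0 s c = ennreal t) = t"
          by (rule some_equality) (use t len in auto)
        then show ?thesis by (simp add: arclength_param_def)
      qed
      then show ?thesis
        unfolding curve_integral_def line_integral_def using len[of l] l
        by (intro nn_integral_cong) (auto simp: indicator_def)
    qed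
    ultimately show ?thesis using ug by metis
  qed
  have B: "ext_absdiff (u (\<gamma> a)) (u (\<gamma> b)) \<le> curve_integral a b \<gamma> g"
    if ug: "\<And>l c. unit_speed l c \<Longrightarrow> ext_absdiff (u (c 0)) (u (c l)) \<le> line_integral c 0 l g"
      and \<gamma>: "rectifiable_curve a b \<gamma>" "nonconstant_curve a b \<gamma>" for a b \<gamma>
  proof -
    interpret rectifiable a b \<gamma> by standard (rule \<gamma>)
    have "arclen b \<noteq> 0"
    proof
      assume "arclen b = 0"
      then have "dist (\<gamma> a) (\<gamma> t) \<le> 0" if "t \<in> {a..b}" for t
        using dist_le_arclen[of a t] curve_length_arclen(2)[of t b] arclen_start that
        unfolding atLeastAtMost_iff by linarith
      then have "\<gamma> constant_on {a..b}" unfolding constant_on_def by (metis dist_le_zero_iff)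
      then show False using \<gamma>(2) by (simp add: nonconstant_curve_def)
    qed
    then have "unit_speed (arclen b) (arclength_param a b \<gamma>)"
      using curve_length_arclength_param arclen_nonneg[of b] le by (auto simp: unit_speed_def)
    from ug[OF this] show ?thesis
      using arclength_param_arclen[of a] arclength_param_arclen[of b] arclen_start le
      by (simp add: curve_integral_def line_integral_def arclen_def)
  qed
  show ?thesis unfolding upper_gradient_def using A B by blast
qed

section \<open>Powers of extended nonnegative functions\<close>

lemma ennpowr_ennreal: "0 \<le> x \<Longrightarrow> ennpowr (ennreal x) p = ennreal (x powr p)"
  by (simp add: ennpowr_def)

lemma ennpowr_top [simp]: "ennpowr top p = top"
  by (simp add: ennpowr_def)

lemma ennpowr_zero [simp]: "ennpowr 0 p = 0"
  by (simp add: ennpowr_def)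

lemma ennpowr_one [simp]: "ennpowr x 1 = x"
  by (cases x) (simp_all add: ennpowr_ennreal)

lemma ennpowr_mono:
  assumes "x \<le> y" "0 \<le> p"
  shows "ennpowr x p \<le> ennpowr y p"
  using assms by (cases x; cases y) (auto simp: ennpowr_ennreal top_unique intro!: ennreal_leI powr_mono2)

lemma ennpowr_less_top [simp]: "ennpowr x p < top \<longleftrightarrow> x < top"
  by (cases x) (auto simp: ennpowr_ennreal)

text \<open>Compatible with \<open>0 * \<infinity> = 0\<close>, because the power fixes 0 and
  \<open>\<infinity>\<close>.\<close>

lemma ennpowr_mult:
  assumes "0 < p"
  shows "ennpowr (x * y) p = ennpowr x p * ennpowr y p"
proof (cases x)
  case x: (real r)
  show ?thesis
  proof (cases y)
    case (real s)
    then show ?thesis using x by (simp add: ennpowr_ennreal powr_mult flip: ennreal_mult)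
  next
    case top
    then show ?thesis using x by (cases "r = 0") (auto simp: ennreal_mult_top ennpowr_ennreal)
  qed
next
  case top
  show ?thesis
  proof (cases y)
    case (real s)
    then show ?thesis using top by (cases "s = 0") (auto simp: ennreal_top_mult ennpowr_ennreal)
  qed (simp add: top)
qed

lemma ennpowr_ennpowr: "ennpowr (ennpowr x p) q = ennpowr x (p * q)"
  by (cases x) (auto simp: ennpowr_ennreal powr_powr)

lemma borel_measurable_ennpowr [measurable (raw)]:
  assumes [measurable]: "f \<in> borel_measurable N"
  shows "(\<lambda>x. ennpowr (f x) p) \<in> borel_measurable N"
  unfolding ennpowr_def by measurable

lemma powr_convex_combination:
  fixes a b t p :: real
  assumes "1 \<le> p" "0 \<le> a" "0 \<le> b" "0 \<le> t" "t \<le> 1"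
  shows "(t * a + (1 - t) * b) powr p \<le> t * a powr p + (1 - t) * b powr p"
proof -
  have zero: "(s * c) powr p \<le> s * c powr p" if "0 \<le> s" "s \<le> 1" "0 \<le> c" for s c :: real
    using that assms(1) powr_mono'[of 1 p s]
    by (cases "s = 0") (auto simp: powr_mult intro: mult_right_mono)
  show ?thesis
  proof (cases "a = 0 \<or> b = 0")
    case True
    then show ?thesis using zero[of t a] zero[of "1 - t" b] assms by auto
  next
    case False
    then show ?thesis
      using convex_onD[OF powr_convex[OF assms(1)], of "1 - t" a b] assms by simp
  qed
qed

lemma ennpowr_convex:
  assumes p: "1 \<le> p" and t: "0 < t" "t < 1"
  shows "ennpowr (ennreal t * x + ennreal (1 - t) * y) p
    \<le> ennreal t * ennpowr x p + ennreal (1 - t) * ennpowr y p"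
proof (cases "x = top \<or> y = top")
  case True
  then show ?thesis using t by (auto simp: ennreal_mult_top)
next
  case False
  then obtain a b where "0 \<le> a" "x = ennreal a" "0 \<le> b" "y = ennreal b" by (cases x; cases y) auto
  then show ?thesis
    using powr_convex_combination[OF p, of a b t] t
    by (simp add: ennpowr_ennreal ennreal_leI flip: ennreal_mult ennreal_plus)
qed

text \<open>Convexity at the midpoint of \<open>2 * x\<close> and \<open>2 * y\<close>. The factor
  \<open>1/2\<close> is discarded, whence the constant \<open>2 powr p\<close>.\<close>

lemma ennpowr_add_le:
  assumes p: "1 \<le> p"
  shows "ennpowr (x + y) p \<le> ennreal (2 powr p) * (ennpowr x p + ennpowr y p)"
proof -
  have half: "z = ennreal (1/2) * (2 * z)" for z :: ennreal
  proof -
    have "ennreal (1/2) * 2 = ennreal ((1/2) * 2)" by (subst ennreal_mult) auto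
    then show ?thesis by (simp add: mult.assoc[symmetric])
  qed
  have le1: "ennreal s \<le> 1" if "s \<le> 1" for s
    using that by (metis ennreal_1 ennreal_leI)
  have two: "ennpowr (2 * z) p = ennreal (2 powr p) * ennpowr z p" for z
    using ennpowr_mult[of p 2 z] ennpowr_ennreal[of 2 p] p by simp
  have "ennpowr (x + y) p = ennpowr (ennreal (1/2) * (2 * x) + ennreal (1 - 1/2) * (2 * y)) p"
    using half[of x] half[of y] by simp
  also have "\<dots> \<le> ennreal (1/2) * ennpowr (2 * x) p + ennreal (1 - 1/2) * ennpowr (2 * y) p"
    by (rule ennpowr_convex) (use p in auto)
  also have "\<dots> \<le> 1 * ennpowr (2 * x) p + 1 * ennpowr (2 * y) p"
    by (intro add_mono mult_right_mono le1) auto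
  finally show ?thesis by (simp add: two distrib_left)
qed

lemma ennreal_abs_diff_eq_0: "ennreal \<bar>x - y\<bar> = 0 \<longleftrightarrow> x = y"
  by (simp add: ennreal_eq_0_iff)

section \<open>Line integrals over unit speed arcs\<close>

text \<open>Continuity of the arc is known on \<open>{0..l}\<close> only, hence the indicator in the
  statement and the detour through the restricted space.\<close>

lemma borel_measurable_unit_speed:
  assumes c: "unit_speed l c" and st: "0 \<le> s" "t \<le> l" and [measurable]: "g \<in> borel_measurable borel"
  shows "(\<lambda>\<tau>. (g (c \<tau>) :: ennreal) * indicator {s..t} \<tau>) \<in> borel_measurable borel"
proof -
  have "continuous_on {s..t} c" using unit_speed_continuous[OF c] st by (auto elim: continuous_on_subset)
  then have "c \<in> borel_measurable (restrict_space borel {s..t})"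
    by (rule borel_measurable_continuous_on_restrict)
  then have "(\<lambda>\<tau>. g (c \<tau>)) \<in> borel_measurable (restrict_space borel {s..t})" by simp
  then show ?thesis by (subst (asm) borel_measurable_restrict_space_iff_ennreal) auto
qed

lemma line_integral_add:
  assumes c: "unit_speed l c" and st: "0 \<le> s" "t \<le> l"
    and g: "g \<in> borel_measurable borel" "h \<in> borel_measurable borel"
  shows "line_integral c s t (\<lambda>x. g x + h x) = line_integral c s t g + line_integral c s t h"
  unfolding line_integral_def distrib_right
  using borel_measurable_unit_speed[OF c st] g by (intro nn_integral_add) simp_all

lemma line_integral_cmult:
  assumes c: "unit_speed l c" and st: "0 \<le> s" "t \<le> l" and g: "g \<in> borel_measurable borel"
  shows "line_integral c s t (\<lambda>x. a * g x) = a * line_integral c s t g"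
  unfolding line_integral_def mult.assoc
  using borel_measurable_unit_speed[OF c st] g by (intro nn_integral_cmult) simp

lemma line_integral_mono:
  assumes "\<And>\<tau>. \<tau> \<in> {s..t} \<Longrightarrow> g (c \<tau>) \<le> h (c \<tau>)"
  shows "line_integral c s t g \<le> line_integral c s t h"
  unfolding line_integral_def using assms by (intro nn_integral_mono) (auto simp: indicator_def)

lemma line_integral_subset:
  assumes "s \<le> s'" "t' \<le> t"
  shows "line_integral c s' t' g \<le> line_integral c s t g"
  unfolding line_integral_def using assms by (intro nn_integral_mono) (auto simp: indicator_def)

lemma line_integral_shift:
  assumes c: "unit_speed l c" and st: "0 \<le> s" "s < t" "t \<le> l" and g: "g \<in> borel_measurable borel"
  shows "line_integral (\<lambda>\<tau>. c (s + \<tau>)) 0 (t - s) g = line_integral c s t g"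
proof -
  have "line_integral c s t g = (\<integral>\<^sup>+\<tau>. g (c (s + 1 * \<tau>)) * indicator {s..t} (s + 1 * \<tau>) \<partial>lborel)"
    unfolding line_integral_def
    using nn_integral_real_affine[of "\<lambda>\<tau>. g (c \<tau>) * indicator {s..t} \<tau>" 1 s]
      borel_measurable_unit_speed[OF c st(1,3) g] by simp
  also have "\<dots> = line_integral (\<lambda>\<tau>. c (s + \<tau>)) 0 (t - s) g"
    unfolding line_integral_def by (intro nn_integral_cong) (auto simp: indicator_def)
  finally show ?thesis ..
qed

lemma upper_gradient_subarc:
  assumes ug: "upper_gradient u g" and c: "unit_speed l c" and st: "0 \<le> s" "s < t" "t \<le> l"
  shows "ext_absdiff (u (c s)) (u (c t)) \<le> line_integral c s t g"
  using ug unit_speed_subarc[OF c st] line_integral_shift[OF c st, of g]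
  unfolding upper_gradient_iff_unit_speed by fastforce

text \<open>An arc staying in \<open>N\<close> throughout an open interval of times would have
  infinite integral. Null sets are avoided in this way, since a function that is infinite on a null
  set and 0 elsewhere may be added to any dominating function at no cost in
  \<open>Lp_powr\<close>.\<close>

lemma unit_speed_avoids:
  assumes c: "unit_speed l c" and st: "0 \<le> s" "s < t" "t \<le> l"
    and N: "N \<in> sets borel" and fin: "line_integral c 0 l (\<lambda>x. \<infinity> * indicator N x) < \<infinity>"
  shows "\<exists>\<tau>. s < \<tau> \<and> \<tau> < t \<and> c \<tau> \<notin> N"
proof (rule ccontr)
  assume "\<not> ?thesis"
  then have *: "c \<tau> \<in> N" if "s < \<tau>" "\<tau> < t" for \<tau> using that by blast
  have "\<infinity> = (\<integral>\<^sup>+\<tau>. \<infinity> * indicator {s<..<t} \<tau> \<partial>lborel)"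
    using st by (subst nn_integral_cmult_indicator) (auto simp: ennreal_top_mult)
  also have "\<dots> \<le> line_integral c 0 l (\<lambda>x. \<infinity> * indicator N x)"
    unfolding line_integral_def using * st by (intro nn_integral_mono) (auto simp: indicator_def)
  finally show False using fin by simp
qed

text \<open>Dominated convergence on intervals shrinking to an end point. Together with
  \<open>unit_speed_avoids\<close> it moves the ends of an arc to good points at small cost.\<close>

lemma line_integral_small:
  assumes c: "unit_speed l c" and g: "g \<in> borel_measurable borel"
    and fin: "line_integral c 0 l g < \<infinity>" and e: "0 < e"
  shows "\<exists>d>0. d < l \<and> line_integral c 0 d g < e"
    and "\<exists>d>0. d < l \<and> line_integral c (l - d) l g < e"
proof -
  define G where "G = (\<lambda>\<tau>. g (c \<tau>) * indicator {0..l} \<tau>)"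
  have l: "0 < l" using c by (simp add: unit_speed_def)
  have [measurable]: "G \<in> borel_measurable borel"
    unfolding G_def using borel_measurable_unit_speed[OF c _ _ g, of 0 l] by simp
  \<comment> \<open>The shift by 2 keeps \<open>d n\<close> strictly below \<open>l\<close> already
    for \<open>n = 0\<close>.\<close>
  define d where "d n = l / real (n + 2)" for n :: nat
  have d: "0 < d n" "d n < l" for n using l by (auto simp: d_def field_simps add_pos_nonneg)
  have d0: "d \<longlonglongrightarrow> 0"
    unfolding d_def by (rule LIMSEQ_ignore_initial_segment[where f = "\<lambda>n. l / real n" and k = 2, OF lim_const_over_n])
  have lim: "(\<lambda>n. \<integral>\<^sup>+\<tau>. G \<tau> * indicator (A n) \<tau> \<partial>lborel) \<longlonglongrightarrow> 0"
    if [measurable]: "\<And>n. A n \<in> sets borel" and A: "\<And>\<tau>. \<tau> \<noteq> a \<Longrightarrow> \<forall>\<^sub>F n in sequentially. \<tau> \<notin> A n"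
    for A :: "nat \<Rightarrow> real set" and a
  proof -
    have "(\<lambda>n. \<integral>\<^sup>+\<tau>. G \<tau> * indicator (A n) \<tau> \<partial>lborel) \<longlonglongrightarrow> (\<integral>\<^sup>+\<tau>. 0 \<partial>(lborel :: real measure))"
    proof (rule nn_integral_dominated_convergence[where w = G])
      show "(\<integral>\<^sup>+\<tau>. G \<tau> \<partial>lborel) < \<infinity>" using fin by (simp add: line_integral_def G_def)
      have "AE \<tau> in lborel. \<tau> \<noteq> a" by (rule AE_lborel_singleton)
      then show "AE \<tau> in lborel. (\<lambda>n. G \<tau> * indicator (A n) \<tau>) \<longlonglongrightarrow> 0"
      proof eventually_elim
        case (elim \<tau>)
        have "\<forall>\<^sub>F n in sequentially. G \<tau> * indicator (A n) \<tau> = 0"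
          using A[OF elim] by eventually_elim simp
        then show ?case by (rule tendsto_eventually)
      qed
    qed (auto simp: indicator_def)
    then show ?thesis by simp
  qed
  have ev: "\<forall>\<^sub>F n in sequentially. d n < x" if "0 < x" for x
    using order_tendstoD(2)[OF d0 that] .
  have "(\<lambda>n. \<integral>\<^sup>+\<tau>. G \<tau> * indicator {0..d n} \<tau> \<partial>lborel) \<longlonglongrightarrow> 0"
  proof (rule lim[where a = 0])
    fix \<tau> :: real assume "\<tau> \<noteq> 0"
    then show "\<forall>\<^sub>F n in sequentially. \<tau> \<notin> {0..d n}"
      using ev[of \<tau>] by (cases "\<tau> > 0") (auto elim!: eventually_mono)
  qed simp
  then have "\<forall>\<^sub>F n in sequentially. (\<integral>\<^sup>+\<tau>. G \<tau> * indicator {0..d n} \<tau> \<partial>lborel) < e"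
    using e by (rule order_tendstoD(2))
  then obtain n where n: "(\<integral>\<^sup>+\<tau>. G \<tau> * indicator {0..d n} \<tau> \<partial>lborel) < e"
    using eventually_happens'[OF sequentially_bot] by blast
  moreover have "(\<integral>\<^sup>+\<tau>. G \<tau> * indicator {0..d n} \<tau> \<partial>lborel) = line_integral c 0 (d n) g"
    unfolding line_integral_def G_def using d[of n] by (intro nn_integral_cong) (auto simp: indicator_def)
  ultimately show "\<exists>d>0. d < l \<and> line_integral c 0 d g < e" using d by metis
  have "(\<lambda>n. \<integral>\<^sup>+\<tau>. G \<tau> * indicator {l - d n..l} \<tau> \<partial>lborel) \<longlonglongrightarrow> 0"
  proof (rule lim[where a = l])
    fix \<tau> :: real assume "\<tau> \<noteq> l"
    then show "\<forall>\<^sub>F n in sequentially. \<tau> \<notin> {l - d n..l}"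
      using ev[of "l - \<tau>"] by (cases "\<tau> < l") (auto elim!: eventually_mono)
  qed simp
  then have "\<forall>\<^sub>F n in sequentially. (\<integral>\<^sup>+\<tau>. G \<tau> * indicator {l - d n..l} \<tau> \<partial>lborel) < e"
    using e by (rule order_tendstoD(2))
  then obtain n where n: "(\<integral>\<^sup>+\<tau>. G \<tau> * indicator {l - d n..l} \<tau> \<partial>lborel) < e"
    using eventually_happens'[OF sequentially_bot] by blast
  moreover have "(\<integral>\<^sup>+\<tau>. G \<tau> * indicator {l - d n..l} \<tau> \<partial>lborel) = line_integral c (l - d n) l g"
    unfolding line_integral_def G_def using d[of n] by (intro nn_integral_cong) (auto simp: indicator_def)
  ultimately show "\<exists>d>0. d < l \<and> line_integral c (l - d) l g < e" using d by metis
qed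

lemma ext_absdiff_real [simp]: "ext_absdiff (ereal x) (ereal y) = ennreal \<bar>x - y\<bar>"
  by (simp add: ext_absdiff_def e2ennreal_ereal)

lemma ext_absdiff_infinite:
  assumes "\<bar>x\<bar> = \<infinity> \<or> \<bar>y\<bar> = \<infinity>"
  shows "ext_absdiff x y = \<infinity>"
  using assms by (cases x; cases y) (auto simp: ext_absdiff_def)

lemma ext_absdiff_eq_0:
  assumes "ext_absdiff x y = 0"
  shows "x = y"
proof -
  have "\<bar>x\<bar> \<noteq> \<infinity>" "\<bar>y\<bar> \<noteq> \<infinity>" using ext_absdiff_infinite assms by force+
  then show ?thesis using assms by (cases x; cases y) (auto simp: ennreal_abs_diff_eq_0)
qed

lemma upper_gradient_realI:
  fixes f :: "'a::metric_space \<Rightarrow> real"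
  assumes "f \<in> borel_measurable borel" "g \<in> borel_measurable borel"
    and "\<And>l c. unit_speed l c \<Longrightarrow> ennreal \<bar>f (c 0) - f (c l)\<bar> \<le> line_integral c 0 l g"
  shows "upper_gradient (\<lambda>x. ereal (f x)) g"
  using assms unfolding upper_gradient_iff_unit_speed by simp

lemma upper_gradient_add:
  fixes f f' :: "'a::metric_space \<Rightarrow> real"
  assumes f: "upper_gradient (\<lambda>x. ereal (f x)) g" and f': "upper_gradient (\<lambda>x. ereal (f' x)) g'"
    and m: "f \<in> borel_measurable borel" "f' \<in> borel_measurable borel"
  shows "upper_gradient (\<lambda>x. ereal (f x + f' x)) (\<lambda>x. g x + g' x)"
proof (rule upper_gradient_realI)
  have [measurable]: "g \<in> borel_measurable borel" "g' \<in> borel_measurable borel"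
    using f f' by (auto simp: upper_gradient_def)
  show "(\<lambda>x. g x + g' x) \<in> borel_measurable borel" by measurable
  fix l :: real and c :: "real \<Rightarrow> 'a" assume c: "unit_speed l c"
  have "ennreal \<bar>f (c 0) + f' (c 0) - (f (c l) + f' (c l))\<bar>
      \<le> ennreal \<bar>f (c 0) - f (c l)\<bar> + ennreal \<bar>f' (c 0) - f' (c l)\<bar>"
    by (simp add: ennreal_leI flip: ennreal_plus)
  also have "\<dots> \<le> line_integral c 0 l g + line_integral c 0 l g'"
    using f f' c unfolding upper_gradient_iff_unit_speed by (intro add_mono) auto
  also have "\<dots> = line_integral c 0 l (\<lambda>x. g x + g' x)"
    by (rule line_integral_add[symmetric, OF c]) auto
  finally show "ennreal \<bar>f (c 0) + f' (c 0) - (f (c l) + f' (c l))\<bar> \<le> line_integral c 0 l (\<lambda>x. g x + g' x)" .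
qed (use m in simp)

lemma upper_gradient_cmult:
  fixes f :: "'a::metric_space \<Rightarrow> real"
  assumes f: "upper_gradient (\<lambda>x. ereal (f x)) g" and m: "f \<in> borel_measurable borel"
  shows "upper_gradient (\<lambda>x. ereal (a * f x)) (\<lambda>x. ennreal \<bar>a\<bar> * g x)"
proof (rule upper_gradient_realI)
  have g [measurable]: "g \<in> borel_measurable borel" using f by (auto simp: upper_gradient_def)
  show "(\<lambda>x. ennreal \<bar>a\<bar> * g x) \<in> borel_measurable borel" by measurable
  fix l :: real and c :: "real \<Rightarrow> 'a" assume c: "unit_speed l c"
  have "ennreal \<bar>a * f (c 0) - a * f (c l)\<bar> = ennreal \<bar>a\<bar> * ennreal \<bar>f (c 0) - f (c l)\<bar>"
    by (simp add: ennreal_mult[symmetric] abs_mult[symmetric] right_diff_distrib)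
  also have "\<dots> \<le> ennreal \<bar>a\<bar> * line_integral c 0 l g"
    using f c unfolding upper_gradient_iff_unit_speed by (intro mult_left_mono) auto
  also have "\<dots> = line_integral c 0 l (\<lambda>x. ennreal \<bar>a\<bar> * g x)"
    by (rule line_integral_cmult[symmetric, OF c _ _ g]) auto
  finally show "ennreal \<bar>a * f (c 0) - a * f (c l)\<bar> \<le> line_integral c 0 l (\<lambda>x. ennreal \<bar>a\<bar> * g x)" .
qed (use m in simp)

section \<open>The Sobolev space\<close>

lemma e2ennreal_zero [simp]: "e2ennreal 0 = 0"
  using e2ennreal_ereal[of 0] by (simp add: zero_ereal_def)

locale sobolev =
  fixes M :: "'a::metric_space measure" and p :: real
  assumes mms: "metric_measure_space M" and p: "1 \<le> p"
begin

lemma space_M [simp]: "space M = UNIV"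
  and sets_borel: "sets borel \<subseteq> sets M"
  using mms by (auto simp: metric_measure_space_def)

lemma borel_imp_M: "f \<in> borel_measurable borel \<Longrightarrow> f \<in> borel_measurable M"
  using measurable_mono[of borel borel borel M] sets_borel by auto

lemma sets_borel_M: "A \<in> sets borel \<Longrightarrow> A \<in> sets M"
  using sets_borel by auto

lemma emeasure_eq_0_AE:
  assumes "A \<in> sets borel" "AE x in M. x \<notin> A"
  shows "emeasure M A = 0"
  using AE_iff_null[of M "\<lambda>x. x \<notin> A"] sets_borel_M assms by (auto simp: null_sets_def)

lemma ennpowr_inverse [simp]: "ennpowr (ennpowr x p) (1 / p) = x" "ennpowr (ennpowr x (1 / p)) p = x"
  using p by (simp_all add: ennpowr_ennpowr)

lemma borel_Lp_measurable:
  "g \<in> borel_measurable borel \<Longrightarrow> (\<lambda>x. ennpowr (g x) p) \<in> borel_measurable M"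
  by (rule borel_imp_M) measurable

lemma Lp_powr_mono: "(\<And>x. f x \<le> g x) \<Longrightarrow> Lp_powr M p f \<le> Lp_powr M p g"
  unfolding Lp_powr_def using p by (intro nn_integral_mono ennpowr_mono) auto

lemma Lp_powr_cmult:
  assumes "g \<in> borel_measurable borel"
  shows "Lp_powr M p (\<lambda>x. a * g x) = ennpowr a p * Lp_powr M p g"
  unfolding Lp_powr_def using p borel_Lp_measurable[OF assms]
  by (simp add: ennpowr_mult nn_integral_cmult)

lemma Lp_powr_add_le:
  assumes "f \<in> borel_measurable borel" "g \<in> borel_measurable borel"
  shows "Lp_powr M p (\<lambda>x. f x + g x) \<le> ennreal (2 powr p) * (Lp_powr M p f + Lp_powr M p g)"
proof -
  note [measurable] = borel_Lp_measurable[OF assms(1)] borel_Lp_measurable[OF assms(2)]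
  have "Lp_powr M p (\<lambda>x. f x + g x)
      \<le> (\<integral>\<^sup>+x. ennreal (2 powr p) * (ennpowr (f x) p + ennpowr (g x) p) \<partial>M)"
    unfolding Lp_powr_def by (intro nn_integral_mono ennpowr_add_le p)
  then show ?thesis by (simp add: nn_integral_cmult nn_integral_add Lp_powr_def)
qed

lemma Lp_powr_add_finite:
  assumes "f \<in> borel_measurable borel" "g \<in> borel_measurable borel"
    "Lp_powr M p f < \<infinity>" "Lp_powr M p g < \<infinity>"
  shows "Lp_powr M p (\<lambda>x. f x + g x) < \<infinity>"
  using Lp_powr_add_le[OF assms(1,2)] assms(3,4)
  by (auto simp: ennreal_mult_less_top intro: le_less_trans)

lemma Lp_powr_convex:
  assumes "f \<in> borel_measurable M" "g \<in> borel_measurable M" and t: "0 < t" "t < 1"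
  shows "Lp_powr M p (\<lambda>x. ennreal t * f x + ennreal (1 - t) * g x)
    \<le> ennreal t * Lp_powr M p f + ennreal (1 - t) * Lp_powr M p g"
proof -
  note [measurable] = assms(1,2)
  have "Lp_powr M p (\<lambda>x. ennreal t * f x + ennreal (1 - t) * g x)
      \<le> (\<integral>\<^sup>+x. ennreal t * ennpowr (f x) p + ennreal (1 - t) * ennpowr (g x) p \<partial>M)"
    unfolding Lp_powr_def by (intro nn_integral_mono ennpowr_convex p t)
  then show ?thesis by (simp add: nn_integral_cmult nn_integral_add Lp_powr_def)
qed

lemma Lp_powr_indicator_null:
  assumes N: "N \<in> sets borel" "emeasure M N = 0"
  shows "Lp_powr M p (\<lambda>x. \<infinity> * indicator N x) = 0"
proof -
  have "AE x in M. x \<notin> N" using N sets_borel_M by (intro AE_not_in) auto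
  then have "(\<integral>\<^sup>+x. ennpowr (\<infinity> * indicator N x) p \<partial>M) = (\<integral>\<^sup>+x. 0 \<partial>M)"
    by (intro nn_integral_cong_AE) auto
  then show ?thesis by (simp add: Lp_powr_def)
qed

text \<open>Replaces Minkowski's inequality for infinite sums.\<close>

lemma rapid_domination:
  fixes r :: "nat \<Rightarrow> 'a \<Rightarrow> ennreal"
  assumes [measurable]: "\<And>n. r n \<in> borel_measurable borel"
    and small: "\<And>n. Lp_powr M p (r n) \<le> ennreal (((1/4) ^ n) powr p)"
  obtains \<rho> where "\<rho> \<in> borel_measurable borel" "Lp_powr M p \<rho> < \<infinity>"
    "\<And>n x. r n x \<le> ennreal ((1/2) ^ n) * \<rho> x"
proof -
  define S where "S x = (\<Sum>n. ennpowr (ennreal (2 ^ n) * r n x) p)" for x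
  define \<rho> where "\<rho> x = ennpowr (S x) (1 / p)" for x
  have [measurable]: "S \<in> borel_measurable borel" unfolding S_def by measurable
  have 1: "\<rho> \<in> borel_measurable borel" unfolding \<rho>_def by measurable
  have "Lp_powr M p \<rho> = (\<integral>\<^sup>+x. (\<Sum>n. ennpowr (ennreal (2 ^ n) * r n x) p) \<partial>M)"
    by (simp add: Lp_powr_def \<rho>_def S_def)
  also have "\<dots> = (\<Sum>n. Lp_powr M p (\<lambda>x. ennreal (2 ^ n) * r n x))"
    unfolding Lp_powr_def by (intro nn_integral_suminf borel_Lp_measurable) measurable
  also have "\<dots> \<le> (\<Sum>n. ennreal ((1/2) ^ n))"
  proof (intro suminf_le summableI)
    fix n
    have "Lp_powr M p (\<lambda>x. ennreal (2 ^ n) * r n x) = ennreal ((2 ^ n) powr p) * Lp_powr M p (r n)"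
      by (subst Lp_powr_cmult) (auto simp: ennpowr_ennreal)
    also have "\<dots> \<le> ennreal ((2 ^ n) powr p) * ennreal (((1/4) ^ n) powr p)"
      by (intro mult_left_mono small) auto
    also have "\<dots> = ennreal (((1/2) ^ n) powr p)"
      by (simp add: ennreal_mult[symmetric] powr_mult[symmetric] power_mult_distrib[symmetric])
    also have "\<dots> \<le> ennreal ((1/2) ^ n)"
      using powr_mono'[of 1 p "(1/2) ^ n :: real"] p by (intro ennreal_leI) (auto simp: power_le_one)
    finally show "Lp_powr M p (\<lambda>x. ennreal (2 ^ n) * r n x) \<le> ennreal ((1/2) ^ n)" .
  qed
  also have "\<dots> < \<infinity>"
    using summable_geometric[of "1/2 :: real"] by (subst suminf_ennreal2) auto
  finally have 2: "Lp_powr M p \<rho> < \<infinity>" .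
  have 3: "r n x \<le> ennreal ((1/2) ^ n) * \<rho> x" for n x
  proof -
    have "ennpowr (ennreal (2 ^ n) * r n x) p \<le> S x"
      unfolding S_def using sum_le_suminf[of "\<lambda>n. ennpowr (ennreal (2 ^ n) * r n x) p" "{n}"] by simp
    then have "ennreal (2 ^ n) * r n x \<le> \<rho> x"
      using ennpowr_mono[of "ennpowr (ennreal (2 ^ n) * r n x) p" "S x" "1/p"] p by (simp add: \<rho>_def)
    then have "ennreal ((1/2) ^ n) * (ennreal (2 ^ n) * r n x) \<le> ennreal ((1/2) ^ n) * \<rho> x"
      by (rule mult_left_mono) simp
    moreover have "ennreal ((1/2) ^ n) * ennreal (2 ^ n) = 1"
      by (simp add: ennreal_mult[symmetric] power_mult_distrib[symmetric])
    ultimately show ?thesis by (simp add: mult.assoc[symmetric])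
  qed
  show ?thesis using that 1 2 3 by blast
qed

text \<open>Sets of capacity zero, described by curves: null sets for which a single
  \<open>p\<close>-integrable \<open>\<rho>\<close> has infinite integral along every arc that
  begins or ends there. Naming the end points is enough, since an arc through the set contains a
  subarc ending in it.\<close>

definition exceptional :: "'a set \<Rightarrow> bool" where
  "exceptional E \<longleftrightarrow> E \<in> sets borel \<and> emeasure M E = 0 \<and>
    (\<exists>\<rho>\<in>borel_measurable borel. Lp_powr M p \<rho> < \<infinity> \<and>
      (\<forall>l c. unit_speed l c \<and> (c 0 \<in> E \<or> c l \<in> E) \<longrightarrow> line_integral c 0 l \<rho> = \<infinity>))"

lemma exceptionalI:
  assumes "E \<in> sets borel" "emeasure M E = 0" "\<rho> \<in> borel_measurable borel" "Lp_powr M p \<rho> < \<infinity>"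
    and "\<And>l c. unit_speed l c \<Longrightarrow> c 0 \<in> E \<or> c l \<in> E \<Longrightarrow> line_integral c 0 l \<rho> = \<infinity>"
  shows "exceptional E"
  using assms unfolding exceptional_def by blast

lemma exceptional_null: "exceptional E \<Longrightarrow> E \<in> null_sets M"
  using sets_borel_M by (simp add: exceptional_def null_sets_def)

lemma exceptional_Un:
  assumes "exceptional A" "exceptional B"
  shows "exceptional (A \<union> B)"
proof -
  obtain \<rho> where \<rho>: "\<rho> \<in> borel_measurable borel" "Lp_powr M p \<rho> < \<infinity>"
    "\<And>l c. unit_speed l c \<Longrightarrow> c 0 \<in> A \<or> c l \<in> A \<Longrightarrow> line_integral c 0 l \<rho> = \<infinity>"
    using assms(1) unfolding exceptional_def by blast
  obtain \<sigma> where \<sigma>: "\<sigma> \<in> borel_measurable borel" "Lp_powr M p \<sigma> < \<infinity>"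
    "\<And>l c. unit_speed l c \<Longrightarrow> c 0 \<in> B \<or> c l \<in> B \<Longrightarrow> line_integral c 0 l \<sigma> = \<infinity>"
    using assms(2) unfolding exceptional_def by blast
  have "line_integral c 0 l (\<lambda>x. \<rho> x + \<sigma> x) = \<infinity>"
    if "unit_speed l c" "c 0 \<in> A \<union> B \<or> c l \<in> A \<union> B" for l c
    using that \<rho>(3)[OF that(1)] \<sigma>(3)[OF that(1)] by (auto simp: line_integral_add[OF that(1) _ _ \<rho>(1) \<sigma>(1)])
  moreover have "emeasure M (A \<union> B) = 0"
    using null_sets.Un[OF assms[THEN exceptional_null]] by auto
  ultimately show ?thesis
    using assms \<rho>(1,2) \<sigma>(1,2) Lp_powr_add_finite[OF \<rho>(1) \<sigma>(1)]
    by (intro exceptionalI[of _ "\<lambda>x. \<rho> x + \<sigma> x"]) (auto simp: exceptional_def)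
qed

lemma exceptional_subset:
  assumes "exceptional A" "B \<subseteq> A" "B \<in> sets borel"
  shows "exceptional B"
proof -
  have "emeasure M B = 0"
    using assms emeasure_mono[OF assms(2), of M] sets_borel_M by (auto simp: exceptional_def)
  then show ?thesis using assms unfolding exceptional_def by blast
qed

lemma exceptional_empty: "exceptional {}"
  unfolding exceptional_def using p
  by (auto intro!: bexI[of _ "\<lambda>x. 0"] simp: Lp_powr_def)

lemma N1p_finiteD:
  assumes "u \<in> N1p_functions M p"
  obtains g where "upper_gradient u g" "Lp_powr M p g < \<infinity>"
    and "Lp_powr M p (\<lambda>x. e2ennreal \<bar>u x\<bar>) < \<infinity>" "u \<in> borel_measurable borel"
proof -
  have "Lp_powr M p (\<lambda>x. e2ennreal \<bar>u x\<bar>) + (INF g\<in>{g. upper_gradient u g}. Lp_powr M p g) < \<infinity>"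
    and u: "u \<in> borel_measurable borel"
    using assms by (auto simp: N1p_functions_def N1p_norm_def)
  then have 1: "Lp_powr M p (\<lambda>x. e2ennreal \<bar>u x\<bar>) < \<infinity>"
    and "(INF g\<in>{g. upper_gradient u g}. Lp_powr M p g) < \<infinity>"
    by (auto simp: ennreal_add_less_top less_top)
  then obtain g where "upper_gradient u g" "Lp_powr M p g < \<infinity>" by (auto simp: INF_less_iff)
  then show ?thesis using that 1 u by blast
qed

text \<open>By the convention on infinite values every upper gradient of \<open>u\<close> has
  infinite integral along arcs with an end where \<open>u\<close> is infinite. A
  \<open>p\<close>-integrable one is therefore the witness.\<close>

lemma exceptional_infinite:
  assumes "u \<in> N1p_functions M p"
  shows "exceptional {x. \<bar>u x\<bar> = \<infinity>}"
proof -
  obtain g where g: "upper_gradient u g" "Lp_powr M p g < \<infinity>"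
    and u: "Lp_powr M p (\<lambda>x. e2ennreal \<bar>u x\<bar>) < \<infinity>" and [measurable]: "u \<in> borel_measurable borel"
    using N1p_finiteD[OF assms] by blast
  have B: "{x. \<bar>u x\<bar> = \<infinity>} \<in> sets borel" by measurable
  have "AE x in M. ennpowr (e2ennreal \<bar>u x\<bar>) p \<noteq> \<infinity>"
    using u unfolding Lp_powr_def by (intro nn_integral_noteq_infinite borel_Lp_measurable) auto
  then have "AE x in M. \<not> (\<bar>u x\<bar> = \<infinity>)"
    by eventually_elim auto
  then have "emeasure M {x. \<bar>u x\<bar> = \<infinity>} = 0"
    using B by (intro emeasure_eq_0_AE) auto
  moreover have "line_integral c 0 l g = \<infinity>"
    if "unit_speed l c" "c 0 \<in> {x. \<bar>u x\<bar> = \<infinity>} \<or> c l \<in> {x. \<bar>u x\<bar> = \<infinity>}" for l c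
  proof -
    have "ext_absdiff (u (c 0)) (u (c l)) \<le> line_integral c 0 l g"
      using g(1) that(1) unfolding upper_gradient_iff_unit_speed by blast
    then show ?thesis using that(2) ext_absdiff_infinite[of "u (c 0)" "u (c l)"] by (simp add: top_unique)
  qed
  ultimately show ?thesis
    using B g by (intro exceptionalI[of _ g]) (auto simp: upper_gradient_def)
qed

text \<open>Adding a small multiple of the witness \<open>\<rho>\<close> turns an upper gradient of
  \<open>u\<close> into one of \<open>v\<close>: along an arc with an end where the functions
  differ, the integral becomes infinite.\<close>

lemma N1p_norm_cong_le:
  assumes E: "exceptional {x. u x \<noteq> v x}" and v: "v \<in> borel_measurable borel"
  shows "N1p_norm M p v \<le> N1p_norm M p u"
proof -
  obtain \<rho> where \<rho> [measurable]: "\<rho> \<in> borel_measurable borel" and fin: "Lp_powr M p \<rho> < \<infinity>"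
    and inf: "\<And>l c. unit_speed l c \<Longrightarrow> u (c 0) \<noteq> v (c 0) \<or> u (c l) \<noteq> v (c l) \<Longrightarrow> line_integral c 0 l \<rho> = \<infinity>"
    using E unfolding exceptional_def by blast
  have "{x. u x \<noteq> v x} \<in> null_sets M" by (rule exceptional_null[OF E])
  then have "AE x in M. u x = v x" by (auto dest: AE_not_in)
  then have L: "Lp_powr M p (\<lambda>x. e2ennreal \<bar>v x\<bar>) = Lp_powr M p (\<lambda>x. e2ennreal \<bar>u x\<bar>)"
    unfolding Lp_powr_def by (intro nn_integral_cong_AE) auto
  have le: "(INF g\<in>{g. upper_gradient v g}. Lp_powr M p g) \<le> Lp_powr M p g"
    if g: "upper_gradient u g" for g
  proof (cases "Lp_powr M p g < \<infinity>")
    case True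
    have [measurable]: "g \<in> borel_measurable borel" using g by (simp add: upper_gradient_def)
    \<comment> \<open>Written as a convex combination of \<open>g\<close> and
      \<open>g + \<rho>\<close>, so that \<open>Lp_powr_convex\<close> applies and the weight of the
      second term can tend to 0. The shift by 2 keeps both weights strictly between 0 and 1.\<close>
    define h where "h n x = ennreal (1 - 1 / (real n + 2)) * g x + ennreal (1 / (real n + 2)) * (g x + \<rho> x)" for n x
    have h_eq: "h n x = g x + ennreal (1 / (real n + 2)) * \<rho> x" for n x
    proof -
      have "ennreal (1 - 1 / (real n + 2)) + ennreal (1 / (real n + 2)) = 1"
        by (subst ennreal_plus[symmetric]) auto
      then show ?thesis by (simp add: h_def distrib_left add.assoc[symmetric] distrib_right[symmetric])
    qed
    have ug: "upper_gradient v (h n)" for n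
      unfolding upper_gradient_iff_unit_speed
    proof (intro conjI allI impI)
      show "h n \<in> borel_measurable borel" unfolding h_def by measurable
      fix l and c :: "real \<Rightarrow> 'a" assume c: "unit_speed l c"
      have eq: "line_integral c 0 l (h n) = line_integral c 0 l g + ennreal (1 / (real n + 2)) * line_integral c 0 l \<rho>"
        unfolding h_eq by (subst line_integral_add[OF c]) (auto simp: line_integral_cmult[OF c])
      show "ext_absdiff (v (c 0)) (v (c l)) \<le> line_integral c 0 l (h n)"
      proof (cases "line_integral c 0 l \<rho> = \<infinity>")
        case True
        then show ?thesis unfolding eq by (simp add: ennreal_mult_top)
      next
        case False
        then have "v (c 0) = u (c 0)" "v (c l) = u (c l)" using inf c by metis+
        then have "ext_absdiff (v (c 0)) (v (c l)) \<le> line_integral c 0 l g"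
          using g c unfolding upper_gradient_iff_unit_speed by simp
        then show ?thesis unfolding eq by (auto intro: order_trans)
      qed
    qed (rule v)
    have bound: "(INF g\<in>{g. upper_gradient v g}. Lp_powr M p g)
        \<le> ennreal (1 - 1 / (real n + 2)) * Lp_powr M p g + ennreal (1 / (real n + 2)) * Lp_powr M p (\<lambda>x. g x + \<rho> x)" for n
    proof -
      have "(INF g\<in>{g. upper_gradient v g}. Lp_powr M p g) \<le> Lp_powr M p (h n)"
        using ug by (intro INF_lower) auto
      also have "\<dots> \<le> ennreal (1 / (real n + 2)) * Lp_powr M p (\<lambda>x. g x + \<rho> x)
          + ennreal (1 - 1 / (real n + 2)) * Lp_powr M p g"
        unfolding h_def add.commute[of "ennreal (1 - 1 / (real n + 2)) * g _"]
        by (intro Lp_powr_convex borel_imp_M) (auto simp: field_simps)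
      finally show ?thesis by (simp add: add.commute)
    qed
    obtain A B where A: "0 \<le> A" "Lp_powr M p g = ennreal A"
      and B: "0 \<le> B" "Lp_powr M p (\<lambda>x. g x + \<rho> x) = ennreal B"
      using True Lp_powr_add_finite[of g \<rho>] fin by (metis \<open>g \<in> borel_measurable borel\<close> \<rho> infinity_ennreal_def less_top_ennreal)
    have conv: "ennreal ((1 - x) * A + x * B) = ennreal (1 - x) * ennreal A + ennreal x * ennreal B"
      if "0 \<le> x" "x \<le> 1" for x
      using that A(1) B(1) by (simp add: ennreal_mult ennreal_plus)
    have "(\<lambda>n. 1 / (real n + 2)) \<longlonglongrightarrow> 0"
      using LIMSEQ_ignore_initial_segment[OF lim_const_over_n[of "1 :: real"], of 2] by (simp add: add.commute)
    then have "(\<lambda>n. ennreal ((1 - 1 / (real n + 2)) * A + 1 / (real n + 2) * B)) \<longlonglongrightarrow> ennreal ((1 - 0) * A + 0 * B)"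
      by (intro tendsto_ennrealI tendsto_intros) auto
    then have lim: "(\<lambda>n. ennreal ((1 - 1 / (real n + 2)) * A + 1 / (real n + 2) * B)) \<longlonglongrightarrow> Lp_powr M p g"
      by (simp add: A)
    show ?thesis
    proof (rule LIMSEQ_le_const[OF lim], intro exI allI impI)
      fix n
      show "(INF g\<in>{g. upper_gradient v g}. Lp_powr M p g) \<le> ennreal ((1 - 1 / (real n + 2)) * A + 1 / (real n + 2) * B)"
        using bound[of n] conv[of "1 / (real n + 2)"] unfolding A(2) B(2) by simp
    qed
  qed (simp add: not_less top_unique)
  have "(INF g\<in>{g. upper_gradient v g}. Lp_powr M p g) \<le> (INF g\<in>{g. upper_gradient u g}. Lp_powr M p g)"
    using le by (intro INF_greatest) auto
  then show ?thesis unfolding N1p_norm_def L using p by (intro ennpowr_mono add_left_mono) auto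
qed

lemma N1p_norm_cong:
  assumes "exceptional {x. u x \<noteq> v x}" "u \<in> borel_measurable borel" "v \<in> borel_measurable borel"
  shows "N1p_norm M p u = N1p_norm M p v"
proof -
  have "{x. v x \<noteq> u x} = {x. u x \<noteq> v x}" by auto
  then show ?thesis using N1p_norm_cong_le[of u v] N1p_norm_cong_le[of v u] assms by (auto intro: antisym)
qed

lemma N1p_norm_zero: "N1p_norm M p (\<lambda>x. 0) = 0"
proof -
  have "upper_gradient (\<lambda>x. 0 :: ereal) (\<lambda>x. 0)"
    unfolding upper_gradient_iff_unit_speed by (simp add: ext_absdiff_def)
  then have "(INF g\<in>{g. upper_gradient (\<lambda>x::'a. 0 :: ereal) g}. Lp_powr M p g) \<le> Lp_powr M p (\<lambda>x. 0)"
    by (intro INF_lower) auto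
  then show ?thesis by (simp add: N1p_norm_def Lp_powr_def)
qed

text \<open>If the norm vanishes, there are upper gradients dominated by 2^-n times one function, so
  \<open>w\<close> is constant along arcs of finite integral. The summand that is infinite on the
  null set \<open>{x. w x \<noteq> 0}\<close> makes such an arc visit zeros of \<open>w\<close>,
  hence \<open>w\<close> vanishes at its ends.\<close>

lemma N1p_norm_eq_0_iff:
  assumes w [measurable]: "w \<in> borel_measurable borel"
  shows "N1p_norm M p w = 0 \<longleftrightarrow> exceptional {x. w x \<noteq> 0}"
proof
  assume "exceptional {x. w x \<noteq> 0}"
  then show "N1p_norm M p w = 0" using N1p_norm_cong[of w "\<lambda>x. 0"] N1p_norm_zero by simp
next
  assume "N1p_norm M p w = 0"
  then have "ennpowr (N1p_norm M p w) p = 0" by simp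
  then have L: "Lp_powr M p (\<lambda>x. e2ennreal \<bar>w x\<bar>) = 0"
    and I: "(INF g\<in>{g. upper_gradient w g}. Lp_powr M p g) = 0"
    unfolding N1p_norm_def by auto
  have B: "{x. w x \<noteq> 0} \<in> sets borel" by measurable
  have "AE x in M. ennpowr (e2ennreal \<bar>w x\<bar>) p = 0"
    using L nn_integral_0_iff_AE[OF borel_Lp_measurable[of "\<lambda>x. e2ennreal \<bar>w x\<bar>"]] unfolding Lp_powr_def by simp
  then have "AE x in M. \<not> w x \<noteq> 0"
  proof eventually_elim
    case (elim x)
    then have "ennpowr (ennpowr (e2ennreal \<bar>w x\<bar>) p) (1/p) = 0" by simp
    then have "e2ennreal \<bar>w x\<bar> = 0" by simp
    then show ?case by (cases "w x") (auto simp: e2ennreal_ereal)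
  qed
  then have null: "emeasure M {x. w x \<noteq> 0} = 0"
    using B by (intro emeasure_eq_0_AE) auto
  have "\<exists>g. upper_gradient w g \<and> Lp_powr M p g \<le> ennreal (((1/4) ^ n) powr p)" for n :: nat
  proof -
    have "(INF g\<in>{g. upper_gradient w g}. Lp_powr M p g) < ennreal (((1/4) ^ n) powr p)" unfolding I by simp
    then show ?thesis by (auto simp: INF_less_iff intro: less_imp_le)
  qed
  then obtain g where g: "\<And>n::nat. upper_gradient w (g n)"
    and small: "\<And>n. Lp_powr M p (g n) \<le> ennreal (((1/4) ^ n) powr p)" by metis
  have "g n \<in> borel_measurable borel" for n using g by (simp add: upper_gradient_def)
  then obtain \<rho> where \<rho> [measurable]: "\<rho> \<in> borel_measurable borel" and fin: "Lp_powr M p \<rho> < \<infinity>"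
    and dom: "\<And>n x. g n x \<le> ennreal ((1/2) ^ n) * \<rho> x"
    using rapid_domination small by metis
  define \<sigma> where "\<sigma> x = \<rho> x + \<infinity> * indicator {x. w x \<noteq> 0} x" for x
  have \<sigma>: "\<sigma> \<in> borel_measurable borel" "Lp_powr M p \<sigma> < \<infinity>"
    unfolding \<sigma>_def using Lp_powr_add_finite[of \<rho>] fin Lp_powr_indicator_null[OF B null] by auto
  have "line_integral c 0 l \<sigma> = \<infinity>" if c: "unit_speed l c" and E: "w (c 0) \<noteq> 0 \<or> w (c l) \<noteq> 0" for l c
  proof (rule ccontr)
    assume "line_integral c 0 l \<sigma> \<noteq> \<infinity>"
    moreover have "line_integral c 0 l \<sigma> = line_integral c 0 l \<rho> + line_integral c 0 l (\<lambda>x. \<infinity> * indicator {x. w x \<noteq> 0} x)"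
      unfolding \<sigma>_def by (rule line_integral_add[OF c]) auto
    ultimately have fin: "line_integral c 0 l \<rho> < \<infinity>"
      "line_integral c 0 l (\<lambda>x. \<infinity> * indicator {x. w x \<noteq> 0} x) < \<infinity>"
      by (auto simp: less_top)
    have const: "w (c s) = w (c t)" if st: "0 \<le> s" "s < t" "t \<le> l" for s t
    proof -
      have "ext_absdiff (w (c s)) (w (c t)) \<le> ennreal ((1/2) ^ n) * line_integral c 0 l \<rho>" for n
      proof -
        have "ext_absdiff (w (c s)) (w (c t)) \<le> line_integral c s t (g n)"
          by (rule upper_gradient_subarc[OF g c st])
        also have "\<dots> \<le> line_integral c 0 l (g n)" by (rule line_integral_subset) (use st in auto)
        also have "\<dots> \<le> line_integral c 0 l (\<lambda>x. ennreal ((1/2) ^ n) * \<rho> x)"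
          by (rule line_integral_mono) (rule dom)
        finally show ?thesis using line_integral_cmult[OF c _ _ \<rho>] by simp
      qed
      moreover obtain K where K: "0 \<le> K" "line_integral c 0 l \<rho> = ennreal K"
        using fin(1) by (metis infinity_ennreal_def less_top_ennreal)
      ultimately have le: "ext_absdiff (w (c s)) (w (c t)) \<le> ennreal ((1/2) ^ n * K)" for n
        by (simp add: ennreal_mult)
      have "(\<lambda>n. (1/2) ^ n * K) \<longlonglongrightarrow> 0 * K" by (intro tendsto_intros) auto
      then have "(\<lambda>n. ennreal ((1/2) ^ n * K)) \<longlonglongrightarrow> ennreal (0 * K)" by (rule tendsto_ennrealI)
      then have "ext_absdiff (w (c s)) (w (c t)) \<le> ennreal (0 * K)"
        using le by (intro LIMSEQ_le_const) auto
      then show ?thesis by (intro ext_absdiff_eq_0) simp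
    qed
    have l: "0 < l" using c by (simp add: unit_speed_def)
    obtain \<tau> where "0 < \<tau>" "\<tau> < l" "w (c \<tau>) = 0"
      using unit_speed_avoids[OF c order_refl l order_refl B fin(2)] by auto
    then show False using const[of 0 \<tau>] const[of \<tau> l] E by simp
  qed
  then show "exceptional {x. w x \<noteq> 0}"
    using B null \<sigma> by (intro exceptionalI[of _ \<sigma>]) auto
qed

end

text \<open>The triangle inequality is the convexity of the unit ball \<open>{E \<le> 1}\<close>.\<close>

lemma seminorm_of_convex:
  fixes E :: "('a \<Rightarrow> real) \<Rightarrow> ennreal" and p :: real
  assumes p: "1 \<le> p"
    and scale_V: "\<And>a f. f \<in> V \<Longrightarrow> (\<lambda>x. a * f x) \<in> V"
    and add_V: "\<And>f g. f \<in> V \<Longrightarrow> g \<in> V \<Longrightarrow> (\<lambda>x. f x + g x) \<in> V"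
    and fin: "\<And>f. f \<in> V \<Longrightarrow> E f < \<infinity>"
    and hom: "\<And>a f. f \<in> V \<Longrightarrow> E (\<lambda>x. a * f x) = ennreal (\<bar>a\<bar> powr p) * E f"
    and convex: "\<And>t f g. f \<in> V \<Longrightarrow> g \<in> V \<Longrightarrow> 0 < t \<Longrightarrow> t < 1 \<Longrightarrow>
      E (\<lambda>x. t * f x + (1 - t) * g x) \<le> ennreal t * E f + ennreal (1 - t) * E g"
  defines "N \<equiv> \<lambda>f. enn2real (ennpowr (E f) (1 / p))"
  shows "f \<in> V \<Longrightarrow> N (\<lambda>x. a * f x) = \<bar>a\<bar> * N f"
    and "f \<in> V \<Longrightarrow> g \<in> V \<Longrightarrow> N (\<lambda>x. f x + g x) \<le> N f + N g"
proof -
  define e where "e f = enn2real (E f)" for f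
  have E: "E f = ennreal (e f)" "0 \<le> e f" if "f \<in> V" for f using fin[OF that] by (auto simp: e_def)
  have N: "N f = e f powr (1/p)" if "f \<in> V" for f
    using E[OF that] by (simp add: N_def ennpowr_ennreal)
  have N_hom: "N (\<lambda>x. a * f x) = \<bar>a\<bar> * N f" if f: "f \<in> V" for a f
  proof -
    have "E (\<lambda>x. a * f x) = ennreal (\<bar>a\<bar> powr p * e f)"
      using hom[OF f] E[OF f] by (simp add: ennreal_mult)
    then have "e (\<lambda>x. a * f x) = \<bar>a\<bar> powr p * e f"
      by (simp only: e_def[of "\<lambda>x. a * f x"]) (simp add: E(2)[OF f])
    then show ?thesis using N[OF f] N[OF scale_V[OF f]] E[OF f] p by (simp add: powr_mult powr_powr)
  qed
  then show "f \<in> V \<Longrightarrow> N (\<lambda>x. a * f x) = \<bar>a\<bar> * N f" .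
  assume f: "f \<in> V" and g: "g \<in> V"
  have unit: "e (\<lambda>x. inverse \<alpha> * f x) \<le> 1" if f: "f \<in> V" and \<alpha>: "N f < \<alpha>" for f \<alpha>
  proof -
    have "0 \<le> N f" by (simp add: N_def)
    then have a: "\<alpha> > 0" using \<alpha> by simp
    have "N (\<lambda>x. inverse \<alpha> * f x) = inverse \<alpha> * N f" using N_hom[OF f, of "inverse \<alpha>"] a by simp
    also have "\<dots> \<le> inverse \<alpha> * \<alpha>" using \<alpha> a by (intro mult_left_mono) auto
    finally have "e (\<lambda>x. inverse \<alpha> * f x) powr (1/p) \<le> 1" using N[OF scale_V[OF f]] a by simp
    then have "(e (\<lambda>x. inverse \<alpha> * f x) powr (1/p)) powr p \<le> 1 powr p" using p by (intro powr_mono2) auto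
    then show ?thesis using p E(2)[OF scale_V[OF f]] by (simp add: powr_powr)
  qed
  show "N (\<lambda>x. f x + g x) \<le> N f + N g"
  proof (rule field_le_epsilon)
    fix d :: real assume d: "0 < d"
    \<comment> \<open>Slightly above the norms, so that functions of norm 0 can be normalised as
      well.\<close>
    define \<alpha> where "\<alpha> = N f + d/2"
    define \<beta> where "\<beta> = N g + d/2"
    have "0 \<le> N f" "0 \<le> N g" by (auto simp: N_def)
    then have ab: "0 < \<alpha>" "0 < \<beta>" using d by (auto simp: \<alpha>_def \<beta>_def)
    define s where "s = \<alpha> + \<beta>"
    define t where "t = \<alpha> / s"
    have t: "0 < t" "t < 1" "1 - t = \<beta> / s" "0 < s" using ab by (auto simp: t_def s_def field_simps)
    let ?f = "\<lambda>x. inverse \<alpha> * f x" and ?g = "\<lambda>x. inverse \<beta> * g x"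
    have fg: "?f \<in> V" "?g \<in> V" using f g by (auto intro: scale_V)
    have eq: "(\<lambda>x. t * ?f x + (1 - t) * ?g x) = (\<lambda>x. inverse s * (f x + g x))"
    proof
      fix x
      have "t * inverse \<alpha> = inverse s" "(1 - t) * inverse \<beta> = inverse s"
        using ab t(4) by (simp_all add: t(3)) (simp_all add: t_def divide_inverse)
      then show "t * ?f x + (1 - t) * ?g x = inverse s * (f x + g x)"
        by (simp add: mult.assoc[symmetric] distrib_left)
    qed
    have "E (\<lambda>x. inverse s * (f x + g x)) \<le> ennreal t * E ?f + ennreal (1 - t) * E ?g"
      using convex[OF fg t(1,2)] unfolding eq .
    also have "\<dots> = ennreal (t * e ?f + (1 - t) * e ?g)"
      using t(1,2) E[OF fg(1)] E[OF fg(2)] by (simp add: ennreal_mult ennreal_plus)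
    also have "\<dots> \<le> ennreal (t * 1 + (1 - t) * 1)"
      using unit[OF f, of \<alpha>] unit[OF g, of \<beta>] t d
      by (intro ennreal_leI add_mono mult_left_mono) (auto simp: \<alpha>_def \<beta>_def)
    finally have "ennpowr (E (\<lambda>x. inverse s * (f x + g x))) (1/p) \<le> ennpowr 1 (1/p)"
      using p by (intro ennpowr_mono) auto
    then have "N (\<lambda>x. inverse s * (f x + g x)) \<le> 1"
      unfolding N_def using ennpowr_ennreal[of 1 "1/p"] by (intro enn2real_leI) auto
    then have "inverse s * N (\<lambda>x. f x + g x) \<le> 1" using N_hom[OF add_V[OF f g], of "inverse s"] t(4) by simp
    then have "N (\<lambda>x. f x + g x) \<le> s" using t(4) by (simp add: field_simps)
    then show "N (\<lambda>x. f x + g x) \<le> N f + N g + d" by (simp add: s_def \<alpha>_def \<beta>_def)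
  qed
qed

lemma less_add_ennreal:
  assumes "x < \<infinity>" "0 < e"
  shows "x < x + ennreal e"
  using assms by (cases x) (simp_all add: ennreal_lessI flip: ennreal_plus)

section \<open>Energies of real-valued functions and their classes\<close>

context sobolev
begin

definition grad_energy :: "('a \<Rightarrow> real) \<Rightarrow> ennreal" where
  "grad_energy f = (INF g\<in>{g. upper_gradient (\<lambda>x. ereal (f x)) g}. Lp_powr M p g)"

definition energy :: "('a \<Rightarrow> real) \<Rightarrow> ennreal" where
  "energy f = Lp_powr M p (\<lambda>x. ennreal \<bar>f x\<bar>) + grad_energy f"

text \<open>Every class has a member of this kind, which keeps infinite values out of all later
  estimates.\<close>

definition V :: "('a \<Rightarrow> real) set" where
  "V = {f \<in> borel_measurable borel. energy f < \<infinity>}"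

lemma N1p_norm_real: "N1p_norm M p (\<lambda>x. ereal (f x)) = ennpowr (energy f) (1 / p)"
  by (simp add: N1p_norm_def energy_def grad_energy_def e2ennreal_ereal)

lemma V_iff: "f \<in> V \<longleftrightarrow> (\<lambda>x. ereal (f x)) \<in> N1p_functions M p"
  by (auto simp: V_def N1p_functions_def N1p_norm_real)

lemma V_measurable: "f \<in> V \<Longrightarrow> f \<in> borel_measurable borel"
  by (simp add: V_def)

lemma grad_energy_le: "upper_gradient (\<lambda>x. ereal (f x)) g \<Longrightarrow> grad_energy f \<le> Lp_powr M p g"
  unfolding grad_energy_def by (intro INF_lower) auto

lemma grad_energy_lessD:
  "grad_energy f < K \<Longrightarrow> \<exists>g. upper_gradient (\<lambda>x. ereal (f x)) g \<and> Lp_powr M p g < K"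
  unfolding grad_energy_def by (auto simp: INF_less_iff)

lemma Lp_abs_cmult:
  fixes f :: "'a \<Rightarrow> real"
  assumes "f \<in> borel_measurable borel"
  shows "Lp_powr M p (\<lambda>x. ennreal \<bar>a * f x\<bar>) = ennreal (\<bar>a\<bar> powr p) * Lp_powr M p (\<lambda>x. ennreal \<bar>f x\<bar>)"
  using Lp_powr_cmult[of "\<lambda>x. ennreal \<bar>f x\<bar>" "ennreal \<bar>a\<bar>"] assms
  by (simp add: abs_mult ennreal_mult ennpowr_ennreal)

lemma Lp_abs_convex:
  fixes f g :: "'a \<Rightarrow> real"
  assumes "f \<in> borel_measurable borel" "g \<in> borel_measurable borel" and t: "0 < t" "t < 1"
  shows "Lp_powr M p (\<lambda>x. ennreal \<bar>t * f x + (1 - t) * g x\<bar>)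
    \<le> ennreal t * Lp_powr M p (\<lambda>x. ennreal \<bar>f x\<bar>) + ennreal (1 - t) * Lp_powr M p (\<lambda>x. ennreal \<bar>g x\<bar>)"
proof -
  have "Lp_powr M p (\<lambda>x. ennreal \<bar>t * f x + (1 - t) * g x\<bar>)
      \<le> Lp_powr M p (\<lambda>x. ennreal t * ennreal \<bar>f x\<bar> + ennreal (1 - t) * ennreal \<bar>g x\<bar>)"
  proof (rule Lp_powr_mono)
    fix x
    have "\<bar>t * f x + (1 - t) * g x\<bar> \<le> t * \<bar>f x\<bar> + (1 - t) * \<bar>g x\<bar>"
      using abs_triangle_ineq[of "t * f x" "(1 - t) * g x"] t by (simp add: abs_mult)
    then show "ennreal \<bar>t * f x + (1 - t) * g x\<bar> \<le> ennreal t * ennreal \<bar>f x\<bar> + ennreal (1 - t) * ennreal \<bar>g x\<bar>"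
      using t by (simp add: ennreal_leI flip: ennreal_mult ennreal_plus)
  qed
  also have "\<dots> \<le> ennreal t * Lp_powr M p (\<lambda>x. ennreal \<bar>f x\<bar>) + ennreal (1 - t) * Lp_powr M p (\<lambda>x. ennreal \<bar>g x\<bar>)"
    using assms by (intro Lp_powr_convex borel_imp_M) auto
  finally show ?thesis .
qed

lemma grad_energy_cmult_le:
  assumes "f \<in> borel_measurable borel" and ug: "upper_gradient (\<lambda>x. ereal (f x)) g"
  shows "grad_energy (\<lambda>x. a * f x) \<le> ennreal (\<bar>a\<bar> powr p) * Lp_powr M p g"
proof -
  have "grad_energy (\<lambda>x. a * f x) \<le> Lp_powr M p (\<lambda>x. ennreal \<bar>a\<bar> * g x)"
    by (intro grad_energy_le upper_gradient_cmult assms)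
  then show ?thesis using ug by (simp add: Lp_powr_cmult upper_gradient_def ennpowr_ennreal)
qed

lemma grad_energy_zero: "grad_energy (\<lambda>x. 0) = 0"
proof -
  have "upper_gradient (\<lambda>x. ereal 0) (\<lambda>x. 0)"
    by (rule upper_gradient_realI) auto
  from grad_energy_le[OF this] show ?thesis by (simp add: Lp_powr_def)
qed

text \<open>Scaling upper gradients gives one inequality; the other is the same inequality for the
  factor \<open>1/a\<close>.\<close>

lemma grad_energy_cmult:
  assumes f: "f \<in> borel_measurable borel" and fin: "grad_energy f < \<infinity>"
  shows "grad_energy (\<lambda>x. a * f x) = ennreal (\<bar>a\<bar> powr p) * grad_energy f"
proof -
  have le: "grad_energy (\<lambda>x. a * f x) \<le> ennreal (\<bar>a\<bar> powr p) * grad_energy f"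
    if f: "f \<in> borel_measurable borel" and "a \<noteq> 0" for f a
  proof -
    have "ennreal (inverse (\<bar>a\<bar> powr p)) * grad_energy (\<lambda>x. a * f x) \<le> grad_energy f"
      unfolding grad_energy_def[of f]
    proof (rule INF_greatest)
      fix g assume "g \<in> {g. upper_gradient (\<lambda>x. ereal (f x)) g}"
      then have "ennreal (inverse (\<bar>a\<bar> powr p)) * grad_energy (\<lambda>x. a * f x)
          \<le> ennreal (inverse (\<bar>a\<bar> powr p)) * (ennreal (\<bar>a\<bar> powr p) * Lp_powr M p g)"
        using grad_energy_cmult_le[OF f] by (intro mult_left_mono) auto
      also have "\<dots> = Lp_powr M p g"
        using \<open>a \<noteq> 0\<close> by (simp add: mult.assoc[symmetric] flip: ennreal_mult)
      finally show "ennreal (inverse (\<bar>a\<bar> powr p)) * grad_energy (\<lambda>x. a * f x) \<le> Lp_powr M p g" .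
    qed
    then have "ennreal (\<bar>a\<bar> powr p) * (ennreal (inverse (\<bar>a\<bar> powr p)) * grad_energy (\<lambda>x. a * f x))
        \<le> ennreal (\<bar>a\<bar> powr p) * grad_energy f" by (intro mult_left_mono) auto
    then show ?thesis using \<open>a \<noteq> 0\<close> by (simp add: mult.assoc[symmetric] flip: ennreal_mult)
  qed
  show ?thesis
  proof (cases "a = 0")
    case True
    then show ?thesis using grad_energy_zero by simp
  next
    case False
    have "ennreal (\<bar>a\<bar> powr p) * grad_energy (\<lambda>x. (1/a) * (a * f x))
        \<le> ennreal (\<bar>a\<bar> powr p) * (ennreal (\<bar>1/a\<bar> powr p) * grad_energy (\<lambda>x. a * f x))"
      using f False by (intro mult_left_mono le) auto
    also have "\<dots> = grad_energy (\<lambda>x. a * f x)"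
      using False by (simp add: mult.assoc[symmetric] powr_mult[symmetric] abs_mult[symmetric] flip: ennreal_mult)
    finally show ?thesis using le[OF f False] False by (intro antisym) auto
  qed
qed

lemma grad_energy_convex:
  assumes f: "f \<in> borel_measurable borel" and g: "g \<in> borel_measurable borel" and t: "0 < t" "t < 1"
  shows "grad_energy (\<lambda>x. t * f x + (1 - t) * g x) \<le> ennreal t * grad_energy f + ennreal (1 - t) * grad_energy g"
proof (rule ennreal_le_epsilon)
  fix e :: real assume e: "0 < e" and fin: "ennreal t * grad_energy f + ennreal (1 - t) * grad_energy g < top"
  then have "grad_energy f < \<infinity>" "grad_energy g < \<infinity>" using t
    by (auto simp: ennreal_add_less_top ennreal_mult_less_top)
  then have "grad_energy f < grad_energy f + ennreal e" "grad_energy g < grad_energy g + ennreal e"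
    using e by (simp_all add: less_add_ennreal)
  then obtain F G where F: "upper_gradient (\<lambda>x. ereal (f x)) F" "Lp_powr M p F < grad_energy f + ennreal e"
    and G: "upper_gradient (\<lambda>x. ereal (g x)) G" "Lp_powr M p G < grad_energy g + ennreal e"
    using grad_energy_lessD by metis
  have [measurable]: "F \<in> borel_measurable borel" "G \<in> borel_measurable borel"
    using F G by (auto simp: upper_gradient_def)
  have "grad_energy (\<lambda>x. t * f x + (1 - t) * g x) \<le> Lp_powr M p (\<lambda>x. ennreal \<bar>t\<bar> * F x + ennreal \<bar>1 - t\<bar> * G x)"
    using f g by (intro grad_energy_le upper_gradient_add upper_gradient_cmult F G) auto
  also have "\<dots> \<le> ennreal t * Lp_powr M p F + ennreal (1 - t) * Lp_powr M p G"
    using t Lp_powr_convex[of F G t] by (simp add: borel_imp_M)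
  also have "\<dots> \<le> ennreal t * (grad_energy f + ennreal e) + ennreal (1 - t) * (grad_energy g + ennreal e)"
    using F G by (intro add_mono mult_left_mono) auto
  also have "\<dots> = ennreal t * grad_energy f + ennreal (1 - t) * grad_energy g + ennreal (t * e + (1 - t) * e)"
    using t e by (simp add: distrib_left ennreal_mult ennreal_plus add_ac)
  finally show "grad_energy (\<lambda>x. t * f x + (1 - t) * g x)
      \<le> ennreal t * grad_energy f + ennreal (1 - t) * grad_energy g + ennreal e"
    by (simp add: algebra_simps)
qed

lemma V_grad_finite: "f \<in> V \<Longrightarrow> grad_energy f < \<infinity>"
  and V_Lp_finite: "f \<in> V \<Longrightarrow> Lp_powr M p (\<lambda>x. ennreal \<bar>f x\<bar>) < \<infinity>"
  by (auto simp: V_def energy_def ennreal_add_less_top)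

lemma energy_cmult:
  assumes "f \<in> V"
  shows "energy (\<lambda>x. a * f x) = ennreal (\<bar>a\<bar> powr p) * energy f"
  unfolding energy_def
  by (simp add: Lp_abs_cmult[OF V_measurable[OF assms]]
      grad_energy_cmult[OF V_measurable[OF assms] V_grad_finite[OF assms]] distrib_left)

lemma energy_convex:
  assumes "f \<in> borel_measurable borel" "g \<in> borel_measurable borel" "0 < t" "t < 1"
  shows "energy (\<lambda>x. t * f x + (1 - t) * g x) \<le> ennreal t * energy f + ennreal (1 - t) * energy g"
  using add_mono[OF Lp_abs_convex[OF assms] grad_energy_convex[OF assms]]
  unfolding energy_def by (simp add: distrib_left add_ac)

lemma V_cmult: "f \<in> V \<Longrightarrow> (\<lambda>x. a * f x) \<in> V"
  using energy_cmult[of f a] by (auto simp: V_def ennreal_mult_less_top)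

text \<open>The sum is the midpoint of \<open>2 * f\<close> and \<open>2 * g\<close>, so convexity
  and homogeneity of the energy suffice.\<close>

lemma V_add:
  assumes "f \<in> V" "g \<in> V"
  shows "(\<lambda>x. f x + g x) \<in> V"
proof -
  have "energy (\<lambda>x. (1/2) * (2 * f x) + (1 - 1/2) * (2 * g x))
      \<le> ennreal (1/2) * energy (\<lambda>x. 2 * f x) + ennreal (1 - 1/2) * energy (\<lambda>x. 2 * g x)"
    using assms by (intro energy_convex V_measurable V_cmult) auto
  also have "\<dots> < \<infinity>"
  proof -
    have fin: "ennreal a * x < top" if "x < top" for a x using that by (simp add: ennreal_mult_less_top)
    have "energy (\<lambda>x. 2 * f x) < top" "energy (\<lambda>x. 2 * g x) < top"
      using V_cmult[OF assms(1), of 2] V_cmult[OF assms(2), of 2] by (simp_all add: V_def)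
    then show ?thesis unfolding infinity_ennreal_def ennreal_add_less_top by (intro conjI fin)
  qed
  finally show ?thesis using assms by (simp add: V_def borel_measurable_add)
qed

lemma V_diff: "f \<in> V \<Longrightarrow> g \<in> V \<Longrightarrow> (\<lambda>x. f x - g x) \<in> V"
  using V_add[OF _ V_cmult[of g "-1"], of f] by simp

lemma V_zero: "(\<lambda>x. 0) \<in> V"
  using grad_energy_zero by (simp add: V_def energy_def Lp_powr_def)

text \<open>Since \<open>\<infinity> - \<infinity> = \<infinity>\<close>, the difference is also
  nonzero where both functions take the same infinite value, but that set is exceptional.
  Equivalence thus becomes equality off an exceptional set.\<close>

lemma N1p_rel_iff:
  "(u, v) \<in> N1p_rel M p \<longleftrightarrow> u \<in> N1p_functions M p \<and> v \<in> N1p_functions M p \<and> exceptional {x. u x \<noteq> v x}"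
proof -
  have "N1p_norm M p (\<lambda>x. u x - v x) = 0 \<longleftrightarrow> exceptional {x. u x \<noteq> v x}"
    if u: "u \<in> N1p_functions M p" and v: "v \<in> N1p_functions M p"
  proof -
    have [measurable]: "u \<in> borel_measurable borel" "v \<in> borel_measurable borel"
      using u v by (auto simp: N1p_functions_def)
    have B: "{x. u x \<noteq> v x} \<in> sets borel" "{x. u x - v x \<noteq> 0} \<in> sets borel" by measurable
    have s1: "{x. u x \<noteq> v x} \<subseteq> {x. u x - v x \<noteq> 0}"
    proof (intro subsetI CollectI)
      fix x assume "x \<in> {x. u x \<noteq> v x}"
      then show "u x - v x \<noteq> 0" by (cases "u x"; cases "v x") auto
    qed
    have s2: "{x. u x - v x \<noteq> 0} \<subseteq> {x. u x \<noteq> v x} \<union> {x. \<bar>u x\<bar> = \<infinity>}"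
    proof (intro subsetI)
      fix x assume "x \<in> {x. u x - v x \<noteq> 0}"
      then show "x \<in> {x. u x \<noteq> v x} \<union> {x. \<bar>u x\<bar> = \<infinity>}" by (cases "u x"; cases "v x") auto
    qed
    show ?thesis
      using N1p_norm_eq_0_iff[of "\<lambda>x. u x - v x"] B exceptional_subset[OF _ s1]
        exceptional_subset[OF exceptional_Un[OF _ exceptional_infinite[OF u]] s2]
      by auto
  qed
  then show ?thesis by (auto simp: N1p_rel_def)
qed

lemma N1p_functions_cong:
  assumes "u \<in> N1p_functions M p" "v \<in> borel_measurable borel" "exceptional {x. u x \<noteq> v x}"
  shows "v \<in> N1p_functions M p"
  using assms N1p_norm_cong_le[of u v] by (auto simp: N1p_functions_def)

lemma equiv_N1p_rel: "equiv (N1p_functions M p) (N1p_rel M p)"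
proof (rule equivI)
  show "N1p_rel M p \<subseteq> N1p_functions M p \<times> N1p_functions M p" by (auto simp: N1p_rel_def)
  show "refl_on (N1p_functions M p) (N1p_rel M p)"
    unfolding refl_on_def by (auto simp: N1p_rel_iff exceptional_empty)
  show "sym (N1p_rel M p)"
    unfolding sym_def N1p_rel_iff by (auto simp: eq_commute)
  show "trans (N1p_rel M p)"
    unfolding trans_def
  proof (intro allI impI)
    fix u v w assume uv: "(u, v) \<in> N1p_rel M p" and vw: "(v, w) \<in> N1p_rel M p"
    then have [measurable]: "u \<in> borel_measurable borel" "w \<in> borel_measurable borel"
      by (auto simp: N1p_rel_def N1p_functions_def)
    have "exceptional {x. u x \<noteq> w x}"
      by (rule exceptional_subset[of "{x. u x \<noteq> v x} \<union> {x. v x \<noteq> w x}"])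
        (use uv vw exceptional_Un in \<open>auto simp: N1p_rel_iff\<close>)
    then show "(u, w) \<in> N1p_rel M p" using uv vw by (simp add: N1p_rel_iff)
  qed
qed

definition cls :: "('a \<Rightarrow> real) \<Rightarrow> ('a \<Rightarrow> ereal) set" where
  "cls f = N1p_rel M p `` {\<lambda>x. ereal (f x)}"

lemma cls_eq_iff:
  assumes "f \<in> V" "g \<in> V"
  shows "cls f = cls g \<longleftrightarrow> exceptional {x. f x \<noteq> g x}"
  using assms eq_equiv_class_iff[OF equiv_N1p_rel] by (simp add: cls_def V_iff N1p_rel_iff)

lemma real_representative:
  assumes u: "u \<in> N1p_functions M p"
  shows "(\<lambda>x. real_of_ereal (u x)) \<in> V"
    and "(u, \<lambda>x. ereal (real_of_ereal (u x))) \<in> N1p_rel M p"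
proof -
  have [measurable]: "u \<in> borel_measurable borel" using u by (simp add: N1p_functions_def)
  have "exceptional {x. u x \<noteq> ereal (real_of_ereal (u x))}"
    by (rule exceptional_subset[OF exceptional_infinite[OF u]]) (auto simp: ereal_real)
  moreover from this have "(\<lambda>x. ereal (real_of_ereal (u x))) \<in> N1p_functions M p"
    by (intro N1p_functions_cong[OF u]) auto
  ultimately show "(\<lambda>x. real_of_ereal (u x)) \<in> V" "(u, \<lambda>x. ereal (real_of_ereal (u x))) \<in> N1p_rel M p"
    using u by (auto simp: V_iff N1p_rel_iff)
qed

lemma cls_mem: "f \<in> V \<Longrightarrow> (\<lambda>x. ereal (f x)) \<in> cls f"
  using equiv_class_self[OF equiv_N1p_rel] by (simp add: cls_def V_iff)

lemma cls_iff: "u \<in> cls f \<longleftrightarrow> (\<lambda>x. ereal (f x), u) \<in> N1p_rel M p"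
  by (simp add: cls_def)

text \<open>Shows that the unions in the definitions of \<open>vadd\<close> and
  \<open>vscale\<close> run over copies of one class.\<close>

lemma cls_cong:
  assumes f: "f \<in> V" and u: "u \<in> borel_measurable borel" "exceptional {x. ereal (f x) \<noteq> u x}"
  shows "N1p_rel M p `` {u} = cls f"
proof -
  have "(\<lambda>x. ereal (f x), u) \<in> N1p_rel M p"
    using N1p_functions_cong[of "\<lambda>x. ereal (f x)" u] assms by (simp add: N1p_rel_iff V_iff)
  then show ?thesis unfolding cls_def by (rule equiv_class_eq[OF equiv_N1p_rel, symmetric])
qed

lemma N1p_carrier: "vcarrier (N1p_space M p) = cls ` V"
proof (intro equalityI subsetI)
  fix c assume "c \<in> vcarrier (N1p_space M p)"
  then obtain u where u: "u \<in> N1p_functions M p" "c = N1p_rel M p `` {u}"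
    by (auto simp: N1p_space_def elim: quotientE)
  then show "c \<in> cls ` V"
    using real_representative[OF u(1)] equiv_class_eq[OF equiv_N1p_rel, of u] by (auto simp: cls_def)
qed (auto simp: N1p_space_def cls_def V_iff intro: quotientI)

lemma N1p_add:
  assumes f: "f \<in> V" and g: "g \<in> V"
  shows "vadd (N1p_space M p) (cls f) (cls g) = cls (\<lambda>x. f x + g x)"
proof -
  have "N1p_rel M p `` {\<lambda>x. u x + v x} = cls (\<lambda>x. f x + g x)" if u: "u \<in> cls f" and v: "v \<in> cls g" for u v
  proof (rule cls_cong)
    have [measurable]: "u \<in> borel_measurable borel" "v \<in> borel_measurable borel"
      using u v by (auto simp: cls_iff N1p_rel_def N1p_functions_def)
    have [measurable]: "f \<in> borel_measurable borel" "g \<in> borel_measurable borel"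
      using f g by (auto intro: V_measurable)
    show "(\<lambda>x. u x + v x) \<in> borel_measurable borel" by measurable
    have "exceptional ({x. ereal (f x) \<noteq> u x} \<union> {x. ereal (g x) \<noteq> v x})"
      using u v by (intro exceptional_Un) (auto simp: cls_iff N1p_rel_iff)
    then show "exceptional {x. ereal (f x + g x) \<noteq> u x + v x}"
      by (rule exceptional_subset) (auto simp flip: plus_ereal.simps(1))
  qed (rule V_add[OF f g])
  then show ?thesis using cls_mem[OF f] cls_mem[OF g] unfolding N1p_space_def by auto
qed

lemma N1p_scale:
  assumes f: "f \<in> V"
  shows "vscale (N1p_space M p) a (cls f) = cls (\<lambda>x. a * f x)"
proof -
  have "N1p_rel M p `` {\<lambda>x. ereal a * u x} = cls (\<lambda>x. a * f x)" if u: "u \<in> cls f" for u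
  proof (rule cls_cong)
    have [measurable]: "u \<in> borel_measurable borel"
      using u by (auto simp: cls_iff N1p_rel_def N1p_functions_def)
    have [measurable]: "f \<in> borel_measurable borel" using f by (auto intro: V_measurable)
    show "(\<lambda>x. ereal a * u x) \<in> borel_measurable borel" by measurable
    have "exceptional {x. ereal (f x) \<noteq> u x}" using u by (auto simp: cls_iff N1p_rel_iff)
    then show "exceptional {x. ereal (a * f x) \<noteq> ereal a * u x}"
      by (rule exceptional_subset) (auto simp flip: times_ereal.simps(1))
  qed (rule V_cmult[OF f])
  then show ?thesis using cls_mem[OF f] unfolding N1p_space_def by auto
qed

lemma N1p_vzero: "vzero (N1p_space M p) = cls (\<lambda>x. 0)"
  by (simp add: N1p_space_def cls_def zero_ereal_def)

lemma class_norm_cls: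
  assumes f: "f \<in> V" and n: "\<And>u v. (u, v) \<in> N1p_rel M p \<Longrightarrow> n u = n v"
  shows "class_norm n (cls f) = enn2real (n (\<lambda>x. ereal (f x)))"
proof -
  have "n u = n (\<lambda>x. ereal (f x))" if "u \<in> cls f" for u
    by (rule n[symmetric]) (use that in \<open>simp add: cls_iff\<close>)
  then have "n ` cls f = (\<lambda>u. n (\<lambda>x. ereal (f x))) ` cls f" by (rule image_cong[OF refl])
  also have "\<dots> = {n (\<lambda>x. ereal (f x))}" by (rule image_constant[OF cls_mem[OF f]])
  finally have "n ` cls f = {n (\<lambda>x. ereal (f x))}" .
  then show ?thesis by (simp add: class_norm_def)
qed

lemma N1p_norm_rel: "(u, v) \<in> N1p_rel M p \<Longrightarrow> N1p_norm M p u = N1p_norm M p v"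
  by (intro N1p_norm_cong) (auto simp: N1p_rel_iff N1p_functions_def)

text \<open>Both norms are roots of a convex functional, homogeneous of degree \<open>p\<close>,
  that vanishes only for functions which are 0 off an exceptional set. The axioms are derived once
  for any such \<open>F\<close>.\<close>

lemma N1p_real_normed_space:
  assumes n: "\<And>u v. (u, v) \<in> N1p_rel M p \<Longrightarrow> n u = n v"
    and F: "\<And>f. f \<in> V \<Longrightarrow> n (\<lambda>x. ereal (f x)) = ennpowr (F f) (1 / p)"
      "\<And>f. f \<in> V \<Longrightarrow> F f < \<infinity>"
      "\<And>a f. f \<in> V \<Longrightarrow> F (\<lambda>x. a * f x) = ennreal (\<bar>a\<bar> powr p) * F f"
      "\<And>t f g. f \<in> V \<Longrightarrow> g \<in> V \<Longrightarrow> 0 < t \<Longrightarrow> t < 1 \<Longrightarrow>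
        F (\<lambda>x. t * f x + (1 - t) * g x) \<le> ennreal t * F f + ennreal (1 - t) * F g"
      "\<And>f. f \<in> V \<Longrightarrow> F f = 0 \<Longrightarrow> exceptional {x. f x \<noteq> 0}"
  shows "real_normed_space ((N1p_space M p)\<lparr>vnorm := class_norm n\<rparr>)"
proof (rule real_normed_space_quotient[where V = V and q = cls and N = "\<lambda>f. enn2real (ennpowr (F f) (1 / p))"])
  show "enn2real (ennpowr (F (\<lambda>x. a * f x)) (1 / p)) = \<bar>a\<bar> * enn2real (ennpowr (F f) (1 / p))"
    if "f \<in> V" for a f by (intro seminorm_of_convex(1)[of p V F] p V_cmult V_add F(2-4) that)
  show "enn2real (ennpowr (F (\<lambda>x. f x + g x)) (1 / p))
      \<le> enn2real (ennpowr (F f) (1 / p)) + enn2real (ennpowr (F g) (1 / p))"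
    if "f \<in> V" "g \<in> V" for f g by (intro seminorm_of_convex(2)[of p V F] p V_cmult V_add F(2-4) that)
  show "cls f = cls (\<lambda>x. 0)" if f: "f \<in> V" and 0: "enn2real (ennpowr (F f) (1 / p)) = 0" for f
  proof -
    have "ennpowr (F f) (1 / p) < top" using F(2)[OF f] by simp
    then have "ennpowr (F f) (1 / p) = 0" using 0 unfolding enn2real_eq_0_iff by (metis less_irrefl)
    then have "ennpowr (ennpowr (F f) (1 / p)) p = 0" by simp
    then have "F f = 0" by (simp only: ennpowr_inverse)
    then show ?thesis using cls_eq_iff[OF f V_zero] F(5)[OF f] by simp
  qed
  show "vnorm ((N1p_space M p)\<lparr>vnorm := class_norm n\<rparr>) (cls f) = enn2real (ennpowr (F f) (1 / p))"
    if "f \<in> V" for f using class_norm_cls[OF that n] F(1)[OF that] by simp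
qed (simp_all add: N1p_carrier N1p_vzero N1p_add N1p_scale V_zero V_add V_cmult)

lemma energy_zeroD: "f \<in> V \<Longrightarrow> energy f = 0 \<Longrightarrow> exceptional {x. f x \<noteq> 0}"
  using N1p_norm_eq_0_iff[of "\<lambda>x. ereal (f x)"] V_measurable[of f] by (simp add: N1p_norm_real)

lemma N1p_norm_cls: "f \<in> V \<Longrightarrow> vnorm (N1p_space M p) (cls f) = enn2real (ennpowr (energy f) (1 / p))"
  using class_norm_cls[OF _ N1p_norm_rel] by (simp add: N1p_norm_real N1p_space_def)

lemma N1p_space_normed: "real_normed_space (N1p_space M p)"
proof -
  have "real_normed_space ((N1p_space M p)\<lparr>vnorm := class_norm (N1p_norm M p)\<rparr>)"
    by (intro N1p_real_normed_space[where F = energy] N1p_norm_rel N1p_norm_real energy_cmult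
        energy_convex energy_zeroD V_measurable) (simp_all add: V_def)
  then show ?thesis by (simp add: N1p_space_def)
qed

text \<open>The increments and their upper gradients are dominated by 2^-n times one
  \<open>\<rho>\<close>, so they sum absolutely where \<open>\<rho>\<close> is finite. Along an arc
  of finite \<open>\<rho>\<close>-integral each increment varies by at most 2^-n times that
  integral. Summability therefore spreads from one good point to the ends, and
  \<open>h - f n\<close> has twice 2^-n times \<open>\<rho>\<close> as an upper gradient.\<close>

lemma rapid_completeness:
  assumes f: "\<And>n. f n \<in> V"
    and rapid: "\<And>n. energy (\<lambda>x. f (Suc n) x - f n x) < ennreal (((1/8) ^ n) powr p)"
  obtains h where "h \<in> V" "(\<lambda>n. energy (\<lambda>x. f n x - h x)) \<longlonglongrightarrow> 0"
proof -
  have f_meas [measurable]: "f n \<in> borel_measurable borel" for n using f by (rule V_measurable)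
  define w where "w n x = f (Suc n) x - f n x" for n x
  have [measurable]: "w n \<in> borel_measurable borel" for n unfolding w_def by measurable
  have "\<exists>g. upper_gradient (\<lambda>x. ereal (w n x)) g \<and> Lp_powr M p g < ennreal (((1/8) ^ n) powr p)" for n
    using rapid[of n] by (intro grad_energy_lessD) (auto simp: w_def energy_def intro: le_less_trans[rotated])
  then obtain G where G: "\<And>n. upper_gradient (\<lambda>x. ereal (w n x)) (G n)"
    and G_small: "\<And>n. Lp_powr M p (G n) < ennreal (((1/8) ^ n) powr p)" by metis
  have [measurable]: "G n \<in> borel_measurable borel" for n using G by (simp add: upper_gradient_def)
  \<comment> \<open>The factor \<open>1/4\<close> absorbs, uniformly in \<open>n\<close>, the
    constant \<open>2 powr p\<close> of the crude triangle inequality and the presence of two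
    summands. The factor 4 in \<open>\<rho>\<close> below undoes it.\<close>
  define r where "r n x = ennreal (1/4) * (ennreal \<bar>w n x\<bar> + G n x)" for n x
  have [measurable]: "r n \<in> borel_measurable borel" for n unfolding r_def by measurable
  have "Lp_powr M p (r n) \<le> ennreal (((1/4) ^ n) powr p)" for n
  proof -
    have "Lp_powr M p (\<lambda>x. ennreal \<bar>w n x\<bar>) \<le> ennreal (((1/8) ^ n) powr p)"
      using rapid[of n] by (auto simp: w_def energy_def intro: order_trans[rotated] less_imp_le)
    then have "Lp_powr M p (\<lambda>x. ennreal \<bar>w n x\<bar> + G n x)
        \<le> ennreal (2 powr p) * (ennreal (((1/8) ^ n) powr p) + ennreal (((1/8) ^ n) powr p))"
      using G_small[of n] by (intro order_trans[OF Lp_powr_add_le] mult_left_mono add_mono) auto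
    also have "\<dots> = ennreal (2 powr p * (2 * ((1/8) ^ n) powr p))"
      by (simp add: ennreal_mult ennreal_plus flip: mult_2)
    finally have "Lp_powr M p (r n) \<le> ennreal ((1/4) powr p) * ennreal (2 powr p * (2 * ((1/8) ^ n) powr p))"
      unfolding r_def by (subst Lp_powr_cmult) (auto simp: ennpowr_ennreal intro!: mult_left_mono)
    also have "\<dots> = ennreal (((1/2) powr p * 2) * ((1/8) ^ n) powr p)"
      by (simp add: powr_mult[symmetric] mult.assoc[symmetric] flip: ennreal_mult)
    also have "\<dots> \<le> ennreal (1 * ((1/4) ^ n) powr p)"
    proof (intro ennreal_leI mult_mono powr_mono2)
      show "(1/2) powr p * 2 \<le> 1" using powr_mono'[of 1 p "1/2"] p by simp
    qed (use p in \<open>auto intro: power_mono\<close>)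
    finally show ?thesis by simp
  qed
  then obtain \<rho>' where \<rho>' [measurable]: "\<rho>' \<in> borel_measurable borel" and "Lp_powr M p \<rho>' < \<infinity>"
    and dom': "\<And>n x. r n x \<le> ennreal ((1/2) ^ n) * \<rho>' x"
    using rapid_domination[of r] by (metis \<open>\<And>n. r n \<in> borel_measurable borel\<close>)
  define \<rho> where "\<rho> x = ennreal 4 * \<rho>' x" for x
  have \<rho> [measurable]: "\<rho> \<in> borel_measurable borel" unfolding \<rho>_def by measurable
  have \<rho>_fin: "Lp_powr M p \<rho> < \<infinity>"
    unfolding \<rho>_def using \<open>Lp_powr M p \<rho>' < \<infinity>\<close> by (subst Lp_powr_cmult) (auto simp: ennreal_mult_less_top ennpowr_ennreal)
  have dom: "ennreal \<bar>w n x\<bar> + G n x \<le> ennreal ((1/2) ^ n) * \<rho> x" for n x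
  proof -
    have "ennreal 4 * r n x \<le> ennreal 4 * (ennreal ((1/2) ^ n) * \<rho>' x)" by (intro mult_left_mono dom') auto
    moreover have "ennreal 4 * r n x = ennreal \<bar>w n x\<bar> + G n x"
      unfolding r_def by (simp add: mult.assoc[symmetric] del: ennreal_numeral flip: ennreal_mult)
    ultimately show ?thesis by (simp add: \<rho>_def mult_ac)
  qed
  have G_dom: "G n x \<le> ennreal ((1/2) ^ n) * \<rho> x" for n x
    using dom[of n x] by (auto intro: order_trans[rotated])
  have w_dom: "\<bar>w n x\<bar> \<le> (1/2) ^ n * enn2real (\<rho> x)" if "\<rho> x < \<infinity>" for n x
  proof -
    have "ennreal \<bar>w n x\<bar> \<le> ennreal ((1/2) ^ n) * \<rho> x" using dom[of n x] by (auto intro: order_trans[rotated])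
    also have "\<dots> = ennreal ((1/2) ^ n * enn2real (\<rho> x))" using that by (simp add: ennreal_mult)
    finally show ?thesis by (simp add: ennreal_le_iff)
  qed
  \<comment> \<open>The value 0 on the divergence set is a harmless default: \<open>\<rho>\<close>
    is infinite there, and arcs of finite \<open>\<rho>\<close>-integral do not end in that
    set.\<close>
  define h where "h x = (if summable (\<lambda>n. \<bar>w n x\<bar>) then f 0 x + (\<Sum>n. w n x) else 0)" for x
  have partial: "f n x = f 0 x + (\<Sum>k<n. w k x)" for n x by (induction n) (auto simp: w_def)
  \<comment> \<open>Uses only the variation of the increments between the two points, because
    \<open>\<rho>\<close> may be infinite at the ends of an arc along which its integral is
    finite.\<close>
  have tail: "\<bar>(h x - f n x) - (h y - f n y)\<bar> \<le> (1/2) ^ n * (2 * K)"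
    if "summable (\<lambda>k. \<bar>w k x\<bar>)" "summable (\<lambda>k. \<bar>w k y\<bar>)" and K: "\<And>k. \<bar>w k x - w k y\<bar> \<le> (1/2) ^ k * K" for x y n K
  proof -
    have sx: "summable (\<lambda>k. w k x)" "summable (\<lambda>k. w k y)" using that by (auto intro: summable_rabs_cancel)
    have eq: "(h z - f n z) = (\<Sum>k. w (k + n) z)" if "summable (\<lambda>k. \<bar>w k z\<bar>)" for z
      using suminf_split_initial_segment[of "\<lambda>k. w k z" n] summable_rabs_cancel[OF that] that
      by (simp add: h_def partial[of n])
    have geo: "(\<lambda>k. (1/2) ^ n * (K * (1/2) ^ k)) sums ((1/2) ^ n * (K * (1 / (1 - 1/2))))"
      by (intro sums_mult geometric_sums) auto
    have K': "norm (w (k + n) x - w (k + n) y) \<le> (1/2) ^ n * (K * (1/2) ^ k)" for k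
      using K[of "k + n"] by (simp add: power_add mult_ac)
    have "(h x - f n x) - (h y - f n y) = (\<Sum>k. w (k + n) x - w (k + n) y)"
      using suminf_diff[OF summable_ignore_initial_segment[OF sx(1), of n]
          summable_ignore_initial_segment[OF sx(2), of n]] that by (simp add: eq)
    also have "norm \<dots> \<le> (1/2) ^ n * (K * (1 / (1 - 1/2)))"
      by (rule norm_suminf_le[OF K' sums_summable[OF geo], unfolded sums_unique[OF geo, symmetric]])
    finally show ?thesis by (simp add: mult_ac)
  qed
  have h_dom: "\<bar>h x - f n x\<bar> \<le> (1/2) ^ n * (2 * enn2real (\<rho> x))"
    if "\<rho> x < \<infinity>" and s: "summable (\<lambda>k. \<bar>w k x\<bar>)" for x n
  proof -
    have geo: "(\<lambda>k. (1/2) ^ n * (enn2real (\<rho> x) * (1/2) ^ k)) sums ((1/2) ^ n * (enn2real (\<rho> x) * (1 / (1 - 1/2))))"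
      by (intro sums_mult geometric_sums) auto
    have b: "norm (w (k + n) x) \<le> (1/2) ^ n * (enn2real (\<rho> x) * (1/2) ^ k)" for k
      using w_dom[OF that(1), of "k + n"] by (simp add: power_add mult_ac)
    have "h x - f n x = (\<Sum>k. w (k + n) x)"
      using suminf_split_initial_segment[of "\<lambda>k. w k x" n] summable_rabs_cancel[OF s] s
      by (simp add: h_def partial[of n])
    also have "norm \<dots> \<le> (1/2) ^ n * (enn2real (\<rho> x) * (1 / (1 - 1/2)))"
      by (rule norm_suminf_le[OF b sums_summable[OF geo], unfolded sums_unique[OF geo, symmetric]])
    finally show ?thesis by (simp add: mult_ac)
  qed
  have s_fin: "summable (\<lambda>k. \<bar>w k x\<bar>)" if "\<rho> x < \<infinity>" for x
    by (rule summable_comparison_test'[where N = 0 and g = "\<lambda>k. (1/2) ^ k * enn2real (\<rho> x)"])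
      (use w_dom[OF that] in \<open>auto intro: summable_mult2 summable_geometric\<close>)
  have [measurable]: "h \<in> borel_measurable borel"
  proof -
    have "summable (\<lambda>n. \<bar>w n x\<bar>) \<longleftrightarrow> (\<Sum>n. ennreal \<bar>w n x\<bar>) \<noteq> top" for x
    proof
      assume "summable (\<lambda>n. \<bar>w n x\<bar>)"
      then show "(\<Sum>n. ennreal \<bar>w n x\<bar>) \<noteq> top" by (rule ennreal_suminf_neq_top) simp
    next
      assume "(\<Sum>n. ennreal \<bar>w n x\<bar>) \<noteq> top"
      then show "summable (\<lambda>n. \<bar>w n x\<bar>)" by (rule summable_suminf_not_top[rotated]) simp
    qed
    then show ?thesis unfolding h_def by simp
  qed
  have "upper_gradient (\<lambda>x. ereal (h x - f n x)) (\<lambda>x. ennreal ((1/2) ^ n * 2) * \<rho> x)" for n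
  proof (rule upper_gradient_realI)
    fix l and c :: "real \<Rightarrow> 'a" assume c: "unit_speed l c"
    have l: "0 < l" using c by (simp add: unit_speed_def)
    show "ennreal \<bar>h (c 0) - f n (c 0) - (h (c l) - f n (c l))\<bar>
        \<le> line_integral c 0 l (\<lambda>x. ennreal ((1/2) ^ n * 2) * \<rho> x)"
    proof (cases "line_integral c 0 l \<rho> = \<infinity>")
      case True
      then show ?thesis using line_integral_cmult[OF c _ _ \<rho>] by (simp add: ennreal_mult_top)
    next
      case False
      then obtain K where K: "0 \<le> K" "line_integral c 0 l \<rho> = ennreal K"
        by (metis infinity_ennreal_def ennreal_cases)
      have var: "\<bar>w k (c s) - w k (c t)\<bar> \<le> (1/2) ^ k * K" if st: "0 \<le> s" "s < t" "t \<le> l" for s t k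
      proof -
        have "ennreal \<bar>w k (c s) - w k (c t)\<bar> \<le> line_integral c s t (G k)"
          using upper_gradient_subarc[OF G c st, of k] by simp
        also have "\<dots> \<le> line_integral c 0 l (G k)" by (rule line_integral_subset) (use st in auto)
        also have "\<dots> \<le> line_integral c 0 l (\<lambda>x. ennreal ((1/2) ^ k) * \<rho> x)"
          by (rule line_integral_mono) (rule G_dom)
        also have "\<dots> = ennreal ((1/2) ^ k * K)" using line_integral_cmult[OF c _ _ \<rho>] K by (simp add: ennreal_mult)
        finally show ?thesis using K by (simp add: ennreal_le_iff)
      qed
      have N: "{x. \<rho> x = \<infinity>} \<in> sets borel" by measurable
      have "line_integral c 0 l (\<lambda>x. \<infinity> * indicator {x. \<rho> x = \<infinity>} x) \<le> line_integral c 0 l \<rho>"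
        by (rule line_integral_mono) (auto simp: indicator_def)
      then have "line_integral c 0 l (\<lambda>x. \<infinity> * indicator {x. \<rho> x = \<infinity>} x) < \<infinity>"
        using False by (simp add: less_top le_less_trans)
      then obtain \<tau> where \<tau>: "0 < \<tau>" "\<tau> < l" "\<rho> (c \<tau>) < \<infinity>"
        using unit_speed_avoids[OF c order_refl l order_refl N] by (auto simp: less_top)
      have sum: "summable (\<lambda>k. \<bar>w k y\<bar>)" if "\<And>k. \<bar>w k y - w k (c \<tau>)\<bar> \<le> (1/2) ^ k * K" for y
      proof (rule summable_comparison_test'[where N = 0])
        show "summable (\<lambda>k. (1/2) ^ k * K + \<bar>w k (c \<tau>)\<bar>)"
          by (intro summable_add summable_mult2 summable_geometric s_fin \<tau>) auto
        show "norm \<bar>w k y\<bar> \<le> (1/2) ^ k * K + \<bar>w k (c \<tau>)\<bar>" for k using that[of k] by simp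
      qed
      have "\<bar>h (c 0) - f n (c 0) - (h (c l) - f n (c l))\<bar> \<le> (1/2) ^ n * (2 * K)"
        using var[of 0 \<tau>] var[of \<tau> l] var[of 0 l] \<tau> l
        by (intro tail sum) (auto simp: abs_minus_commute)
      then have "ennreal \<bar>h (c 0) - f n (c 0) - (h (c l) - f n (c l))\<bar> \<le> ennreal ((1/2) ^ n * 2 * K)"
        by (intro ennreal_leI) (simp add: mult_ac)
      then show ?thesis using line_integral_cmult[OF c _ _ \<rho>, of 0 l "ennreal ((1/2) ^ n * 2)"] K
        by (simp add: ennreal_mult)
    qed
  qed measurable
  then have "grad_energy (\<lambda>x. h x - f n x) \<le> Lp_powr M p (\<lambda>x. ennreal ((1/2) ^ n * 2) * \<rho> x)" for n
    by (rule grad_energy_le)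
  moreover have "Lp_powr M p (\<lambda>x. ennreal \<bar>h x - f n x\<bar>) \<le> Lp_powr M p (\<lambda>x. ennreal ((1/2) ^ n * 2) * \<rho> x)" for n
  proof (rule Lp_powr_mono)
    fix x
    show "ennreal \<bar>h x - f n x\<bar> \<le> ennreal ((1/2) ^ n * 2) * \<rho> x"
    proof (cases "\<rho> x < \<infinity>")
      case True
      have "ennreal \<bar>h x - f n x\<bar> \<le> ennreal ((1/2) ^ n * 2 * enn2real (\<rho> x))"
        using h_dom[OF True s_fin[OF True], of n] by (intro ennreal_leI) (simp add: mult_ac)
      then show ?thesis using True by (simp add: ennreal_mult)
    qed (simp add: not_less top_unique ennreal_mult_top)
  qed
  moreover obtain R where R: "0 \<le> R" "Lp_powr M p \<rho> = ennreal R"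
    using \<rho>_fin by (metis infinity_ennreal_def less_top_ennreal)
  moreover have "Lp_powr M p (\<lambda>x. ennreal a * \<rho> x) = ennreal (a powr p * R)" if "0 \<le> a" for a
    using Lp_powr_cmult[OF \<rho>, of "ennreal a"] ennpowr_ennreal[OF that] R by (simp add: ennreal_mult)
  ultimately have two: "energy (\<lambda>x. h x - f n x)
      \<le> ennreal (((1/2) ^ n * 2) powr p * R) + ennreal (((1/2) ^ n * 2) powr p * R)" for n
    unfolding energy_def by (intro add_mono) auto
  have bound: "energy (\<lambda>x. h x - f n x) \<le> ennreal (2 * ((1/2) ^ n * 2) powr p * R)" for n
  proof -
    have "energy (\<lambda>x. h x - f n x) \<le> ennreal (((1/2) ^ n * 2) powr p * R + ((1/2) ^ n * 2) powr p * R)"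
      using two[of n] R by (subst ennreal_plus) auto
    then show ?thesis by (simp only: mult_2 distrib_right)
  qed
  have d: "(\<lambda>x. h x - f n x) \<in> V" for n
    using bound[of n] by (auto simp: V_def intro: le_less_trans)
  have h: "h \<in> V" using V_add[OF d[of 0] f[of 0]] by simp
  have "(\<lambda>n. 2 * ((1/2) ^ n * 2) powr p * R) \<longlonglongrightarrow> 2 * (0 * 2) powr p * R"
    by (intro tendsto_intros LIMSEQ_power_zero tendsto_powr2) (use p in auto)
  then have "(\<lambda>n. ennreal (2 * ((1/2) ^ n * 2) powr p * R)) \<longlonglongrightarrow> ennreal (2 * (0 * 2) powr p * R)"
    by (rule tendsto_ennrealI)
  then have lim: "(\<lambda>n. ennreal (2 * ((1/2) ^ n * 2) powr p * R)) \<longlonglongrightarrow> 0" using p by simp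
  have "energy (\<lambda>x. f n x - h x) = energy (\<lambda>x. h x - f n x)" for n
    using energy_cmult[OF d[of n], of "-1"] p by (simp add: algebra_simps)
  then have "(\<lambda>n. energy (\<lambda>x. f n x - h x)) \<longlonglongrightarrow> 0"
    using bound by (intro tendsto_sandwich[OF _ _ tendsto_const lim]) auto
  then show ?thesis using that h by blast
qed

end

section \<open>Doubling and bounded overlap\<close>

lemma diameter_ball_le:
  fixes x :: "'a::metric_space"
  assumes "0 < r"
  shows "diameter (ball x r) \<le> 2 * r"
proof -
  have "dist y z \<le> 2 * r" if "y \<in> ball x r" "z \<in> ball x r" for y z
    using that dist_triangle[of y z x] by (simp add: dist_commute)
  then show ?thesis unfolding diameter_def using assms by (auto intro!: cSUP_least)
qed

text \<open>\<open>D\<close> is the doubling constant, \<open>P\<close> and \<open>\<Lambda>\<close>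
  are the constant and the dilation of the Poincare inequality. Fixing them makes it visible that
  all bounds are uniform in the scale \<open>k\<close>.\<close>

locale covered_space = sobolev M p
  for M :: "'a::metric_space measure" and p :: real +
  fixes m :: "int \<Rightarrow> enat" and ctr :: "int \<Rightarrow> nat \<Rightarrow> 'a" and D P \<Lambda> :: real
  assumes cov: "ball_coverings m ctr"
    and D: "1 \<le> D" "\<And>x r. 0 < r \<Longrightarrow> emeasure M (ball x (2 * r)) \<le> ennreal D * emeasure M (ball x r)"
    and P: "0 < P" and \<Lambda>: "1 \<le> \<Lambda>"
    and poincare: "\<And>x r u g. 0 < r \<Longrightarrow> u \<in> borel_measurable borel \<Longrightarrow> loc_integrable M u \<Longrightarrow>
      upper_gradient u g \<Longrightarrow>
      (\<integral>\<^sup>+ y \<in> ball x r. e2ennreal \<bar>u y - ereal (avg M u (ball x r))\<bar> \<partial>M) / emeasure M (ball x r)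
        \<le> ennreal (P * diameter (ball x r)) *
          ennpowr ((\<integral>\<^sup>+ y \<in> ball x (\<Lambda> * r). ennpowr (g y) p \<partial>M) / emeasure M (ball x (\<Lambda> * r))) (1 / p)"
begin

abbreviation \<mu> :: "'a \<Rightarrow> real \<Rightarrow> real" where "\<mu> x r \<equiv> measure M (ball x r)"
abbreviation I :: "int \<Rightarrow> nat set" where "I k \<equiv> cov_index m k"
abbreviation B :: "int \<Rightarrow> nat \<Rightarrow> 'a set" where "B k i \<equiv> cov_ball ctr k i"
abbreviation fi :: "int \<Rightarrow> 'a \<Rightarrow> nat" where "fi k x \<equiv> first_index m ctr k x"

definition rad :: "int \<Rightarrow> real" where "rad k = 2 powi (- k)"

lemma rad_pos [simp]: "0 < rad k" by (simp add: rad_def)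

lemma rad_nonneg [simp]: "0 \<le> rad k" "\<not> rad k \<le> 0"
  using rad_pos[of k] by (auto simp del: rad_pos)

lemma rad_mult: "2 powi k * rad k = 1"
  by (simp add: rad_def power_int_minus)

lemma B_eq: "B k i = ball (ctr k i) (rad k)"
  by (simp add: cov_ball_def rad_def)

lemma ball_sets [measurable, simp]: "ball x r \<in> sets M"
  by (rule sets_borel_M) simp

lemma emeasure_ball: "emeasure M (ball x r) = ennreal (\<mu> x r)"
proof (cases "0 < r")
  case True
  then have "emeasure M (ball x r) < top" using mms by (simp add: metric_measure_space_def)
  then show ?thesis by (intro emeasure_eq_ennreal_measure) (simp add: less_top)
next
  case False
  then have empty: "ball x r = {}" by simp
  show ?thesis unfolding empty by simp
qed

lemma \<mu>_pos: "0 < r \<Longrightarrow> 0 < \<mu> x r"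
  using mms emeasure_ball[of x r] unfolding metric_measure_space_def by (metis ennreal_less_zero_iff)

lemma \<mu>_mono:
  assumes "dist x y + r \<le> s"
  shows "\<mu> x r \<le> \<mu> y s"
proof -
  have "ball x r \<subseteq> ball y s"
  proof
    fix z assume "z \<in> ball x r"
    then show "z \<in> ball y s" using assms dist_triangle[of y z x] by (simp add: dist_commute)
  qed
  then have "emeasure M (ball x r) \<le> emeasure M (ball y s)" by (intro emeasure_mono) auto
  then show ?thesis by (simp add: emeasure_ball ennreal_le_iff)
qed

lemma \<mu>_doubling:
  assumes "0 < r"
  shows "\<mu> x (2 ^ n * r) \<le> D ^ n * \<mu> x r"
proof (induction n)
  case (Suc n)
  have "ennreal (\<mu> x (2 * (2 ^ n * r))) \<le> ennreal (D * \<mu> x (2 ^ n * r))"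
    using D(2)[of "2 ^ n * r" x] assms D(1) by (simp add: emeasure_ball ennreal_mult)
  then have "\<mu> x (2 * (2 ^ n * r)) \<le> D * \<mu> x (2 ^ n * r)" using D(1) by (simp add: ennreal_le_iff)
  also have "\<dots> \<le> D * (D ^ n * \<mu> x r)" using D(1) Suc by (intro mult_left_mono) auto
  finally show ?case by (simp add: mult_ac)
qed simp

text \<open>Volume comparison: the balls of one fifth of the radius are disjoint and lie in the ball
  of radius \<open>(R + 1) * rad k\<close> about \<open>x\<close>, while by doubling the measure of
  that ball is at most \<open>D ^ n\<close> times the measure of each of them.\<close>

lemma bounded_overlap:
  assumes R: "0 \<le> R"
  obtains N :: nat where
    "\<And>k x. finite {i \<in> I k. dist (ctr k i) x < R * rad k} \<and> card {i \<in> I k. dist (ctr k i) x < R * rad k} \<le> N"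
proof -
  \<comment> \<open>After \<open>n\<close> doublings the radius \<open>rad k / 5\<close> reaches
    \<open>(2 * R + 1) * rad k\<close>, which contains the ball about \<open>x\<close> from each of
    the centres.\<close>
  obtain n :: nat where n: "5 * (2 * R + 1) \<le> 2 ^ n"
    using real_arch_pow[of 2 "5 * (2 * R + 1)"] by (auto intro: less_imp_le)
  show ?thesis
  proof (rule that[of "nat \<lfloor>D ^ n\<rfloor>"], rule finite_if_finite_subsets_card_bdd)
    fix k x F assume F: "F \<subseteq> {i \<in> I k. dist (ctr k i) x < R * rad k}" "finite F"
    let ?s = "1/5 * rad k"
    let ?X = "\<mu> x ((R + 1) * rad k)"
    have d: "dist (ctr k i) x < R * rad k" if "i \<in> F" for i using that F by blast
    have lower: "?X \<le> D ^ n * \<mu> (ctr k i) ?s" if "i \<in> F" for i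
    proof -
      have "dist x (ctr k i) + (R + 1) * rad k \<le> (2 * R + 1) * rad k"
        using d[OF that] by (simp add: dist_commute algebra_simps)
      also have "\<dots> \<le> 2 ^ n * ?s" using mult_right_mono[OF n less_imp_le[OF rad_pos[of k]]] by (simp add: algebra_simps)
      finally have "?X \<le> \<mu> (ctr k i) (2 ^ n * ?s)" by (rule \<mu>_mono)
      also have "\<dots> \<le> D ^ n * \<mu> (ctr k i) ?s" by (rule \<mu>_doubling) simp
      finally show ?thesis .
    qed
    have dj: "disjoint_family_on (\<lambda>i. ball (ctr k i) ?s) F"
      using cov F unfolding ball_coverings_def rad_def by (blast intro: disjoint_family_on_mono)
    have "(\<Sum>i\<in>F. \<mu> (ctr k i) ?s) = measure M (\<Union>i\<in>F. ball (ctr k i) ?s)"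
    proof (rule measure_finite_Union[symmetric, OF F(2) _ dj])
      show "emeasure M (ball (ctr k i) ?s) \<noteq> \<infinity>" for i by (simp add: emeasure_ball)
    qed auto
    also have "\<dots> \<le> ?X"
    proof (rule measure_mono_fmeasurable)
      show "(\<Union>i\<in>F. ball (ctr k i) ?s) \<subseteq> ball x ((R + 1) * rad k)"
      proof
        fix z assume "z \<in> (\<Union>i\<in>F. ball (ctr k i) ?s)"
        then obtain i where i: "i \<in> F" "dist (ctr k i) z < ?s" by auto
        have "dist x z \<le> dist (ctr k i) x + dist (ctr k i) z"
          using dist_triangle[of x z "ctr k i"] by (simp add: dist_commute)
        also have "\<dots> < (R + 1) * rad k" using d[OF i(1)] i(2) rad_pos[of k] unfolding distrib_right by linarith
        finally show "z \<in> ball x ((R + 1) * rad k)" by simp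
      qed
    qed (use F in \<open>auto simp: fmeasurable_def emeasure_ball\<close>)
    finally have sum: "(\<Sum>i\<in>F. \<mu> (ctr k i) ?s) \<le> ?X" .
    have "real (card F) * ?X = (\<Sum>i\<in>F. ?X)" by simp
    also have "\<dots> \<le> (\<Sum>i\<in>F. D ^ n * \<mu> (ctr k i) ?s)" by (rule sum_mono) (rule lower)
    also have "\<dots> \<le> D ^ n * ?X" unfolding sum_distrib_left[symmetric] using sum D(1) by (intro mult_left_mono) auto
    finally have "real (card F) \<le> D ^ n" using \<mu>_pos[of "(R + 1) * rad k" x] R by simp
    then show "card F \<le> nat \<lfloor>D ^ n\<rfloor>" by linarith
  qed
qed

lemma fi: "fi k x \<in> I k" "x \<in> B k (fi k x)"
proof -
  have "x \<in> (\<Union>i\<in>I k. B k i)" using cov unfolding ball_coverings_def by simp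
  then obtain i where "i \<in> I k \<and> x \<in> B k i" by blast
  then have "fi k x \<in> I k \<and> x \<in> B k (fi k x)" unfolding first_index_def by (rule LeastI)
  then show "fi k x \<in> I k" "x \<in> B k (fi k x)" by auto
qed

lemma fi_measurable [measurable]: "fi k \<in> borel \<rightarrow>\<^sub>M count_space UNIV"
proof -
  have "Measurable.pred borel (\<lambda>x. i \<in> I k \<and> x \<in> B k i)" for i
    using borel_open[OF open_ball, of "ctr k i" "rad k"] by (cases "i \<in> I k") (simp_all add: pred_def B_eq ball_def)
  then show ?thesis unfolding first_index_def by (rule measurable_Least)
qed

lemma fi_compose_measurable: "(\<lambda>x. h (fi k x)) \<in> borel_measurable borel"
  by (rule measurable_compose[OF fi_measurable]) simp

lemma neighbor_dist:
  assumes "j \<in> neighbors m ctr k i"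
  shows "dist (ctr k j) (ctr k i) < 3 * rad k"
proof -
  have "setdist (B k j) (B k i) < rad k" using assms by (simp add: neighbors_def rad_def)
  moreover have "B k j \<noteq> {}" "B k i \<noteq> {}" by (auto simp: B_eq)
  ultimately obtain y z where yz: "y \<in> B k j" "z \<in> B k i" "dist y z < rad k" by (metis setdist_ltE)
  have "dist (ctr k j) (ctr k i) \<le> dist (ctr k j) y + (dist y z + dist z (ctr k i))"
    using dist_triangle[of "ctr k j" "ctr k i" y] dist_triangle[of y "ctr k i" z] by linarith
  then show ?thesis using yz by (simp add: B_eq dist_commute)
qed

lemma fi_neighbor:
  assumes "dist x y < rad k"
  shows "fi k y \<in> neighbors m ctr k (fi k x)"
  using setdist_le_dist[OF fi(2)[of y k] fi(2)[of x k]] assms fi(1)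
  by (simp add: neighbors_def rad_def dist_commute)

section \<open>Consequences of the Poincare inequality\<close>

abbreviation mean :: "('a \<Rightarrow> real) \<Rightarrow> 'a set \<Rightarrow> real" where
  "mean f A \<equiv> avg M (\<lambda>x. ereal (f x)) A"

lemma mean_def: "mean f A = (LINT y:A|M. f y) / measure M A"
  by (simp add: avg_def)

lemma nn_integral_ball_finite:
  assumes f: "f \<in> V"
  shows "(\<integral>\<^sup>+ y \<in> ball x r. ennreal \<bar>f y\<bar> \<partial>M) < \<infinity>"
proof -
  have [measurable]: "f \<in> borel_measurable M" using V_measurable[OF f] by (rule borel_imp_M)
  have pow: "a \<le> 1 + a powr p" if "0 \<le> a" for a
  proof (cases "a \<le> 1")
    case False
    then show ?thesis using powr_mono[of 1 p a] p by simp
  qed (use that in \<open>simp add: add_increasing2\<close>)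
  have "(\<integral>\<^sup>+ y \<in> ball x r. ennreal \<bar>f y\<bar> \<partial>M)
      \<le> (\<integral>\<^sup>+ y. indicator (ball x r) y + ennreal (\<bar>f y\<bar> powr p) \<partial>M)"
  proof (rule nn_integral_mono)
    fix y
    have "ennreal \<bar>f y\<bar> \<le> 1 + ennreal (\<bar>f y\<bar> powr p)"
      using ennreal_leI[OF pow[of "\<bar>f y\<bar>"]] by (simp add: ennreal_plus)
    then show "ennreal \<bar>f y\<bar> * indicator (ball x r) y \<le> indicator (ball x r) y + ennreal (\<bar>f y\<bar> powr p)"
      by (simp add: indicator_def)
  qed
  also have "\<dots> = emeasure M (ball x r) + (\<integral>\<^sup>+ y. ennreal (\<bar>f y\<bar> powr p) \<partial>M)"
    by (subst nn_integral_add) auto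
  also have "\<dots> < \<infinity>"
    using V_Lp_finite[OF f] by (simp add: emeasure_ball Lp_powr_def ennpowr_ennreal)
  finally show ?thesis .
qed

lemma loc_integrable_V:
  assumes f: "f \<in> V"
  shows "loc_integrable M (\<lambda>x. ereal (f x))"
  using nn_integral_ball_finite[OF f] borel_imp_M[OF V_measurable[OF f]]
  by (simp add: loc_integrable_def e2ennreal_ereal)

lemma set_integrable_V:
  assumes f: "f \<in> V"
  shows "set_integrable M (ball x r) f"
  unfolding set_integrable_def
proof (rule integrableI_bounded)
  have [measurable]: "f \<in> borel_measurable M" using V_measurable[OF f] by (rule borel_imp_M)
  show "(\<lambda>y. indicat_real (ball x r) y *\<^sub>R f y) \<in> borel_measurable M" by measurable
  have "(\<integral>\<^sup>+ y. ennreal (norm (indicat_real (ball x r) y *\<^sub>R f y)) \<partial>M) = (\<integral>\<^sup>+ y \<in> ball x r. ennreal \<bar>f y\<bar> \<partial>M)"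
    by (intro nn_integral_cong) (auto simp: indicator_def)
  then show "(\<integral>\<^sup>+ y. ennreal (norm (indicat_real (ball x r) y *\<^sub>R f y)) \<partial>M) < \<infinity>"
    using nn_integral_ball_finite[OF f] by simp
qed

lemma mean_cmult: "mean (\<lambda>x. a * f x) A = a * mean f A"
  by (simp add: mean_def)

lemma mean_add:
  assumes "f \<in> V" "g \<in> V"
  shows "mean (\<lambda>x. f x + g x) (ball x r) = mean f (ball x r) + mean g (ball x r)"
  using set_integrable_V[OF assms(1)] set_integrable_V[OF assms(2)]
  by (simp add: mean_def add_divide_distrib)

definition ball_avg :: "('a \<Rightarrow> ennreal) \<Rightarrow> 'a \<Rightarrow> real \<Rightarrow> ennreal" where
  "ball_avg h x r = (\<integral>\<^sup>+ y \<in> ball x r. h y \<partial>M) / emeasure M (ball x r)"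

text \<open>Left undivided by the measure: it dominates the same integral over a smaller ball, as
  \<open>mean_diff_le_osc\<close> requires, and can be summed over a covering.\<close>

definition osc :: "('a \<Rightarrow> real) \<Rightarrow> 'a \<Rightarrow> real \<Rightarrow> ennreal" where
  "osc f x r = (\<integral>\<^sup>+ y \<in> ball x r. ennreal \<bar>f y - mean f (ball x r)\<bar> \<partial>M)"

lemma ennreal_mult_divide_cancel: "0 < a \<Longrightarrow> ennreal a * (x / ennreal a) = x"
  by (simp add: ennreal_times_divide mult.commute[of "ennreal a"] mult_divide_eq_ennreal)

lemma ball_avg_mult: "0 < r \<Longrightarrow> emeasure M (ball x r) * ball_avg h x r = (\<integral>\<^sup>+ y \<in> ball x r. h y \<partial>M)"
  unfolding ball_avg_def emeasure_ball by (rule ennreal_mult_divide_cancel) (rule \<mu>_pos)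

lemma osc_le:
  assumes f: "f \<in> V" and g: "upper_gradient (\<lambda>x. ereal (f x)) g" and r: "0 < r"
  shows "osc f x r \<le> emeasure M (ball x r) *
    (ennreal (2 * P * r) * ennpowr (ball_avg (\<lambda>y. ennpowr (g y) p) x (\<Lambda> * r)) (1 / p))"
proof -
  have "osc f x r / emeasure M (ball x r)
      \<le> ennreal (P * diameter (ball x r)) * ennpowr (ball_avg (\<lambda>y. ennpowr (g y) p) x (\<Lambda> * r)) (1 / p)"
    using poincare[OF r _ loc_integrable_V[OF f] g, of x] V_measurable[OF f]
    by (simp add: osc_def ball_avg_def e2ennreal_ereal)
  also have "\<dots> \<le> ennreal (2 * P * r) * ennpowr (ball_avg (\<lambda>y. ennpowr (g y) p) x (\<Lambda> * r)) (1 / p)"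
    using P diameter_ball_le[OF r, of x] by (intro mult_right_mono ennreal_leI) (auto simp: field_simps)
  finally have "emeasure M (ball x r) * (osc f x r / emeasure M (ball x r)) \<le> emeasure M (ball x r) *
    (ennreal (2 * P * r) * ennpowr (ball_avg (\<lambda>y. ennpowr (g y) p) x (\<Lambda> * r)) (1 / p))"
    by (rule mult_left_mono) simp
  then show ?thesis
    unfolding emeasure_ball using ennreal_mult_divide_cancel[OF \<mu>_pos[OF r], of x] by simp
qed

lemma mean_diff_le_osc:
  assumes f: "f \<in> V" and s: "0 < s" and sub: "ball y s \<subseteq> ball x r"
  shows "emeasure M (ball y s) * ennreal \<bar>mean f (ball y s) - mean f (ball x r)\<bar> \<le> osc f x r"
proof -
  let ?m = "mean f (ball x r)"
  have [measurable]: "f \<in> borel_measurable M" using V_measurable[OF f] by (rule borel_imp_M)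
  have int: "set_integrable M (ball y s) (\<lambda>z. ?m)"
    unfolding set_integrable_def by (simp add: emeasure_ball)
  note intf = set_integrable_V[OF f, of y s]
  have "(LINT z:ball y s|M. f z - ?m) = (LINT z:ball y s|M. f z) - (LINT z:ball y s|M. ?m)"
    by (rule set_integral_diff(2)[OF intf int])
  also have "(LINT z:ball y s|M. ?m) = \<mu> y s * ?m"
    using set_integral_const[of "ball y s" M ?m] by (simp add: emeasure_ball)
  also have "(LINT z:ball y s|M. f z) = \<mu> y s * mean f (ball y s)"
    using \<mu>_pos[OF s, of y] by (simp add: mean_def)
  finally have eq: "(LINT z:ball y s|M. f z - ?m) = \<mu> y s * (mean f (ball y s) - ?m)"
    by (simp add: algebra_simps)
  have "emeasure M (ball y s) * ennreal \<bar>mean f (ball y s) - ?m\<bar> = ennreal (norm (LINT z:ball y s|M. f z - ?m))"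
    unfolding eq emeasure_ball by (simp add: abs_mult ennreal_mult)
  also have "\<dots> \<le> (\<integral>\<^sup>+z. ennreal (norm (indicat_real (ball y s) z *\<^sub>R (f z - ?m))) \<partial>M)"
    unfolding set_lebesgue_integral_def
    using set_integral_diff(1)[OF intf int] by (intro integral_norm_bound_ennreal) (simp add: set_integrable_def)
  also have "\<dots> \<le> osc f x r"
    unfolding osc_def using sub by (intro nn_integral_mono) (auto simp: indicator_def)
  finally show ?thesis .
qed

text \<open>The oscillation on the large ball is divided by the measure of the small one, which
  costs the factor \<open>K\<close>.\<close>

lemma mean_diff_le:
  assumes f: "f \<in> V" and g: "upper_gradient (\<lambda>x. ereal (f x)) g" and r: "0 < r" "0 < s"
    and sub: "ball y s \<subseteq> ball x r" and K: "\<mu> x r \<le> K * \<mu> y s"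
  shows "ennreal \<bar>mean f (ball y s) - mean f (ball x r)\<bar>
    \<le> ennreal (K * (2 * P * r)) * ennpowr (ball_avg (\<lambda>y. ennpowr (g y) p) x (\<Lambda> * r)) (1 / p)"
proof -
  let ?X = "ennpowr (ball_avg (\<lambda>y. ennpowr (g y) p) x (\<Lambda> * r)) (1 / p)"
  have "0 < K * \<mu> y s" using K \<mu>_pos[OF r(1), of x] by linarith
  then have K0: "0 < K" using \<mu>_pos[OF r(2), of y] by (simp add: zero_less_mult_iff)
  have "ennreal (\<mu> y s) * ennreal \<bar>mean f (ball y s) - mean f (ball x r)\<bar> \<le> ennreal (\<mu> x r) * (ennreal (2 * P * r) * ?X)"
    using mean_diff_le_osc[OF f r(2) sub] osc_le[OF f g r(1), of x] by (simp add: emeasure_ball)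
  also have "\<dots> \<le> ennreal (K * \<mu> y s) * (ennreal (2 * P * r) * ?X)"
    using K by (intro mult_right_mono ennreal_leI) auto
  also have "\<dots> = ennreal (\<mu> y s) * (ennreal (K * (2 * P * r)) * ?X)"
    using K0 P r by (simp add: ennreal_mult mult_ac)
  finally show ?thesis using \<mu>_pos[OF r(2), of y] by (simp add: ennreal_mult_le_mult_iff)
qed

text \<open>Interchanging sum and integral leaves the number of dilated balls containing
  \<open>y\<close>, at most \<open>N\<close>. The index set enters as a factor 0 or 1, so that
  finite and infinite coverings are both series over the naturals.\<close>

lemma overlap_integral:
  fixes h :: "'a \<Rightarrow> ennreal" and N :: nat
  assumes [measurable]: "h \<in> borel_measurable M"
    and N: "\<And>x. finite {i \<in> I k. dist (ctr k i) x < R * rad k} \<and> card {i \<in> I k. dist (ctr k i) x < R * rad k} \<le> N"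
  shows "(\<Sum>i. (if i \<in> I k then 1 else 0) * (\<integral>\<^sup>+ y \<in> ball (ctr k i) (R * rad k). h y \<partial>M)) \<le> of_nat N * (\<integral>\<^sup>+ y. h y \<partial>M)"
proof -
  have "(\<Sum>i. (if i \<in> I k then 1 else 0) * (\<integral>\<^sup>+ y \<in> ball (ctr k i) (R * rad k). h y \<partial>M))
      = (\<integral>\<^sup>+ y. (\<Sum>i. (if i \<in> I k then 1 else 0) * (h y * indicator (ball (ctr k i) (R * rad k)) y)) \<partial>M)"
    by (subst nn_integral_suminf) (auto intro!: suminf_cong simp: nn_integral_cmult)
  also have "\<dots> \<le> (\<integral>\<^sup>+ y. of_nat N * h y \<partial>M)"
  proof (rule nn_integral_mono)
    fix y
    let ?J = "{i \<in> I k. dist (ctr k i) y < R * rad k}"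
    have "(\<Sum>i. (if i \<in> I k then 1 else 0) * (h y * indicator (ball (ctr k i) (R * rad k)) y)) = (\<Sum>i\<in>?J. h y)"
      using N[of y] by (subst suminf_finite[of ?J]) (auto simp: indicator_def)
    also have "\<dots> = of_nat (card ?J) * h y" by simp
    also have "\<dots> \<le> of_nat N * h y" using N[of y] by (intro mult_right_mono) auto
    finally show "(\<Sum>i. (if i \<in> I k then 1 else 0) * (h y * indicator (ball (ctr k i) (R * rad k)) y)) \<le> of_nat N * h y" .
  qed
  also have "\<dots> = of_nat N * (\<integral>\<^sup>+ y. h y \<partial>M)" by (simp add: nn_integral_cmult)
  finally show ?thesis .
qed

text \<open>Counting \<open>x\<close> in every ball that contains it, and not only in the first one,
  can only increase the integral, and the balls overlap boundedly anyway.\<close>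

lemma nn_integral_fi_le:
  fixes h :: "nat \<Rightarrow> 'a \<Rightarrow> ennreal"
  assumes [measurable]: "\<And>i. h i \<in> borel_measurable M"
  shows "(\<integral>\<^sup>+ x. h (fi k x) x \<partial>M) \<le> (\<Sum>i. (if i \<in> I k then 1 else 0) * (\<integral>\<^sup>+ x \<in> B k i. h i x \<partial>M))"
proof -
  have [measurable]: "B k i \<in> sets M" for i by (simp add: B_eq)
  have "(\<integral>\<^sup>+ x. h (fi k x) x \<partial>M) \<le> (\<integral>\<^sup>+ x. (\<Sum>i. (if i \<in> I k then 1 else 0) * (h i x * indicator (B k i) x)) \<partial>M)"
  proof (rule nn_integral_mono)
    fix x
    show "h (fi k x) x \<le> (\<Sum>i. (if i \<in> I k then 1 else 0) * (h i x * indicator (B k i) x))"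
      using sum_le_suminf[of "\<lambda>i. (if i \<in> I k then 1 else 0) * (h i x * indicator (B k i) x)" "{fi k x}"] fi(1)[of k x] fi(2)[of x k]
      by simp
  qed
  also have "\<dots> = (\<Sum>i. (if i \<in> I k then 1 else 0) * (\<integral>\<^sup>+ x \<in> B k i. h i x \<partial>M))"
    by (subst nn_integral_suminf) (auto intro!: suminf_cong simp: nn_integral_cmult)
  finally show ?thesis .
qed

text \<open>Averaging over the dilated balls is bounded on \<open>L\<^sup>1\<close> uniformly in the
  scale: the average, integrated over the covering ball, gives at most the integral of
  \<open>h\<close> over the dilated ball.\<close>

lemma nn_integral_ball_avg_le:
  fixes N :: nat
  assumes h [measurable]: "h \<in> borel_measurable M" and R: "1 \<le> R"
    and N: "\<And>x. finite {i \<in> I k. dist (ctr k i) x < R * rad k} \<and> card {i \<in> I k. dist (ctr k i) x < R * rad k} \<le> N"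
  shows "(\<integral>\<^sup>+ x. ball_avg h (ctr k (fi k x)) (R * rad k) \<partial>M) \<le> of_nat N * (\<integral>\<^sup>+ x. h x \<partial>M)"
proof -
  have "(\<integral>\<^sup>+ x. ball_avg h (ctr k (fi k x)) (R * rad k) \<partial>M)
      \<le> (\<Sum>i. (if i \<in> I k then 1 else 0) * (\<integral>\<^sup>+ x \<in> B k i. ball_avg h (ctr k i) (R * rad k) \<partial>M))"
    by (rule nn_integral_fi_le[where h = "\<lambda>i x. ball_avg h (ctr k i) (R * rad k)"]) simp
  also have "\<dots> \<le> (\<Sum>i. (if i \<in> I k then 1 else 0) * (\<integral>\<^sup>+ y \<in> ball (ctr k i) (R * rad k). h y \<partial>M))"
  proof (intro suminf_le mult_left_mono summableI)
    fix i
    have "(\<integral>\<^sup>+ x \<in> B k i. ball_avg h (ctr k i) (R * rad k) \<partial>M)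
        = emeasure M (B k i) * ball_avg h (ctr k i) (R * rad k)"
      by (subst nn_integral_cmult_indicator) (auto simp: B_eq mult.commute)
    also have "\<dots> \<le> emeasure M (ball (ctr k i) (R * rad k)) * ball_avg h (ctr k i) (R * rad k)"
      unfolding B_eq using R by (intro mult_right_mono emeasure_mono subset_ball) auto
    also have "\<dots> = (\<integral>\<^sup>+ y \<in> ball (ctr k i) (R * rad k). h y \<partial>M)"
      using R by (intro ball_avg_mult) auto
    finally show "(\<integral>\<^sup>+ x \<in> B k i. ball_avg h (ctr k i) (R * rad k) \<partial>M)
        \<le> (\<integral>\<^sup>+ y \<in> ball (ctr k i) (R * rad k). h y \<partial>M)" .
  qed simp
  also have "\<dots> \<le> of_nat N * (\<integral>\<^sup>+ x. h x \<partial>M)" by (rule overlap_integral[OF h N])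
  finally show ?thesis .
qed

section \<open>The operators at a fixed scale and their upper bound\<close>

abbreviation T :: "int \<Rightarrow> ('a \<Rightarrow> real) \<Rightarrow> 'a \<Rightarrow> real" where
  "T k f x \<equiv> T_abs M m ctr p k (\<lambda>x. ereal (f x)) x"

lemma T_nonneg: "0 \<le> T k f x"
  by (simp add: T_abs_def Let_def)

lemma T_measurable [measurable]: "T k f \<in> borel_measurable borel"
  unfolding T_abs_def Let_def by (rule fi_compose_measurable)

lemma T_powr: "T k f x powr p = (\<Sum>j\<in>neighbors m ctr k (fi k x).
    \<bar>2 powi k * (mean f (B k (fi k x)) - mean f (B k j))\<bar> powr p)"
proof -
  have "T k f x powr p = (2 powi k) powr p *
      (\<Sum>j\<in>neighbors m ctr k (fi k x). \<bar>mean f (B k (fi k x)) - mean f (B k j)\<bar> powr p)"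
    using p by (simp add: T_abs_def Let_def powr_mult powr_powr sum_nonneg)
  then show ?thesis by (simp add: sum_distrib_left powr_mult abs_mult)
qed

lemma finite_neighbors: "finite (neighbors m ctr k i)"
proof -
  obtain N where "\<And>k x. finite {i \<in> I k. dist (ctr k i) x < 3 * rad k} \<and> card {i \<in> I k. dist (ctr k i) x < 3 * rad k} \<le> N"
    using bounded_overlap[of 3] by auto
  then have "finite {j \<in> I k. dist (ctr k j) (ctr k i) < 3 * rad k}" by blast
  then show ?thesis by (rule rev_finite_subset) (use neighbor_dist in \<open>auto simp: neighbors_def\<close>)
qed

text \<open>A covering ball and its neighbours lie in the concentric ball of four times the radius,
  so the Poincare inequality there compares all their averages with one number. The radius it
  produces cancels the factor \<open>2 powi k\<close>.\<close>

lemma T_pointwise_bound: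
  obtains C :: real where "0 < C" "\<And>f g k x. f \<in> V \<Longrightarrow> upper_gradient (\<lambda>x. ereal (f x)) g \<Longrightarrow>
    ennreal (T k f x powr p) \<le> ennreal C * ball_avg (\<lambda>y. ennpowr (g y) p) (ctr k (fi k x)) (4 * \<Lambda> * rad k)"
proof -
  obtain N where N: "\<And>k x. finite {i \<in> I k. dist (ctr k i) x < 3 * rad k} \<and> card {i \<in> I k. dist (ctr k i) x < 3 * rad k} \<le> N"
    using bounded_overlap[of 3] by auto
  \<comment> \<open>Three doublings: the ball of radius \<open>4 * rad k\<close> about the centre
    lies in the ball of radius \<open>8 * rad k\<close> about a neighbour's centre, as
    \<open>3 + 4 \<le> 8\<close>.\<close>
  define K where "K = D ^ 3"
  have K1: "1 \<le> K" using D(1) by (simp add: K_def)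
  \<comment> \<open>The 16 comes from two comparisons, each with the constant
    \<open>K * (2 * P * 4)\<close>. The count \<open>N + 1\<close> keeps \<open>C\<close>
    positive.\<close>
  define C where "C = real (N + 1) * (16 * K * P) powr p"
  have C: "0 < C" using K1 P by (simp add: C_def)
  show ?thesis
  proof (rule that[OF C])
    fix f g and k :: int and x assume f: "f \<in> V" and g: "upper_gradient (\<lambda>x. ereal (f x)) g"
    let ?i = "fi k x"
    let ?J = "neighbors m ctr k ?i"
    let ?A = "ball_avg (\<lambda>y. ennpowr (g y) p) (ctr k ?i) (4 * \<Lambda> * rad k)"
    let ?m = "mean f (ball (ctr k ?i) (4 * rad k))"
    let ?X = "ennreal (8 * K * P * rad k) * ennpowr ?A (1 / p)"
    have near: "ennreal \<bar>mean f (B k j) - ?m\<bar> \<le> ?X" if j: "dist (ctr k j) (ctr k ?i) < 3 * rad k" for j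
    proof -
      have sub: "ball (ctr k j) (rad k) \<subseteq> ball (ctr k ?i) (4 * rad k)"
      proof
        fix z assume "z \<in> ball (ctr k j) (rad k)"
        then show "z \<in> ball (ctr k ?i) (4 * rad k)"
          using j dist_triangle[of "ctr k ?i" z "ctr k j"] by (simp add: dist_commute)
      qed
      have "\<mu> (ctr k ?i) (4 * rad k) \<le> \<mu> (ctr k j) (2 ^ 3 * rad k)"
      proof (rule \<mu>_mono)
        have "2 ^ 3 * rad k = 8 * rad k" by simp
        then show "dist (ctr k ?i) (ctr k j) + 4 * rad k \<le> 2 ^ 3 * rad k"
          using j rad_pos[of k] dist_commute[of "ctr k ?i" "ctr k j"] by linarith
      qed
      also have "\<dots> \<le> K * \<mu> (ctr k j) (rad k)" unfolding K_def by (intro \<mu>_doubling) simp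
      finally have "ennreal \<bar>mean f (ball (ctr k j) (rad k)) - ?m\<bar>
          \<le> ennreal (K * (2 * P * (4 * rad k))) * ennpowr (ball_avg (\<lambda>y. ennpowr (g y) p) (ctr k ?i) (\<Lambda> * (4 * rad k))) (1 / p)"
        by (intro mean_diff_le[OF f g _ _ sub]) auto
      then show ?thesis by (simp add: B_eq mult_ac)
    qed
    have one: "ennreal (\<bar>2 powi k * (mean f (B k ?i) - mean f (B k j))\<bar> powr p) \<le> ennreal ((16 * K * P) powr p) * ?A"
      if j: "j \<in> ?J" for j
    proof -
      have "ennreal \<bar>mean f (B k ?i) - mean f (B k j)\<bar> \<le> ennreal \<bar>mean f (B k ?i) - ?m\<bar> + ennreal \<bar>mean f (B k j) - ?m\<bar>"
        by (simp add: ennreal_leI flip: ennreal_plus)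
      also have "\<dots> \<le> ?X + ?X" using near[of ?i] near[OF neighbor_dist[OF j]] by (intro add_mono) auto
      also have "\<dots> = ennreal (8 * K * P * rad k + 8 * K * P * rad k) * ennpowr ?A (1 / p)"
        using K1 P rad_pos[of k] by (subst ennreal_plus) (auto simp: distrib_right)
      finally have "ennreal (2 powi k) * ennreal \<bar>mean f (B k ?i) - mean f (B k j)\<bar>
          \<le> ennreal (2 powi k) * (ennreal (16 * K * P * rad k) * ennpowr ?A (1 / p))"
        by (intro mult_left_mono) (auto simp: algebra_simps)
      also have "\<dots> = ennreal (2 powi k * (16 * K * P * rad k)) * ennpowr ?A (1 / p)"
        using K1 P rad_pos[of k] by (subst ennreal_mult) (auto simp: mult_ac)
      also have "2 powi k * (16 * K * P * rad k) = 16 * K * P"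
        using rad_mult[of k] by (simp add: mult_ac)
      finally have "ennreal \<bar>2 powi k * (mean f (B k ?i) - mean f (B k j))\<bar> \<le> ennreal (16 * K * P) * ennpowr ?A (1 / p)"
        by (simp add: abs_mult ennreal_mult)
      then have "ennpowr (ennreal \<bar>2 powi k * (mean f (B k ?i) - mean f (B k j))\<bar>) p
          \<le> ennpowr (ennreal (16 * K * P) * ennpowr ?A (1 / p)) p"
        using p by (intro ennpowr_mono) auto
      then show ?thesis using p K1 P by (simp add: ennpowr_ennreal ennpowr_mult)
    qed
    have card: "card ?J \<le> N"
    proof -
      have "?J \<subseteq> {j \<in> I k. dist (ctr k j) (ctr k ?i) < 3 * rad k}"
        using neighbor_dist by (auto simp: neighbors_def)
      then show ?thesis using N[of k "ctr k ?i"] card_mono le_trans by blast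
    qed
    have "ennreal (T k f x powr p) = (\<Sum>j\<in>?J. ennreal (\<bar>2 powi k * (mean f (B k ?i) - mean f (B k j))\<bar> powr p))"
      unfolding T_powr by simp
    also have "\<dots> \<le> (\<Sum>j\<in>?J. ennreal ((16 * K * P) powr p) * ?A)" by (rule sum_mono) (rule one)
    also have "\<dots> = of_nat (card ?J) * (ennreal ((16 * K * P) powr p) * ?A)" by simp
    also have "\<dots> \<le> ennreal (real (N + 1)) * (ennreal ((16 * K * P) powr p) * ?A)"
    proof (intro mult_right_mono)
      have "(of_nat (card ?J) :: ennreal) = ennreal (real (card ?J))"
        by (rule ennreal_of_nat_eq_real_of_nat)
      also have "\<dots> \<le> ennreal (real (N + 1))" using card by (intro ennreal_leI) auto
      finally show "of_nat (card ?J) \<le> ennreal (real (N + 1))" .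
    qed simp
    also have "\<dots> = ennreal C * ?A" unfolding C_def by (simp add: ennreal_mult mult.assoc)
    finally show "ennreal (T k f x powr p) \<le> ennreal C * ?A" .
  qed
qed

definition T_energy :: "int \<Rightarrow> ('a \<Rightarrow> real) \<Rightarrow> ennreal" where
  "T_energy k f = Lp_powr M p (\<lambda>x. ennreal (T k f x))"

lemma T_energy_eq: "T_energy k f = (\<integral>\<^sup>+ x. ennreal (T k f x powr p) \<partial>M)"
  by (simp add: T_energy_def Lp_powr_def ennpowr_ennreal T_nonneg)

text \<open>The pointwise bound is integrated using the bounded overlap. Its constant is the same
  for all upper gradients, so the infimum may be taken, with the constant moved to the left for this
  purpose.\<close>

lemma T_energy_upper:
  obtains C :: real where "0 < C" "\<And>f k. f \<in> V \<Longrightarrow> T_energy k f \<le> ennreal C * grad_energy f"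
proof -
  obtain C where C: "0 < C" "\<And>f g k x. f \<in> V \<Longrightarrow> upper_gradient (\<lambda>x. ereal (f x)) g \<Longrightarrow>
    ennreal (T k f x powr p) \<le> ennreal C * ball_avg (\<lambda>y. ennpowr (g y) p) (ctr k (fi k x)) (4 * \<Lambda> * rad k)"
    using T_pointwise_bound by blast
  obtain N where N: "\<And>k x. finite {i \<in> I k. dist (ctr k i) x < (4 * \<Lambda>) * rad k} \<and>
      card {i \<in> I k. dist (ctr k i) x < (4 * \<Lambda>) * rad k} \<le> N"
    using bounded_overlap[of "4 * \<Lambda>"] \<Lambda> by auto
  have "T_energy k f \<le> ennreal (C * real (N + 1)) * Lp_powr M p g"
    if f: "f \<in> V" and g: "upper_gradient (\<lambda>x. ereal (f x)) g" for f g k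
  proof -
    have gm: "(\<lambda>y. ennpowr (g y) p) \<in> borel_measurable M"
      using g by (intro borel_Lp_measurable) (simp add: upper_gradient_def)
    have "T_energy k f \<le> (\<integral>\<^sup>+ x. ennreal C * ball_avg (\<lambda>y. ennpowr (g y) p) (ctr k (fi k x)) (4 * \<Lambda> * rad k) \<partial>M)"
      unfolding T_energy_eq by (intro nn_integral_mono C(2) f g)
    also have "\<dots> = ennreal C * (\<integral>\<^sup>+ x. ball_avg (\<lambda>y. ennpowr (g y) p) (ctr k (fi k x)) (4 * \<Lambda> * rad k) \<partial>M)"
      by (intro nn_integral_cmult borel_imp_M fi_compose_measurable)
    also have "\<dots> \<le> ennreal C * (of_nat N * Lp_powr M p g)"
      unfolding Lp_powr_def using \<Lambda> by (intro mult_left_mono nn_integral_ball_avg_le gm N) auto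
    also have "\<dots> \<le> ennreal C * (ennreal (real (N + 1)) * Lp_powr M p g)"
    proof (intro mult_left_mono mult_right_mono)
      have "(of_nat N :: ennreal) = ennreal (real N)" by (rule ennreal_of_nat_eq_real_of_nat)
      also have "\<dots> \<le> ennreal (real (N + 1))" by (intro ennreal_leI) auto
      finally show "of_nat N \<le> ennreal (real (N + 1))" .
    qed auto
    also have "\<dots> = ennreal (C * real (N + 1)) * Lp_powr M p g"
      using C(1) by (simp add: ennreal_mult mult.assoc)
    finally show ?thesis .
  qed
  note bound = this
  define K where "K = C * real (N + 1)"
  have K: "0 < K" using C(1) by (simp add: K_def)
  have cancel: "ennreal (inverse K) * (ennreal K * z) = z" "ennreal K * (ennreal (inverse K) * z) = z" for z
    using K by (simp_all add: mult.assoc[symmetric] flip: ennreal_mult)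
  have "T_energy k f \<le> ennreal K * grad_energy f" if f: "f \<in> V" for f k
  proof -
    have "ennreal (inverse K) * T_energy k f \<le> grad_energy f"
      unfolding grad_energy_def
    proof (rule INF_greatest)
      fix g assume "g \<in> {g. upper_gradient (\<lambda>x. ereal (f x)) g}"
      then have "ennreal (inverse K) * T_energy k f \<le> ennreal (inverse K) * (ennreal K * Lp_powr M p g)"
        unfolding K_def using f by (intro mult_left_mono bound) auto
      then show "ennreal (inverse K) * T_energy k f \<le> Lp_powr M p g" unfolding cancel .
    qed
    then have "ennreal K * (ennreal (inverse K) * T_energy k f) \<le> ennreal K * grad_energy f"
      by (intro mult_left_mono) auto
    then show ?thesis unfolding cancel .
  qed
  then show ?thesis using that[OF K] by blast
qed

section \<open>Step functions of averages\<close>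

definition step :: "int \<Rightarrow> ('a \<Rightarrow> real) \<Rightarrow> 'a \<Rightarrow> real" where
  "step k f x = mean f (B k (fi k x))"

lemma step_measurable [measurable]: "step k f \<in> borel_measurable borel"
  unfolding step_def by (rule fi_compose_measurable)

text \<open>The ball chosen at \<open>y\<close> is a neighbour of the one chosen at
  \<open>x\<close>, so the jump is one of the terms of \<open>T k f x\<close>. The base point
  \<open>x\<close> may be any nearby point, which later permits averaging along an arc.\<close>

lemma step_jump:
  assumes "dist x y < rad k"
  shows "\<bar>step k f x - step k f y\<bar> \<le> rad k * T k f x"
proof -
  have le: "\<bar>2 powi k * (step k f x - step k f y)\<bar> powr p \<le> T k f x powr p"
    unfolding T_powr step_def
    using fi_neighbor[OF assms] finite_neighbors
    by (intro member_le_sum[where f = "\<lambda>j. \<bar>2 powi k * (mean f (B k (fi k x)) - mean f (B k j))\<bar> powr p"]) auto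
  have "\<bar>2 powi k * (step k f x - step k f y)\<bar> \<le> T k f x"
  proof (rule ccontr)
    assume "\<not> ?thesis"
    then have "T k f x powr p < \<bar>2 powi k * (step k f x - step k f y)\<bar> powr p"
      using p T_nonneg by (intro powr_less_mono2) auto
    then show False using le by simp
  qed
  then have "rad k * (2 powi k * \<bar>step k f x - step k f y\<bar>) \<le> rad k * T k f x"
    by (intro mult_left_mono) (auto simp: abs_mult)
  then show ?thesis using rad_mult[of k] by (simp add: mult.assoc[symmetric] mult.commute[of "rad k"])
qed

text \<open>The Poincare inequality bounds the integral of the difference over a fixed ball by a
  multiple of 2^-n. The bounds are summable, so the series of differences converges almost
  everywhere and its terms tend to 0.\<close>

lemma step_converges:
  assumes f: "f \<in> V"
  shows "AE x in M. (\<lambda>n. step (int n) f x) \<longlonglongrightarrow> f x"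
proof -
  have [measurable]: "f \<in> borel_measurable M" using V_measurable[OF f] by (rule borel_imp_M)
  obtain g where g: "upper_gradient (\<lambda>x. ereal (f x)) g" "Lp_powr M p g < \<infinity>"
    using grad_energy_lessD[OF V_grad_finite[OF f]] by auto
  have gm [measurable]: "(\<lambda>y. ennpowr (g y) p) \<in> borel_measurable M"
    using g by (intro borel_Lp_measurable) (simp add: upper_gradient_def)
  obtain N where N: "\<And>k x. finite {i \<in> I k. dist (ctr k i) x < \<Lambda> * rad k} \<and>
      card {i \<in> I k. dist (ctr k i) x < \<Lambda> * rad k} \<le> N"
    using bounded_overlap[of \<Lambda>] \<Lambda> by auto
  \<comment> \<open>Takes the place of Hoelder's inequality: the root of an average is at most 1
    plus the average, and the 1 integrates to the measure of a bounded set.\<close>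
  have root: "ennpowr z (1/p) \<le> 1 + z" for z
  proof (cases z)
    case (real r)
    have "r powr (1/p) \<le> 1 + r"
    proof (cases "r \<le> 1")
      case True
      then have "r powr (1/p) \<le> 1 powr (1/p)" using real p by (intro powr_mono2) auto
      then show ?thesis using real by simp
    next
      case False
      then show ?thesis using powr_mono[of "1/p" 1 r] p by simp
    qed
    then show ?thesis using real by (simp add: ennpowr_ennreal ennreal_leI flip: ennreal_1 ennreal_plus)
  qed simp
  have ball: "AE x in M. x \<in> ball x0 R \<longrightarrow> (\<lambda>n. step (int n) f x) \<longlonglongrightarrow> f x" for x0 and R :: real
  proof -
    \<comment> \<open>The larger ball contains all dilated covering balls in question: their radii
      are at most \<open>\<Lambda>\<close>, and their centres are within distance 1 of
      \<open>ball x0 R\<close>.\<close>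
    let ?G = "\<lambda>y. indicator (ball x0 (R + 1 + \<Lambda>)) y + ennpowr (g y) p"
    define K where "K = (\<integral>\<^sup>+ y. ?G y \<partial>M)"
    have K: "K < \<infinity>"
      unfolding K_def using g(2) by (subst nn_integral_add) (auto simp: emeasure_ball Lp_powr_def)
    define d where "d n x = ennreal \<bar>f x - step (int n) f x\<bar> * indicator (ball x0 R) x" for n x
    have [measurable]: "d n \<in> borel_measurable M" for n
      unfolding d_def using borel_imp_M[OF step_measurable[of "int n" f]] by measurable
    have bound: "(\<integral>\<^sup>+ x. d n x \<partial>M) \<le> ennreal ((1/2) ^ n) * (ennreal (2 * P) * (of_nat N * K))" for n
    proof -
      let ?k = "int n"
      have rad: "rad ?k = (1/2) ^ n" by (simp add: rad_def power_int_minus power_one_over inverse_eq_divide)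
      let ?h = "\<lambda>i x. ennreal \<bar>f x - mean f (B ?k i)\<bar> * indicator (ball x0 R) x"
      have "(\<integral>\<^sup>+ x. d n x \<partial>M) \<le> (\<Sum>i. (if i \<in> I ?k then 1 else 0) * (\<integral>\<^sup>+ x \<in> B ?k i. ?h i x \<partial>M))"
        unfolding d_def step_def by (rule nn_integral_fi_le[where h = ?h]) measurable
      also have "\<dots> \<le> (\<Sum>i. (if i \<in> I ?k then 1 else 0) *
          (ennreal (2 * P * rad ?k) * (\<integral>\<^sup>+ y \<in> ball (ctr ?k i) (\<Lambda> * rad ?k). ?G y \<partial>M)))"
      proof (intro suminf_le mult_left_mono summableI)
        fix i
        let ?c = "ctr ?k i"
        show "(\<integral>\<^sup>+ x \<in> B ?k i. ?h i x \<partial>M)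
            \<le> ennreal (2 * P * rad ?k) * (\<integral>\<^sup>+ y \<in> ball ?c (\<Lambda> * rad ?k). ?G y \<partial>M)"
        proof (cases "B ?k i \<inter> ball x0 R = {}")
          case True
          then have "(\<integral>\<^sup>+ x \<in> B ?k i. ?h i x \<partial>M) = (\<integral>\<^sup>+ x. 0 \<partial>M)"
            by (intro nn_integral_cong) (auto simp: indicator_def)
          then show ?thesis by simp
        next
          case False
          then obtain z where "z \<in> B ?k i" "z \<in> ball x0 R" by blast
          then have z: "dist ?c z < rad ?k" "dist x0 z < R" by (simp_all add: B_eq)
          have "rad ?k \<le> 1" unfolding rad by (simp add: power_le_one)
          then have rad\<Lambda>: "\<Lambda> * rad ?k \<le> \<Lambda>" using \<Lambda> by (simp add: mult_left_le)
          have sub: "ball ?c (\<Lambda> * rad ?k) \<subseteq> ball x0 (R + 1 + \<Lambda>)"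
          proof
            fix y assume "y \<in> ball ?c (\<Lambda> * rad ?k)"
            then show "y \<in> ball x0 (R + 1 + \<Lambda>)"
              using z rad\<Lambda> \<open>rad ?k \<le> 1\<close> dist_triangle[of x0 y z] dist_triangle[of z y ?c]
              by (simp add: dist_commute)
          qed
          let ?A = "ball_avg (\<lambda>y. ennpowr (g y) p) ?c (\<Lambda> * rad ?k)"
          let ?E = "emeasure M (ball ?c (\<Lambda> * rad ?k))"
          have "(\<integral>\<^sup>+ x \<in> B ?k i. ?h i x \<partial>M) \<le> osc f ?c (rad ?k)"
            unfolding osc_def B_eq by (intro nn_integral_mono) (auto simp: indicator_def)
          also have "\<dots> \<le> emeasure M (ball ?c (rad ?k)) * (ennreal (2 * P * rad ?k) * ennpowr ?A (1 / p))"
            by (rule osc_le[OF f g(1)]) simp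
          also have "\<dots> \<le> ?E * (ennreal (2 * P * rad ?k) * (1 + ?A))"
            using \<Lambda> by (intro mult_mono root emeasure_mono subset_ball order_refl) auto
          also have "\<dots> = ennreal (2 * P * rad ?k) * (?E + ?E * ?A)"
            by (simp add: distrib_left mult_ac)
          also have "?E * ?A = (\<integral>\<^sup>+ y \<in> ball ?c (\<Lambda> * rad ?k). ennpowr (g y) p \<partial>M)"
            using \<Lambda> by (intro ball_avg_mult) auto
          also have "?E = (\<integral>\<^sup>+ y \<in> ball ?c (\<Lambda> * rad ?k). indicator (ball x0 (R + 1 + \<Lambda>)) y \<partial>M)"
          proof -
            have "?E = (\<integral>\<^sup>+ y. indicator (ball ?c (\<Lambda> * rad ?k)) y \<partial>M)" by simp
            also have "\<dots> = (\<integral>\<^sup>+ y \<in> ball ?c (\<Lambda> * rad ?k). indicator (ball x0 (R + 1 + \<Lambda>)) y \<partial>M)"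
              using sub by (intro nn_integral_cong) (auto simp: indicator_def)
            finally show ?thesis .
          qed
          also have "(\<integral>\<^sup>+ y \<in> ball ?c (\<Lambda> * rad ?k). indicator (ball x0 (R + 1 + \<Lambda>)) y \<partial>M)
              + (\<integral>\<^sup>+ y \<in> ball ?c (\<Lambda> * rad ?k). ennpowr (g y) p \<partial>M)
              = (\<integral>\<^sup>+ y \<in> ball ?c (\<Lambda> * rad ?k). ?G y \<partial>M)"
            unfolding distrib_right by (rule nn_integral_add[symmetric]) auto
          finally show ?thesis .
        qed
      qed simp
      also have "\<dots> = (\<Sum>i. ennreal (2 * P * rad ?k) * ((if i \<in> I ?k then 1 else 0) *
          (\<integral>\<^sup>+ y \<in> ball (ctr ?k i) (\<Lambda> * rad ?k). ?G y \<partial>M)))"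
        by (intro suminf_cong) (simp add: mult.left_commute)
      also have "\<dots> = ennreal (2 * P * rad ?k) * (\<Sum>i. (if i \<in> I ?k then 1 else 0) *
          (\<integral>\<^sup>+ y \<in> ball (ctr ?k i) (\<Lambda> * rad ?k). ?G y \<partial>M))"
        by (rule ennreal_suminf_cmult)
      also have "\<dots> \<le> ennreal (2 * P * rad ?k) * (of_nat N * K)"
        unfolding K_def by (intro mult_left_mono overlap_integral N) measurable
      also have "\<dots> = ennreal ((1/2) ^ n) * (ennreal (2 * P) * (of_nat N * K))"
        unfolding rad using P by (subst ennreal_mult) (auto simp: mult_ac)
      finally show ?thesis .
    qed
    have "(\<integral>\<^sup>+ x. (\<Sum>n. d n x) \<partial>M) = (\<Sum>n. \<integral>\<^sup>+ x. d n x \<partial>M)"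
      by (rule nn_integral_suminf) measurable
    also have "\<dots> \<le> (\<Sum>n. ennreal ((1/2) ^ n) * (ennreal (2 * P) * (of_nat N * K)))"
      by (intro suminf_le bound summableI)
    also have "\<dots> = (\<Sum>n. ennreal ((1/2) ^ n)) * (ennreal (2 * P) * (of_nat N * K))"
      by (rule ennreal_suminf_multc)
    also have "\<dots> < \<infinity>"
      using K summable_geometric[of "1/2 :: real"]
      by (subst suminf_ennreal2) (auto simp: ennreal_mult_less_top of_nat_less_top)
    finally have "AE x in M. (\<Sum>n. d n x) \<noteq> \<infinity>"
      by (intro nn_integral_noteq_infinite) auto
    then show ?thesis
    proof eventually_elim
      case (elim x)
      show ?case
      proof
        assume x: "x \<in> ball x0 R"
        then have "(\<Sum>n. ennreal \<bar>f x - step (int n) f x\<bar>) \<noteq> top" using elim by (simp add: d_def)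
        then have "summable (\<lambda>n. \<bar>f x - step (int n) f x\<bar>)" by (rule summable_suminf_not_top[rotated]) simp
        then have "(\<lambda>n. \<bar>f x - step (int n) f x\<bar>) \<longlonglongrightarrow> 0" by (rule summable_LIMSEQ_zero)
        then have "(\<lambda>n. f x - step (int n) f x) \<longlonglongrightarrow> 0" by (rule tendsto_rabs_zero_cancel)
        then have "(\<lambda>n. f x - (f x - step (int n) f x)) \<longlonglongrightarrow> f x - 0" by (intro tendsto_intros)
        then show "(\<lambda>n. step (int n) f x) \<longlonglongrightarrow> f x" by simp
      qed
    qed
  qed
  have "AE x in M. \<forall>R::nat. x \<in> ball (undefined :: 'a) (real R) \<longrightarrow> (\<lambda>n. step (int n) f x) \<longlonglongrightarrow> f x"
    using ball by (subst AE_all_countable) blast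
  then show ?thesis
  proof eventually_elim
    case (elim x)
    obtain R :: nat where "dist undefined x < real R" using reals_Archimedean2 by blast
    then show ?case using elim[rule_format, of R] by simp
  qed
qed

end

section \<open>Convex combinations converging in norm\<close>

text \<open>Iterated midpoints of terms with index at least \<open>n\<close>. Such dyadic
  combinations suffice for the parallelogram law, and invariants pass to them by rule induction. The
  element type is arbitrary, so that several functions can be combined with the same
  weights.\<close>

inductive midpoints :: "(nat \<Rightarrow> 'g) \<Rightarrow> ('g \<Rightarrow> 'g \<Rightarrow> 'g) \<Rightarrow> nat \<Rightarrow> 'g \<Rightarrow> bool"
  for x :: "nat \<Rightarrow> 'g" and mid :: "'g \<Rightarrow> 'g \<Rightarrow> 'g" and n :: nat where
  base: "n \<le> k \<Longrightarrow> midpoints x mid n (x k)"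
| mid: "midpoints x mid n a \<Longrightarrow> midpoints x mid n b \<Longrightarrow> midpoints x mid n (mid a b)"

lemma midpoints_antimono:
  assumes "midpoints x mid m a" "n \<le> m"
  shows "midpoints x mid n a"
  using assms by (induction rule: midpoints.induct) (auto intro: midpoints.intros)

text \<open>Allows components that were carried along, such as truncations, to be forgotten.\<close>

lemma midpoints_map:
  assumes "midpoints x mid n a" "\<And>a b. h (mid a b) = mid' (h a) (h b)"
  shows "midpoints (\<lambda>k. h (x k)) mid' n (h a)"
  using assms(1) by (induction rule: midpoints.induct) (auto simp: assms(2) intro: midpoints.intros)

text \<open>Near-minimisers of a quadratic functional over decreasing convex sets form a Cauchy sequence, by
  the parallelogram law.\<close>

lemma parallelogram_minimizers:
  fixes K :: "nat \<Rightarrow> 'g \<Rightarrow> bool" and Q :: "'g \<Rightarrow> ennreal" and C :: real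
  assumes ne: "\<And>n. \<exists>a. K n a" and anti: "\<And>n m a. K m a \<Longrightarrow> n \<le> m \<Longrightarrow> K n a"
    and fin: "\<And>n a. K n a \<Longrightarrow> Q a \<le> ennreal C" and C: "0 \<le> C"
    and mid: "\<And>n a b. K n a \<Longrightarrow> K n b \<Longrightarrow> K n (mid a b)"
    and par: "\<And>n a b. K n a \<Longrightarrow> K n b \<Longrightarrow> 2 * (Q (dif a b) + Q (mid a b)) = Q a + Q b"
  obtains a where "\<And>n. K n (a n)"
    "\<And>e. 0 < e \<Longrightarrow> \<exists>n0. \<forall>n\<ge>n0. \<forall>m\<ge>n0. Q (dif (a n) (a m)) \<le> ennreal e"
proof -
  define q where "q a = enn2real (Q a)" for a
  have q: "Q a = ennreal (q a)" "0 \<le> q a" "q a \<le> C" if "K n a" for n a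
    using fin[OF that] C unfolding q_def by (auto simp: le_less_trans top_unique enn2real_leI less_top)
  define d where "d n = Inf (q ` {a. K n a})" for n
  have bdd: "bdd_below (q ` {a. K n a})" for n using q(2) by (intro bdd_belowI[of _ 0]) auto
  have d_le: "d n \<le> q a" if "K n a" for n a unfolding d_def using that bdd by (intro cInf_lower) auto
  have d_mono: "d n \<le> d m" if "n \<le> m" for n m
    unfolding d_def using ne[of m] anti[OF _ that] bdd by (intro cInf_superset_mono) auto
  have d_C: "d n \<le> C" for n using ne[of n] d_le q(3) order_trans by blast
  have bd: "bdd_above (range d)" using d_C by (intro bdd_aboveI[of _ C]) auto
  define d' where "d' = Sup (range d)"
  have d_le': "d n \<le> d'" for n unfolding d'_def using bd by (intro cSup_upper) auto
  have "\<exists>a. K n a \<and> q a < d n + inverse (real (Suc n))" for n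
  proof -
    have "Inf (q ` {a. K n a}) < d n + inverse (real (Suc n))" by (simp add: d_def[symmetric])
    then show ?thesis using cInf_lessD[of "q ` {a. K n a}"] ne[of n] by blast
  qed
  then obtain a where a: "\<And>n. K n (a n)" "\<And>n. q (a n) < d n + inverse (real (Suc n))" by metis
  have "\<exists>n0. \<forall>n\<ge>n0. \<forall>m\<ge>n0. Q (dif (a n) (a m)) \<le> ennreal e" if e: "0 < e" for e
  proof -
    \<comment> \<open>The midpoint of two late terms still lies in \<open>K n1\<close>, so its value
      exceeds \<open>d' - e/2\<close>, whereas the terms themselves are at most
      \<open>d' + e/2\<close>. The parallelogram law leaves at most \<open>e\<close> for the
      difference.\<close>
    obtain n1 where n1: "d' - e/2 < d n1"
      using less_cSupD[of "range d" "d' - e/2"] e unfolding d'_def by auto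
    obtain n2 where n2: "inverse (real (Suc n2)) < e/2" using reals_Archimedean[of "e/2"] e by auto
    have small: "q (a n) \<le> d' + e/2" if "n \<ge> max n1 n2" for n
    proof -
      have "inverse (real (Suc n)) \<le> inverse (real (Suc n2))" using that by (intro le_imp_inverse_le) auto
      then show ?thesis using a(2)[of n] d_le'[of n] n2 by linarith
    qed
    have "Q (dif (a n) (a m)) \<le> ennreal e" if nm: "n \<ge> max n1 n2" "m \<ge> max n1 n2" for n m
    proof -
      have K: "K n1 (a n)" "K n1 (a m)" using a(1) anti nm by auto
      note Km = mid[OF K]
      have eq: "2 * (Q (dif (a n) (a m)) + ennreal (q (mid (a n) (a m)))) = ennreal (q (a n) + q (a m))"
        using par[OF K] q[OF K(1)] q[OF K(2)] q[OF Km] by (simp add: ennreal_plus)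
      have "Q (dif (a n) (a m)) \<noteq> top"
      proof
        assume "Q (dif (a n) (a m)) = top"
        then show False using eq by (simp add: ennreal_mult_top)
      qed
      then obtain r where r: "0 \<le> r" "Q (dif (a n) (a m)) = ennreal r" by (cases "Q (dif (a n) (a m))") auto
      have "ennreal (2 * (r + q (mid (a n) (a m)))) = ennreal (q (a n) + q (a m))"
        using eq r q(2)[OF Km] by (simp add: ennreal_mult ennreal_plus)
      then have "2 * (r + q (mid (a n) (a m))) = q (a n) + q (a m)"
        using r q(2)[OF Km] q(2)[OF K(1)] q(2)[OF K(2)] by (subst (asm) ennreal_inj) auto
      then have "r \<le> e" using small[OF nm(1)] small[OF nm(2)] d_le[OF Km] n1 by argo
      then show ?thesis using r by (simp add: ennreal_leI)
    qed
    then show ?thesis by blast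
  qed
  then show ?thesis using that a(1) by blast
qed

text \<open>After scaling to the unit interval \<open>z powr p \<le> z\<close>, and \<open>z\<close>
  is below \<open>\<eta>\<close> or below \<open>z\<^sup>2 / \<eta>\<close>. On a set of finite
  measure this turns convergence in \<open>L\<^sup>2\<close> of functions bounded by
  \<open>s\<close> into convergence in \<open>L\<^sup>p\<close>.\<close>

lemma powr_le_cut:
  fixes y :: real
  assumes p: "1 \<le> p" and y: "0 \<le> y" "y \<le> s" and \<eta>: "0 < \<eta>" and s: "0 < s"
  shows "y powr p \<le> s powr p * (\<eta> + (1 / \<eta>) * (y / s)\<^sup>2)"
proof -
  define z where "z = y / s"
  have z: "0 \<le> z" "z \<le> 1" using y s by (auto simp: z_def)
  have "z powr p \<le> z"
    using powr_mono'[of 1 p z] p z by (cases "z = 0") auto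
  also have "z \<le> \<eta> + (1 / \<eta>) * z\<^sup>2"
  proof (cases "z \<le> \<eta>")
    case True
    then show ?thesis using \<eta> by (simp add: add_increasing2)
  next
    case False
    then have "z * \<eta> \<le> z * z" using z by (intro mult_left_mono) auto
    then have "z \<le> (1 / \<eta>) * z\<^sup>2" using \<eta> by (simp add: power2_eq_square field_simps)
    then show ?thesis using \<eta> by simp
  qed
  finally have "s powr p * z powr p \<le> s powr p * (\<eta> + (1 / \<eta>) * z\<^sup>2)" by (intro mult_left_mono) auto
  moreover have "s powr p * z powr p = y powr p" using y s by (simp add: z_def flip: powr_mult)
  ultimately show ?thesis by (simp add: z_def)
qed

context sobolev
begin

text \<open>Sublevel sets of \<open>Lp_powr\<close> are closed under midpoints by convexity, so
  energy and tail bounds survive in \<open>midpoints\<close>.\<close>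

lemma Lp_powr_diff_le:
  fixes f g :: "'a \<Rightarrow> real"
  assumes [measurable]: "f \<in> borel_measurable borel" "g \<in> borel_measurable borel"
    and t: "Lp_powr M p (\<lambda>x. ennreal (f x)) \<le> ennreal c" "Lp_powr M p (\<lambda>x. ennreal (g x)) \<le> ennreal c"
    and nonneg: "\<And>x. 0 \<le> f x" "\<And>x. 0 \<le> g x" and c: "0 \<le> c"
  shows "Lp_powr M p (\<lambda>x. ennreal ((f x + g x) / 2)) \<le> ennreal c"
proof -
  have "Lp_powr M p (\<lambda>x. ennreal ((f x + g x) / 2))
      = Lp_powr M p (\<lambda>x. ennreal (1/2) * ennreal (f x) + ennreal (1 - 1/2) * ennreal (g x))"
    using nonneg by (intro arg_cong[where f = "Lp_powr M p"] ext)
      (subst ennreal_mult[symmetric] | subst ennreal_plus[symmetric] | simp add: add_divide_distrib)+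
  also have "\<dots> \<le> ennreal (1/2) * Lp_powr M p (\<lambda>x. ennreal (f x)) + ennreal (1 - 1/2) * Lp_powr M p (\<lambda>x. ennreal (g x))"
    by (intro Lp_powr_convex borel_imp_M) auto
  also have "\<dots> \<le> ennreal (1/2) * ennreal c + ennreal (1 - 1/2) * ennreal c"
    by (intro add_mono mult_left_mono t) auto
  also have "\<dots> = ennreal (1/2 * c + (1 - 1/2) * c)"
    using c by (subst (1 2) ennreal_mult[symmetric]) (auto simp: ennreal_plus[symmetric] simp del: ennreal_plus)
  finally show ?thesis by simp
qed

text \<open>A version of Mazur's lemma covering \<open>p = 1\<close>: the uniform tail condition replaces weak
  compactness. The truncations at all levels \<open>s\<close> are made to converge simultaneously in a weighted
  \<open>L\<^sup>2\<close> norm.\<close>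

lemma mazur:
  fixes u \<tau> :: "nat \<Rightarrow> 'a \<Rightarrow> real" and x0 :: 'a
  defines "level \<equiv> \<lambda>s x. real s * indicator (ball x0 (real s)) x"
    and "pmid \<equiv> \<lambda>(v, F) (v', F'). (\<lambda>x. (v x + v' x) / 2, \<lambda>x. (F x + F' x) / 2)"
  assumes \<tau> [measurable]: "\<And>k. \<tau> k \<in> borel_measurable borel" and nonneg: "\<And>k x. 0 \<le> \<tau> k x"
    and tails: "\<And>e. 0 < e \<Longrightarrow> \<exists>s. \<forall>k. Lp_powr M p (\<lambda>x. ennreal (\<tau> k x - min (\<tau> k x) (level s x))) \<le> ennreal e"
  obtains v F where "\<And>j::nat. midpoints (\<lambda>k. (u k, \<tau> k)) pmid j (v j, F j)"
    "\<And>j. Lp_powr M p (\<lambda>x. ennreal \<bar>F (Suc j) x - F j x\<bar>) \<le> ennreal (((1/4) ^ j) powr p)"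
proof -
  \<comment> \<open>Triples consist of \<open>u\<close>, \<open>\<tau>\<close> and the truncations
    of \<open>\<tau>\<close> at all levels. The midpoint of two truncations is in general not the
    truncation of the midpoint, so the third component is carried separately.\<close>
  define tmid :: "('a \<Rightarrow> real) \<times> ('a \<Rightarrow> real) \<times> (nat \<Rightarrow> 'a \<Rightarrow> real) \<Rightarrow> _ \<Rightarrow> ('a \<Rightarrow> real) \<times> ('a \<Rightarrow> real) \<times> (nat \<Rightarrow> 'a \<Rightarrow> real)"
    where "tmid = (\<lambda>(v, F, G) (v', F', G'). (\<lambda>x. (v x + v' x) / 2, \<lambda>x. (F x + F' x) / 2, \<lambda>s x. (G s x + G' s x) / 2))"
  define tdif :: "('a \<Rightarrow> real) \<times> ('a \<Rightarrow> real) \<times> (nat \<Rightarrow> 'a \<Rightarrow> real) \<Rightarrow> _ \<Rightarrow> ('a \<Rightarrow> real) \<times> ('a \<Rightarrow> real) \<times> (nat \<Rightarrow> 'a \<Rightarrow> real)"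
    where "tdif = (\<lambda>(v, F, G) (v', F', G'). (\<lambda>x. (v x - v' x) / 2, \<lambda>x. (F x - F' x) / 2, \<lambda>s x. (G s x - G' s x) / 2))"
  define tup where "tup k = (u k, \<tau> k, \<lambda>s x. min (\<tau> k x) (level s x))" for k
  define K where "K = midpoints tup tmid"
  define \<nu> where "\<nu> s = measure M (ball x0 (real s))" for s :: nat
  have emeas: "emeasure M (ball x0 (real s)) = ennreal (\<nu> s)" for s
  proof (cases "s = 0")
    case False
    then have "emeasure M (ball x0 (real s)) < top" using mms by (simp add: metric_measure_space_def)
    then show ?thesis unfolding \<nu>_def by (intro emeasure_eq_ennreal_measure) (simp add: less_top)
  qed (simp add: \<nu>_def)
  \<comment> \<open>With these weights the squared levels have total integral at most 2, whatever
    the measures of the balls, so \<open>Q\<close> is bounded. The 1 in the denominator excludes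
    division by 0.\<close>
  define w where "w s = (1/2) ^ s / (1 + (real s)\<^sup>2 * \<nu> s)" for s
  have \<nu>0: "0 \<le> \<nu> s" for s by (simp add: \<nu>_def)
  have w: "0 < w s" "w s * ((real s)\<^sup>2 * \<nu> s) \<le> (1/2) ^ s" for s
  proof -
    define X where "X = (real s)\<^sup>2 * \<nu> s"
    have X: "0 \<le> X" using \<nu>0[of s] by (simp add: X_def)
    then show "0 < w s" unfolding w_def X_def[symmetric] by (simp add: add_pos_nonneg)
    have "(1/2) ^ s / (1 + X) * X = (1/2) ^ s * (X / (1 + X))" by simp
    also have "\<dots> \<le> (1/2) ^ s * 1" using X by (intro mult_left_mono) auto
    finally show "w s * ((real s)\<^sup>2 * \<nu> s) \<le> (1/2) ^ s" unfolding w_def X_def[symmetric] by simp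
  qed
  have level0: "0 \<le> level s x" for s x by (simp add: level_def)
  have [measurable]: "level s \<in> borel_measurable borel" for s
    unfolding level_def by (intro borel_measurable_times borel_measurable_const borel_measurable_indicator) simp
  define Q :: "('a \<Rightarrow> real) \<times> ('a \<Rightarrow> real) \<times> (nat \<Rightarrow> 'a \<Rightarrow> real) \<Rightarrow> ennreal"
    where "Q = (\<lambda>(v, F, G). \<integral>\<^sup>+x. (\<Sum>s. ennreal (w s * (G s x)\<^sup>2)) \<partial>M)"
  have inv: "F \<in> borel_measurable borel \<and> (\<forall>s. G s \<in> borel_measurable borel) \<and>
      (\<forall>s x. 0 \<le> G s x \<and> G s x \<le> F x \<and> G s x \<le> level s x)" if "K n (v, F, G)" for n v F G
    using that unfolding K_def
  proof (induction "(v, F, G)" arbitrary: v F G rule: midpoints.induct)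
    case (base k)
    then show ?case using nonneg level0 by (auto simp: tup_def)
  next
    case (mid a b)
    obtain v1 F1 G1 v2 F2 G2 where ab: "a = (v1, F1, G1)" "b = (v2, F2, G2)" by (cases a; cases b) auto
    have [measurable]: "F1 \<in> borel_measurable borel" "F2 \<in> borel_measurable borel"
      "\<And>s. G1 s \<in> borel_measurable borel" "\<And>s. G2 s \<in> borel_measurable borel"
      using mid.hyps ab by auto
    have eq: "F = (\<lambda>x. (F1 x + F2 x) / 2)" "G = (\<lambda>s x. (G1 s x + G2 s x) / 2)"
      using mid.hyps(5) ab by (auto simp: tmid_def)
    have b: "0 \<le> G1 s x \<and> G1 s x \<le> F1 x \<and> G1 s x \<le> level s x" "0 \<le> G2 s x \<and> G2 s x \<le> F2 x \<and> G2 s x \<le> level s x" for s x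
      using mid.hyps(2)[OF ab(1)] mid.hyps(4)[OF ab(2)] by auto
    have "0 \<le> G s x \<and> G s x \<le> F x \<and> G s x \<le> level s x" for s x
      unfolding eq using b(1)[of s x] b(2)[of s x] by auto
    moreover have "F \<in> borel_measurable borel" "\<And>s. G s \<in> borel_measurable borel"
      unfolding eq by measurable
    ultimately show ?case by blast
  qed
  have Q_fin: "Q a \<le> ennreal 2" if "K n a" for n a
  proof -
    obtain v F G where a: "a = (v, F, G)" using prod_cases3[of a] by blast
    have "Q a \<le> (\<integral>\<^sup>+x. (\<Sum>s. ennreal (w s * (level s x)\<^sup>2)) \<partial>M)"
      unfolding Q_def a prod.case
    proof (intro nn_integral_mono suminf_le summableI ennreal_leI mult_left_mono)
      show "(G s x)\<^sup>2 \<le> (level s x)\<^sup>2" for s x using inv that a by (intro power_mono) auto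
    qed (use w less_imp_le in auto)
    also have "\<dots> = (\<Sum>s. \<integral>\<^sup>+x. ennreal (w s * (level s x)\<^sup>2) \<partial>M)"
      by (intro nn_integral_suminf borel_imp_M) measurable
    also have "\<dots> \<le> (\<Sum>s. ennreal ((1/2) ^ s))"
    proof (intro suminf_le summableI)
      fix s
      have "(\<integral>\<^sup>+x. ennreal (w s * (level s x)\<^sup>2) \<partial>M) = (\<integral>\<^sup>+x. ennreal (w s * (real s)\<^sup>2) * indicator (ball x0 (real s)) x \<partial>M)"
        by (intro nn_integral_cong) (auto simp: level_def indicator_def)
      also have "\<dots> = ennreal (w s * (real s)\<^sup>2) * ennreal (\<nu> s)"
        by (subst nn_integral_cmult_indicator) (auto simp: emeas sets_borel_M)
      also have "\<dots> = ennreal (w s * ((real s)\<^sup>2 * \<nu> s))"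
        using w(1)[of s] \<nu>0[of s] by (simp add: ennreal_mult[symmetric] mult.assoc)
      also have "\<dots> \<le> ennreal ((1/2) ^ s)" using w(2) by (rule ennreal_leI)
      finally show "(\<integral>\<^sup>+x. ennreal (w s * (level s x)\<^sup>2) \<partial>M) \<le> ennreal ((1/2) ^ s)" .
    qed
    also have "\<dots> = ennreal (\<Sum>s. (1/2) ^ s)"
      by (intro suminf_ennreal2 summable_geometric) auto
    also have "(\<Sum>s. (1/2 :: real) ^ s) = 2" using suminf_geometric[of "1/2 :: real"] by simp
    finally show ?thesis by simp
  qed
  have par: "2 * (Q (tdif a b) + Q (tmid a b)) = Q a + Q b" if "K n a" "K n b" for n a b
  proof -
    obtain v F G v' F' G' where ab: "a = (v, F, G)" "b = (v', F', G')" by (cases a; cases b) auto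
    have [measurable]: "G s \<in> borel_measurable borel" "G' s \<in> borel_measurable borel" for s
      using inv that ab by auto
    have int: "(\<integral>\<^sup>+x. (\<Sum>s. ennreal (w s * (H s x)\<^sup>2)) \<partial>M) + (\<integral>\<^sup>+x. (\<Sum>s. ennreal (w s * (H' s x)\<^sup>2)) \<partial>M)
        = (\<integral>\<^sup>+x. (\<Sum>s. ennreal (w s * ((H s x)\<^sup>2 + (H' s x)\<^sup>2))) \<partial>M)"
      if [measurable]: "\<And>s. H s \<in> borel_measurable borel" "\<And>s. H' s \<in> borel_measurable borel" for H H' :: "nat \<Rightarrow> 'a \<Rightarrow> real"
    proof -
      have "ennreal (w s * (H s x)\<^sup>2) + ennreal (w s * (H' s x)\<^sup>2) = ennreal (w s * ((H s x)\<^sup>2 + (H' s x)\<^sup>2))" for s x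
        using w(1)[of s] by (simp add: distrib_left ennreal_plus less_imp_le)
      then have "(\<Sum>s. ennreal (w s * (H s x)\<^sup>2)) + (\<Sum>s. ennreal (w s * (H' s x)\<^sup>2))
          = (\<Sum>s. ennreal (w s * ((H s x)\<^sup>2 + (H' s x)\<^sup>2)))" for x
        by (subst suminf_add) auto
      moreover have "(\<integral>\<^sup>+x. (\<Sum>s. ennreal (w s * (H s x)\<^sup>2)) + (\<Sum>s. ennreal (w s * (H' s x)\<^sup>2)) \<partial>M)
          = (\<integral>\<^sup>+x. (\<Sum>s. ennreal (w s * (H s x)\<^sup>2)) \<partial>M) + (\<integral>\<^sup>+x. (\<Sum>s. ennreal (w s * (H' s x)\<^sup>2)) \<partial>M)"
        by (intro nn_integral_add borel_imp_M) measurable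
      ultimately show ?thesis by simp
    qed
    have two: "2 * (\<integral>\<^sup>+x. (\<Sum>s. ennreal (w s * H s x)) \<partial>M) = (\<integral>\<^sup>+x. (\<Sum>s. ennreal (w s * (2 * H s x))) \<partial>M)"
      if [measurable]: "\<And>s. H s \<in> borel_measurable borel" and H: "\<And>s x. 0 \<le> H s x" for H :: "nat \<Rightarrow> 'a \<Rightarrow> real"
    proof -
      have "ennreal (w s * (2 * H s x)) = 2 * ennreal (w s * H s x)" for s x
        using ennreal_mult[of 2 "w s * H s x"] w(1)[of s] H[of s x] by (simp add: less_imp_le mult.left_commute)
      then have "(\<Sum>s. ennreal (w s * (2 * H s x))) = 2 * (\<Sum>s. ennreal (w s * H s x))" for x
        by simp
      moreover have "(\<integral>\<^sup>+x. 2 * (\<Sum>s. ennreal (w s * H s x)) \<partial>M) = 2 * (\<integral>\<^sup>+x. (\<Sum>s. ennreal (w s * H s x)) \<partial>M)"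
        by (intro nn_integral_cmult borel_imp_M) measurable
      ultimately show ?thesis by simp
    qed
    have sq: "2 * (((G s x - G' s x) / 2)\<^sup>2 + ((G s x + G' s x) / 2)\<^sup>2) = (G s x)\<^sup>2 + (G' s x)\<^sup>2" for s x
      by (simp add: power2_eq_square field_simps)
    show ?thesis
      unfolding ab Q_def tdif_def tmid_def prod.case
    proof -
      let ?d = "\<lambda>s x. (G s x - G' s x) / 2" and ?m = "\<lambda>s x. (G s x + G' s x) / 2"
      have "2 * ((\<integral>\<^sup>+x. (\<Sum>s. ennreal (w s * (?d s x)\<^sup>2)) \<partial>M) + (\<integral>\<^sup>+x. (\<Sum>s. ennreal (w s * (?m s x)\<^sup>2)) \<partial>M))
          = 2 * (\<integral>\<^sup>+x. (\<Sum>s. ennreal (w s * ((?d s x)\<^sup>2 + (?m s x)\<^sup>2))) \<partial>M)"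
        by (subst int) measurable
      also have "\<dots> = (\<integral>\<^sup>+x. (\<Sum>s. ennreal (w s * (2 * ((?d s x)\<^sup>2 + (?m s x)\<^sup>2)))) \<partial>M)"
      proof (rule two)
        show "(\<lambda>x. (?d s x)\<^sup>2 + (?m s x)\<^sup>2) \<in> borel_measurable borel" for s by measurable
      qed simp
      also have "\<dots> = (\<integral>\<^sup>+x. (\<Sum>s. ennreal (w s * ((G s x)\<^sup>2 + (G' s x)\<^sup>2))) \<partial>M)"
        unfolding sq ..
      also have "\<dots> = (\<integral>\<^sup>+x. (\<Sum>s. ennreal (w s * (G s x)\<^sup>2)) \<partial>M) + (\<integral>\<^sup>+x. (\<Sum>s. ennreal (w s * (G' s x)\<^sup>2)) \<partial>M)"
        by (rule int[symmetric]) measurable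
      finally show "2 * ((\<integral>\<^sup>+x. (\<Sum>s. ennreal (w s * (?d s x)\<^sup>2)) \<partial>M) + (\<integral>\<^sup>+x. (\<Sum>s. ennreal (w s * (?m s x)\<^sup>2)) \<partial>M))
          = (\<integral>\<^sup>+x. (\<Sum>s. ennreal (w s * (G s x)\<^sup>2)) \<partial>M) + (\<integral>\<^sup>+x. (\<Sum>s. ennreal (w s * (G' s x)\<^sup>2)) \<partial>M)" .
    qed
  qed
  obtain a where a: "\<And>n. K n (a n)"
    and cauchy: "\<And>e. 0 < e \<Longrightarrow> \<exists>n0. \<forall>n\<ge>n0. \<forall>m\<ge>n0. Q (tdif (a n) (a m)) \<le> ennreal e"
  proof (rule parallelogram_minimizers[of K Q 2 tmid tdif])
    show "\<exists>a. K n a" for n unfolding K_def using midpoints.base[of n n tup tmid] by blast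
    show "K m a \<Longrightarrow> n \<le> m \<Longrightarrow> K n a" for n m a unfolding K_def by (rule midpoints_antimono)
    show "K n a \<Longrightarrow> K n b \<Longrightarrow> K n (tmid a b)" for n a b unfolding K_def by (rule midpoints.mid)
  qed (use Q_fin par in auto)
  define V' where "V' n = fst (a n)" for n
  define F where "F n = fst (snd (a n))" for n
  define G where "G n = snd (snd (a n))" for n
  have a_eq: "a n = (V' n, F n, G n)" for n by (simp add: V'_def F_def G_def)
  have inv_a: "F n \<in> borel_measurable borel \<and> (\<forall>s. G n s \<in> borel_measurable borel) \<and>
      (\<forall>s x. 0 \<le> G n s x \<and> G n s x \<le> F n x \<and> G n s x \<le> level s x)" for n
    using inv a[of n] unfolding a_eq by blast
  have [measurable]: "F n \<in> borel_measurable borel" "G n s \<in> borel_measurable borel" for n s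
    using inv_a by auto
  \<comment> \<open>By convexity the tail bound passes from the \<open>\<tau> k\<close> to all
    combinations, with \<open>G n s\<close> in the role of the truncation.\<close>
  have tail: "Lp_powr M p (\<lambda>x. ennreal (F n x - G n s x)) \<le> ennreal e"
    if s: "\<And>k. Lp_powr M p (\<lambda>x. ennreal (\<tau> k x - min (\<tau> k x) (level s x))) \<le> ennreal e" and e: "0 < e" for s e n
  proof -
    have "Lp_powr M p (\<lambda>x. ennreal (F x - G s x)) \<le> ennreal e" if "K n (v, F, G)" for v F G
      using that unfolding K_def
    proof (induction "(v, F, G)" arbitrary: v F G rule: midpoints.induct)
      case (base k)
      then show ?case using s by (auto simp: tup_def)
    next
      case (mid a b)
      obtain v1 F1 G1 v2 F2 G2 where ab: "a = (v1, F1, G1)" "b = (v2, F2, G2)" by (cases a; cases b) auto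
      have eq: "F = (\<lambda>x. (F1 x + F2 x) / 2)" "G = (\<lambda>s x. (G1 s x + G2 s x) / 2)"
        using mid.hyps(5) ab by (auto simp: tmid_def)
      have i1: "F1 \<in> borel_measurable borel \<and> (\<forall>s. G1 s \<in> borel_measurable borel) \<and> (\<forall>s x. 0 \<le> G1 s x \<and> G1 s x \<le> F1 x \<and> G1 s x \<le> level s x)"
        and i2: "F2 \<in> borel_measurable borel \<and> (\<forall>s. G2 s \<in> borel_measurable borel) \<and> (\<forall>s x. 0 \<le> G2 s x \<and> G2 s x \<le> F2 x \<and> G2 s x \<le> level s x)"
        using inv mid.hyps(1,3) ab unfolding K_def by blast+
      have "Lp_powr M p (\<lambda>x. ennreal (((F1 x - G1 s x) + (F2 x - G2 s x)) / 2)) \<le> ennreal e"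
        using i1 i2 mid.hyps(2)[OF ab(1)] mid.hyps(4)[OF ab(2)] e
        by (intro Lp_powr_diff_le borel_measurable_diff) auto
      then show ?case unfolding eq by (simp add: add_divide_distrib diff_divide_distrib algebra_simps)
    qed
    then show ?thesis using a[of n] a_eq[of n] by metis
  qed
  have middle: "\<exists>n0. \<forall>n\<ge>n0. \<forall>m\<ge>n0. Lp_powr M p (\<lambda>x. ennreal \<bar>G n s x - G m s x\<bar>) \<le> ennreal e"
    if s: "0 < s" and e: "0 < e" for s e
  proof -
    have [measurable]: "ball x0 (real s) \<in> sets borel" by simp
    define c where "c = (real s) powr p"
    have c: "0 < c" using s by (simp add: c_def)
    \<comment> \<open>\<open>\<eta>\<close> makes the constant term of \<open>powr_le_cut\<close>
      integrate to at most \<open>e/2\<close> over the ball, and \<open>\<kappa>\<close> rewrites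
      its quadratic term through the weighted square of the half difference. Then \<open>Q\<close>
      has to be below \<open>e / (2 * \<kappa>)\<close>.\<close>
    define \<eta> where "\<eta> = e / (2 * c * (1 + \<nu> s))"
    have \<eta>: "0 < \<eta>" using e c \<nu>0[of s] by (auto simp: \<eta>_def intro!: divide_pos_pos mult_pos_pos)
    define \<kappa> where "\<kappa> = 4 * c / (\<eta> * (real s)\<^sup>2 * w s)"
    have \<kappa>: "0 < \<kappa>" using c \<eta> s w(1)[of s] by (simp add: \<kappa>_def)
    obtain n0 where n0: "\<And>n m. n \<ge> n0 \<Longrightarrow> m \<ge> n0 \<Longrightarrow> Q (tdif (a n) (a m)) \<le> ennreal (e / (2 * \<kappa>))"
      using cauchy[of "e / (2 * \<kappa>)"] e \<kappa> by auto
    have "Lp_powr M p (\<lambda>x. ennreal \<bar>G n s x - G m s x\<bar>) \<le> ennreal e" if nm: "n \<ge> n0" "m \<ge> n0" for n m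
    proof -
      let ?d = "\<lambda>x. (G n s x - G m s x) / 2"
      have pw: "ennpowr (ennreal \<bar>G n s x - G m s x\<bar>) p
          \<le> ennreal (c * \<eta>) * indicator (ball x0 (real s)) x + ennreal \<kappa> * ennreal (w s * (?d x)\<^sup>2)" for x
      proof (cases "x \<in> ball x0 (real s)")
        case True
        have "G n s x \<le> level s x" "G m s x \<le> level s x" "0 \<le> G n s x" "0 \<le> G m s x"
          using inv_a by blast+
        then have "\<bar>G n s x - G m s x\<bar> powr p \<le> (real s) powr p * (\<eta> + (1 / \<eta>) * (\<bar>G n s x - G m s x\<bar> / real s)\<^sup>2)"
          using s True by (intro powr_le_cut p \<eta>) (auto simp: level_def)
        also have "\<dots> = c * \<eta> + \<kappa> * (w s * (?d x)\<^sup>2)"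
          using \<eta> s w(1)[of s] by (simp add: c_def[symmetric] \<kappa>_def power_divide field_simps)
        finally have "ennreal (\<bar>G n s x - G m s x\<bar> powr p) \<le> ennreal (c * \<eta>) + ennreal \<kappa> * ennreal (w s * (?d x)\<^sup>2)"
          using c \<eta> \<kappa> w(1)[of s] by (simp add: ennreal_leI flip: ennreal_mult ennreal_plus)
        then show ?thesis using True by (simp add: ennpowr_ennreal)
      next
        case False
        have "G n s x \<le> level s x" "G m s x \<le> level s x" "0 \<le> G n s x" "0 \<le> G m s x"
          using inv_a by blast+
        then have "G n s x = 0" "G m s x = 0" using False by (auto simp: level_def)
        then show ?thesis by simp
      qed
      have Qs: "(\<integral>\<^sup>+x. ennreal (w s * (?d x)\<^sup>2) \<partial>M) \<le> ennreal (e / (2 * \<kappa>))"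
      proof -
        have "(\<integral>\<^sup>+x. ennreal (w s * (?d x)\<^sup>2) \<partial>M) \<le> Q (tdif (a n) (a m))"
          unfolding a_eq tdif_def Q_def prod.case
        proof (rule nn_integral_mono)
          fix x
          show "ennreal (w s * (?d x)\<^sup>2) \<le> (\<Sum>s. ennreal (w s * ((G n s x - G m s x) / 2)\<^sup>2))"
            using sum_le_suminf[of "\<lambda>s. ennreal (w s * ((G n s x - G m s x) / 2)\<^sup>2)" "{s}"] by simp
        qed
        then show ?thesis using n0[OF nm] by simp
      qed
      have "Lp_powr M p (\<lambda>x. ennreal \<bar>G n s x - G m s x\<bar>)
          \<le> (\<integral>\<^sup>+x. ennreal (c * \<eta>) * indicator (ball x0 (real s)) x + ennreal \<kappa> * ennreal (w s * (?d x)\<^sup>2) \<partial>M)"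
        unfolding Lp_powr_def by (rule nn_integral_mono) (rule pw)
      also have "\<dots> = (\<integral>\<^sup>+x. ennreal (c * \<eta>) * indicator (ball x0 (real s)) x \<partial>M) + (\<integral>\<^sup>+x. ennreal \<kappa> * ennreal (w s * (?d x)\<^sup>2) \<partial>M)"
        by (intro nn_integral_add borel_imp_M) measurable
      also have "(\<integral>\<^sup>+x. ennreal \<kappa> * ennreal (w s * (?d x)\<^sup>2) \<partial>M) = ennreal \<kappa> * (\<integral>\<^sup>+x. ennreal (w s * (?d x)\<^sup>2) \<partial>M)"
        by (intro nn_integral_cmult borel_imp_M) measurable
      also have "(\<integral>\<^sup>+x. ennreal (c * \<eta>) * indicator (ball x0 (real s)) x \<partial>M) = ennreal (c * \<eta>) * ennreal (\<nu> s)"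
        by (subst nn_integral_cmult_indicator) (auto simp: emeas sets_borel_M)
      also have "ennreal (c * \<eta>) * ennreal (\<nu> s) + ennreal \<kappa> * (\<integral>\<^sup>+x. ennreal (w s * (?d x)\<^sup>2) \<partial>M)
          \<le> ennreal (c * \<eta>) * ennreal (\<nu> s) + ennreal \<kappa> * ennreal (e / (2 * \<kappa>))"
        by (intro add_mono mult_left_mono Qs) auto
      also have "\<dots> = ennreal (c * \<eta> * \<nu> s + \<kappa> * (e / (2 * \<kappa>)))"
        using c \<eta> \<kappa> e \<nu>0[of s] by (simp flip: ennreal_mult ennreal_plus)
      also have "\<dots> \<le> ennreal e"
      proof (rule ennreal_leI)
        have "c * \<eta> * \<nu> s = e / 2 * (\<nu> s / (1 + \<nu> s))"
        proof -
          have "1 + \<nu> s \<noteq> 0" using \<nu>0[of s] by linarith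
          then show ?thesis using c by (simp add: \<eta>_def divide_simps)
        qed
        also have "\<dots> \<le> e / 2 * 1" using e \<nu>0[of s] by (intro mult_left_mono) (auto simp: field_simps)
        finally show "c * \<eta> * \<nu> s + \<kappa> * (e / (2 * \<kappa>)) \<le> e" using \<kappa> by simp
      qed
      finally show ?thesis .
    qed
    then show ?thesis by blast
  qed
  have total: "\<exists>n0. \<forall>n\<ge>n0. \<forall>m\<ge>n0. Lp_powr M p (\<lambda>x. ennreal \<bar>F n x - F m x\<bar>) \<le> ennreal e" if e: "0 < e" for e
  proof -
    \<comment> \<open>For three terms the crude triangle inequality is applied twice, at a cost of
      at most \<open>2 powr p * 2 powr p\<close> for each term.\<close>
    define \<delta> where "\<delta> = e / (3 * (2 powr p * 2 powr p))"
    have \<delta>: "0 < \<delta>" using e by (simp add: \<delta>_def)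
    obtain s0 where s0: "\<And>k. Lp_powr M p (\<lambda>x. ennreal (\<tau> k x - min (\<tau> k x) (level s0 x))) \<le> ennreal \<delta>"
      using tails[OF \<delta>] by blast
    \<comment> \<open>Raising the level only shrinks the tails; the successor makes it positive, as
      \<open>middle\<close> requires.\<close>
    define s where "s = Suc s0"
    have s: "Lp_powr M p (\<lambda>x. ennreal (\<tau> k x - min (\<tau> k x) (level s x))) \<le> ennreal \<delta>" for k
    proof -
      have "level s0 x \<le> level s x" for x by (auto simp: level_def s_def indicator_def)
      then have "Lp_powr M p (\<lambda>x. ennreal (\<tau> k x - min (\<tau> k x) (level s x))) \<le> Lp_powr M p (\<lambda>x. ennreal (\<tau> k x - min (\<tau> k x) (level s0 x)))"
        by (intro Lp_powr_mono ennreal_leI diff_left_mono min.mono) auto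
      then show ?thesis using s0[of k] by simp
    qed
    obtain n0 where n0: "\<And>n m. n \<ge> n0 \<Longrightarrow> m \<ge> n0 \<Longrightarrow> Lp_powr M p (\<lambda>x. ennreal \<bar>G n s x - G m s x\<bar>) \<le> ennreal \<delta>"
      using middle[of s \<delta>] \<delta> unfolding s_def by blast
    have "Lp_powr M p (\<lambda>x. ennreal \<bar>F n x - F m x\<bar>) \<le> ennreal e" if nm: "n \<ge> n0" "m \<ge> n0" for n m
    proof -
      let ?A = "\<lambda>x. ennreal (F n x - G n s x)" and ?B = "\<lambda>x. ennreal \<bar>G n s x - G m s x\<bar>" and ?C = "\<lambda>x. ennreal (F m x - G m s x)"
      have "Lp_powr M p (\<lambda>x. ennreal \<bar>F n x - F m x\<bar>) \<le> Lp_powr M p (\<lambda>x. ?A x + (?B x + ?C x))"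
      proof (rule Lp_powr_mono)
        fix x
        have "G n s x \<le> F n x" "G m s x \<le> F m x" using inv_a by blast+
        then have "\<bar>F n x - F m x\<bar> \<le> (F n x - G n s x) + (\<bar>G n s x - G m s x\<bar> + (F m x - G m s x))" by linarith
        then show "ennreal \<bar>F n x - F m x\<bar> \<le> ?A x + (?B x + ?C x)"
          using \<open>G n s x \<le> F n x\<close> \<open>G m s x \<le> F m x\<close> by (simp add: ennreal_leI flip: ennreal_plus)
      qed
      also have "\<dots> \<le> ennreal (2 powr p) * (Lp_powr M p ?A + Lp_powr M p (\<lambda>x. ?B x + ?C x))"
        by (intro Lp_powr_add_le) auto
      also have "\<dots> \<le> ennreal (2 powr p) * (Lp_powr M p ?A + ennreal (2 powr p) * (Lp_powr M p ?B + Lp_powr M p ?C))"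
        by (intro mult_left_mono add_left_mono Lp_powr_add_le) auto
      also have "\<dots> \<le> ennreal (2 powr p) * (ennreal \<delta> + ennreal (2 powr p) * (ennreal \<delta> + ennreal \<delta>))"
        by (intro mult_left_mono add_mono tail s \<delta> n0 nm) auto
      also have "\<dots> = ennreal (2 powr p * (\<delta> + 2 powr p * (\<delta> + \<delta>)))"
        using \<delta> by (simp flip: ennreal_mult ennreal_plus)
      also have "\<dots> \<le> ennreal e"
      proof (rule ennreal_leI)
        have "1 \<le> 2 powr p" using powr_mono[of 0 p 2] p by simp
        then have "\<delta> \<le> 2 powr p * \<delta>" using \<delta> by (simp add: mult_le_cancel_right1)
        then have "2 powr p * (\<delta> + 2 powr p * (\<delta> + \<delta>)) \<le> 2 powr p * (2 powr p * \<delta> + 2 powr p * (\<delta> + \<delta>))"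
          by (intro mult_left_mono add_right_mono \<open>\<delta> \<le> 2 powr p * \<delta>\<close>) auto
        also have "\<dots> = e" by (simp add: \<delta>_def field_simps)
        finally show "2 powr p * (\<delta> + 2 powr p * (\<delta> + \<delta>)) \<le> e" .
      qed
      finally show ?thesis .
    qed
    then show ?thesis by blast
  qed
  have "\<exists>n0. \<forall>n\<ge>n0. \<forall>m\<ge>n0. Lp_powr M p (\<lambda>x. ennreal \<bar>F n x - F m x\<bar>) \<le> ennreal (((1/4) ^ j) powr p)" for j :: nat
    by (rule total) simp
  then obtain n0 where n0: "\<And>j n m. n \<ge> n0 j \<Longrightarrow> m \<ge> n0 j \<Longrightarrow>
      Lp_powr M p (\<lambda>x. ennreal \<bar>F n x - F m x\<bar>) \<le> ennreal (((1/4) ^ j) powr p)" for j :: nat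
    by metis
  \<comment> \<open>An index past \<open>j\<close> and past the threshold for \<open>j\<close>;
    summing the thresholds ensures that \<open>r (Suc j)\<close> also passes the one for
    \<open>j\<close>.\<close>
  define r where "r j = j + (\<Sum>i\<le>j. n0 i)" for j
  have r: "j \<le> r j" "n0 j \<le> r j" "n0 j \<le> r (Suc j)" for j
    using member_le_sum[of j "{..j}" n0] by (auto simp: r_def)
  show ?thesis
  proof (rule that[of "\<lambda>j. V' (r j)" "\<lambda>j. F (r j)"])
    show "Lp_powr M p (\<lambda>x. ennreal \<bar>F (r (Suc j)) x - F (r j) x\<bar>) \<le> ennreal (((1/4) ^ j) powr p)" for j
      by (rule n0) (use r in auto)
    show "midpoints (\<lambda>k. (u k, \<tau> k)) pmid j (V' (r j), F (r j))" for j
    proof -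
      have "midpoints tup tmid (r j) (a (r j))" using a[of "r j"] by (simp add: K_def)
      then have "midpoints tup tmid j (a (r j))" using r(1)[of j] by (rule midpoints_antimono)
      then have "midpoints tup tmid j (V' (r j), F (r j), G (r j))" by (simp add: a_eq)
      from midpoints_map[OF this, of "\<lambda>(v, F, G). (v, F)" pmid]
      show ?thesis by (simp add: tup_def tmid_def pmid_def split_beta)
    qed
  qed
qed

end

section \<open>The lower bound\<close>

lemma line_integral_split:
  assumes c: "unit_speed l c" and st: "0 \<le> s" "s \<le> r" "r \<le> t" "t \<le> l" and g: "g \<in> borel_measurable borel"
  shows "line_integral c s t g = line_integral c s r g + line_integral c r t g"
proof -
  have "line_integral c s r g + line_integral c r t g
      = (\<integral>\<^sup>+ \<tau>. g (c \<tau>) * indicator {s..r} \<tau> + g (c \<tau>) * indicator {r..t} \<tau> \<partial>lborel)"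
    unfolding line_integral_def using borel_measurable_unit_speed[OF c _ _ g] st
    by (intro nn_integral_add[symmetric]) auto
  also have "\<dots> = line_integral c s t g"
    unfolding line_integral_def
  proof (rule nn_integral_cong_AE)
    have "AE \<tau> in lborel. \<tau> \<noteq> r" by (rule AE_lborel_singleton)
    then show "AE \<tau> in lborel. g (c \<tau>) * indicator {s..r} \<tau> + g (c \<tau>) * indicator {r..t} \<tau> = g (c \<tau>) * indicator {s..t} \<tau>"
      by eventually_elim (use st in \<open>auto simp: indicator_def\<close>)
  qed
  finally show ?thesis ..
qed

context covered_space
begin

text \<open>Every point of the arc is within \<open>rad k\<close> of both ends, so two jumps bound
  the difference by \<open>2 * rad k\<close> times \<open>T k f\<close> at that point, hence by
  \<open>6 * (t - s)\<close> times it. Integrating over the arc and dividing by its length gives the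
  claim.\<close>

lemma step_short_arc:
  assumes c: "unit_speed l c" and st: "0 \<le> s" "s < t" "t \<le> l" and short: "t - s < rad k" "rad k \<le> 3 * (t - s)"
  shows "ennreal \<bar>step k f (c s) - step k f (c t)\<bar> \<le> 6 * line_integral c s t (\<lambda>x. ennreal (T k f x))"
proof -
  let ?h = "step k f" and ?d = "t - s"
  let ?L = "line_integral c s t (\<lambda>x. ennreal (T k f x))"
  have pt: "\<bar>?h (c s) - ?h (c t)\<bar> \<le> 6 * ?d * T k f (c \<tau>)" if \<tau>: "\<tau> \<in> {s..t}" for \<tau>
  proof -
    have "dist (c \<tau>) (c s) < rad k" "dist (c \<tau>) (c t) < rad k"
      using unit_speed_dist[OF c, of \<tau> s] unit_speed_dist[OF c, of \<tau> t] \<tau> st short by auto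
    then have "\<bar>?h (c \<tau>) - ?h (c s)\<bar> \<le> rad k * T k f (c \<tau>)" "\<bar>?h (c \<tau>) - ?h (c t)\<bar> \<le> rad k * T k f (c \<tau>)"
      by (auto intro: step_jump)
    then have "\<bar>?h (c s) - ?h (c t)\<bar> \<le> 2 * rad k * T k f (c \<tau>)" by linarith
    also have "\<dots> \<le> 6 * ?d * T k f (c \<tau>)" using short by (intro mult_right_mono T_nonneg) auto
    finally show ?thesis .
  qed
  have "ennreal ?d * ennreal \<bar>?h (c s) - ?h (c t)\<bar>
      = (\<integral>\<^sup>+ \<tau>. ennreal \<bar>?h (c s) - ?h (c t)\<bar> * indicator {s..t} \<tau> \<partial>lborel)"
    using st by (subst nn_integral_cmult_indicator) (auto simp: mult.commute)
  also have "\<dots> \<le> line_integral c s t (\<lambda>x. ennreal (6 * ?d) * ennreal (T k f x))"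
    unfolding line_integral_def
  proof (rule nn_integral_mono)
    fix \<tau>
    show "ennreal \<bar>?h (c s) - ?h (c t)\<bar> * indicator {s..t} \<tau> \<le> ennreal (6 * ?d) * ennreal (T k f (c \<tau>)) * indicator {s..t} \<tau>"
      using pt[of \<tau>] st by (auto simp: indicator_def ennreal_leI T_nonneg simp flip: ennreal_mult)
  qed
  also have "\<dots> = ennreal (6 * ?d) * ?L"
    using st by (intro line_integral_cmult[OF c]) auto
  also have "\<dots> = ennreal ?d * (6 * ?L)"
    using st ennreal_mult[of 6 ?d] by (simp add: mult_ac)
  finally show ?thesis using st by (simp add: ennreal_mult_le_mult_iff)
qed

text \<open>The arc is cut into equal pieces to which \<open>step_short_arc\<close> applies, and the
  pieces add up.\<close>

lemma step_along_arc:
  assumes c: "unit_speed l c" and st: "0 \<le> s" "s < t" "t \<le> l" and long: "rad k \<le> t - s"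
  shows "ennreal \<bar>step k f (c s) - step k f (c t)\<bar> \<le> 6 * line_integral c s t (\<lambda>x. ennreal (T k f x))"
proof -
  let ?h = "step k f"
  let ?T = "\<lambda>x. ennreal (T k f x)"
  \<comment> \<open>The target length of a piece is half the mesh. Rounding the number up makes the
    pieces shorter still, but not shorter than \<open>rad k / 3\<close>, since the whole arc has
    length at least \<open>rad k\<close>.\<close>
  define n where "n = nat \<lceil>2 * (t - s) / rad k\<rceil>"
  have q: "2 \<le> 2 * (t - s) / rad k" using long by (simp add: field_simps)
  have n: "2 * (t - s) / rad k \<le> real n" "real n \<le> 2 * (t - s) / rad k + 1"
    using q unfolding n_def by linarith+
  define d where "d = (t - s) / real n"
  have n0: "0 < real n" using n q by linarith
  have "real n * rad k \<ge> 2 * (t - s)" using n(1) by (simp add: field_simps)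
  then have d1: "d < rad k" using n0 st rad_pos[of k] by (simp add: d_def field_simps)
  have "real n * rad k \<le> (2 * (t - s) / rad k + 1) * rad k" using n(2) by (intro mult_right_mono) auto
  also have "\<dots> = 2 * (t - s) + rad k"
  proof -
    have "rad k \<noteq> 0" using rad_pos[of k] by linarith
    then show ?thesis by (simp add: distrib_right)
  qed
  also have "\<dots> \<le> 3 * (t - s)" using long by simp
  finally have "real n * rad k \<le> 3 * (t - s)" .
  then have d2: "rad k \<le> 3 * d" using n0 by (simp add: d_def field_simps)
  have d0: "0 < d" using n0 st by (simp add: d_def)
  have "ennreal \<bar>?h (c s) - ?h (c (s + real j * d))\<bar> \<le> 6 * line_integral c s (s + real j * d) ?T" if "j \<le> n" for j
    using that
  proof (induction j)
    case (Suc j)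
    let ?a = "s + real j * d" and ?b = "s + real (Suc j) * d"
    have "real (Suc j) * d \<le> real n * d" using Suc.prems d0 by (intro mult_right_mono) auto
    then have b: "?b \<le> t" using n0 by (simp add: d_def)
    have ab: "0 \<le> ?a" "?a < ?b" "?b - ?a = d" "s \<le> ?a" using st d0 by (auto simp: distrib_right)
    have "ennreal \<bar>?h (c s) - ?h (c ?b)\<bar> \<le> ennreal \<bar>?h (c s) - ?h (c ?a)\<bar> + ennreal \<bar>?h (c ?a) - ?h (c ?b)\<bar>"
      by (simp add: ennreal_leI flip: ennreal_plus)
    also have "\<dots> \<le> 6 * line_integral c s ?a ?T + 6 * line_integral c ?a ?b ?T"
    proof (intro add_mono)
      have sh: "?b - ?a < rad k" "rad k \<le> 3 * (?b - ?a)" using d1 d2 unfolding ab(3) by auto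
      have "?b \<le> l" using b st by linarith
      then show "ennreal \<bar>?h (c ?a) - ?h (c ?b)\<bar> \<le> 6 * line_integral c ?a ?b ?T"
        by (rule step_short_arc[OF c ab(1,2) _ sh])
    qed (use Suc in simp)
    also have "\<dots> = 6 * line_integral c s ?b ?T"
      using st ab b line_integral_split[OF c, of s ?a ?b ?T] by (simp add: distrib_left)
    finally show ?case .
  qed simp
  from this[of n] show ?thesis using n0 by (simp add: d_def)
qed

text \<open>The \<open>p\<close>-th power of \<open>T k f\<close> is dominated by averages of a
  fixed integrable \<open>h\<close>. The part of \<open>h\<close> that is bounded by
  \<open>\<sigma>\<close> and supported in a ball accounts only for bounded values near that ball.
  Whatever exceeds the level is due to averages of the rest of \<open>h\<close>, whose integral is
  small uniformly in \<open>k\<close>.\<close>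

lemma T_tails:
  assumes f: "f \<in> V" and e: "0 < e"
  shows "\<exists>s::nat. \<forall>k::nat. Lp_powr M p (\<lambda>x. ennreal (T (int k) f x
    - min (T (int k) f x) (real s * indicator (ball x0 (real s)) x))) \<le> ennreal e"
proof -
  obtain g where g: "upper_gradient (\<lambda>x. ereal (f x)) g" "Lp_powr M p g < \<infinity>"
    using grad_energy_lessD[OF V_grad_finite[OF f]] by auto
  define h where "h y = ennpowr (g y) p" for y
  have [measurable]: "h \<in> borel_measurable borel"
  proof -
    have [measurable]: "g \<in> borel_measurable borel" using g by (simp add: upper_gradient_def)
    show ?thesis unfolding h_def by measurable
  qed
  have h_eq: "h = (\<lambda>y. ennpowr (g y) p)" by (rule ext) (rule h_def)
  have hM [measurable]: "h \<in> borel_measurable M" by (rule borel_imp_M) simp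
  have h_fin: "(\<integral>\<^sup>+ y. h y \<partial>M) < \<infinity>" using g(2) by (simp add: h_def Lp_powr_def)
  obtain C where C: "0 < C" "\<And>f g k x. f \<in> V \<Longrightarrow> upper_gradient (\<lambda>x. ereal (f x)) g \<Longrightarrow>
    ennreal (T k f x powr p) \<le> ennreal C * ball_avg (\<lambda>y. ennpowr (g y) p) (ctr k (fi k x)) (4 * \<Lambda> * rad k)"
    using T_pointwise_bound by blast
  obtain N where N: "\<And>k x. finite {i \<in> I k. dist (ctr k i) x < (4 * \<Lambda>) * rad k} \<and>
      card {i \<in> I k. dist (ctr k i) x < (4 * \<Lambda>) * rad k} \<le> N"
    using bounded_overlap[of "4 * \<Lambda>"] \<Lambda> by auto
  define W where "W \<sigma> = {y. h y \<le> of_nat \<sigma> \<and> y \<in> ball x0 (real \<sigma>)}" for \<sigma> :: nat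
  have [measurable]: "W \<sigma> \<in> sets borel" for \<sigma>
  proof -
    have "W \<sigma> = {y. h y \<le> of_nat \<sigma>} \<inter> ball x0 (real \<sigma>)" by (auto simp: W_def)
    then show ?thesis by simp
  qed
  have WM [measurable]: "W \<sigma> \<in> sets M" for \<sigma> by (rule sets_borel_M) simp
  have "(\<lambda>\<sigma>. \<integral>\<^sup>+ y. h y * indicator (- W \<sigma>) y \<partial>M) \<longlonglongrightarrow> (\<integral>\<^sup>+ y. 0 \<partial>M)"
  proof (rule nn_integral_dominated_convergence[where w = h])
    have "AE y in M. h y \<noteq> \<infinity>" using h_fin by (intro nn_integral_noteq_infinite) auto
    then show "AE y in M. (\<lambda>\<sigma>. h y * indicator (- W \<sigma>) y) \<longlonglongrightarrow> 0"
    proof eventually_elim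
      case (elim y)
      obtain n1 :: nat where n1: "h y \<le> of_nat n1"
        using elim ennreal_Ex_less_of_nat[of "h y"] by (auto simp: less_top intro: less_imp_le)
      obtain n2 :: nat where n2: "dist x0 y < real n2" using reals_Archimedean2 by blast
      have "h y * indicator (- W \<sigma>) y = 0" if "\<sigma> \<ge> max n1 n2" for \<sigma>
      proof -
        have "(of_nat n1 :: ennreal) \<le> of_nat \<sigma>" using that by simp
        then have "h y \<le> of_nat \<sigma>" using n1 order_trans by blast
        then have "y \<in> W \<sigma>" using n2 that by (simp add: W_def)
        then show ?thesis by simp
      qed
      then have "\<forall>\<^sub>F \<sigma> in sequentially. h y * indicator (- W \<sigma>) y = 0"
        unfolding eventually_sequentially by blast
      then show ?case by (rule tendsto_eventually)
    qed
  qed (use h_fin in \<open>auto simp: indicator_def\<close>)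
  then have lim: "(\<lambda>\<sigma>. \<integral>\<^sup>+ y. h y * indicator (- W \<sigma>) y \<partial>M) \<longlonglongrightarrow> 0" by simp
  \<comment> \<open>Compensates the constant \<open>2 * C\<close> and the overlap count in the final
    estimate; \<open>N + 1\<close> excludes division by 0.\<close>
  define \<delta> where "\<delta> = e / (2 * C * real (N + 1))"
  have \<delta>: "0 < \<delta>" using e C by (simp add: \<delta>_def)
  have "\<forall>\<^sub>F \<sigma> in sequentially. (\<integral>\<^sup>+ y. h y * indicator (- W \<sigma>) y \<partial>M) < ennreal \<delta>"
    using \<delta> by (intro order_tendstoD(2)[OF lim]) simp
  then obtain \<sigma> where \<sigma>: "(\<integral>\<^sup>+ y. h y * indicator (- W \<sigma>) y \<partial>M) < ennreal \<delta>"
    using eventually_happens'[OF sequentially_bot] by blast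
  \<comment> \<open>Outside radius \<open>\<sigma> + 4 * \<Lambda> + 1\<close> the averages no
    longer see \<open>W \<sigma>\<close>. Above the value \<open>2 * C * \<sigma>\<close> the
    contribution \<open>C * \<sigma>\<close> of the bounded part is at most half of the
    \<open>p\<close>-th power and can be absorbed.\<close>
  obtain s :: nat where s: "real \<sigma> + 4 * \<Lambda> + 1 + 2 * C * real \<sigma> \<le> real s" using real_arch_simple by blast
  have s1: "1 \<le> real s" "real \<sigma> + 4 * \<Lambda> + 1 \<le> real s" "2 * C * real \<sigma> \<le> real s"
  proof -
    have "0 \<le> 2 * C * real \<sigma>" using C by simp
    then show "1 \<le> real s" "real \<sigma> + 4 * \<Lambda> + 1 \<le> real s" "2 * C * real \<sigma> \<le> real s" using s \<Lambda> by linarith+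
  qed
  let ?b = "\<lambda>y. h y * indicator (- W \<sigma>) y"
  have "Lp_powr M p (\<lambda>x. ennreal (T (int k) f x - min (T (int k) f x) (real s * indicator (ball x0 (real s)) x))) \<le> ennreal e" for k :: nat
  proof -
    let ?k = "int k"
    let ?c = "\<lambda>x. ctr ?k (fi ?k x)" and ?R = "4 * \<Lambda> * rad ?k"
    have rad1: "rad ?k \<le> 1" by (simp add: rad_def power_int_minus inverse_le_1_iff)
    have R: "0 < ?R" "?R \<le> 4 * \<Lambda>" using \<Lambda> rad1 by (auto simp: mult_left_le)
    have split: "ball_avg h z ?R = ball_avg (\<lambda>y. h y * indicator (W \<sigma>) y) z ?R + ball_avg ?b z ?R" for z
    proof -
      have "(\<integral>\<^sup>+ y \<in> ball z ?R. h y \<partial>M) = (\<integral>\<^sup>+ y. (h y * indicator (W \<sigma>) y) * indicator (ball z ?R) y + ?b y * indicator (ball z ?R) y \<partial>M)"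
        by (intro nn_integral_cong) (auto simp: indicator_def)
      also have "\<dots> = (\<integral>\<^sup>+ y \<in> ball z ?R. h y * indicator (W \<sigma>) y \<partial>M) + (\<integral>\<^sup>+ y \<in> ball z ?R. ?b y \<partial>M)"
        by (rule nn_integral_add) measurable
      finally show ?thesis unfolding ball_avg_def by (simp add: add_divide_distrib_ennreal)
    qed
    have avg_le: "ball_avg (\<lambda>y. h y * indicator (W \<sigma>) y) z ?R \<le> ennreal (real \<sigma>)" for z
    proof -
      have "(\<integral>\<^sup>+ y \<in> ball z ?R. h y * indicator (W \<sigma>) y \<partial>M) \<le> (\<integral>\<^sup>+ y. ennreal (real \<sigma>) * indicator (ball z ?R) y \<partial>M)"
        by (intro nn_integral_mono) (auto simp: indicator_def W_def ennreal_of_nat_eq_real_of_nat)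
      also have "\<dots> = ennreal (real \<sigma>) * ennreal (\<mu> z ?R)"
        by (subst nn_integral_cmult_indicator) (auto simp: emeasure_ball)
      finally have "ball_avg (\<lambda>y. h y * indicator (W \<sigma>) y) z ?R \<le> ennreal (real \<sigma>) * ennreal (\<mu> z ?R) / ennreal (\<mu> z ?R)"
        unfolding ball_avg_def emeasure_ball by (rule divide_right_mono_ennreal)
      then show ?thesis using \<mu>_pos[OF R(1), of z] by (simp add: mult_divide_eq_ennreal)
    qed
    have avg_zero: "ball_avg (\<lambda>y. h y * indicator (W \<sigma>) y) (?c x) ?R = 0" if x: "x \<notin> ball x0 (real s)" for x
    proof -
      have dx: "dist (?c x) x < 1" using fi(2)[of x ?k] rad1 by (simp add: B_eq)
      have zero: "h y * indicator (W \<sigma>) y * indicator (ball (?c x) ?R) y = 0" for y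
      proof (cases "y \<in> W \<sigma> \<and> y \<in> ball (?c x) ?R")
        case True
        then have "dist x0 y < real \<sigma>" "dist (?c x) y < 4 * \<Lambda>" using R by (auto simp: W_def)
        then have "dist x0 x < real \<sigma> + 4 * \<Lambda> + 1"
          using dx dist_triangle[of x0 x y] dist_triangle[of y x "?c x"] by (simp add: dist_commute)
        then show ?thesis using x s1(2) by simp
      qed auto
      have "(\<integral>\<^sup>+ y \<in> ball (?c x) ?R. h y * indicator (W \<sigma>) y \<partial>M) = (\<integral>\<^sup>+ y. 0 \<partial>M)"
        unfolding zero ..
      then show ?thesis by (simp add: ball_avg_def)
    qed
    have pw: "ennpowr (ennreal (T ?k f x - min (T ?k f x) (real s * indicator (ball x0 (real s)) x))) p
        \<le> ennreal (2 * C) * ball_avg ?b (?c x) ?R" for x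
    proof (cases "T ?k f x \<le> real s * indicator (ball x0 (real s)) x")
      case False
      let ?t = "T ?k f x powr p"
      have main: "ennreal ?t \<le> ennreal C * (ball_avg (\<lambda>y. h y * indicator (W \<sigma>) y) (?c x) ?R + ball_avg ?b (?c x) ?R)"
        using C(2)[OF f g(1), of ?k x] split[of "?c x"] unfolding h_eq[symmetric] by simp
      have "ennreal ?t \<le> ennreal (2 * C) * ball_avg ?b (?c x) ?R"
      proof (cases "x \<in> ball x0 (real s)")
        case True
        then have "real s \<le> T ?k f x" using False by simp
        then have "real s powr p \<le> ?t" using p by (intro powr_mono2) auto
        moreover have "real s \<le> real s powr p" using powr_mono[of 1 p "real s"] p s1(1) by simp
        ultimately have half: "C * real \<sigma> \<le> ?t / 2" using s1(3) by linarith
        show ?thesis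
        proof (cases "ball_avg ?b (?c x) ?R")
          case (real r)
          note main
          also have "ennreal C * (ball_avg (\<lambda>y. h y * indicator (W \<sigma>) y) (?c x) ?R + ball_avg ?b (?c x) ?R)
              \<le> ennreal C * (ennreal (real \<sigma>) + ennreal r)"
            unfolding real(2) by (intro mult_left_mono add_right_mono avg_le) auto
          also have "\<dots> = ennreal (C * (real \<sigma> + r))" using C(1) real by (simp flip: ennreal_mult ennreal_plus)
          finally have "?t \<le> C * (real \<sigma> + r)" using C(1) real by (subst (asm) ennreal_le_iff) auto
          then have "?t \<le> 2 * C * r" using half by (simp add: distrib_left)
          then show ?thesis using real C(1) by (simp add: ennreal_leI flip: ennreal_mult)
        next
          case top
          then show ?thesis using C(1) by (simp add: ennreal_mult_top)
        qed
      next
        case False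
        have "ennreal ?t \<le> ennreal C * ball_avg ?b (?c x) ?R" using main avg_zero[OF False] by simp
        also have "\<dots> \<le> ennreal (2 * C) * ball_avg ?b (?c x) ?R" using C(1) by (intro mult_right_mono ennreal_leI) auto
        finally show ?thesis .
      qed
      moreover have "ennpowr (ennreal (T ?k f x - min (T ?k f x) (real s * indicator (ball x0 (real s)) x))) p \<le> ennpowr (ennreal (T ?k f x)) p"
        using p T_nonneg[of ?k f x] by (intro ennpowr_mono ennreal_leI) (auto simp: min_def indicator_def)
      ultimately show ?thesis unfolding ennpowr_ennreal[OF T_nonneg] by (rule order_trans[rotated])
    qed (simp add: min_def)
    have "Lp_powr M p (\<lambda>x. ennreal (T ?k f x - min (T ?k f x) (real s * indicator (ball x0 (real s)) x)))
        \<le> (\<integral>\<^sup>+ x. ennreal (2 * C) * ball_avg ?b (?c x) ?R \<partial>M)"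
      unfolding Lp_powr_def by (rule nn_integral_mono) (rule pw)
    also have "\<dots> = ennreal (2 * C) * (\<integral>\<^sup>+ x. ball_avg ?b (?c x) ?R \<partial>M)"
      by (intro nn_integral_cmult borel_imp_M fi_compose_measurable)
    also have "\<dots> \<le> ennreal (2 * C) * (of_nat N * (\<integral>\<^sup>+ y. ?b y \<partial>M))"
      using \<Lambda> by (intro mult_left_mono nn_integral_ball_avg_le N) auto
    also have "\<dots> \<le> ennreal (2 * C) * (ennreal (real (N + 1)) * ennreal \<delta>)"
      using \<sigma> unfolding ennreal_of_nat_eq_real_of_nat by (intro mult_left_mono mult_mono ennreal_leI) auto
    also have "\<dots> = ennreal (2 * C * (real (N + 1) * \<delta>))"
      using C(1) \<delta> by (simp only: ennreal_mult[symmetric] mult_nonneg_nonneg of_nat_0_le_iff less_imp_le zero_le_numeral)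
    also have "2 * C * (real (N + 1) * \<delta>) = e"
    proof -
      have "2 * C * (X * (e / (2 * C * X))) = e" if "0 < X" for X using C(1) that by (simp add: field_simps)
      from this[of "real (N + 1)"] show ?thesis unfolding \<delta>_def by simp
    qed
    finally show ?thesis .
  qed
  then show ?thesis by blast
qed

text \<open>The factor 12 is the product of the 6 in \<open>step_along_arc\<close> and the 2 in the crude inequality
  \<open>(a + b)\<^sup>p \<le> 2\<^sup>p (a\<^sup>p + b\<^sup>p)\<close>.\<close>

lemma grad_energy_le_liminf:
  assumes f: "f \<in> V" and \<kappa>: "\<And>n. n \<le> \<kappa> n" and L: "\<And>n. T_energy (int (\<kappa> n)) f \<le> ennreal L" "0 \<le> L"
  shows "grad_energy f \<le> ennreal (12 powr p * L)"
proof -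
  have fB [measurable]: "f \<in> borel_measurable borel" by (rule V_measurable[OF f])
  define u where "u n = step (int (\<kappa> n)) f" for n
  define \<tau> where "\<tau> n = T (int (\<kappa> n)) f" for n
  define pmid :: "('a \<Rightarrow> real) \<times> ('a \<Rightarrow> real) \<Rightarrow> _ \<Rightarrow> ('a \<Rightarrow> real) \<times> ('a \<Rightarrow> real)"
    where "pmid = (\<lambda>(v, F) (v', F'). (\<lambda>x. (v x + v' x) / 2, \<lambda>x. (F x + F' x) / 2))"
  define K where "K = midpoints (\<lambda>k. (u k, \<tau> k)) pmid"
  have \<tau> [measurable]: "\<tau> n \<in> borel_measurable borel" and \<tau>0: "0 \<le> \<tau> n x" for n x
    unfolding \<tau>_def by (auto intro: T_nonneg)
  have inv: "F \<in> borel_measurable borel \<and> (\<forall>x. 0 \<le> F x) \<and> Lp_powr M p (\<lambda>x. ennreal (F x)) \<le> ennreal L" if "K n (v, F)" for n v F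
    using that unfolding K_def
  proof (induction "(v, F)" arbitrary: v F rule: midpoints.induct)
    case (base k)
    then show ?case using \<tau> \<tau>0 L(1)[of k] by (auto simp: T_energy_def \<tau>_def)
  next
    case (mid a b)
    obtain v1 F1 v2 F2 where ab: "a = (v1, F1)" "b = (v2, F2)" by (cases a; cases b) auto
    have eq: "F = (\<lambda>x. (F1 x + F2 x) / 2)" using mid.hyps(5) ab by (auto simp: pmid_def)
    have "F1 \<in> borel_measurable borel" "F2 \<in> borel_measurable borel" "\<And>x. 0 \<le> F1 x" "\<And>x. 0 \<le> F2 x"
      "Lp_powr M p (\<lambda>x. ennreal (F1 x)) \<le> ennreal L" "Lp_powr M p (\<lambda>x. ennreal (F2 x)) \<le> ennreal L"
      using mid.hyps(2)[OF ab(1)] mid.hyps(4)[OF ab(2)] by auto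
    then show ?case unfolding eq using L(2) by (auto intro!: Lp_powr_diff_le)
  qed
  \<comment> \<open>Members of \<open>K n\<close> combine scales with mesh at most 2^-n, so
    \<open>step_along_arc\<close> applies to each of them on arcs of at least this length, and
    midpoints preserve the estimate.\<close>
  have arc: "ennreal \<bar>v (c s) - v (c t)\<bar> \<le> 6 * line_integral c s t (\<lambda>x. ennreal (F x))"
    if "K n (v, F)" and c: "unit_speed l c" and st: "0 \<le> s" "s < t" "t \<le> l" and n: "(1/2) ^ n \<le> t - s" for n v F l c s t
    using that(1) unfolding K_def
  proof (induction "(v, F)" arbitrary: v F rule: midpoints.induct)
    case (base k)
    have "rad (int (\<kappa> k)) = (1/2) ^ \<kappa> k" by (simp add: rad_def power_int_minus power_one_over inverse_eq_divide)
    also have "\<dots> \<le> (1/2) ^ n" using base.hyps(1) \<kappa>[of k] by (intro power_decreasing) auto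
    also have "\<dots> \<le> t - s" by (rule n)
    finally show ?case using base.hyps step_along_arc[OF c st, of "int (\<kappa> k)" f] by (simp add: u_def \<tau>_def)
  next
    case (mid a b)
    obtain v1 F1 v2 F2 where ab: "a = (v1, F1)" "b = (v2, F2)" by (cases a; cases b) auto
    have eq: "F = (\<lambda>x. (F1 x + F2 x) / 2)" "v = (\<lambda>x. (v1 x + v2 x) / 2)" using mid.hyps(5) ab by (auto simp: pmid_def)
    have F [measurable]: "F1 \<in> borel_measurable borel" "F2 \<in> borel_measurable borel" and F0: "\<And>x. 0 \<le> F1 x" "\<And>x. 0 \<le> F2 x"
      using inv mid.hyps(1,3) ab unfolding K_def by blast+
    have "ennreal \<bar>v (c s) - v (c t)\<bar> \<le> ennreal (1/2) * (ennreal \<bar>v1 (c s) - v1 (c t)\<bar> + ennreal \<bar>v2 (c s) - v2 (c t)\<bar>)"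
    proof -
      have "v (c s) - v (c t) = 1/2 * ((v1 (c s) - v1 (c t)) + (v2 (c s) - v2 (c t)))"
        unfolding eq by (simp add: field_simps)
      then have "\<bar>v (c s) - v (c t)\<bar> \<le> 1/2 * (\<bar>v1 (c s) - v1 (c t)\<bar> + \<bar>v2 (c s) - v2 (c t)\<bar>)"
        using abs_triangle_ineq[of "v1 (c s) - v1 (c t)" "v2 (c s) - v2 (c t)"] by (simp only: abs_mult) simp
      then have "ennreal \<bar>v (c s) - v (c t)\<bar> \<le> ennreal (1/2 * (\<bar>v1 (c s) - v1 (c t)\<bar> + \<bar>v2 (c s) - v2 (c t)\<bar>))"
        by (rule ennreal_leI)
      then show ?thesis by (subst (asm) ennreal_mult) (auto simp: ennreal_plus)
    qed
    also have "\<dots> \<le> ennreal (1/2) * (6 * line_integral c s t (\<lambda>x. ennreal (F1 x)) + 6 * line_integral c s t (\<lambda>x. ennreal (F2 x)))"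
      by (intro mult_left_mono add_mono mid.hyps(2)[OF ab(1)] mid.hyps(4)[OF ab(2)]) auto
    also have "\<dots> = 6 * (ennreal (1/2) * line_integral c s t (\<lambda>x. ennreal (F1 x) + ennreal (F2 x)))"
      using st by (subst line_integral_add[OF c]) (auto simp: distrib_left mult_ac)
    also have "ennreal (1/2) * line_integral c s t (\<lambda>x. ennreal (F1 x) + ennreal (F2 x))
        = line_integral c s t (\<lambda>x. ennreal (1/2) * (ennreal (F1 x) + ennreal (F2 x)))"
      using st by (intro line_integral_cmult[OF c, symmetric]) auto
    also have "(\<lambda>x. ennreal (1/2) * (ennreal (F1 x) + ennreal (F2 x))) = (\<lambda>x. ennreal (F x))"
    proof
      fix x
      have "ennreal (1/2) * (ennreal (F1 x) + ennreal (F2 x)) = ennreal (1/2 * (F1 x + F2 x))"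
        using F0[of x] by (subst ennreal_mult) (auto simp: ennreal_plus)
      then show "ennreal (1/2) * (ennreal (F1 x) + ennreal (F2 x)) = ennreal (F x)" by (simp add: eq)
    qed
    finally show ?case .
  qed
  \<comment> \<open>Combinations of late terms inherit pointwise convergence, because an interval
    about \<open>y\<close> is convex.\<close>
  have close: "\<bar>v x - y\<bar> \<le> e" if "K n (v, F)" and k: "\<And>k. k \<ge> n \<Longrightarrow> \<bar>u k x - y\<bar> \<le> e" for n v F x y e
    using that(1) unfolding K_def
  proof (induction "(v, F)" arbitrary: v F rule: midpoints.induct)
    case (base k)
    then show ?case using k by simp
  next
    case (mid a b)
    obtain v1 F1 v2 F2 where ab: "a = (v1, F1)" "b = (v2, F2)" by (cases a; cases b) auto
    have eq: "v = (\<lambda>x. (v1 x + v2 x) / 2)" using mid.hyps(5) ab by (auto simp: pmid_def)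
    have "\<bar>v1 x - y\<bar> \<le> e" "\<bar>v2 x - y\<bar> \<le> e" using mid.hyps(2)[OF ab(1)] mid.hyps(4)[OF ab(2)] by auto
    then show ?case unfolding eq by argo
  qed
  define x0 :: 'a where "x0 = undefined"
  have tails: "\<exists>s. \<forall>k. Lp_powr M p (\<lambda>x. ennreal (\<tau> k x - min (\<tau> k x) (real s * indicator (ball x0 (real s)) x))) \<le> ennreal e"
    if "0 < e" for e
    using T_tails[OF f that, of x0] unfolding \<tau>_def by blast
  obtain v F where vF: "\<And>j::nat. K j (v j, F j)"
    and rapid: "\<And>j. Lp_powr M p (\<lambda>x. ennreal \<bar>F (Suc j) x - F j x\<bar>) \<le> ennreal (((1/4) ^ j) powr p)"
    using mazur[of \<tau> x0 u, OF \<tau> \<tau>0 tails] unfolding K_def pmid_def by blast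
  have FB [measurable]: "F j \<in> borel_measurable borel" and F0: "0 \<le> F j x" and FL: "Lp_powr M p (\<lambda>x. ennreal (F j x)) \<le> ennreal L" for j x
    using inv[OF vF] by auto
  obtain \<rho> where \<rho> [measurable]: "\<rho> \<in> borel_measurable borel" and \<rho>_fin: "Lp_powr M p \<rho> < \<infinity>"
    and dom: "\<And>j x. ennreal \<bar>F (Suc j) x - F j x\<bar> \<le> ennreal ((1/2) ^ j) * \<rho> x"
  proof (rule rapid_domination[OF _ rapid])
    show "(\<lambda>x. ennreal \<bar>F (Suc j) x - F j x\<bar>) \<in> borel_measurable borel" for j by measurable
  qed blast
  have F_dom: "ennreal (F (j + i) x) \<le> ennreal (F j x) + ennreal (2 * (1/2) ^ j) * \<rho> x" for i j x
  proof -
    \<comment> \<open>The sharper coefficient is the geometric sum over the exponents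
      \<open>j\<close> to \<open>j + i - 1\<close>, which makes the induction go through.\<close>
    have "ennreal (F (j + i) x) \<le> ennreal (F j x) + ennreal (2 * (1/2) ^ j - 2 * (1/2) ^ (j + i)) * \<rho> x"
    proof (induction i)
      case (Suc i)
      have "ennreal (F (j + Suc i) x) \<le> ennreal (F (j + i) x) + ennreal \<bar>F (Suc (j + i)) x - F (j + i) x\<bar>"
        using F0[of "j + i" x] by (simp add: ennreal_leI flip: ennreal_plus)
      also have "\<dots> \<le> (ennreal (F j x) + ennreal (2 * (1/2) ^ j - 2 * (1/2) ^ (j + i)) * \<rho> x) + ennreal ((1/2) ^ (j + i)) * \<rho> x"
        by (intro add_mono Suc dom)
      also have "\<dots> = ennreal (F j x) + (ennreal (2 * (1/2) ^ j - 2 * (1/2) ^ (j + i)) + ennreal ((1/2) ^ (j + i))) * \<rho> x"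
        by (simp add: add.assoc distrib_right)
      also have "ennreal (2 * (1/2) ^ j - 2 * (1/2) ^ (j + i)) + ennreal ((1/2) ^ (j + i)) = ennreal (2 * (1/2) ^ j - 2 * (1/2) ^ (j + Suc i))"
      proof -
        have "(1/2 :: real) ^ (j + i) \<le> (1/2) ^ j" by (intro power_decreasing) auto
        then show ?thesis by (subst ennreal_plus[symmetric]) auto
      qed
      finally show ?case .
    qed simp
    also have "\<dots> \<le> ennreal (F j x) + ennreal (2 * (1/2) ^ j) * \<rho> x"
      by (intro add_left_mono mult_right_mono ennreal_leI) auto
    finally show ?thesis .
  qed
  obtain g where g: "upper_gradient (\<lambda>x. ereal (f x)) g" "Lp_powr M p g < \<infinity>"
    using grad_energy_lessD[OF V_grad_finite[OF f]] by auto
  have gB [measurable]: "g \<in> borel_measurable borel" using g by (simp add: upper_gradient_def)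
  \<comment> \<open>The points where the step functions fail to converge to \<open>f\<close>, with
    quantifiers over naturals only, for measurability.\<close>
  define E where "E = {x. \<not> (\<forall>i::nat. \<exists>n0. \<forall>n\<ge>n0. \<bar>u n x - f x\<bar> \<le> 1 / real (Suc i))}"
  have [measurable]: "u n \<in> borel_measurable borel" for n unfolding u_def by measurable
  have EB [measurable]: "E \<in> sets borel" unfolding E_def by measurable
  have "AE x in M. x \<notin> E"
    using step_converges[OF f]
  proof eventually_elim
    case (elim x)
    have "\<exists>n0. \<forall>n\<ge>n0. \<bar>u n x - f x\<bar> \<le> 1 / real (Suc i)" for i :: nat
    proof -
      obtain n0 where "\<And>n. n \<ge> n0 \<Longrightarrow> norm (step (int n) f x - f x) < 1 / real (Suc i)"
        using LIMSEQ_D[OF elim, of "1 / real (Suc i)"] by auto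
      then have "\<bar>u n x - f x\<bar> \<le> 1 / real (Suc i)" if "n \<ge> n0" for n
        using \<kappa>[of n] that unfolding u_def by (force intro: less_imp_le)
      then show ?thesis by blast
    qed
    then show ?case by (simp add: E_def)
  qed
  then have E0: "emeasure M E = 0" by (rule emeasure_eq_0_AE[OF EB])
  \<comment> \<open>One error function for three purposes: \<open>\<rho>\<close> bounds the tails of
    the combinations, \<open>g\<close> pays for moving the end points, and the last term keeps arcs
    of finite integral outside \<open>E\<close> at almost all times.\<close>
  define R where "R x = \<rho> x + (g x + \<infinity> * indicator E x)" for x
  have RB [measurable]: "R \<in> borel_measurable borel" unfolding R_def by measurable
  have R_fin: "Lp_powr M p R < \<infinity>"
    unfolding R_def using Lp_powr_indicator_null[OF EB E0] g(2) \<rho>_fin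
    by (intro Lp_powr_add_finite) auto
  have ug: "upper_gradient (\<lambda>x. ereal (f x)) (\<lambda>x. 6 * ennreal (F j x) + ennreal (12 * (1/2) ^ j) * R x)" for j
  proof (rule upper_gradient_realI[OF fB])
    show "(\<lambda>x. 6 * ennreal (F j x) + ennreal (12 * (1/2) ^ j) * R x) \<in> borel_measurable borel" by measurable
    fix l and c :: "real \<Rightarrow> 'a" assume c: "unit_speed l c"
    have l: "0 < l" using c by (simp add: unit_speed_def)
    let ?A = "line_integral c 0 l (\<lambda>x. 6 * ennreal (F j x) + ennreal (12 * (1/2) ^ j) * R x)"
    have A_eq: "?A = 6 * line_integral c 0 l (\<lambda>x. ennreal (F j x)) + ennreal (12 * (1/2) ^ j) * line_integral c 0 l R"
    proof -
      have "?A = line_integral c 0 l (\<lambda>x. 6 * ennreal (F j x)) + line_integral c 0 l (\<lambda>x. ennreal (12 * (1/2) ^ j) * R x)"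
        by (rule line_integral_add[OF c]) auto
      then show ?thesis by (simp add: line_integral_cmult[OF c])
    qed
    show "ennreal \<bar>f (c 0) - f (c l)\<bar> \<le> ?A"
    proof (cases "line_integral c 0 l R = \<infinity>")
      case True
      then show ?thesis unfolding A_eq by (simp add: ennreal_mult_top)
    next
      case False
      have R_eq: "line_integral c 0 l R = line_integral c 0 l \<rho> + (line_integral c 0 l g + line_integral c 0 l (\<lambda>x. \<infinity> * indicator E x))"
        unfolding R_def by (simp add: line_integral_add[OF c])
      then have fin: "line_integral c 0 l g < \<infinity>" "line_integral c 0 l (\<lambda>x. \<infinity> * indicator E x) < \<infinity>"
        using False by (auto simp: less_top)
      \<comment> \<open>Between points outside \<open>E\<close> the estimate \<open>arc\<close>
        passes to the limit. The index \<open>n\<close> is large enough for convergence at both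
        points and for the length of the subarc, and \<open>F n\<close> is replaced by
        \<open>F j\<close> plus the tail.\<close>
      have good: "ennreal \<bar>f (c s) - f (c t)\<bar> \<le> ?A" if st: "0 \<le> s" "s < t" "t \<le> l" and E: "c s \<notin> E" "c t \<notin> E" for s t
      proof (rule ennreal_le_epsilon)
        fix e :: real assume e: "0 < e"
        obtain i :: nat where i: "1 / real (Suc i) < e / 2" using nat_approx_posE[of "e/2"] e by auto
        obtain n1 where n1: "\<And>n. n \<ge> n1 \<Longrightarrow> \<bar>u n (c s) - f (c s)\<bar> \<le> 1 / real (Suc i)" using E(1) unfolding E_def by blast
        obtain n2 where n2: "\<And>n. n \<ge> n2 \<Longrightarrow> \<bar>u n (c t) - f (c t)\<bar> \<le> 1 / real (Suc i)" using E(2) unfolding E_def by blast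
        obtain n3 where n3: "(1/2) ^ n3 < t - s" using real_arch_pow_inv[of "t - s" "1/2"] st by auto
        define n where "n = j + (n1 + n2 + n3)"
        have "(1/2 :: real) ^ n \<le> (1/2) ^ n3" by (intro power_decreasing) (auto simp: n_def)
        then have short: "(1/2) ^ n \<le> t - s" using n3 by linarith
        have "\<bar>v n (c s) - f (c s)\<bar> \<le> 1 / real (Suc i)" "\<bar>v n (c t) - f (c t)\<bar> \<le> 1 / real (Suc i)"
          by (rule close[OF vF]; use n1 n2 in \<open>simp add: n_def\<close>)+
        then have "\<bar>f (c s) - f (c t)\<bar> \<le> \<bar>v n (c s) - v n (c t)\<bar> + e" using i by linarith
        then have "ennreal \<bar>f (c s) - f (c t)\<bar> \<le> ennreal \<bar>v n (c s) - v n (c t)\<bar> + ennreal e"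
          using e by (simp add: ennreal_leI flip: ennreal_plus)
        also have "ennreal \<bar>v n (c s) - v n (c t)\<bar> \<le> 6 * line_integral c s t (\<lambda>x. ennreal (F n x))"
          by (rule arc[OF vF c st short])
        also have "line_integral c s t (\<lambda>x. ennreal (F n x)) \<le> line_integral c 0 l (\<lambda>x. ennreal (F j x) + ennreal (2 * (1/2) ^ j) * R x)"
        proof -
          have "line_integral c s t (\<lambda>x. ennreal (F n x)) \<le> line_integral c 0 l (\<lambda>x. ennreal (F n x))"
            by (rule line_integral_subset) (use st in auto)
          also have "\<dots> \<le> line_integral c 0 l (\<lambda>x. ennreal (F j x) + ennreal (2 * (1/2) ^ j) * R x)"
          proof (rule line_integral_mono)
            fix \<tau>
            have "ennreal (F n (c \<tau>)) \<le> ennreal (F j (c \<tau>)) + ennreal (2 * (1/2) ^ j) * \<rho> (c \<tau>)"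
              unfolding n_def by (rule F_dom)
            also have "\<dots> \<le> ennreal (F j (c \<tau>)) + ennreal (2 * (1/2) ^ j) * R (c \<tau>)"
              by (intro add_left_mono mult_left_mono) (auto simp: R_def)
            finally show "ennreal (F n (c \<tau>)) \<le> ennreal (F j (c \<tau>)) + ennreal (2 * (1/2) ^ j) * R (c \<tau>)" .
          qed
          finally show ?thesis .
        qed
        also have "6 * line_integral c 0 l (\<lambda>x. ennreal (F j x) + ennreal (2 * (1/2) ^ j) * R x) = ?A"
        proof -
          have "line_integral c 0 l (\<lambda>x. ennreal (F j x) + ennreal (2 * (1/2) ^ j) * R x)
              = line_integral c 0 l (\<lambda>x. ennreal (F j x)) + ennreal (2 * (1/2) ^ j) * line_integral c 0 l R"
            by (subst line_integral_add[OF c]) (auto simp: line_integral_cmult[OF c])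
          moreover have "6 * ennreal (2 * (1/2) ^ j) = ennreal (12 * (1/2) ^ j)"
            using ennreal_mult[of 6 "2 * (1/2) ^ j"] by simp
          ultimately show ?thesis unfolding A_eq by (simp only: distrib_left mult.assoc[symmetric])
        qed
        finally show "ennreal \<bar>f (c s) - f (c t)\<bar> \<le> ?A + ennreal e" by (simp add: add_right_mono mult_left_mono)
      qed
      show ?thesis
      proof (rule ennreal_le_epsilon)
        fix e :: real assume e: "0 < e"
        \<comment> \<open>End pieces on which \<open>g\<close> has small integral; points outside
          \<open>E\<close> are picked in them. The minimum and maximum with \<open>l/2\<close> keep
          the two points in order.\<close>
        obtain d1 where d1: "0 < d1" "d1 < l" "line_integral c 0 d1 g < ennreal (e/2)"
          using line_integral_small(1)[OF c gB fin(1), of "ennreal (e/2)"] e by auto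
        obtain d2 where d2: "0 < d2" "d2 < l" "line_integral c (l - d2) l g < ennreal (e/2)"
          using line_integral_small(2)[OF c gB fin(1), of "ennreal (e/2)"] e by auto
        have m: "0 < min d1 (l/2)" "min d1 (l/2) \<le> l" "0 \<le> max (l - d2) (l/2)" "max (l - d2) (l/2) < l"
          using l d1 d2 by auto
        obtain s where s: "0 < s" "s < min d1 (l/2)" "c s \<notin> E"
          using unit_speed_avoids[OF c order_refl m(1,2) EB fin(2)] by blast
        obtain t where t: "max (l - d2) (l/2) < t" "t < l" "c t \<notin> E"
          using unit_speed_avoids[OF c m(3,4) order_refl EB fin(2)] by blast
        have "ennreal \<bar>f (c 0) - f (c s)\<bar> \<le> line_integral c 0 s g"
          using upper_gradient_subarc[OF g(1) c, of 0 s] s l by simp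
        also have "\<dots> \<le> line_integral c 0 d1 g" by (rule line_integral_subset) (use s in auto)
        finally have 1: "ennreal \<bar>f (c 0) - f (c s)\<bar> \<le> ennreal (e/2)" using d1 by simp
        have "ennreal \<bar>f (c t) - f (c l)\<bar> \<le> line_integral c t l g"
          using upper_gradient_subarc[OF g(1) c, of t l] t l by simp
        also have "\<dots> \<le> line_integral c (l - d2) l g" by (rule line_integral_subset) (use t in auto)
        finally have 3: "ennreal \<bar>f (c t) - f (c l)\<bar> \<le> ennreal (e/2)" using d2 by simp
        have 2: "ennreal \<bar>f (c s) - f (c t)\<bar> \<le> ?A" by (rule good) (use s t in auto)
        have "ennreal \<bar>f (c 0) - f (c l)\<bar> \<le> ennreal (\<bar>f (c s) - f (c t)\<bar> + (\<bar>f (c 0) - f (c s)\<bar> + \<bar>f (c t) - f (c l)\<bar>))"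
          by (rule ennreal_leI) linarith
        also have "\<dots> = ennreal \<bar>f (c s) - f (c t)\<bar> + (ennreal \<bar>f (c 0) - f (c s)\<bar> + ennreal \<bar>f (c t) - f (c l)\<bar>)"
          by (simp add: ennreal_plus)
        also have "\<dots> \<le> ?A + (ennreal (e/2) + ennreal (e/2))" by (intro add_mono 1 2 3)
        also have "ennreal (e/2) + ennreal (e/2) = ennreal e" using e by (subst ennreal_plus[symmetric]) auto
        finally show "ennreal \<bar>f (c 0) - f (c l)\<bar> \<le> ?A + ennreal e" .
      qed
    qed
  qed
  obtain r where r: "0 \<le> r" "Lp_powr M p R = ennreal r"
    using R_fin by (metis infinity_ennreal_def less_top_ennreal)
  have bound: "grad_energy f \<le> ennreal (2 powr p * (6 powr p * L + (12 * (1/2) ^ j) powr p * r))" for j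
  proof -
    have "grad_energy f \<le> Lp_powr M p (\<lambda>x. 6 * ennreal (F j x) + ennreal (12 * (1/2) ^ j) * R x)"
      by (rule grad_energy_le[OF ug])
    also have "\<dots> \<le> ennreal (2 powr p) * (Lp_powr M p (\<lambda>x. 6 * ennreal (F j x)) + Lp_powr M p (\<lambda>x. ennreal (12 * (1/2) ^ j) * R x))"
      by (intro Lp_powr_add_le) auto
    also have "Lp_powr M p (\<lambda>x. ennreal (12 * (1/2) ^ j) * R x) = ennreal ((12 * (1/2) ^ j) powr p * r)"
      using Lp_powr_cmult[OF RB, of "ennreal (12 * (1/2) ^ j)"] ennpowr_ennreal[of "12 * (1/2) ^ j" p] r
      by (simp add: ennreal_mult del: ennreal_numeral)
    also have "Lp_powr M p (\<lambda>x. 6 * ennreal (F j x)) = ennreal (6 powr p) * Lp_powr M p (\<lambda>x. ennreal (F j x))"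
      using Lp_powr_cmult[of "\<lambda>x. ennreal (F j x)" 6] ennpowr_ennreal[of 6 p] by simp
    also have "ennreal (2 powr p) * (ennreal (6 powr p) * Lp_powr M p (\<lambda>x. ennreal (F j x)) + ennreal ((12 * (1/2) ^ j) powr p * r))
        \<le> ennreal (2 powr p) * (ennreal (6 powr p) * ennreal L + ennreal ((12 * (1/2) ^ j) powr p * r))"
      by (intro mult_left_mono add_right_mono FL) auto
    also have "\<dots> = ennreal (2 powr p * (6 powr p * L + (12 * (1/2) ^ j) powr p * r))"
    proof -
      have "ennreal x * (ennreal y * ennreal L + ennreal z) = ennreal (x * (y * L + z))"
        if "0 \<le> x" "0 \<le> y" "0 \<le> z" for x y z
        using that L(2) by (simp add: ennreal_mult ennreal_plus)
      then show ?thesis using r(1) by simp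
    qed
    finally show ?thesis .
  qed
  have "(\<lambda>j. 2 powr p * (6 powr p * L + (12 * (1/2) ^ j) powr p * r)) \<longlonglongrightarrow> 2 powr p * (6 powr p * L + (12 * 0) powr p * r)"
    by (intro tendsto_intros LIMSEQ_power_zero tendsto_powr2) (use p in auto)
  then have "(\<lambda>j. ennreal (2 powr p * (6 powr p * L + (12 * (1/2) ^ j) powr p * r))) \<longlonglongrightarrow> ennreal (2 powr p * (6 powr p * L + (12 * 0) powr p * r))"
    by (rule tendsto_ennrealI)
  then have "grad_energy f \<le> ennreal (2 powr p * (6 powr p * L + (12 * 0) powr p * r))"
    using bound by (intro LIMSEQ_le_const) auto
  also have "2 powr p * (6 powr p * L + (12 * 0) powr p * r) = 12 powr p * L"
    using p by (simp add: mult.assoc[symmetric] flip: powr_mult)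
  finally show ?thesis .
qed

end

section \<open>Uniform convexity\<close>

text \<open>The mean value theorem on the two halves, with a strictly increasing derivative. The
  left end 0 is computed directly, so that the derivative is evaluated at positive points
  only.\<close>

lemma powr_midpoint_strict:
  fixes x y p :: real
  assumes p: "1 < p" and xy: "0 \<le> x" "x < y"
  shows "((x + y) / 2) powr p < (x powr p + y powr p) / 2"
proof (cases "x = 0")
  case True
  have "(1/2) powr p < (1/2 :: real) powr 1" using p by (intro powr_less_mono') auto
  then have "(1/2) powr p * y powr p < 1/2 * y powr p" using xy by (intro mult_strict_right_mono) auto
  then show ?thesis using True xy by (simp flip: powr_mult)
next
  case False
  define c where "c = (x + y) / 2"
  have c: "0 < x" "x < c" "c < y" "y - c = c - x" using False xy by (auto simp: c_def field_simps)
  have deriv: "((\<lambda>z. z powr p) has_real_derivative p * z powr (p - 1)) (at z)" if "0 < z" for z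
    using has_real_derivative_powr[OF that] .
  obtain \<eta> where \<eta>: "x < \<eta>" "\<eta> < c" "c powr p - x powr p = (c - x) * (p * \<eta> powr (p - 1))"
    using MVT2[OF c(2), of "\<lambda>z. z powr p" "\<lambda>z. p * z powr (p - 1)"] deriv c(1) by force
  obtain \<xi> where \<xi>: "c < \<xi>" "\<xi> < y" "y powr p - c powr p = (y - c) * (p * \<xi> powr (p - 1))"
    using MVT2[OF c(3), of "\<lambda>z. z powr p" "\<lambda>z. p * z powr (p - 1)"] deriv c(1,2) by force
  have "\<eta> powr (p - 1) < \<xi> powr (p - 1)" using p c \<eta> \<xi> by (intro powr_less_mono2) auto
  then have "c powr p - x powr p < y powr p - c powr p"
    unfolding \<eta>(3) \<xi>(3) c(4) using p c by (intro mult_strict_left_mono) auto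
  then show ?thesis by (simp add: c_def)
qed

text \<open>Different absolute values reduce to the half line by the triangle inequality; equal ones
  force \<open>b = - a\<close>, with midpoint 0.\<close>

lemma abs_powr_midpoint_strict:
  fixes a b p :: real
  assumes p: "1 < p" and ab: "a \<noteq> b"
  shows "\<bar>(a + b) / 2\<bar> powr p < (\<bar>a\<bar> powr p + \<bar>b\<bar> powr p) / 2"
proof -
  have mono: "\<bar>(a + b) / 2\<bar> powr p \<le> ((\<bar>a\<bar> + \<bar>b\<bar>) / 2) powr p"
    using p by (intro powr_mono2) auto
  consider "\<bar>a\<bar> < \<bar>b\<bar>" | "\<bar>b\<bar> < \<bar>a\<bar>" | "\<bar>a\<bar> = \<bar>b\<bar>" by linarith
  then show ?thesis
  proof cases
    case 1
    then show ?thesis using powr_midpoint_strict[OF p, of "\<bar>a\<bar>" "\<bar>b\<bar>"] mono by simp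
  next
    case 2
    then show ?thesis using powr_midpoint_strict[OF p, of "\<bar>b\<bar>" "\<bar>a\<bar>"] mono by (simp add: add.commute)
  next
    case 3
    then have "b = - a" "a \<noteq> 0" using ab by auto
    then show ?thesis by simp
  qed
qed

text \<open>A form of uniform convexity of \<open>t \<mapsto> \<bar>t\<bar>\<^sup>p\<close> that is additive in all terms and hence survives
  summation and integration.\<close>

lemma uniform_convexity_powr:
  fixes p \<epsilon> :: real
  assumes p: "1 < p" and \<epsilon>: "0 < \<epsilon>"
  obtains c where "0 < c" "\<And>a b :: real. c * \<bar>a - b\<bar> powr p + \<bar>(a + b) / 2\<bar> powr p
    \<le> (1/2 + c * \<epsilon>) * (\<bar>a\<bar> powr p + \<bar>b\<bar> powr p)"
proof -
  let ?n = "\<lambda>z::real \<times> real. \<bar>fst z\<bar> powr p + \<bar>snd z\<bar> powr p"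
  \<comment> \<open>Normalised pairs that are not close form a compact set, on which the gap in the
    strict midpoint inequality is bounded below by some \<open>\<delta> > 0\<close>.\<close>
  define K where "K = {z. ?n z = 1 \<and> \<epsilon> \<le> \<bar>fst z - snd z\<bar> powr p}"
  have cont: "continuous_on UNIV (\<lambda>z::real \<times> real. \<bar>h z\<bar> powr p)" if "continuous_on UNIV h" for h
    using p that by (intro continuous_on_powr' continuous_intros) auto
  have "closed K"
    unfolding K_def by (intro closed_Collect_conj closed_Collect_eq closed_Collect_le cont continuous_intros)
  moreover have "bounded K"
  proof (rule boundedI)
    fix z assume z: "z \<in> K"
    have le1: "\<bar>t\<bar> \<le> 1" if "\<bar>t\<bar> powr p \<le> 1" for t :: real
    proof (rule ccontr)
      assume "\<not> ?thesis"
      then have "1 powr p < \<bar>t\<bar> powr p" using p by (intro powr_less_mono2) auto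
      then show False using that by simp
    qed
    have "\<bar>fst z\<bar> powr p + \<bar>snd z\<bar> powr p = 1" using z by (simp add: K_def)
    then have "\<bar>fst z\<bar> powr p \<le> 1" "\<bar>snd z\<bar> powr p \<le> 1"
      using powr_ge_zero[of "\<bar>fst z\<bar>" p] powr_ge_zero[of "\<bar>snd z\<bar>" p] by linarith+
    then have "norm (fst z) \<le> 1" "norm (snd z) \<le> 1" using le1 by auto
    then show "norm z \<le> 2" using norm_Pair_le[of "fst z" "snd z"] by simp
  qed
  ultimately have "compact K" by (simp add: compact_eq_bounded_closed)
  let ?\<phi> = "\<lambda>z::real \<times> real. ?n z / 2 - \<bar>(fst z + snd z) / 2\<bar> powr p"
  obtain \<delta> where \<delta>: "0 < \<delta>" "\<And>z. z \<in> K \<Longrightarrow> \<delta> \<le> ?\<phi> z"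
  proof (cases "K = {}")
    case False
    have "continuous_on K ?\<phi>"
    proof (rule continuous_on_subset[of UNIV])
      have sc: "continuous_on UNIV (\<lambda>z::real \<times> real. (fst z + snd z) / 2)"
        by (intro continuous_intros) auto
      have fs: "continuous_on UNIV (\<lambda>z::real \<times> real. fst z)" "continuous_on UNIV (\<lambda>z::real \<times> real. snd z)"
        by (intro continuous_intros)+
      have "continuous_on UNIV (\<lambda>z::real \<times> real. ?n z / 2)"
        by (rule continuous_on_divide[OF continuous_on_add[OF cont[OF fs(1)] cont[OF fs(2)]] continuous_on_const]) simp
      then show "continuous_on UNIV ?\<phi>" using cont[OF sc] by (rule continuous_on_diff)
    qed simp
    then obtain z where z: "z \<in> K" "\<And>y. y \<in> K \<Longrightarrow> ?\<phi> z \<le> ?\<phi> y"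
      using continuous_attains_inf[OF \<open>compact K\<close> False] by blast
    have "fst z \<noteq> snd z" using z(1) \<epsilon> by (auto simp: K_def)
    then have "0 < ?\<phi> z" using abs_powr_midpoint_strict[OF p] by fastforce
    then show ?thesis using that z(2) by blast
  qed (use that[of 1] in auto)
  \<comment> \<open>On normalised pairs \<open>\<bar>a - b\<bar> powr p\<close> is at most
    \<open>2 powr p\<close>, so the first term costs at most \<open>\<delta>\<close>; for close
    pairs it costs at most \<open>c * \<epsilon>\<close>.\<close>
  define c where "c = \<delta> / 2 powr p"
  have c: "0 < c" using \<delta> by (simp add: c_def)
  have unit: "c * \<bar>a - b\<bar> powr p + \<bar>(a + b) / 2\<bar> powr p \<le> 1/2 + c * \<epsilon>" if n: "\<bar>a\<bar> powr p + \<bar>b\<bar> powr p = 1" for a b :: real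
  proof (cases "\<epsilon> \<le> \<bar>a - b\<bar> powr p")
    case True
    then have "\<delta> \<le> ?\<phi> (a, b)" using n by (intro \<delta>(2)) (simp add: K_def)
    then have 1: "\<bar>(a + b) / 2\<bar> powr p \<le> 1/2 - \<delta>" using n by simp
    have "\<bar>a - b\<bar> powr p = 2 powr p * \<bar>(a + - b) / 2\<bar> powr p" by (simp flip: powr_mult)
    also have "\<bar>(a + - b) / 2\<bar> powr p \<le> (1/2 * \<bar>a\<bar> + (1 - 1/2) * \<bar>b\<bar>) powr p"
      using p by (intro powr_mono2) auto
    also have "\<dots> \<le> 1/2 * \<bar>a\<bar> powr p + (1 - 1/2) * \<bar>b\<bar> powr p"
      using p by (intro powr_convex_combination) auto
    also have "\<dots> \<le> 1" using n by simp
    finally have "\<bar>a - b\<bar> powr p \<le> 2 powr p" by simp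
    then have "c * \<bar>a - b\<bar> powr p \<le> \<delta>" using \<delta> by (simp add: c_def field_simps)
    then show ?thesis using 1 mult_pos_pos[OF c \<epsilon>] by linarith
  next
    case False
    have "\<bar>(a + b) / 2\<bar> powr p \<le> 1/2"
      using abs_powr_midpoint_strict[OF p, of a b] n by (cases "a = b") auto
    moreover have "c * \<bar>a - b\<bar> powr p \<le> c * \<epsilon>" using False c by (intro mult_left_mono) auto
    ultimately show ?thesis by linarith
  qed
  show ?thesis
  proof (rule that[OF c])
    fix a b :: real
    define s where "s = \<bar>a\<bar> powr p + \<bar>b\<bar> powr p"
    show "c * \<bar>a - b\<bar> powr p + \<bar>(a + b) / 2\<bar> powr p \<le> (1/2 + c * \<epsilon>) * (\<bar>a\<bar> powr p + \<bar>b\<bar> powr p)"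
    proof (cases "s = 0")
      case True
      then have "\<bar>a\<bar> powr p = 0 \<and> \<bar>b\<bar> powr p = 0"
        using powr_ge_zero[of "\<bar>a\<bar>" p] powr_ge_zero[of "\<bar>b\<bar>" p] unfolding s_def by linarith
      then show ?thesis by simp
    next
      case False
      then have s: "0 < s" using powr_ge_zero[of "\<bar>a\<bar>" p] powr_ge_zero[of "\<bar>b\<bar>" p] unfolding s_def by linarith
      \<comment> \<open>Both sides are homogeneous of degree \<open>p\<close>, which reduces to
        normalised pairs.\<close>
      define r where "r = s powr (1/p)"
      have r: "0 < r" "r powr p = s" using s p by (auto simp: r_def powr_powr)
      have scale: "\<bar>r * t\<bar> powr p = s * \<bar>t\<bar> powr p" for t using r by (simp add: abs_mult powr_mult)
      obtain a' b' where ab: "a = r * a'" "b = r * b'"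
        using r(1) by (metis nonzero_mult_div_cancel_left times_divide_eq_right less_irrefl)
      have "s * (\<bar>a'\<bar> powr p + \<bar>b'\<bar> powr p) = \<bar>r * a'\<bar> powr p + \<bar>r * b'\<bar> powr p"
        unfolding scale by (rule distrib_left)
      also have "\<dots> = s * 1" by (simp add: s_def ab)
      finally have "s * (\<bar>a'\<bar> powr p + \<bar>b'\<bar> powr p) = s * 1" .
      then have n: "\<bar>a'\<bar> powr p + \<bar>b'\<bar> powr p = 1" using s by simp
      have "a - b = r * (a' - b')" "(a + b) / 2 = r * ((a' + b') / 2)" by (auto simp: ab algebra_simps)
      then have "c * \<bar>a - b\<bar> powr p + \<bar>(a + b) / 2\<bar> powr p = s * (c * \<bar>a' - b'\<bar> powr p + \<bar>(a' + b') / 2\<bar> powr p)"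
        by (simp only: scale) (simp add: algebra_simps)
      also have "\<dots> \<le> s * (1/2 + c * \<epsilon>)" using s by (intro mult_left_mono unit n) auto
      finally show ?thesis by (simp add: s_def mult.commute)
    qed
  qed
qed

lemma Limsup_add_le_ennreal:
  fixes f g :: "'b \<Rightarrow> ennreal"
  assumes "F \<noteq> bot"
  shows "Limsup F (\<lambda>x. f x + g x) \<le> Limsup F f + Limsup F g"
proof (rule ennreal_le_epsilon)
  fix e :: real assume e: "0 < e" and fin: "Limsup F f + Limsup F g < top"
  then have "Limsup F f < Limsup F f + ennreal (e/2)" "Limsup F g < Limsup F g + ennreal (e/2)"
    using e by (auto simp: ennreal_add_less_top intro!: less_add_ennreal)
  then have "\<forall>\<^sub>F x in F. f x < Limsup F f + ennreal (e/2)" "\<forall>\<^sub>F x in F. g x < Limsup F g + ennreal (e/2)"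
    using Limsup_le_iff[of F f "Limsup F f"] Limsup_le_iff[of F g "Limsup F g"] by auto
  then have "\<forall>\<^sub>F x in F. f x + g x \<le> Limsup F f + Limsup F g + ennreal e"
  proof eventually_elim
    case (elim x)
    then have "f x + g x \<le> (Limsup F f + ennreal (e/2)) + (Limsup F g + ennreal (e/2))"
      by (intro add_mono less_imp_le)
    also have "\<dots> = Limsup F f + Limsup F g + (ennreal (e/2) + ennreal (e/2))" by (simp add: add_ac)
    also have "ennreal (e/2) + ennreal (e/2) = ennreal e" using e by (subst ennreal_plus[symmetric]) auto
    finally show ?case .
  qed
  then show "Limsup F (\<lambda>x. f x + g x) \<le> Limsup F f + Limsup F g + ennreal e" by (rule Limsup_bounded)
qed

lemma Limsup_cmult_ennreal:
  fixes f :: "'b \<Rightarrow> ennreal"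
  assumes "F \<noteq> bot"
  shows "Limsup F (\<lambda>x. ennreal c * f x) = ennreal c * Limsup F f"
  using assms by (intro Limsup_compose_continuous_mono ennreal_continuous_on_cmult monoI mult_left_mono continuous_on_id) auto

section \<open>Energies at a scale and their limit superior\<close>

context covered_space
begin

text \<open>The function value and the slopes form a vector that is linear in \<open>f\<close> on
  \<open>V\<close>; \<open>density\<close> sums the \<open>p\<close>-th powers of its coordinates
  and \<open>E k\<close> integrates them.\<close>

definition slope :: "int \<Rightarrow> 'a \<Rightarrow> ('a \<Rightarrow> real) \<Rightarrow> nat \<Rightarrow> real" where
  "slope k x f j = 2 powi k * (mean f (B k (fi k x)) - mean f (B k j))"

definition density :: "int \<Rightarrow> 'a \<Rightarrow> ('a \<Rightarrow> real) \<Rightarrow> real" where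
  "density k x f = \<bar>f x\<bar> powr p + (\<Sum>j\<in>neighbors m ctr k (fi k x). \<bar>slope k x f j\<bar> powr p)"

definition E :: "int \<Rightarrow> ('a \<Rightarrow> real) \<Rightarrow> ennreal" where
  "E k f = Lp_powr M p (\<lambda>x. ennreal \<bar>f x\<bar>) + T_energy k f"

definition S :: "('a \<Rightarrow> real) \<Rightarrow> ennreal" where
  "S f = Limsup at_top (\<lambda>k::int. E k f)"

lemma density_nonneg: "0 \<le> density k x f"
  by (simp add: density_def sum_nonneg)

lemma density_eq: "density k x f = \<bar>f x\<bar> powr p + T k f x powr p"
  by (simp add: density_def T_powr slope_def)

lemma density_measurable:
  assumes "f \<in> V"
  shows "(\<lambda>x. density k x f) \<in> borel_measurable M"
proof (rule borel_imp_M)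
  have [measurable]: "f \<in> borel_measurable borel" using assms by (rule V_measurable)
  show "(\<lambda>x. density k x f) \<in> borel_measurable borel" unfolding density_eq by measurable
qed

lemma E_eq:
  assumes f: "f \<in> V"
  shows "E k f = (\<integral>\<^sup>+x. ennreal (density k x f) \<partial>M)"
proof -
  have [measurable]: "f \<in> borel_measurable borel" using f by (rule V_measurable)
  have "(\<integral>\<^sup>+x. ennreal (density k x f) \<partial>M) = (\<integral>\<^sup>+x. ennreal (\<bar>f x\<bar> powr p) + ennreal (T k f x powr p) \<partial>M)"
    by (simp add: density_eq ennreal_plus)
  also have "\<dots> = (\<integral>\<^sup>+x. ennreal (\<bar>f x\<bar> powr p) \<partial>M) + (\<integral>\<^sup>+x. ennreal (T k f x powr p) \<partial>M)"
    by (intro nn_integral_add borel_imp_M) measurable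
  finally show ?thesis by (simp add: E_def T_energy_eq Lp_powr_def ennpowr_ennreal)
qed

lemma slope_lincomb:
  assumes "f \<in> V" "g \<in> V"
  shows "slope k x (\<lambda>x. s * f x + t * g x) j = s * slope k x f j + t * slope k x g j"
  using mean_add[OF V_cmult[OF assms(1), of s] V_cmult[OF assms(2), of t]]
  by (simp add: slope_def B_eq mean_cmult algebra_simps)

lemma slope_cmult: "slope k x (\<lambda>x. s * f x) j = s * slope k x f j"
  by (simp add: slope_def mean_cmult algebra_simps)

lemma density_cmult: "density k x (\<lambda>x. s * f x) = \<bar>s\<bar> powr p * density k x f"
  by (simp add: density_def slope_cmult abs_mult powr_mult distrib_left sum_distrib_left)

lemma E_cmult:
  assumes f: "f \<in> V"
  shows "E k (\<lambda>x. s * f x) = ennreal (\<bar>s\<bar> powr p) * E k f"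
  using density_measurable[OF f, of k]
  by (simp add: E_eq f V_cmult density_cmult ennreal_mult density_nonneg nn_integral_cmult)

lemma density_convex:
  assumes "f \<in> V" "g \<in> V" and t: "0 < t" "t < 1"
  shows "density k x (\<lambda>x. t * f x + (1 - t) * g x) \<le> t * density k x f + (1 - t) * density k x g"
proof -
  have pt: "\<bar>t * a + (1 - t) * b\<bar> powr p \<le> t * \<bar>a\<bar> powr p + (1 - t) * \<bar>b\<bar> powr p" for a b :: real
  proof -
    have "\<bar>t * a + (1 - t) * b\<bar> \<le> t * \<bar>a\<bar> + (1 - t) * \<bar>b\<bar>"
      using abs_triangle_ineq[of "t * a" "(1 - t) * b"] t by (simp add: abs_mult)
    then have "\<bar>t * a + (1 - t) * b\<bar> powr p \<le> (t * \<bar>a\<bar> + (1 - t) * \<bar>b\<bar>) powr p"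
      using p by (intro powr_mono2) auto
    also have "\<dots> \<le> t * \<bar>a\<bar> powr p + (1 - t) * \<bar>b\<bar> powr p"
      using p t by (intro powr_convex_combination) auto
    finally show ?thesis .
  qed
  have "density k x (\<lambda>x. t * f x + (1 - t) * g x) \<le> (t * \<bar>f x\<bar> powr p + (1 - t) * \<bar>g x\<bar> powr p) +
      (\<Sum>j\<in>neighbors m ctr k (fi k x). t * \<bar>slope k x f j\<bar> powr p + (1 - t) * \<bar>slope k x g j\<bar> powr p)"
    unfolding density_def slope_lincomb[OF assms(1,2)] by (intro add_mono sum_mono pt)
  then show ?thesis by (simp add: density_def sum.distrib sum_distrib_left distrib_left)
qed

lemma E_convex:
  assumes f: "f \<in> V" and g: "g \<in> V" and t: "0 < t" "t < 1"
  shows "E k (\<lambda>x. t * f x + (1 - t) * g x) \<le> ennreal t * E k f + ennreal (1 - t) * E k g"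
proof -
  note [measurable] = density_measurable[OF f, of k] density_measurable[OF g, of k]
  have "(\<lambda>x. t * f x + (1 - t) * g x) \<in> V" using f g by (intro V_add V_cmult)
  then have "E k (\<lambda>x. t * f x + (1 - t) * g x) = (\<integral>\<^sup>+x. ennreal (density k x (\<lambda>x. t * f x + (1 - t) * g x)) \<partial>M)"
    by (rule E_eq)
  also have "\<dots> \<le> (\<integral>\<^sup>+x. ennreal (t * density k x f + (1 - t) * density k x g) \<partial>M)"
    by (intro nn_integral_mono ennreal_leI density_convex f g t)
  also have "\<dots> = (\<integral>\<^sup>+x. ennreal t * ennreal (density k x f) + ennreal (1 - t) * ennreal (density k x g) \<partial>M)"
    using t by (simp add: ennreal_mult ennreal_plus density_nonneg)
  also have "\<dots> = ennreal t * E k f + ennreal (1 - t) * E k g"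
    by (simp add: nn_integral_add nn_integral_cmult E_eq f g)
  finally show ?thesis .
qed

text \<open>The scalar inequality is summed over the coordinates and integrated; \<open>c\<close> is
  the same for all scales and functions.\<close>

lemma E_uniform_convexity:
  assumes p1: "1 < p" and \<epsilon>: "0 < \<epsilon>"
  obtains c where "0 < c" "\<And>k f g. f \<in> V \<Longrightarrow> g \<in> V \<Longrightarrow>
    ennreal c * E k (\<lambda>x. f x - g x) + E k (\<lambda>x. (1/2) * (f x + g x)) \<le> ennreal (1/2 + c * \<epsilon>) * (E k f + E k g)"
proof -
  obtain c where c: "0 < c" and pt: "\<And>a b :: real. c * \<bar>a - b\<bar> powr p + \<bar>(a + b) / 2\<bar> powr p
    \<le> (1/2 + c * \<epsilon>) * (\<bar>a\<bar> powr p + \<bar>b\<bar> powr p)"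
    using uniform_convexity_powr[OF p1 \<epsilon>] by blast
  show ?thesis
  proof (rule that[OF c])
    fix k f g assume f: "f \<in> V" and g: "g \<in> V"
    let ?d = "\<lambda>x. f x - g x" and ?m = "\<lambda>x. (1/2) * (f x + g x)"
    let ?q = "1/2 + c * \<epsilon>"
    have dm: "?d \<in> V" "?m \<in> V" using f g by (auto intro: V_diff V_cmult[of "\<lambda>x. f x + g x" "1/2", simplified] V_add)
    have q: "0 \<le> ?q" using c \<epsilon> by simp
    note [measurable] = density_measurable[OF f, of k] density_measurable[OF g, of k]
      density_measurable[OF dm(1), of k] density_measurable[OF dm(2), of k]
    have sl: "slope k x ?d j = slope k x f j - slope k x g j" "slope k x ?m j = (slope k x f j + slope k x g j) / 2" for x j
      using slope_lincomb[OF f g, of k x 1 "-1" j] slope_lincomb[OF f g, of k x "1/2" "1/2" j]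
      by (simp_all add: distrib_left add_divide_distrib)
    have le: "c * density k x ?d + density k x ?m \<le> ?q * (density k x f + density k x g)" for x
    proof -
      let ?J = "neighbors m ctr k (fi k x)"
      have "c * density k x ?d + density k x ?m = (c * \<bar>f x - g x\<bar> powr p + \<bar>(f x + g x) / 2\<bar> powr p) +
          (\<Sum>j\<in>?J. c * \<bar>slope k x f j - slope k x g j\<bar> powr p + \<bar>(slope k x f j + slope k x g j) / 2\<bar> powr p)"
      proof -
        have "density k x ?m = \<bar>(f x + g x) / 2\<bar> powr p + (\<Sum>j\<in>?J. \<bar>(slope k x f j + slope k x g j) / 2\<bar> powr p)"
          unfolding density_def sl by simp
        then show ?thesis
          unfolding density_def[of k x ?d] sl by (simp only: distrib_left sum_distrib_left sum.distrib add_ac)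
      qed
      also have "\<dots> \<le> ?q * (\<bar>f x\<bar> powr p + \<bar>g x\<bar> powr p) + (\<Sum>j\<in>?J. ?q * (\<bar>slope k x f j\<bar> powr p + \<bar>slope k x g j\<bar> powr p))"
        by (intro add_mono sum_mono pt)
      also have "\<dots> = ?q * (density k x f + density k x g)"
        by (simp only: density_def sum_distrib_left[symmetric] sum.distrib distrib_left[symmetric]) (simp add: algebra_simps)
      finally show ?thesis .
    qed
    have "ennreal c * E k ?d + E k ?m = (\<integral>\<^sup>+x. ennreal (c * density k x ?d + density k x ?m) \<partial>M)"
    proof -
      have "(\<integral>\<^sup>+x. ennreal (c * density k x ?d + density k x ?m) \<partial>M)
          = (\<integral>\<^sup>+x. ennreal c * ennreal (density k x ?d) + ennreal (density k x ?m) \<partial>M)"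
        using c density_nonneg[of k _ ?d] density_nonneg[of k _ ?m]
        by (intro nn_integral_cong) (simp add: ennreal_mult ennreal_plus del: times_divide_eq_left)
      also have "\<dots> = (\<integral>\<^sup>+x. ennreal c * ennreal (density k x ?d) \<partial>M) + (\<integral>\<^sup>+x. ennreal (density k x ?m) \<partial>M)"
        by (rule nn_integral_add) measurable
      also have "(\<integral>\<^sup>+x. ennreal c * ennreal (density k x ?d) \<partial>M) = ennreal c * (\<integral>\<^sup>+x. ennreal (density k x ?d) \<partial>M)"
        by (rule nn_integral_cmult) measurable
      finally show ?thesis unfolding E_eq[OF dm(1)] E_eq[OF dm(2)] by (rule sym)
    qed
    also have "\<dots> \<le> (\<integral>\<^sup>+x. ennreal (?q * (density k x f + density k x g)) \<partial>M)"
      by (intro nn_integral_mono ennreal_leI le)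
    also have "\<dots> = ennreal ?q * (E k f + E k g)"
      unfolding ennreal_mult[OF q add_nonneg_nonneg[OF density_nonneg density_nonneg]]
      by (simp add: E_eq f g ennreal_plus density_nonneg nn_integral_add nn_integral_cmult)
    finally show "ennreal c * E k ?d + E k ?m \<le> ennreal ?q * (E k f + E k g)" .
  qed
qed

lemma S_cmult: "f \<in> V \<Longrightarrow> S (\<lambda>x. s * f x) = ennreal (\<bar>s\<bar> powr p) * S f"
  unfolding S_def by (simp add: E_cmult Limsup_cmult_ennreal)

lemma S_convex:
  assumes "f \<in> V" "g \<in> V" "0 < t" "t < 1"
  shows "S (\<lambda>x. t * f x + (1 - t) * g x) \<le> ennreal t * S f + ennreal (1 - t) * S g"
proof -
  have "S (\<lambda>x. t * f x + (1 - t) * g x) \<le> Limsup at_top (\<lambda>k::int. ennreal t * E k f + ennreal (1 - t) * E k g)"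
    unfolding S_def by (intro Limsup_mono always_eventually allI E_convex assms)
  also have "\<dots> \<le> Limsup at_top (\<lambda>k::int. ennreal t * E k f) + Limsup at_top (\<lambda>k::int. ennreal (1 - t) * E k g)"
    by (intro Limsup_add_le_ennreal) simp
  finally show ?thesis by (simp add: S_def Limsup_cmult_ennreal)
qed

lemma S_le_energy:
  obtains C :: real where "0 < C" "\<And>f. f \<in> V \<Longrightarrow> S f \<le> ennreal C * energy f"
proof -
  obtain C where C: "0 < C" "\<And>f k. f \<in> V \<Longrightarrow> T_energy k f \<le> ennreal C * grad_energy f"
    using T_energy_upper by blast
  have "S f \<le> ennreal (C + 1) * energy f" if f: "f \<in> V" for f
    unfolding S_def
  proof (intro Limsup_bounded always_eventually allI)
    fix k
    have "E k f \<le> 1 * Lp_powr M p (\<lambda>x. ennreal \<bar>f x\<bar>) + ennreal C * grad_energy f"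
      unfolding E_def using C(2)[OF f] by (intro add_mono) auto
    also have "\<dots> \<le> ennreal (C + 1) * Lp_powr M p (\<lambda>x. ennreal \<bar>f x\<bar>) + ennreal (C + 1) * grad_energy f"
    proof (intro add_mono mult_right_mono)
      show "1 \<le> ennreal (C + 1)" using C(1) ennreal_leI[of 1 "C + 1"] by simp
    qed (use C(1) in \<open>auto intro: ennreal_leI\<close>)
    finally show "E k f \<le> ennreal (C + 1) * energy f" by (simp add: energy_def distrib_left)
  qed
  then show ?thesis using that[of "C + 1"] C(1) by auto
qed

text \<open>A bound at infinitely many scales suffices, because \<open>grad_energy_le_liminf\<close>
  accepts any sequence of scales tending to infinity. The added 1 accounts for the
  \<open>L\<^sup>p\<close> part.\<close>

lemma energy_le_frequently:
  assumes f: "f \<in> V" and L: "0 \<le> L" and fr: "\<exists>\<^sub>F k in at_top. E k f \<le> ennreal L"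
  shows "energy f \<le> ennreal ((1 + 12 powr p) * L)"
proof -
  have "\<exists>j::nat. n \<le> j \<and> E (int j) f \<le> ennreal L" for n :: nat
  proof -
    have "\<exists>\<^sub>F k in at_top. E k f \<le> ennreal L \<and> int n \<le> k"
      using fr eventually_ge_at_top[of "int n"]
      by (rule frequently_eventually_frequently)
    then obtain k where "E k f \<le> ennreal L" "int n \<le> k" by (auto dest: frequently_ex)
    then show ?thesis by (intro exI[of _ "nat k"]) auto
  qed
  then obtain \<kappa> where \<kappa>: "\<And>n. n \<le> \<kappa> n" "\<And>n. E (int (\<kappa> n)) f \<le> ennreal L" by metis
  have "T_energy (int (\<kappa> n)) f \<le> ennreal L" for n
    using \<kappa>(2)[of n] unfolding E_def by (auto intro: order_trans[rotated])
  then have 1: "grad_energy f \<le> ennreal (12 powr p * L)" by (rule grad_energy_le_liminf[OF f \<kappa>(1) _ L])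
  have 2: "Lp_powr M p (\<lambda>x. ennreal \<bar>f x\<bar>) \<le> ennreal L"
    using \<kappa>(2)[of 0] unfolding E_def by (auto intro: order_trans[rotated])
  have "energy f \<le> ennreal L + ennreal (12 powr p * L)" unfolding energy_def by (intro add_mono 1 2)
  also have "\<dots> = ennreal ((1 + 12 powr p) * L)" using L by (simp add: distrib_right ennreal_plus)
  finally show ?thesis .
qed

lemma energy_le_S:
  assumes f: "f \<in> V" and fin: "S f < \<infinity>"
  shows "energy f \<le> ennreal (1 + 12 powr p) * S f"
proof (rule ennreal_le_epsilon)
  fix e :: real assume e: "0 < e"
  define d where "d = e / (1 + 12 powr p)"
  have pos: "0 < 1 + 12 powr p" by (simp add: add_pos_nonneg)
  have d: "0 < d" using e pos by (simp add: d_def)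
  obtain s where s: "0 \<le> s" "S f = ennreal s" using fin by (metis infinity_ennreal_def less_top_ennreal)
  have "S f < ennreal (s + d)" using s d by (simp add: ennreal_lessI)
  then have "\<forall>\<^sub>F k in at_top. E k f < ennreal (s + d)"
    using Limsup_le_iff[of at_top "\<lambda>k. E k f" "S f"] unfolding S_def by auto
  then have "\<exists>\<^sub>F k in at_top. E k f \<le> ennreal (s + d)"
    by (intro eventually_frequently) (auto elim: eventually_mono)
  then have "energy f \<le> ennreal ((1 + 12 powr p) * (s + d))"
    using s d by (intro energy_le_frequently[OF f]) auto
  also have "(1 + 12 powr p) * (s + d) = (1 + 12 powr p) * s + e" using pos by (simp add: d_def distrib_left)
  also have "ennreal ((1 + 12 powr p) * s + e) = ennreal (1 + 12 powr p) * S f + ennreal e"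
    using s e pos by (subst ennreal_plus) (auto simp: ennreal_mult)
  finally show "energy f \<le> ennreal (1 + 12 powr p) * S f + ennreal e" .
qed

lemma S_finite: "f \<in> V \<Longrightarrow> S f < \<infinity>"
proof -
  assume f: "f \<in> V"
  obtain C where "0 < C" "S f \<le> ennreal C * energy f" using S_le_energy f by blast
  then show ?thesis using f by (auto simp: V_def ennreal_mult_less_top intro: le_less_trans)
qed

section \<open>The starred norm on classes\<close>

abbreviation star :: "('a \<Rightarrow> ereal) \<Rightarrow> ennreal" where
  "star u \<equiv> star_norm M m ctr p u"

abbreviation Zs :: "('a \<Rightarrow> ereal) set nspace" where
  "Zs \<equiv> N1p_star_space M m ctr p"

lemma star_real: "star (\<lambda>x. ereal (f x)) = ennpowr (S f) (1 / p)"
  unfolding star_norm_def S_def E_def T_energy_def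
  by (simp add: Limsup_const_add e2ennreal_ereal)

text \<open>The starred norm depends only on averages and an \<open>L\<^sup>p\<close> norm, so
  agreement almost everywhere suffices, and exceptional sets are null.\<close>

lemma star_rel:
  assumes "(u, v) \<in> N1p_rel M p"
  shows "star u = star v"
proof -
  have [measurable]: "u \<in> borel_measurable M" "v \<in> borel_measurable M"
    using assms borel_imp_M by (auto simp: N1p_rel_iff N1p_functions_def)
  have "{x. u x \<noteq> v x} \<in> null_sets M" using assms by (intro exceptional_null) (simp add: N1p_rel_iff)
  then have AE: "AE x in M. u x = v x" by (auto dest: AE_not_in)
  have L: "Lp_powr M p (\<lambda>x. e2ennreal \<bar>u x\<bar>) = Lp_powr M p (\<lambda>x. e2ennreal \<bar>v x\<bar>)"
    unfolding Lp_powr_def by (rule nn_integral_cong_AE) (use AE in \<open>auto elim: eventually_mono\<close>)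
  have avg: "avg M u (B k i) = avg M v (B k i)" for k i
  proof -
    have "(LINT y:B k i|M. real_of_ereal (u y)) = (LINT y:B k i|M. real_of_ereal (v y))"
      unfolding set_lebesgue_integral_def B_eq
      by (rule integral_cong_AE) (use AE in \<open>auto elim: eventually_mono\<close>)
    then show ?thesis by (simp add: avg_def)
  qed
  show ?thesis unfolding star_norm_def T_abs_def avg L ..
qed

lemma star_finite:
  assumes "u \<in> N1p_functions M p"
  shows "star u < \<infinity>"
  using star_rel[OF real_representative(2)[OF assms]] S_finite[OF real_representative(1)[OF assms]]
  by (simp add: star_real)

text \<open>Definiteness is where the lower bound enters: \<open>S f = 0\<close> forces zero energy,
  hence a function that vanishes off an exceptional set.\<close>

lemma Zs_normed: "real_normed_space Zs"
  unfolding N1p_star_space_def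
proof (rule N1p_real_normed_space[where F = S])
  show "exceptional {x. f x \<noteq> 0}" if f: "f \<in> V" and 0: "S f = 0" for f
    using energy_le_S[OF f] 0 by (intro energy_zeroD[OF f]) simp
qed (use star_rel star_real S_finite S_cmult S_convex in auto)

lemma Zs_simps: "vcarrier Zs = vcarrier (N1p_space M p)" "vadd Zs = vadd (N1p_space M p)"
  "vscale Zs = vscale (N1p_space M p)"
  by (simp_all add: N1p_star_space_def)

lemma Zs_norm:
  assumes f: "f \<in> V"
  shows "vnorm Zs (cls f) = enn2real (S f) powr (1 / p)"
proof -
  have "vnorm Zs (cls f) = enn2real (ennpowr (S f) (1 / p))"
    using class_norm_cls[OF f star_rel] by (simp add: N1p_star_space_def star_real)
  then show ?thesis using S_finite[OF f] by (simp add: ennpowr_def less_top)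
qed

lemma N1p_norm:
  assumes f: "f \<in> V"
  shows "vnorm (N1p_space M p) (cls f) = enn2real (energy f) powr (1 / p)"
  using N1p_norm_cls[OF f] f by (simp add: V_def ennpowr_def less_top)

lemma norms_equivalent: "equivalent_norms_on (vcarrier (N1p_space M p)) (vnorm Zs) (vnorm (N1p_space M p))"
proof -
  obtain C where C: "0 < C" "\<And>f. f \<in> V \<Longrightarrow> S f \<le> ennreal C * energy f" using S_le_energy by blast
  define C' where "C' = 1 + 12 powr p"
  have C': "0 < C'" by (simp add: C'_def add_pos_nonneg)
  have root: "enn2real x powr (1/p) \<le> K powr (1/p) * enn2real y powr (1/p)"
    if "x \<le> ennreal K * y" "0 < K" "y < \<infinity>" for x y K
  proof -
    have "enn2real x \<le> enn2real (ennreal K * y)"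
      using that by (intro enn2real_mono) (auto simp: ennreal_mult_less_top)
    then have "enn2real x \<le> K * enn2real y" using that by (simp add: enn2real_mult)
    then have "enn2real x powr (1/p) \<le> (K * enn2real y) powr (1/p)" using p by (intro powr_mono2) auto
    then show ?thesis using that by (simp add: powr_mult)
  qed
  have "C' powr (- 1/p) * vnorm (N1p_space M p) c \<le> vnorm Zs c \<and> vnorm Zs c \<le> C powr (1/p) * vnorm (N1p_space M p) c"
    if "c \<in> vcarrier (N1p_space M p)" for c
  proof -
    have "c \<in> cls ` V" using that N1p_carrier by simp
    then obtain f where f: "f \<in> V" "c = cls f" by blast
    have "energy f < \<infinity>" using f by (simp add: V_def)
    then have up: "vnorm Zs c \<le> C powr (1/p) * vnorm (N1p_space M p) c"
      unfolding f(2) Zs_norm[OF f(1)] N1p_norm[OF f(1)] by (intro root C f)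
    have "vnorm (N1p_space M p) c \<le> C' powr (1/p) * vnorm Zs c"
      unfolding f(2) Zs_norm[OF f(1)] N1p_norm[OF f(1)] C'_def
      by (intro root energy_le_S S_finite f) (simp add: add_pos_nonneg)
    then have "C' powr (- 1/p) * vnorm (N1p_space M p) c \<le> C' powr (- 1/p) * (C' powr (1/p) * vnorm Zs c)"
      by (intro mult_left_mono) auto
    also have "\<dots> = vnorm Zs c" using C' by (simp add: mult.assoc[symmetric] flip: powr_add)
    finally show ?thesis using up by simp
  qed
  then show ?thesis
    unfolding equivalent_norms_on_def using C C'
    by (intro exI[of _ "C' powr (- 1/p)"] conjI exI[of _ "C powr (1/p)"]) auto
qed

lemma cls_diff:
  assumes "f \<in> V" "g \<in> V"
  shows "vdiff (N1p_space M p) (cls f) (cls g) = cls (\<lambda>x. f x - g x)"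
  using N1p_add[OF assms(1) V_cmult[OF assms(2), of "-1"]] N1p_scale[OF assms(2), of "-1"]
  by (simp add: vdiff_def)

text \<open>The limit superior is used from above only: \<open>S f = S g = 1\<close> bounds both
  energies by \<open>1 + \<eta>\<close> at all small scales. The lower bound for the difference term
  comes from \<open>energy_le_frequently\<close> by contradiction. What remains is an inequality
  between numbers at each scale.\<close>

lemma Zs_uniformly_convex:
  assumes p1: "1 < p"
  shows "uniformly_convex Zs"
  unfolding uniformly_convex_def
proof (intro allI impI)
  fix \<epsilon> :: real assume \<epsilon>: "0 < \<epsilon>"
  obtain C where C: "0 < C" "\<And>f. f \<in> V \<Longrightarrow> S f \<le> ennreal C * energy f" using S_le_energy by blast
  define \<sigma> where "\<sigma> = \<epsilon> powr p"
  \<comment> \<open>Makes \<open>C * ((1 + 12 powr p) * L)\<close> half of \<open>\<sigma>\<close>,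
    which contradicts \<open>S\<close> of the difference exceeding \<open>\<sigma>\<close>.\<close>
  define L where "L = \<sigma> / (2 * C * (1 + 12 powr p))"
  have pos: "0 < 1 + 12 powr p" by (simp add: add_pos_nonneg)
  have \<sigma>: "0 < \<sigma>" using \<epsilon> by (simp add: \<sigma>_def)
  have L: "0 < L" using \<sigma> C(1) pos by (simp add: L_def)
  obtain c where c: "0 < c" and uc: "\<And>k f g. f \<in> V \<Longrightarrow> g \<in> V \<Longrightarrow>
    ennreal c * E k (\<lambda>x. f x - g x) + E k (\<lambda>x. (1/2) * (f x + g x)) \<le> ennreal (1/2 + c * (L/8)) * (E k f + E k g)"
    using E_uniform_convexity[OF p1, of "L/8"] L by auto
  define q where "q = 1/2 + c * (L/8)"
  have q: "0 < q" using c L by (simp add: q_def add_pos_pos)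
  \<comment> \<open>With tolerance \<open>L/8\<close> the right-hand side is at most
    \<open>1 + \<eta> + c * L / 2\<close>. The difference term takes away \<open>c * L\<close>, so
    \<open>\<eta> \<le> c * L / 4\<close> leaves a gain of \<open>c * L / 4\<close>, which
    \<open>\<theta>\<close> caps at \<open>1/2\<close>.\<close>
  define \<eta> where "\<eta> = min 1 (c * L / 4)"
  have \<eta>: "0 < \<eta>" "\<eta> \<le> 1" "\<eta> \<le> c * L / 4" using c L by (auto simp: \<eta>_def)
  define \<theta> where "\<theta> = min (1/2) (c * L / 4)"
  have \<theta>: "0 < \<theta>" "\<theta> \<le> 1/2" "\<theta> \<le> c * L / 4" using c L by (auto simp: \<theta>_def)
  define \<delta> where "\<delta> = 1 - (1 - \<theta>) powr (1/p)"
  have "(1 - \<theta>) powr (1/p) < 1 powr (1/p)" using \<theta> p by (intro powr_less_mono2) auto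
  then have \<delta>: "0 < \<delta>" by (simp add: \<delta>_def)
  have main: "vnorm Zs (vadd Zs x y) \<le> 2 * (1 - \<delta>)"
    if x: "x \<in> vcarrier Zs" and y: "y \<in> vcarrier Zs" and n: "vnorm Zs x = 1" "vnorm Zs y = 1" "\<epsilon> < vnorm Zs (vdiff Zs x y)" for x y
  proof -
    obtain f g where f: "f \<in> V" "x = cls f" and g: "g \<in> V" "y = cls g"
      using x y N1p_carrier by (auto simp: Zs_simps)
    have d: "(\<lambda>x. f x - g x) \<in> V" and md: "(\<lambda>x. (1/2) * (f x + g x)) \<in> V"
      using V_diff[OF f(1) g(1)] V_cmult[OF V_add[OF f(1) g(1)], of "1/2"] by this
    have one: "S h = 1" if h: "h \<in> V" "vnorm Zs (cls h) = 1" for h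
    proof -
      have "enn2real (S h) powr (1/p) = 1" using h by (simp add: Zs_norm)
      then have "(enn2real (S h) powr (1/p)) powr p = 1" by simp
      then have "enn2real (S h) = 1" using p by (simp add: powr_powr)
      moreover have "S h = ennreal (enn2real (S h))" using S_finite[OF h(1)] by simp
      ultimately show ?thesis by simp
    qed
    have Sf: "S f = 1" "S g = 1" using one f g n by auto
    have "vdiff Zs x y = cls (\<lambda>x. f x - g x)" using cls_diff[OF f(1) g(1)] f g by (simp add: vdiff_def Zs_simps)
    then have "\<epsilon> < enn2real (S (\<lambda>x. f x - g x)) powr (1/p)" using n(3) Zs_norm[OF d] by simp
    then have "\<epsilon> powr p < (enn2real (S (\<lambda>x. f x - g x)) powr (1/p)) powr p"
      using \<epsilon> p by (intro powr_less_mono2) auto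
    then have "\<sigma> < enn2real (S (\<lambda>x. f x - g x))" using p by (simp add: powr_powr \<sigma>_def)
    then have big: "ennreal \<sigma> < S (\<lambda>x. f x - g x)"
      using S_finite[OF d] \<sigma> by (cases "S (\<lambda>x. f x - g x)") (auto intro: ennreal_lessI)
    have "\<not> (\<exists>\<^sub>F k in at_top. E k (\<lambda>x. f x - g x) \<le> ennreal L)"
    proof
      assume "\<exists>\<^sub>F k in at_top. E k (\<lambda>x. f x - g x) \<le> ennreal L"
      then have "energy (\<lambda>x. f x - g x) \<le> ennreal ((1 + 12 powr p) * L)" using L by (intro energy_le_frequently d) auto
      then have "ennreal C * energy (\<lambda>x. f x - g x) \<le> ennreal C * ennreal ((1 + 12 powr p) * L)"
        by (intro mult_left_mono) auto
      then have "S (\<lambda>x. f x - g x) \<le> ennreal C * ennreal ((1 + 12 powr p) * L)"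
        using C(2)[OF d] by (rule order_trans[rotated])
      also have "\<dots> = ennreal (C * ((1 + 12 powr p) * L))" using C(1) by (simp add: ennreal_mult')
      also have "C * ((1 + 12 powr p) * L) = \<sigma> / 2" using C(1) pos by (simp add: L_def)
      also have "ennreal (\<sigma> / 2) \<le> ennreal \<sigma>" using \<sigma> by (intro ennreal_leI) auto
      finally show False using big by simp
    qed
    then have ev1: "\<forall>\<^sub>F k in at_top. ennreal L \<le> E k (\<lambda>x. f x - g x)"
      unfolding not_frequently by (auto elim: eventually_mono)
    have "1 < ennreal (1 + \<eta>)" using \<eta>(1) ennreal_lessI[of "1 + \<eta>" 1] by simp
    then have ev2: "\<forall>\<^sub>F k in at_top. E k f < ennreal (1 + \<eta>)" "\<forall>\<^sub>F k in at_top. E k g < ennreal (1 + \<eta>)"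
      using Limsup_le_iff[of at_top "\<lambda>k. E k f" "S f"] Limsup_le_iff[of at_top "\<lambda>k. E k g" "S g"] Sf
      unfolding S_def by auto
    have "\<forall>\<^sub>F k in at_top. E k (\<lambda>x. (1/2) * (f x + g x)) \<le> ennreal (1 - \<theta>)"
      using ev1 ev2
    proof eventually_elim
      case (elim k)
      let ?e = "E k (\<lambda>x. (1/2) * (f x + g x))"
      have "ennreal c * ennreal L + ?e \<le> ennreal c * E k (\<lambda>x. f x - g x) + ?e"
        using elim by (intro add_right_mono mult_left_mono) auto
      also have "\<dots> \<le> ennreal q * (E k f + E k g)" unfolding q_def by (rule uc[OF f(1) g(1)])
      also have "\<dots> \<le> ennreal q * (ennreal (1 + \<eta>) + ennreal (1 + \<eta>))"
        using elim(2,3) q by (intro mult_left_mono add_mono less_imp_le) auto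
      also have "ennreal (1 + \<eta>) + ennreal (1 + \<eta>) = ennreal ((1 + \<eta>) + (1 + \<eta>))"
        using \<eta>(1) by (intro ennreal_plus[symmetric]) auto
      also have "ennreal q * ennreal ((1 + \<eta>) + (1 + \<eta>)) = ennreal (q * ((1 + \<eta>) + (1 + \<eta>)))"
        using q \<eta>(1) by (intro ennreal_mult[symmetric]) auto
      finally have le: "ennreal c * ennreal L + ?e \<le> ennreal (q * ((1 + \<eta>) + (1 + \<eta>)))" .
      have "?e \<le> ennreal (q * ((1 + \<eta>) + (1 + \<eta>)))" by (rule order_trans[OF _ le]) simp
      then have "?e < top" by (rule le_less_trans) simp
      then obtain e where e: "0 \<le> e" "?e = ennreal e" by (metis less_top_ennreal)
      have "ennreal (c * L + e) = ennreal c * ennreal L + ?e"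
        unfolding e(2) using c L e(1) by (simp add: ennreal_mult ennreal_plus)
      with le have "ennreal (c * L + e) \<le> ennreal (q * ((1 + \<eta>) + (1 + \<eta>)))" by simp
      then have "c * L + e \<le> q * ((1 + \<eta>) + (1 + \<eta>))"
        using q \<eta>(1) by (subst (asm) ennreal_le_iff) auto
      also have "\<dots> = 1 + \<eta> + c * L / 4 * (1 + \<eta>)" by (simp add: q_def field_simps)
      also have "\<dots> \<le> 1 + \<eta> + c * L / 4 * 2" using c L \<eta> by (intro add_left_mono mult_left_mono) auto
      finally have "e \<le> 1 - \<theta>" using \<eta>(3) \<theta>(3) by linarith
      then show ?case unfolding e(2) by (rule ennreal_leI)
    qed
    then have Sm: "S (\<lambda>x. (1/2) * (f x + g x)) \<le> ennreal (1 - \<theta>)" unfolding S_def by (rule Limsup_bounded)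
    have "enn2real (S (\<lambda>x. (1/2) * (f x + g x))) powr (1/p) \<le> (1 - \<theta>) powr (1/p)"
      using Sm \<theta> p by (intro powr_mono2 enn2real_leI) auto
    then have half: "vnorm Zs (cls (\<lambda>x. (1/2) * (f x + g x))) \<le> 1 - \<delta>" using Zs_norm[OF md] by (simp add: \<delta>_def)
    interpret real_normed_space Zs by (rule Zs_normed)
    have "vadd Zs x y = cls (\<lambda>x. f x + g x)" using N1p_add f g by (simp add: Zs_simps)
    moreover have "cls (\<lambda>x. f x + g x) = vscale Zs 2 (cls (\<lambda>x. (1/2) * (f x + g x)))"
    proof -
      have "(\<lambda>x. 2 * ((1/2) * (f x + g x))) = (\<lambda>x. f x + g x)" by auto
      then show ?thesis using N1p_scale[OF md, of 2] unfolding Zs_simps by argo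
    qed
    moreover have "cls (\<lambda>x. (1/2) * (f x + g x)) \<in> vcarrier Zs" using md by (auto simp: Zs_simps N1p_carrier)
    ultimately show ?thesis using half norm_scale by simp
  qed
  show "\<exists>\<delta>>0. \<forall>x\<in>vcarrier Zs. \<forall>y\<in>vcarrier Zs.
      vnorm Zs x = 1 \<and> vnorm Zs y = 1 \<and> vnorm Zs (vdiff Zs x y) > \<epsilon> \<longrightarrow> vnorm Zs (vadd Zs x y) \<le> 2 * (1 - \<delta>)"
    using \<delta> main by blast
qed

end

section \<open>Completeness\<close>

text \<open>A Cauchy sequence converges once a subsequence does, so only sequences with the decay
  demanded by \<open>rapid_completeness\<close> have to be considered.\<close>

lemma complete_nspaceI:
  fixes Z :: "'a nspace"
  assumes Z: "real_normed_space Z"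
    and rapid: "\<And>X. (\<And>n. X n \<in> vcarrier Z) \<Longrightarrow> (\<And>n. vnorm Z (vdiff Z (X (Suc n)) (X n)) < (1/8) ^ n) \<Longrightarrow>
      \<exists>x\<in>vcarrier Z. (\<lambda>n. vnorm Z (vdiff Z (X n) x)) \<longlonglongrightarrow> 0"
  shows "complete_nspace Z"
  unfolding complete_nspace_def
proof (intro allI impI, elim conjE)
  interpret real_normed_space Z by fact
  fix X :: "nat \<Rightarrow> 'a" assume X: "\<forall>n. X n \<in> vcarrier Z" and cauchy: "\<forall>e>0. \<exists>N. \<forall>i\<ge>N. \<forall>j\<ge>N. len (X i \<ominus> X j) < e"
  have "\<forall>n. \<exists>N. \<forall>i\<ge>N. \<forall>j\<ge>N. len (X i \<ominus> X j) < (1/8) ^ n"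
    using cauchy by simp
  then obtain N :: "nat \<Rightarrow> nat" where N: "\<And>n i j. i \<ge> N n \<Longrightarrow> j \<ge> N n \<Longrightarrow> len (X i \<ominus> X j) < (1/8) ^ n" by metis
  define r where "r n = n + (\<Sum>i\<le>n. N i)" for n
  have r: "n \<le> r n" "N n \<le> r n" "N n \<le> r (Suc n)" for n
    using member_le_sum[of n "{..n}" N] by (auto simp: r_def)
  obtain x where x: "x \<in> vcarrier Z" "(\<lambda>n. len (X (r n) \<ominus> x)) \<longlonglongrightarrow> 0"
    using rapid[of "\<lambda>n. X (r n)"] X N r by blast
  have "(\<lambda>n. len (X n \<ominus> x)) \<longlonglongrightarrow> 0"
  proof (rule LIMSEQ_I)
    fix e :: real assume e: "0 < e"
    obtain N1 where N1: "\<And>i j. i \<ge> N1 \<Longrightarrow> j \<ge> N1 \<Longrightarrow> len (X i \<ominus> X j) < e/2" using cauchy e by (meson half_gt_zero)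
    obtain N2 where N2: "\<And>n. n \<ge> N2 \<Longrightarrow> norm (len (X (r n) \<ominus> x) - 0) < e/2" using LIMSEQ_D[OF x(2), of "e/2"] e by auto
    have "len (X n \<ominus> x) < e" if "n \<ge> N1" for n
    proof -
      let ?k = "max N1 N2"
      have "len (X n \<ominus> X (r ?k)) < e/2" using that r(1)[of ?k] by (intro N1) auto
      moreover have "len (X (r ?k) \<ominus> x) < e/2" using N2[of ?k] by simp
      ultimately show ?thesis using len_diff_triangle[of "X n" "X (r ?k)" x] X x(1) by fastforce
    qed
    moreover have "0 \<le> len (X n \<ominus> x)" for n using X x(1) by (intro norm_nonneg diff_closed) auto
    ultimately show "\<exists>N. \<forall>n\<ge>N. norm (len (X n \<ominus> x) - 0) < e" by auto
  qed
  then show "\<exists>x\<in>vcarrier Z. (\<lambda>n. len (X n \<ominus> x)) \<longlonglongrightarrow> 0" using x(1) by blast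
qed

lemma complete_nspace_equivalent_norm:
  fixes Z Z' :: "'a nspace"
  assumes Z: "real_normed_space Z" and Z': "real_normed_space Z'"
    and eq: "vcarrier Z' = vcarrier Z" "vadd Z' = vadd Z" "vscale Z' = vscale Z"
    and equiv: "equivalent_norms_on (vcarrier Z) (vnorm Z') (vnorm Z)"
    and compl: "complete_nspace Z"
  shows "complete_nspace Z'"
  unfolding complete_nspace_def
proof (intro allI impI, elim conjE)
  fix X :: "nat \<Rightarrow> 'a" assume X: "\<forall>n. X n \<in> vcarrier Z'" and cauchy: "\<forall>e>0. \<exists>N. \<forall>i\<ge>N. \<forall>j\<ge>N. vnorm Z' (vdiff Z' (X i) (X j)) < e"
  obtain c C where c: "0 < c" "0 < C" "\<And>x. x \<in> vcarrier Z \<Longrightarrow> c * vnorm Z x \<le> vnorm Z' x"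
    "\<And>x. x \<in> vcarrier Z \<Longrightarrow> vnorm Z' x \<le> C * vnorm Z x"
    using equiv unfolding equivalent_norms_on_def by blast
  have d: "vdiff Z' = vdiff Z" by (simp add: vdiff_def[abs_def] eq)
  have Xc: "X n \<in> vcarrier Z" for n using X eq by simp
  have dc: "vdiff Z x y \<in> vcarrier Z" if "x \<in> vcarrier Z" "y \<in> vcarrier Z" for x y
    using real_normed_space.diff_closed[OF Z that] .
  have "\<exists>N. \<forall>i\<ge>N. \<forall>j\<ge>N. vnorm Z (vdiff Z (X i) (X j)) < e" if e: "0 < e" for e
  proof -
    obtain N where N: "\<And>i j. i \<ge> N \<Longrightarrow> j \<ge> N \<Longrightarrow> vnorm Z' (vdiff Z (X i) (X j)) < c * e"
      using cauchy[unfolded d, rule_format, OF mult_pos_pos[OF c(1) e]] by blast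
    have "vnorm Z (vdiff Z (X i) (X j)) < e" if "i \<ge> N" "j \<ge> N" for i j
    proof -
      have "c * vnorm Z (vdiff Z (X i) (X j)) < c * e" using N[OF that] c(3)[OF dc[OF Xc Xc], of i j] by simp
      then show ?thesis using c(1) by simp
    qed
    then show ?thesis by blast
  qed
  then obtain x where x: "x \<in> vcarrier Z" "(\<lambda>n. vnorm Z (vdiff Z (X n) x)) \<longlonglongrightarrow> 0"
    using compl Xc unfolding complete_nspace_def by blast
  have "(\<lambda>n. vnorm Z' (vdiff Z (X n) x)) \<longlonglongrightarrow> 0"
  proof (rule tendsto_sandwich[OF _ _ tendsto_const])
    show "\<forall>\<^sub>F n in sequentially. vnorm Z' (vdiff Z (X n) x) \<le> C * vnorm Z (vdiff Z (X n) x)"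
      using c(4)[OF dc[OF Xc x(1)]] by simp
    show "\<forall>\<^sub>F n in sequentially. 0 \<le> vnorm Z' (vdiff Z (X n) x)"
      using real_normed_space.norm_nonneg[OF Z'] dc[OF Xc x(1)] eq by simp
    show "(\<lambda>n. C * vnorm Z (vdiff Z (X n) x)) \<longlonglongrightarrow> 0" using tendsto_mult_left[OF x(2), of C] by simp
  qed
  then show "\<exists>x\<in>vcarrier Z'. (\<lambda>n. vnorm Z' (vdiff Z' (X n) x)) \<longlonglongrightarrow> 0" using x(1) eq d by auto
qed

context covered_space
begin

lemma N1p_complete: "complete_nspace (N1p_space M p)"
proof (rule complete_nspaceI[OF N1p_space_normed])
  fix X assume X: "\<And>n. X n \<in> vcarrier (N1p_space M p)"
    and small: "\<And>n. vnorm (N1p_space M p) (vdiff (N1p_space M p) (X (Suc n)) (X n)) < (1/8) ^ n"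
  have "\<forall>n. \<exists>f. f \<in> V \<and> X n = cls f" using X unfolding N1p_carrier by blast
  then obtain f where f: "\<And>n. f n \<in> V" "\<And>n. X n = cls (f n)" by metis
  have "energy (\<lambda>x. f (Suc n) x - f n x) < ennreal (((1/8) ^ n) powr p)" for n
  proof -
    have d: "(\<lambda>x. f (Suc n) x - f n x) \<in> V" by (intro V_diff f(1))
    have "enn2real (energy (\<lambda>x. f (Suc n) x - f n x)) powr (1/p) < (1/8) ^ n"
      using small[of n] f cls_diff N1p_norm[OF d] by simp
    then have "(enn2real (energy (\<lambda>x. f (Suc n) x - f n x)) powr (1/p)) powr p < ((1/8) ^ n) powr p"
      using p by (intro powr_less_mono2) auto
    then have "enn2real (energy (\<lambda>x. f (Suc n) x - f n x)) < ((1/8) ^ n) powr p" using p by (simp add: powr_powr)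
    moreover have "energy (\<lambda>x. f (Suc n) x - f n x) = ennreal (enn2real (energy (\<lambda>x. f (Suc n) x - f n x)))"
      using d by (simp add: V_def)
    ultimately show ?thesis by (metis ennreal_lessI zero_less_power powr_gt_zero zero_less_divide_1_iff zero_less_numeral less_irrefl)
  qed
  then obtain h where h: "h \<in> V" "(\<lambda>n. energy (\<lambda>x. f n x - h x)) \<longlonglongrightarrow> 0"
    by (rule rapid_completeness[of f, OF f(1)]) blast
  have "(\<lambda>n. enn2real (energy (\<lambda>x. f n x - h x))) \<longlonglongrightarrow> 0"
    using tendsto_enn2real[of "\<lambda>n. energy (\<lambda>x. f n x - h x)" 0] h(2) by simp
  then have "(\<lambda>n. enn2real (energy (\<lambda>x. f n x - h x)) powr (1/p)) \<longlonglongrightarrow> 0 powr (1/p)"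
    using p by (intro tendsto_powr') auto
  moreover have "vnorm (N1p_space M p) (vdiff (N1p_space M p) (X n) (cls h)) = enn2real (energy (\<lambda>x. f n x - h x)) powr (1/p)" for n
    using f h cls_diff N1p_norm[OF V_diff] by simp
  ultimately show "\<exists>x\<in>vcarrier (N1p_space M p). (\<lambda>n. vnorm (N1p_space M p) (vdiff (N1p_space M p) (X n) x)) \<longlonglongrightarrow> 0"
    using h(1) N1p_carrier by (intro bexI[of _ "cls h"]) auto
qed

text \<open>Completeness is carried from the Sobolev norm to the starred norm, and reflexivity is
  carried back.\<close>

lemma N1p_reflexive:
  assumes "1 < p"
  shows "reflexive_space (N1p_space M p)"
proof -
  note eq = N1p_space_normed Zs_normed Zs_simps norms_equivalent
  have "complete_nspace Zs" by (rule complete_nspace_equivalent_norm[OF eq N1p_complete])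
  then have "reflexive_space Zs" by (rule milman_pettis[OF Zs_normed _ Zs_uniformly_convex[OF assms]])
  then show ?thesis by (rule reflexive_space_equivalent_norm[OF eq])
qed

end

text \<open>The first two conjuncts state that \<open>star_norm\<close> is finite and constant on
  classes, which gives \<open>class_norm\<close> its meaning in the others. Reflexivity refers to
  the original norm.\<close>

theorem theorem1p1:
  fixes M :: "'a::metric_space measure"
    and m :: "int \<Rightarrow> enat" and ctr :: "int \<Rightarrow> nat \<Rightarrow> 'a"
    and p :: real
  assumes "metric_measure_space M" and "borel_regular M" and "doubling M"
    and "1 \<le> p" and "poincare_inequality M p"
    and "ball_coverings m ctr"
  shows
    "(\<forall>u\<in>N1p_functions M p. star_norm M m ctr p u < \<infinity>) \<and>
     (\<forall>(u, v)\<in>N1p_rel M p. star_norm M m ctr p u = star_norm M m ctr p v) \<and>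
     real_normed_space (N1p_star_space M m ctr p) \<and>
     equivalent_norms_on (vcarrier (N1p_space M p))
       (vnorm (N1p_star_space M m ctr p)) (vnorm (N1p_space M p)) \<and>
     (1 < p \<longrightarrow>
       uniformly_convex (N1p_star_space M m ctr p) \<and> reflexive_space (N1p_space M p))"
proof -
  obtain D where D: "1 \<le> D" "\<And>x r. 0 < r \<Longrightarrow> emeasure M (ball x (2 * r)) \<le> ennreal D * emeasure M (ball x r)"
    using assms(3) unfolding doubling_def by blast
  obtain P \<Lambda> where P: "0 < P" "1 \<le> \<Lambda>" and PI: "\<forall>x r u g.
      0 < r \<and> u \<in> borel_measurable borel \<and> loc_integrable M u \<and> upper_gradient u g \<longrightarrow>
      (\<integral>\<^sup>+ y \<in> ball x r. e2ennreal \<bar>u y - ereal (avg M u (ball x r))\<bar> \<partial>M) / emeasure M (ball x r)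
        \<le> ennreal (P * diameter (ball x r)) *
          ennpowr ((\<integral>\<^sup>+ y \<in> ball x (\<Lambda> * r). ennpowr (g y) p \<partial>M) / emeasure M (ball x (\<Lambda> * r))) (1 / p)"
    using assms(5) unfolding poincare_inequality_def by blast
  interpret covered_space M p m ctr D P \<Lambda>
    by unfold_locales (use assms D P PI in auto)
  show ?thesis
    using star_finite star_rel Zs_normed norms_equivalent Zs_uniformly_convex N1p_reflexive by auto
qed

end
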